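(* Let $n\in\{2,3\}$ and let $\Gamma$ be a bounded, non-empty, relatively open subset of $\Gamma_\infty=\{x\in\mathbb{R}^n:x_n=0\}$. The sesquilinear form on $\tilde H^{-1/2}(\Gamma)\times\tilde H^{-1/2}(\Gamma)$ defined by $$a(\phi,\psi):=\langle S_k\phi,\psi\rangle_{H^{1/2}(\Gamma)\times\tilde H^{-1/2}(\Gamma)},\qquad\phi,\psi\in\tilde H^{-1/2}(\Gamma),$$ satisfies the coercivity estimate $$|a(\phi,\phi)|\ge\frac{1}{2\sqrt2}\,\|\phi\|^2_{\tilde H^{-1/2}_k(\Gamma)},\qquad\phi\in\tilde H^{-1/2}(\Gamma),\ k>0.$$
   Context: $\Gamma_\infty$ is identified with $\mathbb{R}^{n-1}$, and Sobolev spaces on $\Gamma_\infty,\Gamma$ are defined through this identification. Sobolev spaces: with $m=n-1$ and $\hat u(\xi)=(2\pi)^{-m/2}\int_{\mathbb{R}^m}e^{-i\xi\cdot x}u(x)\,dx$ (extended to tempered distributions), $H^s(\mathbb{R}^m)$ is the space of tempered distributions $u$ with $\hat u$ locally integrable and $\|u\|_{H^s_k(\mathbb{R}^m)}^2=\int(k^2+|\xi|^2)^s|\hat u(\xi)|^2\,d\xi<\infty$. For $\Omega$ open, $\tilde H^s(\Omega)$ is the closure of $C_c^\infty(\Omega)$ in $H^s(\mathbb{R}^m)$, with $\|\cdot\|_{\tilde H^s_k(\Omega)}=\|\cdot\|_{H^s_k(\mathbb{R}^m)}$, and $H^s(\Omega)=\{U|_\Omega:U\in H^s(\mathbb{R}^m)\}$.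 For $u\in H^{-s}(\Omega)$, $v\in\tilde H^s(\Omega)$, $\langle u,v\rangle_{H^{-s}(\Omega)\times\tilde H^s(\Omega)}=\int\hat U(\xi)\overline{\hat v(\xi)}\,d\xi$, where $U\in H^{-s}(\mathbb{R}^m)$ is any extension of $u$ (the value is independent of the choice); for smooth functions this is $\int u\bar v$. Single-layer operator: $\Phi(x,y)=e^{ik|x-y|}/(4\pi|x-y|)$ if $n=3$, $\Phi(x,y)=\frac i4H_0^{(1)}(k|x-y|)$ if $n=2$. For $\phi\in C_c^\infty(\Gamma)$, $S_k\phi(x)=\int_\Gamma\Phi(x,y)\phi(y)\,ds(y)$, $x\in\Gamma$; $S_k:\tilde H^{-1/2}(\Gamma)\to H^{1/2}(\Gamma)$ is the unique continuous extension of this operator (equivalently, the trace on $\Gamma$ of the single-layer potential). *)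

theory Defs
  imports "HOL-Analysis.Analysis"
begin

section \<open>Test functions and tempered distributions\<close>

text \<open>Iterated partial derivatives along a list of coordinate directions; the outermost derivative
  is the head of the list.\<close>

primrec partials :: "'m list \<Rightarrow> (real^'m::finite \<Rightarrow> complex) \<Rightarrow> real^'m \<Rightarrow> complex" where
  "partials [] f = f"
| "partials (j # js) f = (\<lambda>x. frechet_derivative (partials js f) (at x) (axis j 1))"

text \<open>All iterated partial derivatives exist and are (totally) differentiable everywhere, i.e.
  \<open>f\<close> is infinitely differentiable.\<close>

definition smooth :: "(real^'m::finite \<Rightarrow> complex) \<Rightarrow> bool" where
  "smooth f \<longleftrightarrow> (\<forall>js x. partials js f differentiable (at x))"

text \<open>Elements of the space of test functions on \<open>\<Omega>\<close> are regarded as functions on the whole space.\<close>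

definition test_functions :: "(real^'m::finite) set \<Rightarrow> (real^'m \<Rightarrow> complex) set" where
  "test_functions \<Omega> = {f. smooth f \<and> compact (closure {x. f x \<noteq> 0}) \<and> closure {x. f x \<noteq> 0} \<subseteq> \<Omega>}"

definition schwartz :: "(real^'m::finite \<Rightarrow> complex) set" where
  "schwartz = {f. smooth f \<and> (\<forall>N js. \<exists>C. \<forall>x. (1 + norm x) ^ N * cmod (partials js f x) \<le> C)}"

definition schwartz_seminorm :: "nat \<Rightarrow> (real^'m::finite \<Rightarrow> complex) \<Rightarrow> real" where
  "schwartz_seminorm N f =
     (SUP (js, x) \<in> {js. length js \<le> N} \<times> UNIV. (1 + norm x) ^ N * cmod (partials js f x))"

text \<open>Distributions are linear (not antilinear) functionals. They are total HOL functions, fixed to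
  be \<open>0\<close> off the space of test functions so that HOL equality is equality of distributions.\<close>

definition tempered :: "((real^'m::finite \<Rightarrow> complex) \<Rightarrow> complex) set" where
  "tempered = {u.
     (\<forall>f. f \<notin> schwartz \<longrightarrow> u f = 0) \<and>
     (\<forall>f\<in>schwartz. \<forall>g\<in>schwartz. u (\<lambda>x. f x + g x) = u f + u g) \<and>
     (\<forall>c. \<forall>f\<in>schwartz. u (\<lambda>x. c * f x) = c * u f) \<and>
     (\<exists>N C. \<forall>f\<in>schwartz. cmod (u f) \<le> C * schwartz_seminorm N f)}"

definition tempered_of :: "(real^'m::finite \<Rightarrow> complex) \<Rightarrow> (real^'m \<Rightarrow> complex) \<Rightarrow> complex" where
  "tempered_of g = (\<lambda>f. if f \<in> schwartz then (\<integral>x. g x * f x \<partial>lborel) else 0)"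

definition distribution_of ::
  "(real^'m::finite) set \<Rightarrow> (real^'m \<Rightarrow> complex) \<Rightarrow> (real^'m \<Rightarrow> complex) \<Rightarrow> complex" where
  "distribution_of \<Omega> w = (\<lambda>f. if f \<in> test_functions \<Omega> then (LINT x:\<Omega>|lborel. w x * f x) else 0)"

definition restrict_dist ::
  "(real^'m::finite) set \<Rightarrow> ((real^'m \<Rightarrow> complex) \<Rightarrow> complex) \<Rightarrow> (real^'m \<Rightarrow> complex) \<Rightarrow> complex" where
  "restrict_dist \<Omega> U = (\<lambda>f. if f \<in> test_functions \<Omega> then U f else 0)"


section \<open>Fourier transform and Sobolev spaces\<close>

definition fourier :: "(real^'m::finite \<Rightarrow> complex) \<Rightarrow> real^'m \<Rightarrow> complex" where
  "fourier f \<xi> = complex_of_real ((2 * pi) powr (- real CARD('m) / 2)) *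
     (\<integral>x. exp (- \<i> * complex_of_real (\<xi> \<bullet> x)) * f x \<partial>lborel)"

definition fourier_dist ::
  "((real^'m::finite \<Rightarrow> complex) \<Rightarrow> complex) \<Rightarrow> (real^'m \<Rightarrow> complex) \<Rightarrow> complex" where
  "fourier_dist u = (\<lambda>f. if f \<in> schwartz then u (fourier f) else 0)"

text \<open>The tempered distribution \<open>v\<close> is given by the locally integrable function \<open>g\<close>. The explicit
  integrability requirement is there because the Bochner integral of a non-integrable function is
  \<open>0\<close>; it holds automatically for the functions of polynomial growth (in the mean) that occur as
  Fourier transforms of elements of the Sobolev spaces.\<close>

definition represents :: "(real^'m::finite \<Rightarrow> complex) \<Rightarrow> ((real^'m \<Rightarrow> complex) \<Rightarrow> complex) \<Rightarrow> bool" where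
  "represents g v \<longleftrightarrow>
     (\<forall>K. compact K \<longrightarrow> set_integrable lborel K g) \<and>
     (\<forall>f\<in>schwartz. integrable lborel (\<lambda>\<xi>. g \<xi> * f \<xi>) \<and> v f = (\<integral>\<xi>. g \<xi> * f \<xi> \<partial>lborel))"

text \<open>The Fourier transform of \<open>u\<close> as a function, determined up to null sets.\<close>

definition fhat :: "((real^'m::finite \<Rightarrow> complex) \<Rightarrow> complex) \<Rightarrow> real^'m \<Rightarrow> complex" where
  "fhat u = (SOME g. represents g (fourier_dist u))"

text \<open>The norms for different \<open>k > 0\<close> are equivalent, so the spaces and their topologies do not depend
  on \<open>k\<close>; they are introduced with \<open>k = 1\<close>.\<close>

definition sobolev :: "real \<Rightarrow> ((real^'m::finite \<Rightarrow> complex) \<Rightarrow> complex) set" where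
  "sobolev s = {u \<in> tempered. \<exists>g. represents g (fourier_dist u) \<and>
     integrable lborel (\<lambda>\<xi>. (1 + (norm \<xi>)\<^sup>2) powr s * (cmod (g \<xi>))\<^sup>2)}"

definition sobolev_norm :: "real \<Rightarrow> real \<Rightarrow> ((real^'m::finite \<Rightarrow> complex) \<Rightarrow> complex) \<Rightarrow> real" where
  "sobolev_norm k s u = sqrt (\<integral>\<xi>. (k\<^sup>2 + (norm \<xi>)\<^sup>2) powr s * (cmod (fhat u \<xi>))\<^sup>2 \<partial>lborel)"

definition sobolev_tilde ::
  "real \<Rightarrow> (real^'m::finite) set \<Rightarrow> ((real^'m \<Rightarrow> complex) \<Rightarrow> complex) set" where
  "sobolev_tilde s \<Omega> = {u \<in> sobolev s. \<forall>\<epsilon>>0. \<exists>\<phi>\<in>test_functions \<Omega>.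
     sobolev_norm 1 s (\<lambda>f. u f - tempered_of \<phi> f) < \<epsilon>}"

definition sobolev_on ::
  "real \<Rightarrow> (real^'m::finite) set \<Rightarrow> ((real^'m \<Rightarrow> complex) \<Rightarrow> complex) set" where
  "sobolev_on s \<Omega> = restrict_dist \<Omega> ` sobolev s"

definition sobolev_on_norm ::
  "real \<Rightarrow> real \<Rightarrow> (real^'m::finite) set \<Rightarrow> ((real^'m \<Rightarrow> complex) \<Rightarrow> complex) \<Rightarrow> real" where
  "sobolev_on_norm k s \<Omega> u = (INF U \<in> {U \<in> sobolev s. restrict_dist \<Omega> U = u}. sobolev_norm k s U)"

text \<open>The pairing of \<open>u \<in> sobolev_on (- s) \<Omega>\<close> with \<open>v \<in> sobolev_tilde s \<Omega>\<close>; its value does not depend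
  on the chosen extension of \<open>u\<close>.\<close>

definition dual_pairing :: "real \<Rightarrow> (real^'m::finite) set \<Rightarrow>
    ((real^'m \<Rightarrow> complex) \<Rightarrow> complex) \<Rightarrow> ((real^'m \<Rightarrow> complex) \<Rightarrow> complex) \<Rightarrow> complex" where
  "dual_pairing s \<Omega> u v =
     (let U = (SOME U. U \<in> sobolev (- s) \<and> restrict_dist \<Omega> U = u)
      in \<integral>\<xi>. fhat U \<xi> * cnj (fhat v \<xi>) \<partial>lborel)"


section \<open>The fundamental solution of the Helmholtz equation\<close>

definition bessel_J0 :: "real \<Rightarrow> real" where
  "bessel_J0 x = (\<Sum>j. (-1) ^ j * (x / 2) ^ (2 * j) / (fact j)\<^sup>2)"

definition bessel_Y0 :: "real \<Rightarrow> real" where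
  "bessel_Y0 x = 2 / pi * ((ln (x / 2) + euler_mascheroni) * bessel_J0 x
     - (\<Sum>j. (-1) ^ j * harm j * (x / 2) ^ (2 * j) / (fact j)\<^sup>2))"

definition hankel1_0 :: "real \<Rightarrow> complex" where
  "hankel1_0 x = complex_of_real (bessel_J0 x) + \<i> * complex_of_real (bessel_Y0 x)"

text \<open>Meant for dimension \<open>2\<close> or \<open>3\<close> only.\<close>

definition fundamental_solution :: "real \<Rightarrow> 'a::euclidean_space \<Rightarrow> 'a \<Rightarrow> complex" where
  "fundamental_solution k x y =
     (if DIM('a) = 3
      then exp (\<i> * complex_of_real (k * norm (x - y))) / complex_of_real (4 * pi * norm (x - y))
      else \<i> / 4 * hankel1_0 (k * norm (x - y)))"


section \<open>The single-layer operator on a flat screen\<close>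

text \<open>The ambient space of dimension \<open>n\<close> is \<open>(real^'m) \<times> real\<close> with \<open>CARD('m) = n - 1\<close>; its norm is the
  Euclidean one, and the second component is the last coordinate.\<close>

definition Gamma_inf :: "((real^'m::finite) \<times> real) set" where
  "Gamma_inf = {x. snd x = 0}"

text \<open>The identification of the hyperplane with \<open>real^'m\<close>, under which the surface measure becomes
  Lebesgue measure.\<close>

definition flat :: "((real^'m::finite) \<times> real) set \<Rightarrow> (real^'m) set" where
  "flat \<Gamma> = {x. (x, 0) \<in> \<Gamma>}"

definition single_layer_classical ::
  "real \<Rightarrow> ((real^'m::finite) \<times> real) set \<Rightarrow> (real^'m \<Rightarrow> complex) \<Rightarrow> real^'m \<Rightarrow> complex" where
  "single_layer_classical k \<Gamma> \<phi> x =
     (LINT y:flat \<Gamma>|lborel. fundamental_solution k (x, 0 :: real) (y, 0) * \<phi> y)"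

text \<open>\<open>A\<close> is a bounded linear operator from \<open>sobolev_tilde (- 1/2)\<close> to \<open>sobolev_on (1/2)\<close> extending the
  classical operator. By density of the test functions, such an \<open>A\<close> is unique on
  \<open>sobolev_tilde (- 1/2)\<close>; its values elsewhere are immaterial.\<close>

definition extends_single_layer :: "real \<Rightarrow> ((real^'m::finite) \<times> real) set \<Rightarrow>
    (((real^'m \<Rightarrow> complex) \<Rightarrow> complex) \<Rightarrow> (real^'m \<Rightarrow> complex) \<Rightarrow> complex) \<Rightarrow> bool" where
  "extends_single_layer k \<Gamma> A \<longleftrightarrow>
     (\<forall>u \<in> sobolev_tilde (- 1/2) (flat \<Gamma>). A u \<in> sobolev_on (1/2) (flat \<Gamma>)) \<and>
     (\<forall>u \<in> sobolev_tilde (- 1/2) (flat \<Gamma>). \<forall>v \<in> sobolev_tilde (- 1/2) (flat \<Gamma>).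
        A (\<lambda>f. u f + v f) = (\<lambda>f. A u f + A v f)) \<and>
     (\<forall>c. \<forall>u \<in> sobolev_tilde (- 1/2) (flat \<Gamma>). A (\<lambda>f. c * u f) = (\<lambda>f. c * A u f)) \<and>
     (\<exists>C. \<forall>u \<in> sobolev_tilde (- 1/2) (flat \<Gamma>).
        sobolev_on_norm 1 (1/2) (flat \<Gamma>) (A u) \<le> C * sobolev_norm 1 (- 1/2) u) \<and>
     (\<forall>\<phi> \<in> test_functions (flat \<Gamma>).
        A (tempered_of \<phi>) = distribution_of (flat \<Gamma>) (single_layer_classical k \<Gamma> \<phi>))"

definition single_layer :: "real \<Rightarrow> ((real^'m::finite) \<times> real) set \<Rightarrow>
    ((real^'m \<Rightarrow> complex) \<Rightarrow> complex) \<Rightarrow> (real^'m \<Rightarrow> complex) \<Rightarrow> complex" where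
  "single_layer k \<Gamma> = (SOME A. extends_single_layer k \<Gamma> A)"

definition single_layer_form :: "real \<Rightarrow> ((real^'m::finite) \<times> real) set \<Rightarrow>
    ((real^'m \<Rightarrow> complex) \<Rightarrow> complex) \<Rightarrow> ((real^'m \<Rightarrow> complex) \<Rightarrow> complex) \<Rightarrow> complex" where
  "single_layer_form k \<Gamma> \<phi> \<psi> = dual_pairing (- 1/2) (flat \<Gamma>) (single_layer k \<Gamma> \<phi>) \<psi>"

end

(* The trace of the fundamental solution on the screen is a convolution kernel on R^(n-1). For wave
   number k = i kappa, kappa > 0, subordination to the heat semigroup shows that it is the Fourier
   multiplier 1/(2 sqrt(|xi|^2 + kappa^2)). Writing mu = - i k, both the quadratic form of the kernel
   and that of the multiplier are holomorphic in mu on the half plane Re mu > 0, hence they agree there,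
   and one lets mu tend to - i k. On the way Re and Im of 1/sqrt(|xi|^2 + mu^2) are both nonnegative, so
   no cancellation occurs beyond the factor 1/sqrt 2, while the modulus is at least
   (|xi|^2 + |mu|^2)^(-1/2). This gives the estimate for test functions; density gives the rest.
   That the operator exists at all follows since the kernel for k differs from the one for kappa = 1
   by a Lipschitz function, whose Fourier transform decays like 1/|xi|. *)

theory Submission
  imports Defs "HOL-Probability.Probability" "HOL-Complex_Analysis.Complex_Analysis"
begin

unbundle no fps_syntax
hide_const (open) Stream.flat

subsection \<open>Integration on \<^typ>\<open>real^'m\<close>\<close>

text \<open>At mu = - i k itself the kernel oscillates and decays too slowly to be integrable, and
  its would-be symbol blows up where |xi| = k. Neither has to be faced. The lower bound is proved
  for mu = epsilon - i k, where the symbol is bounded, and only the quadratic form of the kernel is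
  carried to the limit: the test function has compact support, so a local bound on the kernel,
  uniform down to Re mu = 0, dominates. Existence of the operator avoids the same obstacle
  differently: the screen is bounded, so the kernel may be altered at distances larger than any
  between two of its points, and the altered kernel is integrable. Existence is indispensable
  because \<open>single_layer\<close> is an indefinite choice; coercivity is shown for every
  admissible extension. For n = 2 the given kernel is a power series with a logarithm, while the
  argument needs an integral over heat kernels; a differential equation and the behaviour at the
  origin match the two, and this is where the Euler-Mascheroni constant must come out. The factor 2
  of the final constant is that of the multiplier.\<close>

lemma lborel_vec_prod:
  fixes f :: "'m::finite \<Rightarrow> real \<Rightarrow> 'a::{real_normed_field,banach,second_countable_topology}"
  assumes int: "\<And>i. integrable lborel (f i)"
  shows "integrable lborel (\<lambda>x::real^'m. \<Prod>i\<in>UNIV. f i (x $ i))"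
    and "(\<integral>x. (\<Prod>i\<in>UNIV. f i ((x::real^'m) $ i)) \<partial>lborel) = (\<Prod>i\<in>UNIV. \<integral>t. f i t \<partial>lborel)"
proof -
  interpret product_sigma_finite "\<lambda>b::real^'m. lborel :: real measure"
    by unfold_locales
  define T where "T = (\<lambda>y. \<Sum>b\<in>Basis. y b *\<^sub>R (b::real^'m))"
  \<comment> \<open>The product measure behind \<open>lborel\<close> is indexed by basis vectors
    rather than by coordinates; \<open>ix\<close> recovers the coordinate from its unit
    vector.\<close>
  define ix where "ix b = (THE i. b = axis i (1::real))" for b :: "real^'m"
  have ix: "ix (axis i 1) = i" for i
    unfolding ix_def by (rule the_equality) (auto simp: axis_eq_axis)
  have B: "Basis = range (\<lambda>i. axis i (1::real) :: real^'m)"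
    by (auto simp: Basis_vec_def)
  have inj: "inj (\<lambda>i. axis i (1::real) :: real^'m)"
    by (auto simp: inj_on_def axis_eq_axis)
  have T_nth: "T y $ i = y (axis i 1)" for y i
  proof -
    have "T y $ i = T y \<bullet> axis i 1" by (simp add: inner_axis)
    also have "\<dots> = y (axis i 1)"
      unfolding T_def by (simp add: inner_sum_left_Basis)
    finally show ?thesis .
  qed
  have eq: "(\<Prod>i\<in>UNIV. f i (T y $ i)) = (\<Prod>b\<in>Basis. f (ix b) (y b))" for y
    unfolding B by (subst prod.reindex[OF inj]) (simp add: T_nth ix)
  have meas: "T \<in> measurable (Pi\<^sub>M Basis (\<lambda>_. lborel)) borel"
    unfolding T_def by measurable
  have [measurable]: "f i \<in> borel_measurable borel" for i
    using borel_measurable_integrable[OF int[of i]] by simp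
  have mf: "(\<lambda>x::real^'m. \<Prod>i\<in>UNIV. f i (x $ i)) \<in> borel_measurable borel"
    by measurable
  have L: "(lborel :: (real^'m) measure) = distr (Pi\<^sub>M Basis (\<lambda>_. lborel)) borel T"
    unfolding T_def by (rule lborel_eq)
  show "integrable lborel (\<lambda>x::real^'m. \<Prod>i\<in>UNIV. f i (x $ i))"
    unfolding L by (subst integrable_distr_eq[OF meas mf])
      (use product_integrable_prod[of Basis "\<lambda>b. f (ix b)"] in \<open>simp add: eq int\<close>)
  have "(\<integral>x. (\<Prod>i\<in>UNIV. f i ((x::real^'m) $ i)) \<partial>lborel)
      = (\<Prod>b\<in>(Basis::(real^'m) set). \<integral>t. f (ix b) t \<partial>lborel)"
    unfolding L by (subst integral_distr[OF meas mf]) (use product_integral_prod[of Basis "\<lambda>b. f (ix b)"] in \<open>simp add: eq int\<close>)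
  also have "\<dots> = (\<Prod>i\<in>UNIV. \<integral>t. f i t \<partial>lborel)"
    unfolding B by (subst prod.reindex[OF inj]) (simp add: ix)
  finally show "(\<integral>x. (\<Prod>i\<in>UNIV. f i ((x::real^'m) $ i)) \<partial>lborel) = (\<Prod>i\<in>UNIV. \<integral>t. f i t \<partial>lborel)" .
qed

lemma integrable_inverse_1_plus_square: "integrable lborel (\<lambda>t::real. 1 / (1 + t\<^sup>2))"
proof -
  have "set_integrable lborel (einterval (-\<infinity>) \<infinity>) (\<lambda>t::real. 1 / (1 + t\<^sup>2))"
  proof (rule interval_integral_FTC_nonneg(1))
    show "\<And>x. DERIV arctan x :> 1 / (1 + x\<^sup>2)"
      by (auto intro!: derivative_eq_intros simp: inverse_eq_divide)
    have "(arctan \<longlongrightarrow> -(pi/2)) at_bot" by (rule tendsto_arctan_at_bot)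
    then show "((arctan \<circ> real_of_ereal) \<longlongrightarrow> - (pi/2)) (at_right (-\<infinity>))"
      by (simp add: ereal_tendsto_simps1)
    have "(arctan \<longlongrightarrow> (pi/2)) at_top" by (rule tendsto_arctan_at_top)
    then show "((arctan \<circ> real_of_ereal) \<longlongrightarrow> (pi/2)) (at_left \<infinity>)"
      by (simp add: ereal_tendsto_simps1)
  qed (auto intro!: continuous_intros simp: add_nonneg_eq_0_iff)
  then show ?thesis by (simp add: set_integrable_def)
qed

text \<open>Each factor (1 + norm x)^2 dominates one 1 + x_i^2, so m of them dominate the product,
  whose reciprocal integrates coordinate by coordinate. The exponent is not optimal, but Schwartz
  functions decay at any rate, so this single majorant serves throughout.\<close>

lemma integrable_inverse_polynomial:
  "integrable lborel (\<lambda>x::real^'m::finite. 1 / (1 + norm x) ^ (2 * CARD('m)))"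
proof (rule Bochner_Integration.integrable_bound)
  show "integrable lborel (\<lambda>x::real^'m. \<Prod>i\<in>UNIV. 1 / (1 + (x $ i)\<^sup>2))"
    by (rule lborel_vec_prod) (rule integrable_inverse_1_plus_square)
  show "AE x in lborel. norm (1 / (1 + norm x) ^ (2 * CARD('m)))
      \<le> norm (\<Prod>i\<in>UNIV. 1 / (1 + ((x::real^'m) $ i)\<^sup>2))"
  proof (rule AE_I2)
    fix x :: "real^'m"
    have le: "1 + (x $ i)\<^sup>2 \<le> (1 + norm x)\<^sup>2" for i
    proof -
      have "(x $ i)\<^sup>2 \<le> (norm x)\<^sup>2"
        using component_le_norm_cart[of x i] by (metis abs_ge_zero power2_abs power_mono)
      moreover have "(1 + norm x)\<^sup>2 = 1 + (norm x)\<^sup>2 + 2 * norm x"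
        by (simp add: power2_eq_square algebra_simps)
      ultimately show ?thesis using norm_ge_zero[of x] by linarith
    qed
    have pos: "0 < 1 + (x $ i)\<^sup>2" for i by (simp add: add_pos_nonneg)
    have "1 / (1 + norm x) ^ (2 * CARD('m)) = (\<Prod>i\<in>(UNIV::'m set). 1 / (1 + norm x)\<^sup>2)"
      by (simp add: power_mult power_divide)
    also have "\<dots> \<le> (\<Prod>i\<in>UNIV. 1 / (1 + (x $ i)\<^sup>2))"
    proof (rule prod_mono)
      fix i :: 'm
      have "1 / (1 + norm x)\<^sup>2 \<le> 1 / (1 + (x $ i)\<^sup>2)"
        by (rule divide_left_mono[OF le]) (use pos[of i] in \<open>auto intro!: mult_pos_pos zero_less_power add_pos_nonneg\<close>)
      then show "0 \<le> 1 / (1 + norm x)\<^sup>2 \<and> 1 / (1 + norm x)\<^sup>2 \<le> 1 / (1 + (x $ i)\<^sup>2)"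
        by simp
    qed
    finally show "norm (1 / (1 + norm x) ^ (2 * CARD('m))) \<le> norm (\<Prod>i\<in>UNIV. 1 / (1 + (x $ i)\<^sup>2))"
      by (simp add: abs_prod)
  qed
qed measurable

text \<open>The characteristic function of the standard normal distribution, rescaled:
  \<open>b\<close> is chosen with (b t)^2 / 2 = a t^2, and the frequency becomes
  \<open>\<tau>\<close> = - s / b.\<close>

lemma gaussian_fourier_real:
  fixes a s :: real
  assumes a: "a > 0"
  shows "integrable lborel (\<lambda>t. exp (- \<i> * of_real (s * t)) * complex_of_real (exp (- a * t\<^sup>2)))"
    and "(\<integral>t. exp (- \<i> * of_real (s * t)) * complex_of_real (exp (- a * t\<^sup>2)) \<partial>lborel)
      = complex_of_real (sqrt (pi / a) * exp (- s\<^sup>2 / (4 * a)))"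
proof -
  let ?f = "\<lambda>t. exp (- \<i> * of_real (s * t)) * complex_of_real (exp (- a * t\<^sup>2))"
  define b where "b = sqrt (2 * a)"
  have b: "b > 0" "b\<^sup>2 = 2 * a" using a by (auto simp: b_def)
  define \<tau> where "\<tau> = - s / b"
  define g where "g u = iexp (\<tau> * u) * complex_of_real (std_normal_density u)" for u
  have intg: "integrable lborel g"
  proof (rule Bochner_Integration.integrable_bound)
    show "integrable lborel std_normal_density" by simp
    show "AE u in lborel. norm (g u) \<le> norm (std_normal_density u)"
      by (simp add: g_def norm_mult)
  qed (simp add: g_def[abs_def])
  have "exp (- (\<tau>\<^sup>2) / 2) = char std_normal_distribution \<tau>"
    by (simp add: char_std_normal_distribution)
  also have "\<dots> = (\<integral>u. g u \<partial>lborel)"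
    unfolding char_def g_def
    by (subst integral_density) (auto simp: scaleR_conv_of_real mult.commute normal_density_nonneg)
  finally have G: "(\<integral>u. g u \<partial>lborel) = exp (- (\<tau>\<^sup>2) / 2)" ..
  have f: "?f t = of_real (sqrt (2 * pi)) * g (0 + b * t)" for t
  proof -
    have "(b * t)\<^sup>2 / 2 = a * t\<^sup>2" using b by (simp add: power_mult_distrib)
    then show ?thesis
      using b(1) by (simp add: g_def \<tau>_def std_normal_density_def mult_ac)
  qed
  have "integrable lborel (\<lambda>t. g (0 + b * t))"
    by (rule lborel_integrable_real_affine[OF intg]) (use b in simp)
  then show "integrable lborel ?f" by (subst f) simp
  have "(\<integral>u. g u \<partial>lborel) = \<bar>b\<bar> *\<^sub>R (\<integral>t. g (0 + b * t) \<partial>lborel)"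
    by (rule lborel_integral_real_affine) (use b in simp)
  then have "(\<integral>t. g (0 + b * t) \<partial>lborel) = of_real (exp (- (\<tau>\<^sup>2) / 2) / b)"
    using b(1) G by (simp add: scaleR_conv_of_real field_simps)
  moreover have "sqrt (2 * pi) * (exp (- (\<tau>\<^sup>2) / 2) / b) = sqrt (pi / a) * exp (- s\<^sup>2 / (4 * a))"
  proof -
    have "\<tau>\<^sup>2 / 2 = s\<^sup>2 / (4 * a)" by (simp add: \<tau>_def power_divide b)
    moreover have "sqrt (2 * pi) / b = sqrt (pi / a)"
      using a by (simp add: b_def real_sqrt_divide real_sqrt_mult)
    ultimately show ?thesis by (metis minus_divide_left mult.commute times_divide_eq_left)
  qed
  ultimately show "(\<integral>t. ?f t \<partial>lborel) = complex_of_real (sqrt (pi / a) * exp (- s\<^sup>2 / (4 * a)))"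
    by (subst f) (simp flip: of_real_mult of_real_divide)
qed

lemma gaussian_fourier_vec:
  fixes a :: real and \<xi> :: "real^'m::finite"
  assumes a: "a > 0"
  shows "integrable lborel (\<lambda>x. exp (- \<i> * of_real (\<xi> \<bullet> x)) * complex_of_real (exp (- a * (norm x)\<^sup>2)))"
    and "(\<integral>x. exp (- \<i> * of_real (\<xi> \<bullet> x)) * complex_of_real (exp (- a * (norm x)\<^sup>2)) \<partial>lborel)
      = complex_of_real (sqrt (pi / a) ^ CARD('m) * exp (- (norm \<xi>)\<^sup>2 / (4 * a)))"
proof -
  have n2: "(norm x)\<^sup>2 = (\<Sum>i\<in>UNIV. (x $ i)\<^sup>2)" for x :: "real^'m"
    by (simp add: norm_vec_def L2_set_def sum_nonneg)
  have f: "exp (- \<i> * of_real (\<xi> \<bullet> x)) * complex_of_real (exp (- a * (norm x)\<^sup>2)) =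
    (\<Prod>i\<in>UNIV. exp (- \<i> * of_real (\<xi> $ i * x $ i)) * complex_of_real (exp (- a * (x $ i)\<^sup>2)))" for x
    by (simp add: prod.distrib n2 inner_vec_def sum_distrib_left exp_sum flip: of_real_prod)
  show "integrable lborel (\<lambda>x. exp (- \<i> * of_real (\<xi> \<bullet> x)) * complex_of_real (exp (- a * (norm x)\<^sup>2)))"
    unfolding f by (rule lborel_vec_prod) (rule gaussian_fourier_real[OF a])
  have e: "- (norm \<xi>)\<^sup>2 / (4 * a) = (\<Sum>i\<in>UNIV. - (\<xi> $ i)\<^sup>2 / (4 * a))"
    unfolding n2 by (simp add: sum_negf sum_divide_distrib)
  have "(\<integral>x. exp (- \<i> * of_real (\<xi> \<bullet> x)) * complex_of_real (exp (- a * (norm x)\<^sup>2)) \<partial>lborel)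
      = (\<Prod>i\<in>UNIV. complex_of_real (sqrt (pi / a) * exp (- (\<xi> $ i)\<^sup>2 / (4 * a))))"
    unfolding f by (subst lborel_vec_prod(2)) (rule gaussian_fourier_real[OF a], simp only: gaussian_fourier_real(2)[OF a])
  also have "\<dots> = complex_of_real (sqrt (pi / a) ^ CARD('m) * exp (- (norm \<xi>)\<^sup>2 / (4 * a)))"
    unfolding e by (simp add: prod.distrib exp_sum flip: of_real_prod)
  finally show "(\<integral>x. exp (- \<i> * of_real (\<xi> \<bullet> x)) * complex_of_real (exp (- a * (norm x)\<^sup>2)) \<partial>lborel)
      = complex_of_real (sqrt (pi / a) ^ CARD('m) * exp (- (norm \<xi>)\<^sup>2 / (4 * a)))" .
qed


subsection \<open>Schwartz functions\<close>

lemma partials_append: "partials (js @ ks) f = partials js (partials ks f)"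
  by (induction js) auto

text \<open>Membership in \<open>schwartz\<close> quantifies over all iterated partial derivatives,
  for which a closed formula is rarely at hand. It suffices to place f in a family S that is stable
  under one partial derivative and whose members themselves are differentiable and rapidly
  decreasing; S is a coinductive invariant.\<close>

lemma schwartz_coinduct:
  fixes f :: "real^'m::finite \<Rightarrow> complex"
  assumes f: "f \<in> S"
    and diff: "\<And>f x. f \<in> S \<Longrightarrow> f differentiable (at x)"
    and part: "\<And>f j. f \<in> S \<Longrightarrow> (\<lambda>x. frechet_derivative f (at x) (axis j 1)) \<in> S"
    and decay: "\<And>f N. f \<in> S \<Longrightarrow> \<exists>C. \<forall>x. (1 + norm x) ^ N * cmod (f x) \<le> C"
  shows "f \<in> schwartz"
proof -
  have "partials js f \<in> S" for js
    by (induction js) (auto simp: f part)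
  then show ?thesis
    unfolding schwartz_def smooth_def using diff decay by auto
qed

lemma schwartz_differentiable: "f \<in> schwartz \<Longrightarrow> f differentiable (at x)"
  unfolding schwartz_def smooth_def by (auto dest!: spec[where x="[]"])

lemma schwartz_decay:
  assumes "f \<in> schwartz"
  shows "\<exists>C. \<forall>x. (1 + norm x) ^ N * cmod (f x) \<le> C"
proof -
  have "\<exists>C. \<forall>x. (1 + norm x) ^ N * cmod (partials [] f x) \<le> C"
    using assms by (simp only: schwartz_def mem_Collect_eq)
  then show ?thesis by simp
qed

lemma schwartz_partial:
  fixes f :: "real^'m::finite \<Rightarrow> complex"
  assumes "f \<in> schwartz"
  shows "(\<lambda>x. frechet_derivative f (at x) (axis j 1)) \<in> schwartz"
proof -
  \<comment> \<open>The head of the list is the outermost derivative, so a derivative taken first is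
    appended at the end.\<close>
  have eq: "partials js (\<lambda>x. frechet_derivative f (at x) (axis j 1)) = partials (js @ [j]) f" for js
    by (simp add: partials_append)
  show ?thesis
    unfolding schwartz_def smooth_def mem_Collect_eq eq
  proof (intro conjI allI)
    fix js and x :: "real^'m"
    show "partials (js @ [j]) f differentiable at x"
      using assms by (simp only: schwartz_def smooth_def mem_Collect_eq)
  next
    fix js N
    show "\<exists>C. \<forall>x. (1 + norm x) ^ N * cmod (partials (js @ [j]) f x) \<le> C"
      using assms by (simp only: schwartz_def mem_Collect_eq)
  qed
qed

lemma schwartz_has_derivative:
  "f \<in> schwartz \<Longrightarrow> (f has_derivative frechet_derivative f (at x)) (at x)"
  using schwartz_differentiable frechet_derivative_works by blast

lemma schwartz_add:
  fixes f g :: "real^'m::finite \<Rightarrow> complex"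
  assumes "f \<in> schwartz" "g \<in> schwartz"
  shows "(\<lambda>x. f x + g x) \<in> schwartz"
proof (rule schwartz_coinduct[where S="{\<lambda>x::real^'m. f x + g x | f g. f \<in> schwartz \<and> g \<in> schwartz}"])
  show "(\<lambda>x. f x + g x) \<in> {\<lambda>x::real^'m. f x + g x | f g. f \<in> schwartz \<and> g \<in> schwartz}"
    using assms by blast
next
  fix h and x :: "real^'m" assume "h \<in> {\<lambda>x::real^'m. f x + g x | f g. f \<in> schwartz \<and> g \<in> schwartz}"
  then obtain f g where h: "h = (\<lambda>x. f x + g x)" "f \<in> schwartz" "g \<in> schwartz" by blast
  show "h differentiable at x"
    unfolding h(1) by (intro differentiable_add schwartz_differentiable h)
next
  fix h and j :: 'm assume "h \<in> {\<lambda>x::real^'m. f x + g x | f g. f \<in> schwartz \<and> g \<in> schwartz}"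
  then obtain f g where h: "h = (\<lambda>x. f x + g x)" "f \<in> schwartz" "g \<in> schwartz" by blast
  have "frechet_derivative h (at x) = (\<lambda>v. frechet_derivative f (at x) v + frechet_derivative g (at x) v)" for x
    unfolding h(1) by (rule frechet_derivative_at[symmetric])
      (intro has_derivative_add schwartz_has_derivative h)
  then have e: "(\<lambda>x. frechet_derivative h (at x) (axis j 1)) =
     (\<lambda>x. frechet_derivative f (at x) (axis j 1) + frechet_derivative g (at x) (axis j 1))" by simp
  show "(\<lambda>x. frechet_derivative h (at x) (axis j 1)) \<in> {\<lambda>x::real^'m. f x + g x | f g. f \<in> schwartz \<and> g \<in> schwartz}"
    unfolding e
    by (intro CollectI exI[of _ "\<lambda>x. frechet_derivative f (at x) (axis j 1)"]
        exI[of _ "\<lambda>x. frechet_derivative g (at x) (axis j 1)"] conjI refl schwartz_partial h)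
next
  fix h :: "real^'m \<Rightarrow> complex" and N assume "h \<in> {\<lambda>x::real^'m. f x + g x | f g. f \<in> schwartz \<and> g \<in> schwartz}"
  then obtain f g where h: "h = (\<lambda>x. f x + g x)" "f \<in> schwartz" "g \<in> schwartz" by blast
  obtain C where C: "\<And>x. (1 + norm x) ^ N * cmod (f x) \<le> C" using schwartz_decay[OF h(2)] by blast
  obtain D where D: "\<And>x. (1 + norm x) ^ N * cmod (g x) \<le> D" using schwartz_decay[OF h(3)] by blast
  have "(1 + norm x) ^ N * cmod (h x) \<le> C + D" for x
  proof -
    have "(1 + norm x) ^ N * cmod (h x) \<le> (1 + norm x) ^ N * (cmod (f x) + cmod (g x))"
      unfolding h by (intro mult_left_mono norm_triangle_ineq) auto
    also have "\<dots> \<le> C + D" using C[of x] D[of x] by (simp add: distrib_left)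
    finally show ?thesis .
  qed
  then show "\<exists>C. \<forall>x. (1 + norm x) ^ N * cmod (h x) \<le> C" by blast
qed

text \<open>One argument for complex multiples and for conjugation alike: T is linear over the reals
  only.\<close>

lemma schwartz_bounded_linear:
  fixes T :: "complex \<Rightarrow> complex" and f :: "real^'m::finite \<Rightarrow> complex"
  assumes T: "bounded_linear T" and f: "f \<in> schwartz"
  shows "(\<lambda>x. T (f x)) \<in> schwartz"
proof (rule schwartz_coinduct[where S="{\<lambda>x::real^'m. T (f x) | f. f \<in> schwartz}"])
  show "(\<lambda>x. T (f x)) \<in> {\<lambda>x::real^'m. T (f x) | f. f \<in> schwartz}"
    using f by blast
next
  fix h and x :: "real^'m" assume "h \<in> {\<lambda>x::real^'m. T (f x) | f. f \<in> schwartz}"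
  then obtain f where h: "h = (\<lambda>x. T (f x))" "f \<in> schwartz" by blast
  show "h differentiable at x"
    unfolding h differentiable_def
    using bounded_linear.has_derivative[OF T schwartz_has_derivative[OF h(2)]] by blast
next
  fix h and j :: 'm assume "h \<in> {\<lambda>x::real^'m. T (f x) | f. f \<in> schwartz}"
  then obtain f where h: "h = (\<lambda>x. T (f x))" "f \<in> schwartz" by blast
  have "frechet_derivative h (at x) = (\<lambda>v. T (frechet_derivative f (at x) v))" for x
    unfolding h(1) by (rule frechet_derivative_at[symmetric])
      (intro bounded_linear.has_derivative[OF T] schwartz_has_derivative h)
  then have e: "(\<lambda>x. frechet_derivative h (at x) (axis j 1)) =
     (\<lambda>x. T (frechet_derivative f (at x) (axis j 1)))" by simp
  show "(\<lambda>x. frechet_derivative h (at x) (axis j 1)) \<in> {\<lambda>x::real^'m. T (f x) | f. f \<in> schwartz}"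
    unfolding e
    by (intro CollectI exI[of _ "\<lambda>x. frechet_derivative f (at x) (axis j 1)"] conjI refl schwartz_partial h)
next
  fix h :: "real^'m \<Rightarrow> complex" and N assume "h \<in> {\<lambda>x::real^'m. T (f x) | f. f \<in> schwartz}"
  then obtain f where h: "h = (\<lambda>x. T (f x))" "f \<in> schwartz" by blast
  obtain C where C: "\<And>x. (1 + norm x) ^ N * cmod (f x) \<le> C" using schwartz_decay[OF h(2)] by blast
  obtain K where K: "K > 0" "\<And>z. norm (T z) \<le> norm z * K" using bounded_linear.pos_bounded[OF T] by blast
  have "(1 + norm x) ^ N * cmod (h x) \<le> C * K" for x
  proof -
    have "(1 + norm x) ^ N * cmod (h x) \<le> (1 + norm x) ^ N * (cmod (f x) * K)"
      unfolding h by (intro mult_left_mono K) auto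
    also have "\<dots> \<le> C * K" using mult_right_mono[OF C[of x], of K] K(1) by (simp add: mult_ac)
    finally show ?thesis .
  qed
  then show "\<exists>C. \<forall>x. (1 + norm x) ^ N * cmod (h x) \<le> C" by blast
qed

lemma schwartz_cmult: "f \<in> schwartz \<Longrightarrow> (\<lambda>x. c * f x) \<in> schwartz"
  by (rule schwartz_bounded_linear[OF bounded_linear_mult_right])

lemma schwartz_cnj: "f \<in> schwartz \<Longrightarrow> (\<lambda>x. cnj (f x)) \<in> schwartz"
  by (rule schwartz_bounded_linear[OF bounded_linear_cnj])

lemma coord_has_derivative:
  "((\<lambda>x::real^'m::finite. complex_of_real (x $ j)) has_derivative (\<lambda>v. of_real (v $ j))) (at x)"
  by (rule bounded_linear_imp_has_derivative)
     (intro bounded_linear_compose[OF bounded_linear_of_real] bounded_linear_vec_nth)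

lemma frechet_derivative_coord_mult:
  assumes "f differentiable (at (x::real^'m::finite))"
  shows "frechet_derivative (\<lambda>x. complex_of_real (x $ j) * f x) (at x) v =
    of_real (x $ j) * frechet_derivative f (at x) v + of_real (v $ j) * f x"
proof -
  have "((\<lambda>x. complex_of_real (x $ j) * f x) has_derivative
     (\<lambda>v. of_real (x $ j) * frechet_derivative f (at x) v + of_real (v $ j) * f x)) (at x)"
    by (intro has_derivative_mult coord_has_derivative) (use assms frechet_derivative_works in blast)
  from frechet_derivative_at[OF this, symmetric] show ?thesis by simp
qed

lemma schwartz_coord_mult:
  fixes f :: "real^'m::finite \<Rightarrow> complex"
  assumes "f \<in> schwartz"
  shows "(\<lambda>x. of_real (x $ j) * f x) \<in> schwartz"
proof -
  \<comment> \<open>By the product rule a derivative of x_j f also produces f itself, so the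
    invariant carries a free Schwartz summand g; the function of interest is the member with g =
    0.\<close>
  let ?S = "{\<lambda>x::real^'m. of_real (x $ j) * f x + g x | f g. f \<in> schwartz \<and> g \<in> schwartz}"
  have zero: "(\<lambda>x::real^'m. 0) \<in> schwartz" using schwartz_cmult[OF assms, of 0] by simp
  have "(\<lambda>x::real^'m. of_real (x $ j) * f x + 0) \<in> schwartz"
  proof (rule schwartz_coinduct[where S="?S"])
    show "(\<lambda>x::real^'m. of_real (x $ j) * f x + 0) \<in> ?S" using assms zero
      by (intro CollectI exI[of _ f] exI[of _ "\<lambda>x. 0"] conjI refl)
  next
    fix h x assume "h \<in> ?S"
    then obtain f g where h: "h = (\<lambda>x. of_real (x $ j) * f x + g x)" "f \<in> schwartz" "g \<in> schwartz" by blast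
    have "(\<lambda>x. complex_of_real (x $ j)) differentiable at x"
      using coord_has_derivative differentiable_def by blast
    then show "h differentiable at x"
      unfolding h(1) using schwartz_differentiable[OF h(2)] schwartz_differentiable[OF h(3)]
      by (intro differentiable_add differentiable_mult)
  next
    fix h i assume "h \<in> ?S"
    then obtain f g where h: "h = (\<lambda>x. of_real (x $ j) * f x + g x)" "f \<in> schwartz" "g \<in> schwartz" by blast
    have "frechet_derivative h (at x) v = of_real (x $ j) * frechet_derivative f (at x) v
       + of_real (v $ j) * f x + frechet_derivative g (at x) v" for x v
    proof -
      have "(h has_derivative (\<lambda>v. of_real (x $ j) * frechet_derivative f (at x) v + of_real (v $ j) * f x
          + frechet_derivative g (at x) v)) (at x)"
        unfolding h(1) by (intro has_derivative_add has_derivative_mult coord_has_derivative schwartz_has_derivative h)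
      from frechet_derivative_at[OF this, symmetric] show ?thesis by simp
    qed
    then have e: "(\<lambda>x. frechet_derivative h (at x) (axis i 1)) =
      (\<lambda>x. of_real (x $ j) * frechet_derivative f (at x) (axis i 1) +
        (of_real (axis i 1 $ j) * f x + frechet_derivative g (at x) (axis i 1)))"
      by (simp add: add.assoc)
    show "(\<lambda>x. frechet_derivative h (at x) (axis i 1)) \<in> ?S"
      unfolding e
      by (intro CollectI exI[of _ "\<lambda>x. frechet_derivative f (at x) (axis i 1)"]
        exI[of _ "\<lambda>x. of_real (axis i 1 $ j) * f x + frechet_derivative g (at x) (axis i 1)"]
        conjI refl schwartz_add schwartz_cmult schwartz_partial h)
  next
    fix h N assume "h \<in> ?S"
    then obtain f g where h: "h = (\<lambda>x. of_real (x $ j) * f x + g x)" "f \<in> schwartz" "g \<in> schwartz" by blast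
    obtain C where C: "\<And>x. (1 + norm x) ^ Suc N * cmod (f x) \<le> C" using schwartz_decay[OF h(2)] by blast
    obtain D where D: "\<And>x. (1 + norm x) ^ N * cmod (g x) \<le> D" using schwartz_decay[OF h(3)] by blast
    have "(1 + norm x) ^ N * cmod (h x) \<le> C + D" for x
    proof -
      have "cmod (h x) \<le> (1 + norm x) * cmod (f x) + cmod (g x)"
      proof -
        have "\<bar>x $ j\<bar> * cmod (f x) \<le> (1 + norm x) * cmod (f x)"
          using component_le_norm_cart[of x j] by (intro mult_right_mono) auto
        moreover have "cmod (h x) \<le> \<bar>x $ j\<bar> * cmod (f x) + cmod (g x)"
          unfolding h using norm_triangle_ineq[of "of_real (x $ j) * f x" "g x"] by (simp add: norm_mult)
        ultimately show ?thesis by linarith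
      qed
      then have "(1 + norm x) ^ N * cmod (h x) \<le> (1 + norm x) ^ N * ((1 + norm x) * cmod (f x) + cmod (g x))"
        by (intro mult_left_mono) auto
      also have "\<dots> \<le> C + D" using C[of x] D[of x] by (simp add: algebra_simps)
      finally show ?thesis .
    qed
    then show "\<exists>C. \<forall>x. (1 + norm x) ^ N * cmod (h x) \<le> C" by blast
  qed
  then show ?thesis by (simp only: add_0_right)
qed

lemma schwartz_continuous: "f \<in> schwartz \<Longrightarrow> continuous_on UNIV f"
  by (simp add: differentiable_imp_continuous_within continuous_at_imp_continuous_on schwartz_differentiable)

lemma schwartz_measurable [measurable_dest]:
  "f \<in> schwartz \<Longrightarrow> f \<in> borel_measurable borel"
  by (rule borel_measurable_continuous_onI) (rule schwartz_continuous)

lemma schwartz_decay_pos: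
  assumes "f \<in> schwartz"
  obtains C where "C \<ge> 0" "\<And>x. cmod (f x) \<le> C / (1 + norm x) ^ N"
proof -
  obtain C where C: "\<And>x. (1 + norm x) ^ N * cmod (f x) \<le> C" using schwartz_decay[OF assms] by blast
  have pos: "0 < (1 + norm x) ^ N" for x :: "real^'a"
    by (intro zero_less_power add_pos_nonneg) auto
  show thesis
  proof
    show "C \<ge> 0" using C[of 0] order_trans[OF _ C[of 0]] by simp
    show "cmod (f x) \<le> C / (1 + norm x) ^ N" for x
      using C[of x] pos[of x] by (simp add: pos_le_divide_eq mult.commute)
  qed
qed

lemma schwartz_integrable:
  fixes f :: "real^'m::finite \<Rightarrow> complex"
  assumes "f \<in> schwartz"
  shows "integrable lborel f"
proof -
  obtain C where C: "C \<ge> 0" "\<And>x. cmod (f x) \<le> C / (1 + norm x) ^ (2 * CARD('m))"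
    using schwartz_decay_pos[OF assms] by blast
  show ?thesis
  proof (rule Bochner_Integration.integrable_bound)
    show "integrable lborel (\<lambda>x::real^'m. C * (1 / (1 + norm x) ^ (2 * CARD('m))))"
      by (intro integrable_mult_right integrable_inverse_polynomial)
    show "AE x in lborel. cmod (f x) \<le> norm (C * (1 / (1 + norm x) ^ (2 * CARD('m))))"
      using C by (intro AE_I2) (simp add: abs_mult)
  qed (use schwartz_measurable[OF assms] in simp)
qed

lemma schwartz_integrable_norm_mult:
  fixes f :: "real^'m::finite \<Rightarrow> complex"
  assumes "f \<in> schwartz"
  shows "integrable lborel (\<lambda>x. (norm x) ^ p * cmod (f x))"
proof -
  obtain C where C: "C \<ge> 0" "\<And>x. cmod (f x) \<le> C / (1 + norm x) ^ (2 * CARD('m) + p)"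
    using schwartz_decay_pos[OF assms] by blast
  show ?thesis
  proof (rule Bochner_Integration.integrable_bound)
    show "integrable lborel (\<lambda>x::real^'m. C * (1 / (1 + norm x) ^ (2 * CARD('m))))"
      by (intro integrable_mult_right integrable_inverse_polynomial)
    show "AE x in lborel. norm ((norm x) ^ p * cmod (f x)) \<le> norm (C * (1 / (1 + norm x) ^ (2 * CARD('m))))"
    proof (rule AE_I2)
      fix x :: "real^'m"
      have pos: "0 < 1 + norm x" by (intro add_pos_nonneg) auto
      have "(norm x) ^ p * cmod (f x) \<le> (1 + norm x) ^ p * (C / (1 + norm x) ^ (2 * CARD('m) + p))"
        by (intro mult_mono power_mono C) auto
      also have "\<dots> = C * (1 / (1 + norm x) ^ (2 * CARD('m)))"
        using pos by (simp add: power_add)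
      finally show "norm ((norm x) ^ p * cmod (f x)) \<le> norm (C * (1 / (1 + norm x) ^ (2 * CARD('m))))"
        using C(1) pos by (simp add: abs_mult)
    qed
  qed (use schwartz_measurable[OF assms] in simp)
qed

lemma schwartz_integrable_square:
  fixes f :: "real^'m::finite \<Rightarrow> complex"
  assumes "f \<in> schwartz"
  shows "integrable lborel (\<lambda>x. (cmod (f x))\<^sup>2)"
proof -
  obtain C where C: "C \<ge> 0" "\<And>x. cmod (f x) \<le> C / (1 + norm x) ^ 0"
    using schwartz_decay_pos[OF assms] by blast
  show ?thesis
  proof (rule Bochner_Integration.integrable_bound)
    show "integrable lborel (\<lambda>x. C * cmod (f x))"
      using schwartz_integrable[OF assms] by (intro integrable_mult_right integrable_norm)
    show "AE x in lborel. norm ((cmod (f x))\<^sup>2) \<le> norm (C * cmod (f x))"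
      using C by (intro AE_I2) (simp add: power2_eq_square abs_mult mult_right_mono)
  qed (use schwartz_measurable[OF assms] in simp)
qed

section \<open>Test functions as Schwartz functions\<close>

lemma partials_eq_0_off_closed:
  assumes "closed K" "\<And>x. x \<notin> K \<Longrightarrow> f x = 0" "x \<notin> K"
  shows "partials js f x = 0"
  using assms(3)
proof (induction js arbitrary: x)
  case (Cons j js)
  have "(partials js f has_derivative (\<lambda>_. 0)) (at x)"
  proof (rule has_derivative_transform_within_open[of "\<lambda>_. 0" _ _ _ "- K"])
    show "open (- K)" using assms(1) by (simp add: open_Compl)
  qed (use Cons in auto)
  from frechet_derivative_at[OF this] show ?case by (metis partials.simps(2))
qed (use assms in auto)

lemma test_functions_subset_schwartz: "test_functions \<Omega> \<subseteq> schwartz"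
proof
  fix f assume f: "f \<in> test_functions \<Omega>"
  define K where "K = closure {x. f x \<noteq> 0}"
  have K: "compact K" "closed K" and sm: "smooth f"
    using f by (auto simp: test_functions_def K_def)
  have f0: "f x = 0" if "x \<notin> K" for x
    using that closure_subset[of "{x. f x \<noteq> 0}"] by (auto simp: K_def)
  have "\<exists>C. \<forall>x. (1 + norm x) ^ N * cmod (partials js f x) \<le> C" for N js
  proof -
    have "continuous_on UNIV (partials js f)"
      using sm unfolding smooth_def
      by (simp add: differentiable_imp_continuous_within continuous_at_imp_continuous_on)
    then have "continuous_on K (\<lambda>x. (1 + norm x) ^ N * cmod (partials js f x))"
      by (intro continuous_intros) (auto intro: continuous_on_subset)
    then have "bounded ((\<lambda>x. (1 + norm x) ^ N * cmod (partials js f x)) ` K)"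
      using K(1) compact_continuous_image compact_imp_bounded by blast
    then obtain C where C: "\<And>x. x \<in> K \<Longrightarrow> \<bar>(1 + norm x) ^ N * cmod (partials js f x)\<bar> \<le> C"
      unfolding bounded_iff by auto
    have "(1 + norm x) ^ N * cmod (partials js f x) \<le> max C 0" for x
    proof (cases "x \<in> K")
      case True then show ?thesis using C[OF True] by linarith
    next
      case False
      then show ?thesis using partials_eq_0_off_closed[OF K(2) f0] by simp
    qed
    then show ?thesis by blast
  qed
  with sm show "f \<in> schwartz" by (auto simp: schwartz_def)
qed

lemma test_functions_cnj:
  assumes "f \<in> test_functions \<Omega>"
  shows "(\<lambda>x. cnj (f x)) \<in> test_functions \<Omega>"
proof -
  have "(\<lambda>x. cnj (f x)) \<in> schwartz"
    using assms test_functions_subset_schwartz schwartz_cnj by blast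
  with assms show ?thesis by (auto simp: test_functions_def schwartz_def)
qed

text \<open>Polynomial multiples of one Gaussian, given by generators: closure under partial
  derivatives and the decay estimate then become inductions, with no calculus of polynomials in
  several variables.\<close>

inductive_set gaussian_monomials :: "real \<Rightarrow> real^'m::finite \<Rightarrow> (real^'m \<Rightarrow> complex) set"
  for a :: real and c :: "real^'m" where
  base: "(\<lambda>x. of_real (exp (- a * (norm (x - c))\<^sup>2))) \<in> gaussian_monomials a c"
| coord: "f \<in> gaussian_monomials a c \<Longrightarrow> (\<lambda>x. of_real (x $ j) * f x) \<in> gaussian_monomials a c"
| cmult: "f \<in> gaussian_monomials a c \<Longrightarrow> (\<lambda>x. z * f x) \<in> gaussian_monomials a c"
| add: "f \<in> gaussian_monomials a c \<Longrightarrow> g \<in> gaussian_monomials a c \<Longrightarrow> (\<lambda>x. f x + g x) \<in> gaussian_monomials a c"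

lemma gaussian_has_derivative:
  "((\<lambda>x::real^'m::finite. complex_of_real (exp (- a * (norm (x - c))\<^sup>2))) has_derivative
   (\<lambda>v. of_real (- 2 * a * ((x - c) \<bullet> v)) * of_real (exp (- a * (norm (x - c))\<^sup>2)))) (at x)"
proof -
  have n: "(norm (x - c))\<^sup>2 = (x - c) \<bullet> (x - c)" for x by (rule power2_norm_eq_inner)
  have "((\<lambda>x. exp (- a * ((x - c) \<bullet> (x - c)))) has_derivative
    (\<lambda>v. (- 2 * a * ((x - c) \<bullet> v)) * exp (- a * ((x - c) \<bullet> (x - c))))) (at x)"
    by (auto intro!: derivative_eq_intros simp: inner_commute algebra_simps)
  from bounded_linear.has_derivative[OF bounded_linear_of_real this]
  show ?thesis unfolding n by simp
qed

lemma gaussian_monomials_partial: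
  assumes "f \<in> gaussian_monomials a (c::real^'m::finite)"
  shows "f differentiable (at x) \<and> (\<lambda>x. frechet_derivative f (at x) (axis j 1)) \<in> gaussian_monomials a c"
  using assms
proof (induction arbitrary: x)
  case base
  let ?g = "\<lambda>x. complex_of_real (exp (- a * (norm (x - c))\<^sup>2))"
  have "(\<lambda>x. frechet_derivative ?g (at x) (axis j 1)) =
     (\<lambda>x. of_real (- 2 * a) * (of_real (x $ j) * ?g x) + of_real (2 * a * (c $ j)) * ?g x)"
    by (rule ext, subst frechet_derivative_at[OF gaussian_has_derivative, symmetric])
       (simp add: inner_axis algebra_simps)
  moreover have "\<dots> \<in> gaussian_monomials a c"
    by (intro gaussian_monomials.intros)
  ultimately show ?case
    using gaussian_has_derivative[of a c x] by (auto simp: differentiable_def)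
next
  case (coord f i)
  have "(\<lambda>x. frechet_derivative (\<lambda>x. complex_of_real (x $ i) * f x) (at x) (axis j 1)) =
     (\<lambda>x. of_real (x $ i) * frechet_derivative f (at x) (axis j 1) + of_real (axis j 1 $ i) * f x)"
    using coord.IH by (intro ext frechet_derivative_coord_mult) blast
  moreover have "\<dots> \<in> gaussian_monomials a c"
    by (intro gaussian_monomials.add gaussian_monomials.coord gaussian_monomials.cmult)
       (use coord in auto)
  moreover have "(\<lambda>x. complex_of_real (x $ i) * f x) differentiable (at x)"
    by (intro differentiable_mult) (use coord.IH coord_has_derivative[of i x] in \<open>auto simp: differentiable_def\<close>)
  ultimately show ?case by simp
next
  case (cmult f z)
  have D: "(f has_derivative frechet_derivative f (at x)) (at x)" for x
    using cmult.IH frechet_derivative_works by blast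
  have D': "((\<lambda>x. z * f x) has_derivative (\<lambda>v. z * frechet_derivative f (at x) v)) (at x)" for x
    by (rule bounded_linear.has_derivative[OF bounded_linear_mult_right D])
  have "(\<lambda>x. frechet_derivative (\<lambda>x. z * f x) (at x) (axis j 1)) =
     (\<lambda>x. z * frechet_derivative f (at x) (axis j 1))"
    by (rule ext, subst frechet_derivative_at[OF D', symmetric]) simp
  moreover have "\<dots> \<in> gaussian_monomials a c"
    using cmult by (intro gaussian_monomials.cmult) auto
  ultimately show ?case using D' by (auto simp: differentiable_def)
next
  case (add f g)
  have Df: "(f has_derivative frechet_derivative f (at x)) (at x)"
    and Dg: "(g has_derivative frechet_derivative g (at x)) (at x)" for x
    using add.IH frechet_derivative_works by blast+
  note D' = has_derivative_add[OF Df Dg]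
  have "(\<lambda>x. frechet_derivative (\<lambda>x. f x + g x) (at x) (axis j 1)) =
     (\<lambda>x. frechet_derivative f (at x) (axis j 1) + frechet_derivative g (at x) (axis j 1))"
    by (rule ext, subst frechet_derivative_at[OF D', symmetric]) simp
  moreover have "\<dots> \<in> gaussian_monomials a c"
    using add by (intro gaussian_monomials.add) auto
  ultimately show ?case using D' by (auto simp: differentiable_def)
qed

lemma gaussian_monomials_bound:
  assumes "f \<in> gaussian_monomials a (c::real^'m::finite)"
  shows "\<exists>C M. C \<ge> 0 \<and> (\<forall>x. cmod (f x) \<le> C * (1 + norm x) ^ M * exp (- a * (norm (x - c))\<^sup>2))"
  using assms
proof induction
  case base
  show ?case by (rule exI[of _ 1], rule exI[of _ 0]) simp
next
  case (coord f j)
  then obtain C M where C: "C \<ge> 0" "\<And>x. cmod (f x) \<le> C * (1 + norm x) ^ M * exp (- a * (norm (x - c))\<^sup>2)" by blast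
  have "cmod (of_real (x $ j) * f x) \<le> C * (1 + norm x) ^ Suc M * exp (- a * (norm (x - c))\<^sup>2)" for x
  proof -
    have "cmod (of_real (x $ j) * f x) \<le> (1 + norm x) * (C * (1 + norm x) ^ M * exp (- a * (norm (x - c))\<^sup>2))"
      unfolding norm_mult using component_le_norm_cart[of x j]
      by (intro mult_mono C) auto
    then show ?thesis by (simp add: mult_ac)
  qed
  then show ?case using C(1) by blast
next
  case (cmult f z)
  then obtain C M where C: "C \<ge> 0" "\<And>x. cmod (f x) \<le> C * (1 + norm x) ^ M * exp (- a * (norm (x - c))\<^sup>2)" by blast
  have "cmod (z * f x) \<le> (cmod z * C) * (1 + norm x) ^ M * exp (- a * (norm (x - c))\<^sup>2)" for x
    using mult_left_mono[OF C(2)[of x], of "cmod z"] by (simp add: norm_mult mult_ac)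
  then show ?case using mult_nonneg_nonneg[OF norm_ge_zero C(1)] by blast
next
  case (add f g)
  then obtain C M D L where C: "C \<ge> 0" "\<And>x. cmod (f x) \<le> C * (1 + norm x) ^ M * exp (- a * (norm (x - c))\<^sup>2)"
    and D: "D \<ge> 0" "\<And>x. cmod (g x) \<le> D * (1 + norm x) ^ L * exp (- a * (norm (x - c))\<^sup>2)" by blast
  have "cmod (f x + g x) \<le> (C + D) * (1 + norm x) ^ (M + L) * exp (- a * (norm (x - c))\<^sup>2)" for x
  proof -
    have "C * (1 + norm x) ^ M * exp (- a * (norm (x - c))\<^sup>2) \<le> C * (1 + norm x) ^ (M + L) * exp (- a * (norm (x - c))\<^sup>2)"
      "D * (1 + norm x) ^ L * exp (- a * (norm (x - c))\<^sup>2) \<le> D * (1 + norm x) ^ (M + L) * exp (- a * (norm (x - c))\<^sup>2)"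
      using C(1) D(1) by (intro mult_left_mono mult_right_mono power_increasing; simp)+
    then show ?thesis
      using norm_triangle_ineq[of "f x" "g x"] C(2)[of x] D(2)[of x] by (simp add: algebra_simps)
  qed
  then show ?case using add_nonneg_nonneg[OF C(1) D(1)] by blast
qed

lemma gaussian_polynomial_bounded:
  fixes c :: "'a::real_normed_vector"
  assumes a: "a > 0"
  shows "\<exists>C. \<forall>x. (1 + norm x) ^ M * exp (- a * (norm (x - c))\<^sup>2) \<le> C"
proof -
  \<comment> \<open>With t = norm (x - c) one has 1 + norm x \<le> d + t, which leaves a limit in
    one real variable.\<close>
  define d where "d = 1 + norm c"
  have d: "d \<ge> 1" by (simp add: d_def)
  have "((\<lambda>t::real. (d + t) ^ M * exp (- a * t\<^sup>2)) \<longlongrightarrow> 0) at_top"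
    using a by real_asymp
  then have "eventually (\<lambda>t. norm ((d + t) ^ M * exp (- a * t\<^sup>2)) < 1) at_top"
    by (auto simp: tendsto_iff dist_norm)
  then obtain T where T: "\<And>t. t \<ge> T \<Longrightarrow> norm ((d + t) ^ M * exp (- a * t\<^sup>2)) < 1"
    by (auto simp: eventually_at_top_linorder)
  have "(1 + norm x) ^ M * exp (- a * (norm (x - c))\<^sup>2) \<le> max 1 ((d + max T 0) ^ M)" for x
  proof -
    define t where "t = norm (x - c)"
    have t: "t \<ge> 0" by (simp add: t_def)
    have "norm x \<le> norm c + t" unfolding t_def using norm_triangle_ineq[of c "x - c"] by simp
    then have le: "(1 + norm x) ^ M * exp (- a * t\<^sup>2) \<le> (d + t) ^ M * exp (- a * t\<^sup>2)"
      by (intro mult_right_mono power_mono) (auto simp: d_def)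
    show ?thesis
    proof (cases "t \<ge> T")
      case True
      have "(d + t) ^ M * exp (- a * t\<^sup>2) < 1" using T[OF True] unfolding real_norm_def by linarith
      then show ?thesis using le unfolding t_def[symmetric] by linarith
    next
      case False
      have "(d + t) ^ M * exp (- a * t\<^sup>2) \<le> (d + max T 0) ^ M * 1"
        using False d t a by (intro mult_mono power_mono) (auto intro!: zero_le_power)
      then show ?thesis using le unfolding t_def[symmetric] by linarith
    qed
  qed
  then show ?thesis by blast
qed

lemma gaussian_schwartz:
  assumes "a > 0"
  shows "(\<lambda>x. complex_of_real (exp (- a * (norm (x - c))\<^sup>2))) \<in> schwartz"
proof (rule schwartz_coinduct[where S="gaussian_monomials a c"])
  show "(\<lambda>x. complex_of_real (exp (- a * (norm (x - c))\<^sup>2))) \<in> gaussian_monomials a c"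
    by (rule gaussian_monomials.base)
next
  fix f N assume "f \<in> gaussian_monomials a c"
  then obtain C M where C: "C \<ge> 0" "\<And>x. cmod (f x) \<le> C * (1 + norm x) ^ M * exp (- a * (norm (x - c))\<^sup>2)"
    using gaussian_monomials_bound by blast
  obtain D where D: "\<And>x. (1 + norm x) ^ (N + M) * exp (- a * (norm (x - c))\<^sup>2) \<le> D"
    using gaussian_polynomial_bounded[OF assms] by blast
  have "(1 + norm x) ^ N * cmod (f x) \<le> C * D" for x
  proof -
    have "(1 + norm x) ^ N * cmod (f x) \<le> (1 + norm x) ^ N * (C * (1 + norm x) ^ M * exp (- a * (norm (x - c))\<^sup>2))"
      by (intro mult_left_mono C) auto
    also have "\<dots> = C * ((1 + norm x) ^ (N + M) * exp (- a * (norm (x - c))\<^sup>2))"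
      by (simp add: power_add mult_ac)
    also have "\<dots> \<le> C * D" by (intro mult_left_mono D C)
    finally show ?thesis .
  qed
  then show "\<exists>C. \<forall>x. (1 + norm x) ^ N * cmod (f x) \<le> C" by blast
qed (use gaussian_monomials_partial in blast)+


subsection \<open>Fourier transform\<close>

lemma
  fixes f :: "'a::euclidean_space \<Rightarrow> 'b::{banach,second_countable_topology}"
  assumes c: "c \<noteq> 0"
  shows lborel_integral_affine: "f \<in> borel_measurable borel \<Longrightarrow>
      (\<integral>x. f (t + c *\<^sub>R x) \<partial>lborel) = (1 / \<bar>c\<bar> ^ DIM('a)) *\<^sub>R (\<integral>x. f x \<partial>lborel)"
    and lborel_integrable_affine: "integrable lborel f \<Longrightarrow> integrable lborel (\<lambda>x. f (t + c *\<^sub>R x))"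
proof -
  let ?T = "\<lambda>x::'a. t + c *\<^sub>R x"
  let ?k = "\<bar>c\<bar> ^ DIM('a)"
  have k: "?k > 0" using c by simp
  have L: "(lborel :: 'a measure) = density (distr lborel borel ?T) (\<lambda>_. ennreal ?k)"
    using lborel_affine[OF c, of t] by simp
  { assume f: "f \<in> borel_measurable borel"
    have "(\<integral>x. f x \<partial>lborel) = (\<integral>x. ?k *\<^sub>R f x \<partial>distr lborel borel ?T)"
      by (subst L, subst integral_density) (use f k in auto)
    also have "\<dots> = ?k *\<^sub>R (\<integral>x. f (?T x) \<partial>lborel)"
      by (subst integral_distr) (use f in auto)
    finally show "(\<integral>x. f (?T x) \<partial>lborel) = (1 / ?k) *\<^sub>R (\<integral>x. f x \<partial>lborel)"
      using k by simp }
  { assume i: "integrable lborel f"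
    then have f: "f \<in> borel_measurable borel" by simp
    have "integrable (distr lborel borel ?T) (\<lambda>x. ?k *\<^sub>R f x)"
      using i by (subst (asm) L, subst (asm) integrable_density) (use f k in auto)
    then have "integrable lborel (\<lambda>x. ?k *\<^sub>R f (?T x))"
      by (subst (asm) integrable_distr_eq) (use f in auto)
    then have "integrable lborel (\<lambda>x. (1 / ?k) *\<^sub>R (?k *\<^sub>R f (?T x)))"
      by (rule integrable_scaleR_right)
    moreover have e: "(\<lambda>x. (1 / ?k) *\<^sub>R (?k *\<^sub>R f (?T x))) = (\<lambda>x. f (?T x))" using k by auto
    ultimately show "integrable lborel (\<lambda>x. f (?T x))" by (simp only: e) }
qed

lemma lborel_integral_reflect:
  fixes f :: "'a::euclidean_space \<Rightarrow> 'b::{banach,second_countable_topology}"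
  assumes "f \<in> borel_measurable borel"
  shows "(\<integral>x. f (- x) \<partial>lborel) = (\<integral>x. f x \<partial>lborel)"
  using lborel_integral_affine[of "-1" f 0] assms by simp

lemma integrable_lborel_pair_mult:
  fixes f :: "'a::euclidean_space \<Rightarrow> complex" and g :: "'b::euclidean_space \<Rightarrow> complex"
  assumes f: "integrable lborel f" and g: "integrable lborel g"
  shows "integrable (lborel \<Otimes>\<^sub>M lborel) (\<lambda>(x, y). f x * g y)"
proof (rule lborel_pair.Fubini_integrable)
  have [measurable]: "f \<in> borel_measurable borel" "g \<in> borel_measurable borel"
    using f g by simp_all
  show "(\<lambda>(x, y). f x * g y) \<in> borel_measurable (lborel \<Otimes>\<^sub>M lborel)" by measurable
  have "integrable lborel (\<lambda>x. cmod (f x) * (\<integral>y. cmod (g y) \<partial>lborel))"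
    by (intro integrable_mult_left integrable_norm f)
  then show "integrable lborel (\<lambda>x. \<integral>y. norm (case (x, y) of (x, y) \<Rightarrow> f x * g y) \<partial>lborel)"
    by (simp add: norm_mult)
  show "AE x in lborel. integrable lborel (\<lambda>y. case (x, y) of (x, y) \<Rightarrow> f x * g y)"
    using g by simp
qed

section \<open>Elementary rules for the transform\<close>

lemma fourier_const_eq: "(2 * pi) powr (- real n / 2) = 1 / sqrt (2 * pi) ^ n"
proof -
  have "sqrt (2 * pi) ^ n = (2 * pi) powr (real n / 2)"
    by (simp add: powr_half_sqrt[symmetric] powr_powr flip: powr_realpow)
  then show ?thesis by (simp add: powr_minus_divide)
qed

lemma fourier_kernel_integrable:
  assumes "integrable lborel f"
  shows "integrable lborel (\<lambda>x. exp (- \<i> * complex_of_real (\<xi> \<bullet> x)) * f x)"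
proof (rule Bochner_Integration.integrable_bound[OF assms])
  have [measurable]: "f \<in> borel_measurable borel" using assms by simp
  show "(\<lambda>x. exp (- \<i> * complex_of_real (\<xi> \<bullet> x)) * f x) \<in> borel_measurable lborel" by measurable
qed (simp add: norm_mult)

lemma fourier_add:
  "integrable lborel f \<Longrightarrow> integrable lborel g \<Longrightarrow>
    fourier (\<lambda>x. f x + g x) \<xi> = fourier f \<xi> + fourier g \<xi>"
  by (simp only: fourier_def distrib_left
      Bochner_Integration.integral_add[OF fourier_kernel_integrable fourier_kernel_integrable])

lemma fourier_cmult: "fourier (\<lambda>x. c * f x) \<xi> = c * fourier f \<xi>"
proof -
  have "(\<lambda>x. exp (- \<i> * complex_of_real (\<xi> \<bullet> x)) * (c * f x)) =
    (\<lambda>x. c * (exp (- \<i> * complex_of_real (\<xi> \<bullet> x)) * f x))" by (simp add: mult_ac)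
  then show ?thesis by (simp add: fourier_def)
qed

lemma fourier_cnj: "fourier (\<lambda>x. cnj (f x)) \<xi> = cnj (fourier f (- \<xi>))"
proof -
  have "cnj (\<integral>x. exp (\<i> * complex_of_real (\<xi> \<bullet> x)) * f x \<partial>lborel) =
    (\<integral>x. cnj (exp (\<i> * complex_of_real (\<xi> \<bullet> x)) * f x) \<partial>lborel)"
    by (simp only: Bochner_Integration.integral_cnj)
  then show ?thesis by (simp add: fourier_def exp_cnj)
qed

lemma fourier_norm_le:
  assumes "integrable lborel f"
  shows "cmod (fourier f (\<xi>::real^'m::finite)) \<le> (2 * pi) powr (- real CARD('m) / 2) * (\<integral>x. cmod (f x) \<partial>lborel)"
proof -
  have "cmod (\<integral>x. exp (- \<i> * complex_of_real (\<xi> \<bullet> x)) * f x \<partial>lborel) \<le>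
     (\<integral>x. cmod (exp (- \<i> * complex_of_real (\<xi> \<bullet> x)) * f x) \<partial>lborel)"
    by (rule integral_norm_bound)
  then show ?thesis
    by (simp add: fourier_def norm_mult mult_left_mono)
qed

lemma fourier_measurable [measurable]:
  assumes [measurable]: "f \<in> borel_measurable borel"
  shows "fourier f \<in> borel_measurable borel"
  unfolding fourier_def by measurable

text \<open>A quadratic remainder is what the Taylor estimate of the exponential provides under the
  integral sign; it yields the total derivative of the transform at once, as \<open>smooth\<close>
  demands, and not only partial derivatives.\<close>

lemma has_derivative_quadratic:
  assumes D: "bounded_linear D" and q: "\<And>h. norm (F (x + h) - F x - D h) \<le> K * (norm h)\<^sup>2"
  shows "(F has_derivative D) (at x)"
  unfolding has_derivative_at
proof (intro conjI D)
  show "(\<lambda>h. norm (F (x + h) - F x - D h) / norm h) \<midarrow>0\<rightarrow> 0"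
  proof (rule Lim_null_comparison)
    have "norm (F (x + h) - F x - D h) / norm h \<le> K * norm h" for h
      using q[of h] by (cases "h = 0") (auto simp: field_simps power2_eq_square)
    then show "\<forall>\<^sub>F h in at 0. norm (norm (F (x + h) - F x - D h) / norm h) \<le> K * norm h" by simp
    show "(\<lambda>h. K * norm h) \<midarrow>0\<rightarrow> 0" by (auto intro!: tendsto_eq_intros)
  qed
qed

lemma fourier_has_derivative:
  fixes f :: "real^'m::finite \<Rightarrow> complex"
  assumes f: "f \<in> schwartz"
  shows "(fourier f has_derivative (\<lambda>h. fourier (\<lambda>x. - \<i> * of_real (h \<bullet> x) * f x) \<xi>)) (at \<xi>)"
proof (rule has_derivative_quadratic)
  let ?c = "(2 * pi) powr (- real CARD('m) / 2)"
  have [measurable]: "f \<in> borel_measurable borel" by (rule schwartz_measurable[OF f])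
  have i1: "integrable lborel (\<lambda>x. of_real (h \<bullet> x) * f x)" for h
  proof (rule Bochner_Integration.integrable_bound)
    show "integrable lborel (\<lambda>x. norm h * ((norm x) ^ 1 * cmod (f x)))"
      by (intro integrable_mult_right schwartz_integrable_norm_mult f)
    show "AE x in lborel. cmod (of_real (h \<bullet> x) * f x) \<le> norm (norm h * ((norm x) ^ 1 * cmod (f x)))"
      by (intro AE_I2) (use Cauchy_Schwarz_ineq2[of h] in \<open>auto simp: norm_mult abs_mult mult.assoc[symmetric] mult_right_mono\<close>)
  qed measurable
  have i1': "integrable lborel (\<lambda>x. - \<i> * of_real (h \<bullet> x) * f x)" for h
    using integrable_mult_right[of "- \<i>", OF i1[of h]] by (simp add: mult.assoc)
  show "bounded_linear (\<lambda>h. fourier (\<lambda>x. - \<i> * of_real (h \<bullet> x) * f x) \<xi>)"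
  proof (rule bounded_linear_intro)
    fix h k :: "real^'m" and r :: real
    show "fourier (\<lambda>x. - \<i> * of_real ((h + k) \<bullet> x) * f x) \<xi> =
      fourier (\<lambda>x. - \<i> * of_real (h \<bullet> x) * f x) \<xi> + fourier (\<lambda>x. - \<i> * of_real (k \<bullet> x) * f x) \<xi>"
      by (subst fourier_add[symmetric, OF i1' i1']) (simp add: inner_add_left algebra_simps)
    show "fourier (\<lambda>x. - \<i> * of_real ((r *\<^sub>R h) \<bullet> x) * f x) \<xi> =
      r *\<^sub>R fourier (\<lambda>x. - \<i> * of_real (h \<bullet> x) * f x) \<xi>"
    proof -
      have "(\<lambda>x. - \<i> * of_real ((r *\<^sub>R h) \<bullet> x) * f x) = (\<lambda>x. of_real r * (- \<i> * of_real (h \<bullet> x) * f x))"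
        by (simp add: mult_ac)
      then show ?thesis by (simp only: fourier_cmult scaleR_conv_of_real)
    qed
    have "cmod (fourier (\<lambda>x. - \<i> * of_real (h \<bullet> x) * f x) \<xi>) \<le>
        ?c * (\<integral>x. cmod (- \<i> * of_real (h \<bullet> x) * f x) \<partial>lborel)"
      by (rule fourier_norm_le[OF i1'])
    also have "\<dots> \<le> ?c * (\<integral>x. norm h * ((norm x) ^ 1 * cmod (f x)) \<partial>lborel)"
    proof (intro mult_left_mono integral_mono)
      show "integrable lborel (\<lambda>x. cmod (- \<i> * of_real (h \<bullet> x) * f x))"
        using i1' by (rule integrable_norm)
      show "integrable lborel (\<lambda>x. norm h * ((norm x) ^ 1 * cmod (f x)))"
        by (intro integrable_mult_right schwartz_integrable_norm_mult f)
    qed (use Cauchy_Schwarz_ineq2[of h] in \<open>auto simp: norm_mult mult.assoc[symmetric] mult_right_mono\<close>)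
    finally show "cmod (fourier (\<lambda>x. - \<i> * of_real (h \<bullet> x) * f x) \<xi>) \<le>
        norm h * (?c * (\<integral>x. (norm x) ^ 1 * cmod (f x) \<partial>lborel))"
      by (simp only: integral_mult_right_zero mult.left_commute[of ?c])
  qed
  let ?K = "?c * ((\<integral>x. (norm x)\<^sup>2 * cmod (f x) \<partial>lborel) / 2)"
  fix h :: "real^'m"
  let ?e = "\<lambda>\<xi> x. exp (- \<i> * complex_of_real (\<xi> \<bullet> x))"
  have int_f: "integrable lborel f" by (rule schwartz_integrable[OF f])
  \<comment> \<open>The first-order Taylor remainder of exp (i s) at s = - h . x is at most s^2 / 2,
    so the second moment of f controls the error uniformly in \<xi>.\<close>
  have pt: "cmod (?e (\<xi> + h) x * f x - ?e \<xi> x * f x - ?e \<xi> x * (- \<i> * of_real (h \<bullet> x) * f x)) \<le>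
     (norm h)\<^sup>2 / 2 * ((norm x)\<^sup>2 * cmod (f x))" for x
  proof -
    have "?e (\<xi> + h) x * f x - ?e \<xi> x * f x - ?e \<xi> x * (- \<i> * of_real (h \<bullet> x) * f x) =
      ?e \<xi> x * (exp (\<i> * of_real (- (h \<bullet> x))) - (\<Sum>k\<le>1. (\<i> * of_real (- (h \<bullet> x))) ^ k / fact k)) * f x"
      by (simp add: inner_add_left algebra_simps exp_add exp_diff exp_minus divide_inverse)
    then have "cmod (?e (\<xi> + h) x * f x - ?e \<xi> x * f x - ?e \<xi> x * (- \<i> * of_real (h \<bullet> x) * f x)) =
      cmod (exp (\<i> * of_real (- (h \<bullet> x))) - (\<Sum>k\<le>1. (\<i> * of_real (- (h \<bullet> x))) ^ k / fact k)) * cmod (f x)"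
      by (simp only: norm_mult) simp
    also have "\<dots> \<le> \<bar>- (h \<bullet> x)\<bar> ^ Suc 1 / fact (Suc 1) * cmod (f x)"
      by (intro mult_right_mono iexp_approx1) auto
    also have "\<dots> = (\<bar>h \<bullet> x\<bar>)\<^sup>2 / 2 * cmod (f x)" by (simp add: power2_eq_square)
    also have "\<dots> \<le> (norm h * norm x)\<^sup>2 / 2 * cmod (f x)"
      by (intro mult_right_mono divide_right_mono power_mono Cauchy_Schwarz_ineq2) auto
    finally show ?thesis by (simp add: power_mult_distrib mult_ac)
  qed
  have "fourier f (\<xi> + h) - fourier f \<xi> - fourier (\<lambda>x. - \<i> * of_real (h \<bullet> x) * f x) \<xi> =
    of_real ?c * (\<integral>x. ?e (\<xi> + h) x * f x - ?e \<xi> x * f x - ?e \<xi> x * (- \<i> * of_real (h \<bullet> x) * f x) \<partial>lborel)"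
    unfolding fourier_def right_diff_distrib[symmetric]
    by (subst Bochner_Integration.integral_diff[symmetric],
        (intro Bochner_Integration.integrable_diff fourier_kernel_integrable int_f i1')+)+ simp
  also have "cmod \<dots> \<le> ?c * (\<integral>x. (norm h)\<^sup>2 / 2 * ((norm x)\<^sup>2 * cmod (f x)) \<partial>lborel)"
    unfolding norm_mult
  proof (intro mult_mono)
    show "cmod (\<integral>x. ?e (\<xi> + h) x * f x - ?e \<xi> x * f x - ?e \<xi> x * (- \<i> * of_real (h \<bullet> x) * f x) \<partial>lborel) \<le>
       (\<integral>x. (norm h)\<^sup>2 / 2 * ((norm x)\<^sup>2 * cmod (f x)) \<partial>lborel)"
    proof (rule Bochner_Integration.integral_norm_bound_integral)
      show "integrable lborel (\<lambda>x. ?e (\<xi> + h) x * f x - ?e \<xi> x * f x - ?e \<xi> x * (- \<i> * of_real (h \<bullet> x) * f x))"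
        by (intro Bochner_Integration.integrable_diff fourier_kernel_integrable int_f i1')
      show "integrable lborel (\<lambda>x. (norm h)\<^sup>2 / 2 * ((norm x)\<^sup>2 * cmod (f x)))"
        by (intro integrable_mult_right schwartz_integrable_norm_mult f)
    qed (rule pt)
  qed auto
  also have "\<dots> = ?K * (norm h)\<^sup>2" by (simp only: integral_mult_right_zero) simp
  finally show "cmod (fourier f (\<xi> + h) - fourier f \<xi> - fourier (\<lambda>x. - \<i> * of_real (h \<bullet> x) * f x) \<xi>) \<le> ?K * (norm h)\<^sup>2" .
qed

text \<open>No integration by parts: the difference quotient of f is moved onto the exponential by
  translation invariance, which gives an explicit factor for every step \<open>t n\<close>; both
  sides then converge, the side containing f by dominated convergence.\<close>

lemma fourier_partial:
  fixes f :: "real^'m::finite \<Rightarrow> complex"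
  assumes f: "f \<in> schwartz"
  shows "fourier (\<lambda>x. frechet_derivative f (at x) (axis j 1)) \<xi> = \<i> * of_real (\<xi> $ j) * fourier f \<xi>"
proof -
  let ?g = "\<lambda>x. frechet_derivative f (at x) (axis j 1)"
  let ?e = "\<lambda>x. exp (- \<i> * complex_of_real (\<xi> \<bullet> x))"
  let ?u = "axis j 1 :: real^'m"
  have g: "?g \<in> schwartz" by (rule schwartz_partial[OF f])
  have int_f: "integrable lborel f" by (rule schwartz_integrable[OF f])
  note [measurable] = schwartz_measurable[OF f] schwartz_measurable[OF g]
  define t where "t n = 1 / real (Suc n)" for n
  have t: "0 < t n" "t n \<le> 1" for n by (auto simp: t_def)
  have t0: "t \<longlonglongrightarrow> 0" unfolding t_def by (rule LIMSEQ_Suc[OF lim_1_over_n])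
  define s where "s n x = ?e x * ((f (x + t n *\<^sub>R ?u) - f x) / of_real (t n))" for n x
  have line: "((\<lambda>r. f (x + r *\<^sub>R ?u)) has_vector_derivative ?g (x + r *\<^sub>R ?u)) (at r within A)" for x r A
  proof -
    have "((\<lambda>r. x + r *\<^sub>R ?u) has_derivative (\<lambda>h. h *\<^sub>R ?u)) (at r within A)"
      by (auto intro!: derivative_eq_intros)
    from has_derivative_compose[OF this schwartz_has_derivative[OF f]]
    have "((\<lambda>r. f (x + r *\<^sub>R ?u)) has_derivative
        (\<lambda>h. frechet_derivative f (at (x + r *\<^sub>R ?u)) (h *\<^sub>R ?u))) (at r within A)" .
    then show ?thesis
      unfolding has_vector_derivative_def
      using linear_cmul[OF linear_frechet_derivative[OF schwartz_differentiable[OF f]]] by simp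
  qed
  obtain C where C: "C \<ge> 0" "\<And>x. cmod (?g x) \<le> C / (1 + norm x) ^ (2 * CARD('m))"
    using schwartz_decay_pos[OF g] by blast
  have "(\<lambda>n. \<integral>x. s n x \<partial>lborel) \<longlonglongrightarrow> (\<integral>x. ?e x * ?g x \<partial>lborel)"
  proof (rule integral_dominated_convergence)
    \<comment> \<open>The mean value theorem bounds the difference quotient by the partial
      derivative at a point at distance at most 1 from x. Such a shift at most doubles 1 + norm x,
      hence the factor \<open>2 ^ (2 * CARD('m))\<close>.\<close>
    show "integrable lborel (\<lambda>x::real^'m. C * 2 ^ (2 * CARD('m)) * (1 / (1 + norm x) ^ (2 * CARD('m))))"
      by (intro integrable_mult_right integrable_inverse_polynomial)
    show "AE x in lborel. (\<lambda>n. s n x) \<longlonglongrightarrow> ?e x * ?g x"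
    proof (rule AE_I2)
      fix x
      have "((\<lambda>r. (f (x + r *\<^sub>R ?u) - f x) /\<^sub>R r) \<longlongrightarrow> ?g x) (at 0)"
      proof -
        have lim: "((\<lambda>h. cmod (f (x + h *\<^sub>R ?u) - f x - h *\<^sub>R ?g x) / norm h) \<longlongrightarrow> 0) (at 0)"
          using line[of x 0 UNIV] by (simp add: has_vector_derivative_def has_derivative_at)
        have "((\<lambda>h. (f (x + h *\<^sub>R ?u) - f x) /\<^sub>R h - ?g x) \<longlongrightarrow> 0) (at 0)"
        proof (rule tendsto_norm_zero_cancel, rule Lim_transform_eventually[OF lim])
          have "cmod (A - h *\<^sub>R G) / norm h = cmod (A /\<^sub>R h - G)" if "h \<noteq> 0" for A G h
          proof -
            have "A /\<^sub>R h - G = (A - h *\<^sub>R G) /\<^sub>R h" using that by (simp add: scaleR_right_diff_distrib)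
            then show ?thesis by (simp add: divide_inverse mult.commute)
          qed
          then show "\<forall>\<^sub>F h in at 0. cmod (f (x + h *\<^sub>R ?u) - f x - h *\<^sub>R ?g x) / norm h =
              cmod ((f (x + h *\<^sub>R ?u) - f x) /\<^sub>R h - ?g x)"
            by (auto simp: eventually_at_filter)
        qed
        then show ?thesis by (rule LIM_zero_cancel)
      qed
      then have "(\<lambda>n. (f (x + t n *\<^sub>R ?u) - f x) /\<^sub>R t n) \<longlonglongrightarrow> ?g x"
        by (rule filterlim_compose) (use t(1) t0 in \<open>auto simp: filterlim_at less_imp_neq[symmetric]\<close>)
      then have "(\<lambda>n. ?e x * ((f (x + t n *\<^sub>R ?u) - f x) /\<^sub>R t n)) \<longlonglongrightarrow> ?e x * ?g x"
        by (intro tendsto_mult tendsto_const)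
      then show "(\<lambda>n. s n x) \<longlonglongrightarrow> ?e x * ?g x"
        unfolding s_def by (simp add: scaleR_conv_of_real divide_inverse mult_ac)
    qed
    show "AE x in lborel. cmod (s n x) \<le> C * 2 ^ (2 * CARD('m)) * (1 / (1 + norm x) ^ (2 * CARD('m)))" for n
    proof (rule AE_I2)
      fix x :: "real^'m"
      have der: "((\<lambda>r. f (x + r *\<^sub>R ?u)) has_derivative (\<lambda>h. h *\<^sub>R ?g (x + r *\<^sub>R ?u))) (at r within A)" for r A
        using line[of x r A] by (simp add: has_vector_derivative_def)
      have "continuous_on {0..t n} (\<lambda>r. f (x + r *\<^sub>R ?u))"
        using has_derivative_continuous[OF der] by (simp add: continuous_on_eq_continuous_within)
      from mvt_general[OF t(1)[of n] this der] obtain r where r: "r \<in> {0<..<t n}"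
        "norm (f (x + t n *\<^sub>R ?u) - f (x + 0 *\<^sub>R ?u)) \<le> norm ((t n - 0) *\<^sub>R ?g (x + r *\<^sub>R ?u))"
        by blast
      have "norm (r *\<^sub>R ?u) \<le> 1" using r(1) t(2)[of n] by (auto simp: abs_if)
      moreover have "norm x \<le> norm (x + r *\<^sub>R ?u) + norm (r *\<^sub>R ?u)"
        using norm_triangle_ineq4[of "x + r *\<^sub>R ?u" "r *\<^sub>R ?u"] by (simp only: add_diff_cancel_right')
      ultimately have "norm x \<le> norm (x + r *\<^sub>R ?u) + 1" by linarith
      moreover have "0 \<le> norm (x + r *\<^sub>R ?u)" by (rule norm_ge_zero)
      ultimately have "1 + norm x \<le> 2 + 2 * norm (x + r *\<^sub>R ?u)" by linarith
      then have le: "1 + norm x \<le> 2 * (1 + norm (x + r *\<^sub>R ?u))" by simp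
      have pos: "0 < 1 + norm x" "0 < 1 + norm (x + r *\<^sub>R ?u)" by (intro add_pos_nonneg; simp)+
      have "cmod (?g (x + r *\<^sub>R ?u)) \<le> C / (1 + norm (x + r *\<^sub>R ?u)) ^ (2 * CARD('m))" by (rule C)
      also have "\<dots> \<le> C / ((1 + norm x) / 2) ^ (2 * CARD('m))"
        using le pos C(1) by (intro divide_left_mono power_mono mult_pos_pos zero_less_power) auto
      also have "\<dots> = C * 2 ^ (2 * CARD('m)) * (1 / (1 + norm x) ^ (2 * CARD('m)))"
        by (simp add: power_divide)
      finally have gb: "cmod (?g (x + r *\<^sub>R ?u)) \<le> C * 2 ^ (2 * CARD('m)) * (1 / (1 + norm x) ^ (2 * CARD('m)))" .
      have "cmod (s n x) = cmod (f (x + t n *\<^sub>R ?u) - f x) / t n"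
        using t(1)[of n] by (simp add: s_def norm_mult norm_divide)
      also have "\<dots> \<le> cmod (?g (x + r *\<^sub>R ?u))"
        using r(2) t(1)[of n] by (simp add: pos_divide_le_eq mult.commute)
      finally show "cmod (s n x) \<le> C * 2 ^ (2 * CARD('m)) * (1 / (1 + norm x) ^ (2 * CARD('m)))"
        using gb by linarith
    qed
    show "(\<lambda>x. ?e x * ?g x) \<in> borel_measurable lborel" by measurable
    show "s n \<in> borel_measurable lborel" for n unfolding s_def by measurable
  qed
  moreover have "(\<integral>x. s n x \<partial>lborel) =
     (exp (\<i> * of_real (t n * \<xi> $ j)) - 1) / of_real (t n) * (\<integral>x. ?e x * f x \<partial>lborel)" for n
  proof -
    have ish: "integrable lborel (\<lambda>x. f (x + t n *\<^sub>R ?u))"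
      using lborel_integrable_affine[of 1 f "t n *\<^sub>R ?u", OF _ int_f] by (simp add: add.commute)
    have "(\<integral>x. ?e x * f (x + t n *\<^sub>R ?u) \<partial>lborel) =
      (\<integral>x. exp (\<i> * of_real (t n * \<xi> $ j)) * (?e (t n *\<^sub>R ?u + 1 *\<^sub>R x) * f (t n *\<^sub>R ?u + 1 *\<^sub>R x)) \<partial>lborel)"
    proof (rule Bochner_Integration.integral_cong[OF refl])
      fix x
      have "- \<i> * complex_of_real (\<xi> \<bullet> x) = \<i> * of_real (t n * \<xi> $ j) + - \<i> * complex_of_real (\<xi> \<bullet> (t n *\<^sub>R ?u + 1 *\<^sub>R x))"
        by (simp add: inner_add_right inner_axis algebra_simps)
      then have "?e x = exp (\<i> * of_real (t n * \<xi> $ j)) * ?e (t n *\<^sub>R ?u + 1 *\<^sub>R x)"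
        by (simp only: exp_add[symmetric])
      then show "?e x * f (x + t n *\<^sub>R ?u) =
          exp (\<i> * of_real (t n * \<xi> $ j)) * (?e (t n *\<^sub>R ?u + 1 *\<^sub>R x) * f (t n *\<^sub>R ?u + 1 *\<^sub>R x))"
        by (simp only: scaleR_one add.commute[of x] mult.assoc)
    qed
    also have "\<dots> = exp (\<i> * of_real (t n * \<xi> $ j)) * (\<integral>x. ?e x * f x \<partial>lborel)"
      by (subst integral_mult_right_zero, subst lborel_integral_affine) auto
    finally have sh: "(\<integral>x. ?e x * f (x + t n *\<^sub>R ?u) \<partial>lborel) =
      exp (\<i> * of_real (t n * \<xi> $ j)) * (\<integral>x. ?e x * f x \<partial>lborel)" .
    have "(\<integral>x. s n x \<partial>lborel) = (\<integral>x. (?e x * f (x + t n *\<^sub>R ?u) - ?e x * f x) / of_real (t n) \<partial>lborel)"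
      unfolding s_def by (simp add: right_diff_distrib)
    also have "\<dots> = ((\<integral>x. ?e x * f (x + t n *\<^sub>R ?u) \<partial>lborel) - (\<integral>x. ?e x * f x \<partial>lborel)) / of_real (t n)"
      by (simp only: integral_divide_zero
          Bochner_Integration.integral_diff[OF fourier_kernel_integrable[OF ish] fourier_kernel_integrable[OF int_f]])
    finally show ?thesis unfolding sh by (simp add: left_diff_distrib)
  qed
  moreover have "(\<lambda>n. (exp (\<i> * of_real (t n * \<xi> $ j)) - 1) / of_real (t n) * (\<integral>x. ?e x * f x \<partial>lborel))
     \<longlonglongrightarrow> \<i> * of_real (\<xi> $ j) * (\<integral>x. ?e x * f x \<partial>lborel)"
  proof (intro tendsto_mult tendsto_const)
    have "((\<lambda>z. exp (z * (\<i> * of_real (\<xi> $ j)))) has_field_derivative \<i> * of_real (\<xi> $ j)) (at 0)"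
      by (auto intro!: derivative_eq_intros)
    then have "((\<lambda>z. (exp (z * (\<i> * of_real (\<xi> $ j))) - 1) / z) \<longlongrightarrow> \<i> * of_real (\<xi> $ j)) (at 0)"
      by (simp add: has_field_derivative_iff)
    then have "(\<lambda>n. (exp (of_real (t n) * (\<i> * of_real (\<xi> $ j))) - 1) / of_real (t n)) \<longlonglongrightarrow> \<i> * of_real (\<xi> $ j)"
    proof (rule filterlim_compose)
      have "(\<lambda>n. complex_of_real (t n)) \<longlonglongrightarrow> of_real 0" by (intro tendsto_of_real t0)
      then show "filterlim (\<lambda>n. complex_of_real (t n)) (at 0) sequentially"
        using t(1) by (auto simp: filterlim_at less_imp_neq[symmetric])
    qed
    then show "(\<lambda>n. (exp (\<i> * of_real (t n * \<xi> $ j)) - 1) / of_real (t n)) \<longlonglongrightarrow> \<i> * of_real (\<xi> $ j)"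
      by (simp add: mult_ac)
  qed
  ultimately have "(\<integral>x. ?e x * ?g x \<partial>lborel) = \<i> * of_real (\<xi> $ j) * (\<integral>x. ?e x * f x \<partial>lborel)"
    using LIMSEQ_unique by simp
  then show ?thesis by (simp add: fourier_def mult_ac)
qed

text \<open>Each further power of 1 + norm \<xi> is paid for by a partial derivative of f, through
  \<open>fourier_partial\<close> and the l1 bound on the norm; the induction therefore runs over all
  Schwartz functions at once.\<close>

lemma fourier_decay:
  fixes f :: "real^'m::finite \<Rightarrow> complex"
  assumes "f \<in> schwartz"
  shows "\<exists>C. \<forall>\<xi>. (1 + norm \<xi>) ^ N * cmod (fourier f \<xi>) \<le> C"
  using assms
proof (induction N arbitrary: f)
  case 0
  then show ?case using fourier_norm_le[OF schwartz_integrable] by auto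
next
  case (Suc N)
  let ?g = "\<lambda>j x. frechet_derivative f (at x) (axis j 1)"
  obtain C where C: "\<And>\<xi>. (1 + norm \<xi>) ^ N * cmod (fourier f \<xi>) \<le> C" using Suc by blast
  have "\<forall>j. \<exists>D. \<forall>\<xi>. (1 + norm \<xi>) ^ N * cmod (fourier (?g j) \<xi>) \<le> D"
    using Suc.IH[OF schwartz_partial[OF Suc.prems]] by blast
  then obtain D where D: "\<And>j \<xi>. (1 + norm \<xi>) ^ N * cmod (fourier (?g j) \<xi>) \<le> D j" by metis
  have "(1 + norm \<xi>) ^ Suc N * cmod (fourier f \<xi>) \<le> C + (\<Sum>j\<in>UNIV. D j)" for \<xi> :: "real^'m"
  proof -
    have "norm \<xi> * cmod (fourier f \<xi>) \<le> (\<Sum>j\<in>UNIV. \<bar>\<xi> $ j\<bar>) * cmod (fourier f \<xi>)"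
      by (intro mult_right_mono norm_le_l1_cart) auto
    also have "\<dots> = (\<Sum>j\<in>UNIV. cmod (fourier (?g j) \<xi>))"
      by (simp add: fourier_partial[OF Suc.prems] norm_mult sum_distrib_right)
    finally have "(1 + norm \<xi>) ^ N * (norm \<xi> * cmod (fourier f \<xi>)) \<le>
       (1 + norm \<xi>) ^ N * (\<Sum>j\<in>UNIV. cmod (fourier (?g j) \<xi>))"
      by (intro mult_left_mono) auto
    also have "\<dots> \<le> (\<Sum>j\<in>UNIV. D j)"
      unfolding sum_distrib_left by (intro sum_mono D)
    finally show ?thesis using C[of \<xi>] by (simp add: algebra_simps)
  qed
  then show ?case by blast
qed

theorem fourier_schwartz:
  fixes f :: "real^'m::finite \<Rightarrow> complex"
  assumes "f \<in> schwartz"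
  shows "fourier f \<in> schwartz"
\<comment> \<open>The image of \<open>schwartz\<close> under the transform is its own invariant: a
  partial derivative of \<open>fourier f\<close> is the transform of - i x_j f, which is again
  Schwartz.\<close>
proof (rule schwartz_coinduct[where S="fourier ` schwartz"])
  fix F :: "real^'m \<Rightarrow> complex" and x j assume "F \<in> fourier ` schwartz"
  then obtain f where f: "f \<in> schwartz" "F = fourier f" by blast
  show "F differentiable at x"
    using fourier_has_derivative[OF f(1)] f(2) by (auto simp: differentiable_def)
  have e: "(\<lambda>x. frechet_derivative F (at x) (axis j 1)) = fourier (\<lambda>x. - \<i> * (of_real (x $ j) * f x))"
    unfolding f(2)
    by (rule ext, subst frechet_derivative_at[OF fourier_has_derivative[OF f(1)], symmetric])
       (simp add: inner_commute[of "axis j 1"] inner_axis mult.assoc)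
  show "(\<lambda>x. frechet_derivative F (at x) (axis j 1)) \<in> fourier ` schwartz"
    unfolding e by (intro imageI schwartz_cmult schwartz_coord_mult f)
qed (use assms fourier_decay in auto)

text \<open>Fubini, the kernel being symmetric in its two variables. Integrability is the right
  generality: later one of the functions is a modulated Gaussian or a convolution with a singular
  kernel.\<close>

lemma fourier_multiplication:
  fixes f g :: "real^'m::finite \<Rightarrow> complex"
  assumes f: "integrable lborel f" and g: "integrable lborel g"
  shows "(\<integral>\<xi>. fourier f \<xi> * g \<xi> \<partial>lborel) = (\<integral>x. f x * fourier g x \<partial>lborel)"
proof -
  let ?c = "complex_of_real ((2 * pi) powr (- real CARD('m) / 2))"
  let ?e = "\<lambda>\<xi> x::real^'m. exp (- \<i> * complex_of_real (\<xi> \<bullet> x))"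
  have [measurable]: "f \<in> borel_measurable borel" "g \<in> borel_measurable borel" using f g by simp_all
  have int: "integrable (lborel \<Otimes>\<^sub>M lborel) (\<lambda>(x, \<xi>). ?e \<xi> x * f x * g \<xi>)"
  proof (rule Bochner_Integration.integrable_bound[OF integrable_lborel_pair_mult[OF f g]])
    show "(\<lambda>(x, \<xi>). ?e \<xi> x * f x * g \<xi>) \<in> borel_measurable (lborel \<Otimes>\<^sub>M lborel)" by measurable
  qed (auto simp: norm_mult)
  have "(\<integral>\<xi>. fourier f \<xi> * g \<xi> \<partial>lborel) = ?c * (\<integral>\<xi>. \<integral>x. ?e \<xi> x * f x * g \<xi> \<partial>lborel \<partial>lborel)"
  proof -
    have "fourier f \<xi> * g \<xi> = ?c * (\<integral>x. ?e \<xi> x * f x * g \<xi> \<partial>lborel)" for \<xi>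
      by (subst integral_mult_left_zero) (simp add: fourier_def mult_ac)
    then show ?thesis by (simp only: integral_mult_right_zero)
  qed
  also have "(\<integral>\<xi>. \<integral>x. ?e \<xi> x * f x * g \<xi> \<partial>lborel \<partial>lborel) = (\<integral>x. \<integral>\<xi>. ?e \<xi> x * f x * g \<xi> \<partial>lborel \<partial>lborel)"
    by (rule lborel_pair.Fubini_integral[OF int])
  also have "\<dots> = (\<integral>x. f x * (\<integral>\<xi>. ?e x \<xi> * g \<xi> \<partial>lborel) \<partial>lborel)"
  proof -
    have "?e \<xi> x * f x * g \<xi> = f x * (?e x \<xi> * g \<xi>)" for x \<xi>
      by (simp add: inner_commute mult_ac)
    then show ?thesis by (simp only: integral_mult_right_zero)
  qed
  also have "?c * \<dots> = (\<integral>x. f x * fourier g x \<partial>lborel)"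
  proof -
    have "f x * fourier g x = ?c * (f x * (\<integral>\<xi>. ?e x \<xi> * g \<xi> \<partial>lborel))" for x
      by (simp add: fourier_def)
    then show ?thesis by (simp only: integral_mult_right_zero)
  qed
  finally show ?thesis .
qed

section \<open>Gaussian averages, inversion and Plancherel\<close>

lemma gaussian_integrable:
  assumes "a > 0"
  shows "integrable lborel (\<lambda>x::real^'m::finite. exp (- a * (norm x)\<^sup>2))"
proof -
  have "integrable lborel (\<lambda>x::real^'m. complex_of_real (exp (- a * (norm x)\<^sup>2)))"
    using gaussian_fourier_vec(1)[OF assms, of "0::real^'m"] by simp
  then show ?thesis by (rule complex_of_real_integrable_eq[THEN iffD1])
qed

lemma gaussian_integral:
  assumes "a > 0"
  shows "(\<integral>x. exp (- a * (norm (x::real^'m::finite))\<^sup>2) \<partial>lborel) = sqrt (pi / a) ^ CARD('m)"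
proof -
  have "complex_of_real (\<integral>x. exp (- a * (norm (x::real^'m))\<^sup>2) \<partial>lborel) = of_real (sqrt (pi / a) ^ CARD('m))"
    using gaussian_fourier_vec(2)[OF assms, of "0::real^'m"] by simp
  then show ?thesis by (simp only: of_real_eq_iff)
qed

text \<open>After the substitution y = x + z / sqrt (a n) the Gaussian no longer depends on n and
  the concentration takes place in the argument of f, so that boundedness and continuity of f
  suffice for dominated convergence.\<close>

lemma gaussian_approximate_identity:
  fixes f :: "real^'m::finite \<Rightarrow> complex"
  assumes cont: "continuous_on UNIV f" and B: "\<And>x. cmod (f x) \<le> B" and a: "filterlim a at_top sequentially" "\<And>n::nat. a n > 0"
  shows "(\<lambda>n. of_real (sqrt (a n / pi) ^ CARD('m)) * (\<integral>y. f y * of_real (exp (- a n * (norm (y - x))\<^sup>2)) \<partial>lborel))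
      \<longlonglongrightarrow> f x"
proof -
  have [measurable]: "f \<in> borel_measurable borel" by (rule borel_measurable_continuous_onI[OF cont])
  have eq: "of_real (sqrt (a n / pi) ^ CARD('m)) * (\<integral>y. f y * of_real (exp (- a n * (norm (y - x))\<^sup>2)) \<partial>lborel)
     = of_real (1 / sqrt pi ^ CARD('m)) *
       (\<integral>z. f (x + (1 / sqrt (a n)) *\<^sub>R z) * of_real (exp (- (norm z)\<^sup>2)) \<partial>lborel)" for n
  proof -
    let ?c = "1 / sqrt (a n)"
    have c: "?c > 0" "?c\<^sup>2 = 1 / a n" using a(2)[of n] by (auto simp: power_divide)
    let ?F = "\<lambda>y. f y * of_real (exp (- a n * (norm (y - x))\<^sup>2))"
    have "(\<integral>z. f (x + ?c *\<^sub>R z) * of_real (exp (- (norm z)\<^sup>2)) \<partial>lborel) = (\<integral>z. ?F (x + ?c *\<^sub>R z) \<partial>lborel)"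
      using a(2)[of n] by (simp add: power_divide)
    also have "\<dots> = (1 / \<bar>?c\<bar> ^ DIM(real^'m)) *\<^sub>R (\<integral>y. ?F y \<partial>lborel)"
      by (rule lborel_integral_affine) (use c in auto)
    also have "1 / \<bar>?c\<bar> ^ DIM(real^'m) = sqrt (a n) ^ CARD('m)"
      using a(2)[of n] by (simp add: power_divide)
    finally have e: "(\<integral>z. f (x + ?c *\<^sub>R z) * of_real (exp (- (norm z)\<^sup>2)) \<partial>lborel) =
      of_real (sqrt (a n) ^ CARD('m)) * (\<integral>y. ?F y \<partial>lborel)" by (simp only: scaleR_conv_of_real)
    show ?thesis unfolding e by (simp add: real_sqrt_divide power_divide)
  qed
  have "(\<lambda>n. \<integral>z. f (x + (1 / sqrt (a n)) *\<^sub>R z) * of_real (exp (- (norm z)\<^sup>2)) \<partial>lborel)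
     \<longlonglongrightarrow> (\<integral>z. f x * of_real (exp (- (norm (z::real^'m))\<^sup>2)) \<partial>lborel)"
  proof (rule integral_dominated_convergence)
    show "integrable lborel (\<lambda>z::real^'m. B * exp (- (norm z)\<^sup>2))"
      using gaussian_integrable[of 1, where 'm='m] by simp
    have "B \<ge> 0" using B[of 0] norm_ge_zero[of "f 0"] by linarith
    then show "AE z in lborel. cmod (f (x + (1 / sqrt (a n)) *\<^sub>R z) * of_real (exp (- (norm z)\<^sup>2))) \<le> B * exp (- (norm z)\<^sup>2)" for n
      by (intro AE_I2) (simp add: norm_mult B)
    show "AE z in lborel. (\<lambda>n. f (x + (1 / sqrt (a n)) *\<^sub>R z) * of_real (exp (- (norm z)\<^sup>2)))
        \<longlonglongrightarrow> f x * of_real (exp (- (norm z)\<^sup>2))"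
    proof (rule AE_I2, intro tendsto_mult tendsto_const)
      fix z
      have "filterlim (\<lambda>n. sqrt (a n)) at_top sequentially"
        by (rule filterlim_compose[OF sqrt_at_top a(1)])
      then have "(\<lambda>n. 1 / sqrt (a n)) \<longlonglongrightarrow> 0"
        by (rule tendsto_divide_0[OF tendsto_const filterlim_at_top_imp_at_infinity])
      then have "(\<lambda>n. x + (1 / sqrt (a n)) *\<^sub>R z) \<longlonglongrightarrow> x + 0 *\<^sub>R z"
        by (intro tendsto_intros)
      then show "(\<lambda>n. f (x + (1 / sqrt (a n)) *\<^sub>R z)) \<longlonglongrightarrow> f x"
        using continuous_on_tendsto_compose[OF cont] by simp
    qed
  qed measurable
  also have "(\<integral>z. f x * of_real (exp (- (norm (z::real^'m))\<^sup>2)) \<partial>lborel) = f x * of_real (sqrt pi ^ CARD('m))"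
    using gaussian_integral[of 1, where 'm='m] by (simp del: of_real_power flip: of_real_power)
  finally have "(\<lambda>n. of_real (1 / sqrt pi ^ CARD('m)) *
     (\<integral>z. f (x + (1 / sqrt (a n)) *\<^sub>R z) * of_real (exp (- (norm z)\<^sup>2)) \<partial>lborel))
     \<longlonglongrightarrow> of_real (1 / sqrt pi ^ CARD('m)) * (f x * of_real (sqrt pi ^ CARD('m)))"
    by (intro tendsto_mult tendsto_const)
  then show ?thesis unfolding eq by simp
qed

text \<open>The iterated integral is not absolutely convergent as a double integral, so ever wider
  Gaussians are inserted; the multiplication formula turns the result into Gaussian averages of f
  concentrating at - x. With the unitary normalisation the inverse transform is the reflected
  transform, hence the form of the statement.\<close>

theorem fourier_inversion:
  fixes f :: "real^'m::finite \<Rightarrow> complex"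
  assumes f: "f \<in> schwartz"
  shows "fourier (fourier f) x = f (- x)"
proof -
  let ?c = "(2 * pi) powr (- real CARD('m) / 2)"
  define a where "a n = real (Suc n)" for n
  have a: "a n > 0" "filterlim a at_top sequentially" for n
    unfolding a_def using filterlim_compose[OF filterlim_real_sequentially filterlim_Suc] by auto
  let ?g = "\<lambda>n \<xi>::real^'m. exp (- \<i> * complex_of_real (x \<bullet> \<xi>)) * complex_of_real (exp (- (1 / (4 * a n)) * (norm \<xi>)\<^sup>2))"
  have ig: "integrable lborel (?g n)" for n
    by (rule gaussian_fourier_vec) (use a in simp)
  have Ff: "fourier f \<in> schwartz" by (rule fourier_schwartz[OF f])
  note [measurable] = schwartz_measurable[OF Ff] schwartz_measurable[OF f]
  have fg: "fourier (?g n) y = of_real (?c * sqrt (4 * pi) ^ CARD('m)) * (of_real (sqrt (a n) ^ CARD('m)) * of_real (exp (- a n * (norm (y - (- x)))\<^sup>2)))" for n y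
  proof -
    have "(\<integral>\<xi>. exp (- \<i> * complex_of_real (y \<bullet> \<xi>)) * ?g n \<xi> \<partial>lborel) =
      (\<integral>\<xi>. exp (- \<i> * complex_of_real ((x + y) \<bullet> \<xi>)) * complex_of_real (exp (- (1 / (4 * a n)) * (norm \<xi>)\<^sup>2)) \<partial>lborel)"
    proof -
      have "- \<i> * complex_of_real ((x + y) \<bullet> \<xi>) = - \<i> * complex_of_real (y \<bullet> \<xi>) + - \<i> * complex_of_real (x \<bullet> \<xi>)" for \<xi>
        by (simp add: inner_add_left algebra_simps)
      then show ?thesis by (simp only: exp_add mult.assoc)
    qed
    also have "\<dots> = complex_of_real (sqrt (pi / (1 / (4 * a n))) ^ CARD('m) * exp (- (norm (x + y))\<^sup>2 / (4 * (1 / (4 * a n)))))"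
      by (rule gaussian_fourier_vec) (use a in simp)
    also have "pi / (1 / (4 * a n)) = (4 * pi) * a n" by simp
    also have "- (norm (x + y))\<^sup>2 / (4 * (1 / (4 * a n))) = - a n * (norm (y - (- x)))\<^sup>2" by (simp add: add.commute)
    finally show ?thesis by (simp add: fourier_def real_sqrt_mult power_mult_distrib)
  qed
  have L1: "(\<lambda>n. \<integral>\<xi>. fourier f \<xi> * ?g n \<xi> \<partial>lborel) \<longlonglongrightarrow> (\<integral>\<xi>. exp (- \<i> * complex_of_real (x \<bullet> \<xi>)) * fourier f \<xi> \<partial>lborel)"
  proof (rule integral_dominated_convergence)
    show "integrable lborel (\<lambda>\<xi>. cmod (fourier f \<xi>))"
      by (intro integrable_norm schwartz_integrable Ff)
    show "AE \<xi> in lborel. cmod (fourier f \<xi> * ?g n \<xi>) \<le> cmod (fourier f \<xi>)" for n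
      using a(1)[of n] by (intro AE_I2) (simp add: norm_mult mult_left_le)
    show "AE \<xi> in lborel. (\<lambda>n. fourier f \<xi> * ?g n \<xi>) \<longlonglongrightarrow> exp (- \<i> * complex_of_real (x \<bullet> \<xi>)) * fourier f \<xi>"
    proof (rule AE_I2)
      fix \<xi> :: "real^'m"
      have "(\<lambda>n. 1 / 4 * (1 / a n)) \<longlonglongrightarrow> 1 / 4 * 0"
        unfolding a_def by (intro tendsto_mult tendsto_const LIMSEQ_Suc[OF lim_1_over_n])
      then have "(\<lambda>n. - (1 / (4 * a n)) * (norm \<xi>)\<^sup>2) \<longlonglongrightarrow> - 0 * (norm \<xi>)\<^sup>2"
        by (intro tendsto_mult tendsto_const tendsto_minus) simp
      then have "(\<lambda>n. - (1 / (4 * a n)) * (norm \<xi>)\<^sup>2) \<longlonglongrightarrow> 0" by simp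
      then have "(\<lambda>n. fourier f \<xi> * ?g n \<xi>) \<longlonglongrightarrow> fourier f \<xi> * (exp (- \<i> * complex_of_real (x \<bullet> \<xi>)) * of_real (exp 0))"
        by (intro tendsto_mult tendsto_const tendsto_of_real tendsto_exp)
      then show "(\<lambda>n. fourier f \<xi> * ?g n \<xi>) \<longlonglongrightarrow> exp (- \<i> * complex_of_real (x \<bullet> \<xi>)) * fourier f \<xi>"
        by (simp add: mult.commute)
    qed
  qed measurable
  have E: "(\<integral>\<xi>. fourier f \<xi> * ?g n \<xi> \<partial>lborel) = of_real (?c * (2 * pi) ^ CARD('m)) *
     (of_real (sqrt (a n / pi) ^ CARD('m)) * (\<integral>y. f y * of_real (exp (- a n * (norm (y - (- x)))\<^sup>2)) \<partial>lborel))" for n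
  proof -
    \<comment> \<open>Rearranged so that sqrt (a n / pi)^m, the normalisation of the Gaussian
      average, stands alone; the remaining (2 pi)^m cancels against the two factors
      \<open>?c\<close> of the double transform.\<close>
    have k: "sqrt (4 * pi) ^ CARD('m) * sqrt (a n) ^ CARD('m) = (2 * pi) ^ CARD('m) * sqrt (a n / pi) ^ CARD('m)"
    proof -
      have "(2 * pi) * sqrt (a n / pi) = 2 * (pi / sqrt pi) * sqrt (a n)"
        by (simp add: real_sqrt_divide)
      also have "pi / sqrt pi = sqrt pi" by (rule real_div_sqrt) simp
      also have "2 * sqrt pi * sqrt (a n) = sqrt (4 * pi) * sqrt (a n)"
        by (simp add: real_sqrt_mult)
      finally have "sqrt (4 * pi) * sqrt (a n) = (2 * pi) * sqrt (a n / pi)" ..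
      then show ?thesis by (simp only: power_mult_distrib[symmetric])
    qed
    have "(\<integral>\<xi>. fourier f \<xi> * ?g n \<xi> \<partial>lborel) = (\<integral>y. f y * fourier (?g n) y \<partial>lborel)"
      by (rule fourier_multiplication[OF schwartz_integrable[OF f] ig])
    also have "\<dots> = of_real (?c * (sqrt (4 * pi) ^ CARD('m) * sqrt (a n) ^ CARD('m))) * (\<integral>y. f y * of_real (exp (- a n * (norm (y - (- x)))\<^sup>2)) \<partial>lborel)"
    proof -
      have "f y * fourier (?g n) y = of_real (?c * (sqrt (4 * pi) ^ CARD('m) * sqrt (a n) ^ CARD('m))) *
          (f y * of_real (exp (- a n * (norm (y - (- x)))\<^sup>2)))" for y
        unfolding fg by (simp only: of_real_mult mult_ac)
      then show ?thesis by (simp only: integral_mult_right_zero)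
    qed
    finally show ?thesis unfolding k by (simp only: of_real_mult mult.assoc)
  qed
  have L2: "(\<lambda>n. of_real (?c * (2 * pi) ^ CARD('m)) *
     (of_real (sqrt (a n / pi) ^ CARD('m)) * (\<integral>y. f y * of_real (exp (- a n * (norm (y - (- x)))\<^sup>2)) \<partial>lborel)))
    \<longlonglongrightarrow> of_real (?c * (2 * pi) ^ CARD('m)) * f (- x)"
  proof -
    obtain C where C: "\<And>x. cmod (f x) \<le> C / (1 + norm x) ^ 0" using schwartz_decay_pos[OF f] by blast
    show ?thesis
      by (intro tendsto_mult tendsto_const gaussian_approximate_identity schwartz_continuous[OF f] a)
        (use C in auto)
  qed
  have "(\<integral>\<xi>. exp (- \<i> * complex_of_real (x \<bullet> \<xi>)) * fourier f \<xi> \<partial>lborel) = of_real (?c * (2 * pi) ^ CARD('m)) * f (- x)"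
    by (rule LIMSEQ_unique[OF L1[unfolded E] L2])
  then have "fourier (fourier f) x = of_real (?c * ?c * (2 * pi) ^ CARD('m)) * f (- x)"
    by (simp add: fourier_def[of "fourier f"])
  also have "?c * ?c * (2 * pi) ^ CARD('m) = 1"
  proof -
    have "sqrt (2 * pi) ^ CARD('m) * sqrt (2 * pi) ^ CARD('m) = (2 * pi) ^ CARD('m)"
      by (subst power_mult_distrib[symmetric]) simp
    from this[symmetric] show ?thesis unfolding fourier_const_eq by simp
  qed
  finally show ?thesis by simp
qed

lemma fourier_reflect:
  assumes "f \<in> borel_measurable borel"
  shows "fourier (\<lambda>x. f (- x)) \<xi> = fourier f (- \<xi>)"
  unfolding fourier_def
  using lborel_integral_reflect[of "\<lambda>x. exp (- \<i> * complex_of_real (- \<xi> \<bullet> x)) * f x"] assms by simp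

lemma inverse_fourier_schwartz:
  assumes "f \<in> schwartz"
  shows "(\<lambda>\<xi>. fourier f (- \<xi>)) \<in> schwartz"
  using schwartz_cnj[OF fourier_schwartz[OF schwartz_cnj[OF assms]]] by (simp add: fourier_cnj)

lemma fourier_inverse_fourier:
  assumes "f \<in> schwartz"
  shows "fourier (\<lambda>\<xi>. fourier f (- \<xi>)) = f"
  by (rule ext) (simp add: fourier_reflect schwartz_measurable fourier_schwartz fourier_inversion assms)

lemma plancherel:
  fixes f :: "real^'m::finite \<Rightarrow> complex"
  assumes f: "f \<in> schwartz"
  shows "(\<integral>\<xi>. (cmod (fourier f \<xi>))\<^sup>2 \<partial>lborel) = (\<integral>x. (cmod (f x))\<^sup>2 \<partial>lborel)"
proof -
  have "complex_of_real (\<integral>\<xi>. (cmod (fourier f \<xi>))\<^sup>2 \<partial>lborel) = (\<integral>\<xi>. fourier f \<xi> * cnj (fourier f \<xi>) \<partial>lborel)"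
    by (simp add: complex_norm_square del: of_real_power flip: integral_complex_of_real)
  also have "\<dots> = (\<integral>x. f x * fourier (\<lambda>\<xi>. cnj (fourier f \<xi>)) x \<partial>lborel)"
    by (intro fourier_multiplication schwartz_integrable f schwartz_cnj fourier_schwartz)
  also have "\<dots> = (\<integral>x. f x * cnj (f x) \<partial>lborel)"
    by (simp add: fourier_cnj fourier_inversion f)
  also have "\<dots> = complex_of_real (\<integral>x. (cmod (f x))\<^sup>2 \<partial>lborel)"
    by (simp add: complex_norm_square del: of_real_power flip: integral_complex_of_real)
  finally show ?thesis by (simp only: of_real_eq_iff)
qed


subsection \<open>Uniqueness of the representing function\<close>

text \<open>Boxes are stable under intersection and generate the Borel sets, so the vanishing
  spreads to all Borel sets by Dynkin's argument; real and imaginary part are then densities with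
  vanishing integrals over every set.\<close>

lemma box_integrals_zero_imp_AE_zero:
  fixes h :: "'a::euclidean_space \<Rightarrow> complex"
  assumes h: "integrable lborel h"
    and box: "\<And>a b. (LINT x:box a b|lborel. h x) = 0"
  shows "AE x in lborel. h x = 0"
proof -
  have [measurable]: "h \<in> borel_measurable borel" using h by simp
  have si: "set_integrable lborel A h" if "A \<in> sets borel" for A
    unfolding set_integrable_def using h that by (intro integrable_mult_indicator) auto
  \<comment> \<open>Passing to complements needs the integral over the whole space, which is the
    limit along growing boxes.\<close>
  have tot: "(\<integral>x. h x \<partial>lborel) = 0"
  proof -
    let ?B = "\<lambda>n. box (- real n *\<^sub>R One) (real n *\<^sub>R One) :: 'a set"
    have "(\<lambda>n. LINT x:?B n|lborel. h x) \<longlonglongrightarrow> (LINT x:UNIV|lborel. h x)"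
      unfolding set_lebesgue_integral_def
    proof (rule integral_dominated_convergence[where w="\<lambda>x. cmod (h x)"])
      show "AE x in lborel. (\<lambda>n. indicator (?B n) x *\<^sub>R h x) \<longlonglongrightarrow> indicator UNIV x *\<^sub>R h x"
      proof (rule AE_I2)
        fix x :: 'a
        have "eventually (\<lambda>n. indicator (?B n) x *\<^sub>R h x = indicator UNIV x *\<^sub>R h x) sequentially"
        proof (rule eventually_sequentiallyI[of "Suc (nat \<lceil>norm x\<rceil>)"])
          fix n assume n: "Suc (nat \<lceil>norm x\<rceil>) \<le> n"
          have "norm x < real n" using n by linarith
          then have "x \<in> ?B n"
            using Basis_le_norm[of _ x] by (fastforce simp: mem_box abs_le_iff)
          then show "indicator (?B n) x *\<^sub>R h x = indicator UNIV x *\<^sub>R h x" by simp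
        qed
        then show "(\<lambda>n. indicator (?B n) x *\<^sub>R h x) \<longlonglongrightarrow> indicator UNIV x *\<^sub>R h x"
          by (rule tendsto_eventually)
      qed
    qed (use h in \<open>auto split: split_indicator\<close>)
    then show ?thesis
      unfolding box by (simp add: LIMSEQ_const_iff set_lebesgue_integral_def)
  qed
  have all: "(LINT x:A|lborel. h x) = 0" if A: "A \<in> sets borel" for A
  proof -
    have "Int_stable (range (\<lambda>(a, b). box a b :: 'a set))"
      by (auto simp: Int_stable_def box_Int_box)
    moreover have "range (\<lambda>(a, b). box a b :: 'a set) \<subseteq> Pow UNIV" by auto
    moreover have "A \<in> sigma_sets UNIV (range (\<lambda>(a, b). box a b))"
      using A unfolding borel_eq_box by simp
    ultimately show ?thesis
    proof (induction rule: sigma_sets_induct_disjoint)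
      case (basic A) then show ?case using box by auto
    next
      case empty show ?case by (simp add: set_lebesgue_integral_def)
    next
      case (compl A)
      then have A: "A \<in> sets borel" unfolding borel_eq_box by simp
      have "indicator (UNIV - A) x *\<^sub>R h x = h x - indicator A x *\<^sub>R h x" for x
        by (auto split: split_indicator)
      then have "(LINT x:UNIV - A|lborel. h x) = (\<integral>x. h x \<partial>lborel) - (LINT x:A|lborel. h x)"
        using si[OF A] h by (simp add: set_lebesgue_integral_def set_integrable_def)
      then show ?case using compl tot by simp
    next
      case (union A)
      then have A: "A i \<in> sets lborel" for i unfolding borel_eq_box sets_lborel by auto
      have "(LINT x:(\<Union>i. A i)|lborel. h x) = (\<Sum>i. LINT x:A i|lborel. h x)"
      proof (rule lebesgue_integral_countable_add[OF A])
        show "set_integrable lborel (\<Union>i. A i) h" using A by (intro si) (auto intro!: sets.countable_UN)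
      qed (use union(1) in \<open>auto simp: disjoint_family_on_def\<close>)
      then show ?case using union by simp
    qed
  qed
  have "AE x in lborel. Re (h x) = 0"
  proof (rule density_unique_real)
    fix A :: "'a set" assume A: "A \<in> sets lborel"
    have "(LINT x:A|lborel. Re (h x)) = Re (LINT x:A|lborel. h x)"
      using si[of A] A by (simp add: set_lebesgue_integral_def set_integrable_def integral_Re[symmetric] del: integral_Re)
    then show "(LINT x:A|lborel. Re (h x)) = (LINT x:A|lborel. 0)"
      using all[of A] A by simp
  qed (use h in auto)
  moreover have "AE x in lborel. Im (h x) = 0"
  proof (rule density_unique_real)
    fix A :: "'a set" assume A: "A \<in> sets lborel"
    have "(LINT x:A|lborel. Im (h x)) = Im (LINT x:A|lborel. h x)"
      using si[of A] A by (simp add: set_lebesgue_integral_def set_integrable_def integral_Im[symmetric] del: integral_Im)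
    then show "(LINT x:A|lborel. Im (h x)) = (LINT x:A|lborel. 0)"
      using all[of A] A by simp
  qed (use h in auto)
  ultimately show ?thesis by eventually_elim (simp add: complex_eq_iff)
qed

text \<open>Fubini moves the Gaussian averaging from h onto a bounded continuous integrable
  function, which the averages recover in the limit. Hence h is orthogonal to all such functions,
  and these approximate indicators of boxes.\<close>

lemma gaussian_convolutions_zero_imp_AE_zero:
  fixes h :: "real^'m::finite \<Rightarrow> complex"
  assumes h: "integrable lborel h"
    and gauss: "\<And>a y. a > 0 \<Longrightarrow> (\<integral>x. h x * of_real (exp (- a * (norm (x - y))\<^sup>2)) \<partial>lborel) = 0"
  shows "AE x in lborel. h x = 0"
proof (rule box_integrals_zero_imp_AE_zero[OF h])
  have [measurable]: "h \<in> borel_measurable borel" using h by simp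
  define a where "a n = real (Suc n)" for n
  have a: "a n > 0" "filterlim a at_top sequentially" for n
    unfolding a_def using filterlim_compose[OF filterlim_real_sequentially filterlim_Suc] by auto
  have key: "(\<integral>x. h x * \<psi> x \<partial>lborel) = 0"
    if \<psi>: "integrable lborel \<psi>" "continuous_on UNIV \<psi>" "\<And>x. cmod (\<psi> x) \<le> 1" for \<psi> :: "real^'m \<Rightarrow> complex"
  proof -
    have [measurable]: "\<psi> \<in> borel_measurable borel" using \<psi> by simp
    let ?G = "\<lambda>n x y::real^'m. complex_of_real (exp (- a n * (norm (y - x))\<^sup>2))"
    define c where "c n = complex_of_real (sqrt (a n / pi) ^ CARD('m))" for n
    have zero: "(\<integral>x. h x * (c n * (\<integral>y. \<psi> y * ?G n x y \<partial>lborel)) \<partial>lborel) = 0" for n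
    proof -
      have int: "integrable (lborel \<Otimes>\<^sub>M lborel) (\<lambda>(x, y). h x * \<psi> y * ?G n x y)"
      proof (rule Bochner_Integration.integrable_bound[OF integrable_lborel_pair_mult[OF h \<psi>(1)]])
        show "AE p in lborel \<Otimes>\<^sub>M lborel. cmod (case p of (x, y) \<Rightarrow> h x * \<psi> y * ?G n x y)
            \<le> cmod (case p of (x, y) \<Rightarrow> h x * \<psi> y)"
          using a(1)[of n] by (intro AE_I2) (auto simp: norm_mult mult_left_le)
      qed measurable
      have "(\<integral>x. h x * (c n * (\<integral>y. \<psi> y * ?G n x y \<partial>lborel)) \<partial>lborel) =
        c n * (\<integral>x. \<integral>y. h x * \<psi> y * ?G n x y \<partial>lborel \<partial>lborel)"
      proof -
        have "h x * (c n * (\<integral>y. \<psi> y * ?G n x y \<partial>lborel)) = c n * (\<integral>y. h x * \<psi> y * ?G n x y \<partial>lborel)" for x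
          by (simp only: mult.assoc integral_mult_right_zero mult.left_commute[of "h x" "c n"])
        then show ?thesis by (simp only: integral_mult_right_zero)
      qed
      also have "(\<integral>x. \<integral>y. h x * \<psi> y * ?G n x y \<partial>lborel \<partial>lborel) = (\<integral>y. \<integral>x. h x * \<psi> y * ?G n x y \<partial>lborel \<partial>lborel)"
        by (rule lborel_pair.Fubini_integral[OF int, symmetric])
      also have "\<dots> = (\<integral>y. \<psi> y * (\<integral>x. h x * of_real (exp (- a n * (norm (x - y))\<^sup>2)) \<partial>lborel) \<partial>lborel)"
      proof -
        have "h x * \<psi> y * ?G n x y = \<psi> y * (h x * of_real (exp (- a n * (norm (x - y))\<^sup>2)))" for x y
          by (simp add: mult_ac norm_minus_commute)
        then show ?thesis by (simp only: integral_mult_right_zero)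
      qed
      also have "\<dots> = 0" using gauss[OF a(1)] by simp
      finally show ?thesis by simp
    qed
    have bound: "cmod (c n * (\<integral>y. \<psi> y * ?G n x y \<partial>lborel)) \<le> 1" for n x
    proof -
      have sq: "exp (- a n * (norm (y - x))\<^sup>2) = exp (- a n * (norm (- x + 1 *\<^sub>R y))\<^sup>2)" for y by simp
      have ig: "integrable lborel (\<lambda>y. exp (- a n * (norm (y - x))\<^sup>2))"
        unfolding sq using lborel_integrable_affine[of 1 "\<lambda>y. exp (- a n * (norm y)\<^sup>2)" "- x", OF _ gaussian_integrable[OF a(1)]]
        by simp
      have iv: "(\<integral>y. exp (- a n * (norm (y - x))\<^sup>2) \<partial>lborel) = sqrt (pi / a n) ^ CARD('m)"
        unfolding sq by (subst lborel_integral_affine[of 1 "\<lambda>y. exp (- a n * (norm y)\<^sup>2)" "- x"])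
          (use gaussian_integral[OF a(1)[of n], where 'm='m] in simp_all)
      have "cmod (\<integral>y. \<psi> y * ?G n x y \<partial>lborel) \<le> (\<integral>y. exp (- a n * (norm (y - x))\<^sup>2) \<partial>lborel)"
      proof (rule Bochner_Integration.integral_norm_bound_integral[OF _ ig])
        show "integrable lborel (\<lambda>y. \<psi> y * ?G n x y)"
          by (rule Bochner_Integration.integrable_bound[OF ig]) (use \<psi>(3) in \<open>auto simp: norm_mult mult_left_le_one_le\<close>)
      qed (use \<psi>(3) in \<open>auto simp: norm_mult mult_left_le_one_le\<close>)
      then have "cmod (c n * (\<integral>y. \<psi> y * ?G n x y \<partial>lborel)) \<le> sqrt (a n / pi) ^ CARD('m) * sqrt (pi / a n) ^ CARD('m)"
        unfolding norm_mult iv using a(1)[of n] by (intro mult_mono) (auto simp: c_def norm_power)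
      also have "\<dots> = 1" using a(1)[of n] by (simp flip: power_mult_distrib real_sqrt_mult)
      finally show ?thesis .
    qed
    have "(\<lambda>n. \<integral>x. h x * (c n * (\<integral>y. \<psi> y * ?G n x y \<partial>lborel)) \<partial>lborel) \<longlonglongrightarrow> (\<integral>x. h x * \<psi> x \<partial>lborel)"
    proof (rule integral_dominated_convergence[where w="\<lambda>x. cmod (h x)"])
      show "AE x in lborel. (\<lambda>n. h x * (c n * (\<integral>y. \<psi> y * ?G n x y \<partial>lborel))) \<longlonglongrightarrow> h x * \<psi> x"
        unfolding c_def using gaussian_approximate_identity[OF \<psi>(2,3) a(2,1)]
        by (intro AE_I2 tendsto_mult tendsto_const)
      show "AE x in lborel. cmod (h x * (c n * (\<integral>y. \<psi> y * ?G n x y \<partial>lborel))) \<le> cmod (h x)" for n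
        by (intro AE_I2, subst norm_mult, rule mult_left_le[OF bound norm_ge_zero])
      show "integrable lborel (\<lambda>x. cmod (h x))" using h by simp
    qed measurable
    then show ?thesis unfolding zero by (simp add: LIMSEQ_const_iff)
  qed
  fix u v :: "real^'m"
  let ?U = "box u v"
  define \<psi> where "\<psi> n x = complex_of_real (min 1 (real n * infdist x (- ?U)))" for n x
  have \<psi>01: "cmod (\<psi> n x) \<le> 1" for n x
    using infdist_nonneg[of x "- ?U"] by (simp add: \<psi>_def)
  have Une: "- ?U \<noteq> {}"
  proof
    assume "- ?U = {}"
    then have U: "?U = UNIV" by blast
    have "bounded (UNIV :: (real^'m) set)" using bounded_box[of u v] unfolding U .
    then show False using not_bounded_UNIV by blast
  qed
  have \<psi>0: "\<psi> n x = 0" if "x \<notin> ?U" for n x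
    using that by (simp add: \<psi>_def infdist_zero)
  have cont: "continuous_on UNIV (\<psi> n)" for n
    unfolding \<psi>_def by (intro continuous_intros)
  have [measurable]: "\<psi> n \<in> borel_measurable borel" for n
    by (rule borel_measurable_continuous_onI[OF cont])
  have int: "integrable lborel (\<psi> n)" for n
  proof (rule Bochner_Integration.integrable_bound)
    show "integrable lborel (indicator ?U :: _ \<Rightarrow> real)"
      by (rule integrable_real_indicator) (auto simp: emeasure_lborel_box_eq)
    show "AE x in lborel. cmod (\<psi> n x) \<le> norm (indicator ?U x :: real)"
      using \<psi>01 \<psi>0 by (intro AE_I2) (auto split: split_indicator)
  qed measurable
  have "(\<lambda>n. \<integral>x. h x * \<psi> n x \<partial>lborel) \<longlonglongrightarrow> (\<integral>x. indicator ?U x *\<^sub>R h x \<partial>lborel)"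
  proof (rule integral_dominated_convergence[where w="\<lambda>x. cmod (h x)"])
    show "AE x in lborel. (\<lambda>n. h x * \<psi> n x) \<longlonglongrightarrow> indicator ?U x *\<^sub>R h x"
    proof (rule AE_I2)
      fix x
      show "(\<lambda>n. h x * \<psi> n x) \<longlonglongrightarrow> indicator ?U x *\<^sub>R h x"
      proof (cases "x \<in> ?U")
        case True
        then have d: "infdist x (- ?U) > 0"
          using infdist_pos_not_in_closed[of "- ?U" x] Une by (auto simp: closed_Compl)
        then obtain N where N: "1 < real N * infdist x (- ?U)"
          using reals_Archimedean3 by blast
        have "\<psi> n x = 1" if "n \<ge> N" for n
        proof -
          have "real N * infdist x (- ?U) \<le> real n * infdist x (- ?U)"
            using that d by (intro mult_right_mono) auto
          then show ?thesis using N by (simp add: \<psi>_def)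
        qed
        then have "eventually (\<lambda>n. h x * \<psi> n x = indicator ?U x *\<^sub>R h x) sequentially"
          using True by (intro eventually_sequentiallyI[of N]) simp
        then show ?thesis by (rule tendsto_eventually)
      qed (simp add: \<psi>0)
    qed
    show "AE x in lborel. cmod (h x * \<psi> n x) \<le> cmod (h x)" for n
      using \<psi>01 by (intro AE_I2) (simp add: norm_mult mult_left_le)
    show "integrable lborel (\<lambda>x. cmod (h x))" using h by simp
  qed measurable
  moreover have "(\<integral>x. h x * \<psi> n x \<partial>lborel) = 0" for n
    by (rule key[OF int cont \<psi>01])
  ultimately show "(LINT x:?U|lborel. h x) = 0"
    by (simp add: LIMSEQ_const_iff set_lebesgue_integral_def)
qed

text \<open>h may grow, so it is first made integrable by a Gaussian factor. The product of that
  factor with a second Gaussian is a multiple of a third one, so the hypothesis covers all Gaussian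
  averages of the damped function.\<close>

lemma schwartz_orthogonal_imp_AE_zero:
  fixes h :: "real^'m::finite \<Rightarrow> complex"
  assumes int: "\<And>f. f \<in> schwartz \<Longrightarrow> integrable lborel (\<lambda>x. h x * f x)"
    and zero: "\<And>f. f \<in> schwartz \<Longrightarrow> (\<integral>x. h x * f x \<partial>lborel) = 0"
  shows "AE x in lborel. h x = 0"
proof -
  let ?e = "\<lambda>x::real^'m. complex_of_real (exp (- 1 * (norm (x - 0))\<^sup>2))"
  have "AE x in lborel. h x * ?e x = 0"
  proof (rule gaussian_convolutions_zero_imp_AE_zero)
    show "integrable lborel (\<lambda>x. h x * ?e x)"
      by (intro int gaussian_schwartz) simp
    fix a :: real and y :: "real^'m" assume a: "a > 0"
    \<comment> \<open>Completing the square: \<open>c\<close> is the mean of 0 and y with weights 1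
      and a, and \<open>K\<close> is the constant left over.\<close>
    define c where "c = (a / (1 + a)) *\<^sub>R y"
    define K where "K = a * (y \<bullet> y) - (1 + a) * (c \<bullet> c)"
    have sq: "(norm x)\<^sup>2 + a * (norm (x - y))\<^sup>2 = (1 + a) * (norm (x - c))\<^sup>2 + K" for x
    proof -
      have "(1 + a) * (x \<bullet> c) = a * (x \<bullet> y)" using a by (simp add: c_def)
      then show ?thesis
        unfolding K_def power2_norm_eq_inner
        by (simp add: inner_diff_left inner_diff_right inner_commute algebra_simps)
    qed
    have pw: "h x * ?e x * of_real (exp (- a * (norm (x - y))\<^sup>2)) =
      of_real (exp (- K)) * (h x * of_real (exp (- (1 + a) * (norm (x - c))\<^sup>2)))" for x
    proof -
      have "- (norm x)\<^sup>2 + - a * (norm (x - y))\<^sup>2 = - K + - (1 + a) * (norm (x - c))\<^sup>2"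
        using sq[of x] by (simp add: algebra_simps)
      then have "exp (- (norm x)\<^sup>2) * exp (- a * (norm (x - y))\<^sup>2) = exp (- K) * exp (- (1 + a) * (norm (x - c))\<^sup>2)"
        by (simp only: exp_add[symmetric])
      then show ?thesis
        by (simp add: mult_ac flip: of_real_mult)
    qed
    have "0 < 1 + a" using a by simp
    then show "(\<integral>x. h x * ?e x * of_real (exp (- a * (norm (x - y))\<^sup>2)) \<partial>lborel) = 0"
      by (simp only: pw integral_mult_right_zero zero[OF gaussian_schwartz] mult_zero_right)
  qed
  then show ?thesis by eventually_elim simp
qed

lemma represents_unique:
  assumes "represents g1 v" "represents g2 v"
  shows "AE \<xi> in lborel. g1 \<xi> = g2 \<xi>"
proof -
  have "AE \<xi> in lborel. g1 \<xi> - g2 \<xi> = 0"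
    using assms by (intro schwartz_orthogonal_imp_AE_zero)
      (auto simp: represents_def left_diff_distrib)
  then show ?thesis by simp
qed

text \<open>The product with a Gaussian is integrable, hence measurable, and the Gaussian has no
  zeros, so one may divide by it.\<close>

lemma represents_measurable:
  fixes g :: "real^'m::finite \<Rightarrow> complex"
  assumes "represents g v"
  shows "g \<in> borel_measurable borel"
proof -
  let ?e = "\<lambda>x::real^'m. complex_of_real (exp (- 1 * (norm (x - 0))\<^sup>2))"
  have "integrable lborel (\<lambda>x. g x * ?e x)"
    using assms gaussian_schwartz[of 1 0] unfolding represents_def by force
  then have "(\<lambda>x. g x * ?e x) \<in> borel_measurable borel" by simp
  then have "(\<lambda>x. g x * ?e x / ?e x) \<in> borel_measurable borel" by measurable
  then show ?thesis by simp
qed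


subsection \<open>Weighted square-integrable functions\<close>

lemma
  fixes f g :: "'a \<Rightarrow> real"
  assumes [measurable]: "f \<in> borel_measurable M" "g \<in> borel_measurable M"
    and F: "integrable M (\<lambda>x. (f x)\<^sup>2)" and G: "integrable M (\<lambda>x. (g x)\<^sup>2)"
  shows integrable_mult_L2: "integrable M (\<lambda>x. f x * g x)"
    and Cauchy_Schwarz_L2: "(\<integral>x. \<bar>f x * g x\<bar> \<partial>M) \<le> sqrt (\<integral>x. (f x)\<^sup>2 \<partial>M) * sqrt (\<integral>x. (g x)\<^sup>2 \<partial>M)"
proof -
  have ineq: "\<bar>f x * g x\<bar> \<le> (t * (f x)\<^sup>2 + (g x)\<^sup>2 / t) / 2" if "t > 0" for t x
  proof -
    have "(t * a - b)\<^sup>2 / t = t * a\<^sup>2 + b\<^sup>2 / t - 2 * (a * b)" for a b :: real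
      using that by (simp add: power2_eq_square field_simps)
    from this[of "\<bar>f x\<bar>" "\<bar>g x\<bar>"] have "0 \<le> t * (f x)\<^sup>2 + (g x)\<^sup>2 / t - 2 * \<bar>f x * g x\<bar>"
      using that by (simp only: power2_abs abs_mult) (metis divide_nonneg_pos zero_le_power2)
    then show ?thesis by simp
  qed
  show int: "integrable M (\<lambda>x. f x * g x)"
  proof (rule Bochner_Integration.integrable_bound)
    show "integrable M (\<lambda>x. (1 * (f x)\<^sup>2 + (g x)\<^sup>2 / 1) / 2)" using F G by simp
    show "AE x in M. norm (f x * g x) \<le> norm ((1 * (f x)\<^sup>2 + (g x)\<^sup>2 / 1) / 2)"
      using ineq[of 1] by (intro AE_I2) (simp only: real_norm_def, rule order_trans[OF _ abs_ge_self], simp)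
  qed measurable
  let ?F = "\<integral>x. (f x)\<^sup>2 \<partial>M" and ?G = "\<integral>x. (g x)\<^sup>2 \<partial>M"
  have nn: "?F \<ge> 0" "?G \<ge> 0" by simp_all
  show "(\<integral>x. \<bar>f x * g x\<bar> \<partial>M) \<le> sqrt ?F * sqrt ?G"
  proof (cases "?F = 0 \<or> ?G = 0")
    case True
    then have "(AE x in M. f x = 0) \<or> (AE x in M. g x = 0)"
      using integral_nonneg_eq_0_iff_AE[OF F] integral_nonneg_eq_0_iff_AE[OF G] by auto
    then have "AE x in M. \<bar>f x * g x\<bar> = 0" by auto
    then have "(\<integral>x. \<bar>f x * g x\<bar> \<partial>M) = (\<integral>x. 0 \<partial>M)" by (intro integral_cong_AE) auto
    then show ?thesis using nn by simp
  next
    case False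
    then have pos: "?F > 0" "?G > 0" using nn by linarith+
    define a b where "a = sqrt ?F" and "b = sqrt ?G"
    have ab: "a > 0" "b > 0" "?F = a\<^sup>2" "?G = b\<^sup>2" using pos by (simp_all add: a_def b_def)
    have t: "b / a > 0" using ab by simp
    have "(\<integral>x. \<bar>f x * g x\<bar> \<partial>M) \<le> (\<integral>x. (b / a * (f x)\<^sup>2 + (g x)\<^sup>2 / (b / a)) / 2 \<partial>M)"
      by (rule integral_mono) (use F G int ineq[OF t] in auto)
    also have "\<dots> = (b / a * ?F + ?G / (b / a)) / 2" using F G by simp
    also have "\<dots> = a * b" unfolding ab(3,4) using ab(1,2) by (simp add: power2_eq_square)
    finally show ?thesis by (simp only: a_def b_def)
  qed
qed

section \<open>Weights and weighted norms\<close>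

definition weight :: "real \<Rightarrow> real \<Rightarrow> 'a::real_normed_vector \<Rightarrow> real" where
  "weight k s \<xi> = (k\<^sup>2 + (norm \<xi>)\<^sup>2) powr s"

definition wnorm :: "real \<Rightarrow> real \<Rightarrow> (real^'m::finite \<Rightarrow> complex) \<Rightarrow> real" where
  "wnorm k s g = sqrt (\<integral>\<xi>. weight k s \<xi> * (cmod (g \<xi>))\<^sup>2 \<partial>lborel)"

definition wspace :: "real \<Rightarrow> (real^'m::finite \<Rightarrow> complex) set" where
  "wspace s = {g \<in> borel_measurable borel. integrable lborel (\<lambda>\<xi>. weight 1 s \<xi> * (cmod (g \<xi>))\<^sup>2)}"

lemma sobolev_norm_wnorm: "sobolev_norm k s u = wnorm k s (fhat u)"
  by (simp add: sobolev_norm_def wnorm_def weight_def)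

lemma weight_measurable [measurable]: "weight k s \<in> borel_measurable borel"
  unfolding weight_def by measurable

lemma weight_nonneg [simp]: "weight k s \<xi> \<ge> 0"
  by (simp add: weight_def)

lemma weight_minus:
  assumes "k > 0"
  shows "weight k s \<xi> * weight k (- s) \<xi> = 1"
proof -
  have "k\<^sup>2 + (norm \<xi>)\<^sup>2 > 0" using assms by (simp add: add_pos_nonneg)
  then have "k\<^sup>2 + (norm \<xi>)\<^sup>2 \<noteq> 0" by (rule less_imp_neq[symmetric])
  then show ?thesis unfolding weight_def powr_add[symmetric] by (simp only: add.right_inverse powr_zero_eq_one if_False)
qed

text \<open>With t = (norm \<xi>)^2 the ratio (k^2 + t) / (1 + t) stays between the minimum and the
  maximum of 1 and k^2. Which end dominates after taking the power s depends on the sign of s, so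
  \<open>C\<close> is the larger of the two.\<close>

lemma weight_le:
  assumes "k > 0"
  obtains C where "C > 0" "\<And>\<xi>::'a::real_normed_vector. weight k s \<xi> \<le> C * weight 1 s \<xi>"
proof
  define C where "C = max (max 1 (k\<^sup>2) powr s) (min 1 (k\<^sup>2) powr s)"
  show "C > 0" using assms by (auto simp: C_def less_max_iff_disj)
  fix \<xi> :: 'a
  define t where "t = (norm \<xi>)\<^sup>2"
  have t: "t \<ge> 0" by (simp add: t_def)
  define q where "q = (k\<^sup>2 + t) / (1 + t)"
  have k2: "k\<^sup>2 > 0" using assms by simp
  have q0: "q \<ge> 0" using t k2 by (simp add: q_def)
  have q: "min 1 (k\<^sup>2) \<le> q" "q \<le> max 1 (k\<^sup>2)"
  proof -
    have "min 1 (k\<^sup>2) * t \<le> 1 * t" "1 * t \<le> max 1 (k\<^sup>2) * t"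
      using t by (intro mult_right_mono; simp)+
    then have "min 1 (k\<^sup>2) * (1 + t) \<le> k\<^sup>2 + t" "k\<^sup>2 + t \<le> max 1 (k\<^sup>2) * (1 + t)"
      by (simp_all add: distrib_left)
    then show "min 1 (k\<^sup>2) \<le> q" "q \<le> max 1 (k\<^sup>2)"
      using t by (simp_all add: q_def pos_le_divide_eq pos_divide_le_eq)
  qed
  have "q powr s \<le> C"
  proof (cases "s \<ge> 0")
    case True
    have "q powr s \<le> max 1 (k\<^sup>2) powr s" using q q0 True by (intro powr_mono2)
    then show ?thesis by (simp add: C_def)
  next
    case False
    have "q powr s \<le> min 1 (k\<^sup>2) powr s" using q k2 False by (intro powr_mono2') (auto simp: min_def)
    then show ?thesis by (simp add: C_def)
  qed
  moreover have "weight k s \<xi> = q powr s * weight 1 s \<xi>"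
  proof -
    have "k\<^sup>2 + t = q * (1 + t)" using t by (simp add: q_def)
    then show ?thesis using t q0 unfolding weight_def t_def[symmetric] by (simp add: powr_mult)
  qed
  ultimately show "weight k s \<xi> \<le> C * weight 1 s \<xi>" by (simp add: mult_right_mono)
qed

lemma wspace_measurable: "g \<in> wspace s \<Longrightarrow> g \<in> borel_measurable borel"
  by (simp add: wspace_def)

lemma wspace_integrable:
  fixes g :: "real^'m::finite \<Rightarrow> complex"
  assumes "g \<in> wspace s" "k > 0"
  shows "integrable lborel (\<lambda>\<xi>. weight k s \<xi> * (cmod (g \<xi>))\<^sup>2)"
proof -
  obtain C where C: "C > 0" "\<And>\<xi>::real^'m. weight k s \<xi> \<le> C * weight 1 s \<xi>"
    using weight_le[OF assms(2)] by blast
  have [measurable]: "g \<in> borel_measurable borel" using assms(1) by (rule wspace_measurable)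
  show ?thesis
  proof (rule Bochner_Integration.integrable_bound)
    show "integrable lborel (\<lambda>\<xi>. C * (weight 1 s \<xi> * (cmod (g \<xi>))\<^sup>2))"
      using assms(1) by (simp add: wspace_def)
    show "AE \<xi> in lborel. norm (weight k s \<xi> * (cmod (g \<xi>))\<^sup>2) \<le> norm (C * (weight 1 s \<xi> * (cmod (g \<xi>))\<^sup>2))"
      using C by (intro AE_I2) (simp add: mult.assoc[symmetric] abs_mult mult_right_mono)
  qed measurable
qed

lemma wnorm_nonneg [simp]: "wnorm k s g \<ge> 0"
  by (simp add: wnorm_def)

lemma wnorm_square: "(wnorm k s g)\<^sup>2 = (\<integral>\<xi>. weight k s \<xi> * (cmod (g \<xi>))\<^sup>2 \<partial>lborel)"
  by (simp add: wnorm_def)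

lemma wnorm_le:
  fixes dummy :: "real^'m::finite"
  assumes "k > 0"
  obtains C where "C > 0" "\<And>g::real^'m \<Rightarrow> complex. g \<in> wspace s \<Longrightarrow> wnorm k s g \<le> C * wnorm 1 s g"
proof -
  obtain C where C: "C > 0" "\<And>\<xi>::real^'m. weight k s \<xi> \<le> C * weight 1 s \<xi>"
    using weight_le[OF assms] by blast
  show thesis
  proof
    show "sqrt C > 0" using C by simp
    fix g :: "real^'m \<Rightarrow> complex" assume g: "g \<in> wspace s"
    have "(\<integral>\<xi>. weight k s \<xi> * (cmod (g \<xi>))\<^sup>2 \<partial>lborel) \<le> (\<integral>\<xi>. C * (weight 1 s \<xi> * (cmod (g \<xi>))\<^sup>2) \<partial>lborel)"
    proof (intro integral_mono integrable_mult_right wspace_integrable[OF g] assms)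
      show "weight k s \<xi> * (cmod (g \<xi>))\<^sup>2 \<le> C * (weight 1 s \<xi> * (cmod (g \<xi>))\<^sup>2)" for \<xi>
        using mult_right_mono[OF C(2)[of \<xi>], of "(cmod (g \<xi>))\<^sup>2"] by (simp add: mult.assoc)
    qed simp
    then show "wnorm k s g \<le> sqrt C * wnorm 1 s g"
      unfolding wnorm_def by (simp flip: real_sqrt_mult)
  qed
qed

lemma wnorm_cong_AE:
  assumes "AE \<xi> in lborel. g \<xi> = h \<xi>" "g \<in> borel_measurable borel" "h \<in> borel_measurable borel"
  shows "wnorm k s g = wnorm k s h"
  unfolding wnorm_def using assms by (intro arg_cong[where f=sqrt] integral_cong_AE) auto

lemma wspace_cong_AE:
  assumes "AE \<xi> in lborel. g \<xi> = h \<xi>" "g \<in> borel_measurable borel" "h \<in> wspace s"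
  shows "g \<in> wspace s"
proof -
  have [measurable]: "g \<in> borel_measurable borel" "h \<in> borel_measurable borel"
    using assms wspace_measurable by auto
  have "integrable lborel (\<lambda>\<xi>. weight 1 s \<xi> * (cmod (g \<xi>))\<^sup>2) \<longleftrightarrow> integrable lborel (\<lambda>\<xi>. weight 1 s \<xi> * (cmod (h \<xi>))\<^sup>2)"
    by (rule Bochner_Integration.integrable_cong_AE) (use assms(1) in auto)
  then show ?thesis using assms by (simp add: wspace_def)
qed

text \<open>The weights for s and - s are reciprocal, so their square roots can be distributed over
  the two factors at no cost before applying Cauchy-Schwarz. This is the duality behind every
  pairing below.\<close>

lemma
  fixes g h :: "real^'m::finite \<Rightarrow> complex"
  assumes g: "g \<in> wspace s" and h: "h \<in> wspace (- s)"
  shows wspace_integrable_mult: "integrable lborel (\<lambda>\<xi>. g \<xi> * h \<xi>)"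
    and wspace_Cauchy_Schwarz: "(\<integral>\<xi>. cmod (g \<xi> * h \<xi>) \<partial>lborel) \<le> wnorm 1 s g * wnorm 1 (- s) h"
proof -
  have [measurable]: "g \<in> borel_measurable borel" "h \<in> borel_measurable borel"
    using g h wspace_measurable by auto
  define F where "F \<xi> = sqrt (weight 1 s \<xi>) * cmod (g \<xi>)" for \<xi>
  define H where "H \<xi> = sqrt (weight 1 (- s) \<xi>) * cmod (h \<xi>)" for \<xi>
  have m: "F \<in> borel_measurable lborel" "H \<in> borel_measurable lborel"
    unfolding F_def H_def by measurable
  have F2: "(F \<xi>)\<^sup>2 = weight 1 s \<xi> * (cmod (g \<xi>))\<^sup>2" and H2: "(H \<xi>)\<^sup>2 = weight 1 (- s) \<xi> * (cmod (h \<xi>))\<^sup>2" for \<xi>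
    by (simp_all add: F_def H_def power_mult_distrib)
  have FH: "F \<xi> * H \<xi> = cmod (g \<xi> * h \<xi>)" for \<xi>
  proof -
    have "F \<xi> * H \<xi> = sqrt (weight 1 s \<xi> * weight 1 (- s) \<xi>) * (cmod (g \<xi>) * cmod (h \<xi>))"
      unfolding F_def H_def real_sqrt_mult by (simp add: mult_ac)
    then show ?thesis by (simp add: weight_minus norm_mult)
  qed
  have i: "integrable lborel (\<lambda>\<xi>. (F \<xi>)\<^sup>2)" "integrable lborel (\<lambda>\<xi>. (H \<xi>)\<^sup>2)"
    unfolding F2 H2 using g h by (simp_all add: wspace_def)
  have "integrable lborel (\<lambda>\<xi>. cmod (g \<xi> * h \<xi>))"
    using integrable_mult_L2[OF m i] unfolding FH .
  then show "integrable lborel (\<lambda>\<xi>. g \<xi> * h \<xi>)"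
    by (rule integrable_norm_cancel) measurable
  show "(\<integral>\<xi>. cmod (g \<xi> * h \<xi>) \<partial>lborel) \<le> wnorm 1 s g * wnorm 1 (- s) h"
    using Cauchy_Schwarz_L2[OF m i] unfolding FH F2 H2 by (simp add: wnorm_def)
qed

lemma wspace_pairing_le:
  assumes "g \<in> wspace s" "h \<in> wspace (- s)"
  shows "cmod (\<integral>\<xi>. g \<xi> * h \<xi> \<partial>lborel) \<le> wnorm 1 s g * wnorm 1 (- s) h"
  using wspace_Cauchy_Schwarz[OF assms] integral_norm_bound[of lborel "\<lambda>\<xi>. g \<xi> * h \<xi>"] by linarith

lemma
  fixes g h :: "real^'m::finite \<Rightarrow> complex"
  assumes g: "g \<in> wspace s" and h: "h \<in> wspace s"
  shows wspace_add: "(\<lambda>\<xi>. g \<xi> + h \<xi>) \<in> wspace s"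
    and wnorm_triangle: "k > 0 \<Longrightarrow> wnorm k s (\<lambda>\<xi>. g \<xi> + h \<xi>) \<le> wnorm k s g + wnorm k s h"
proof -
  have [measurable]: "g \<in> borel_measurable borel" "h \<in> borel_measurable borel"
    using g h wspace_measurable by auto
  have sq: "(cmod (g \<xi> + h \<xi>))\<^sup>2 \<le> (cmod (g \<xi>))\<^sup>2 + 2 * (cmod (g \<xi>) * cmod (h \<xi>)) + (cmod (h \<xi>))\<^sup>2" for \<xi>
  proof -
    have "(cmod (g \<xi> + h \<xi>))\<^sup>2 \<le> (cmod (g \<xi>) + cmod (h \<xi>))\<^sup>2"
      by (intro power_mono norm_triangle_ineq) auto
    then show ?thesis by (simp add: power2_sum)
  qed
  have main: "integrable lborel (\<lambda>\<xi>. weight k s \<xi> * (cmod (g \<xi> + h \<xi>))\<^sup>2) \<and>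
      wnorm k s (\<lambda>\<xi>. g \<xi> + h \<xi>) \<le> wnorm k s g + wnorm k s h" if k: "k > 0" for k
  proof -
    define F where "F \<xi> = sqrt (weight k s \<xi>) * cmod (g \<xi>)" for \<xi>
    define H where "H \<xi> = sqrt (weight k s \<xi>) * cmod (h \<xi>)" for \<xi>
    have m: "F \<in> borel_measurable lborel" "H \<in> borel_measurable lborel"
      unfolding F_def H_def by measurable
    have F2: "(F \<xi>)\<^sup>2 = weight k s \<xi> * (cmod (g \<xi>))\<^sup>2" and H2: "(H \<xi>)\<^sup>2 = weight k s \<xi> * (cmod (h \<xi>))\<^sup>2" for \<xi>
      by (simp_all add: F_def H_def power_mult_distrib)
    have i: "integrable lborel (\<lambda>\<xi>. (F \<xi>)\<^sup>2)" "integrable lborel (\<lambda>\<xi>. (H \<xi>)\<^sup>2)"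
      unfolding F2 H2 using g h k by (simp_all add: wspace_integrable)
    have FH: "F \<xi> * H \<xi> = weight k s \<xi> * (cmod (g \<xi>) * cmod (h \<xi>))" for \<xi>
    proof -
      have "F \<xi> * H \<xi> = (sqrt (weight k s \<xi>) * sqrt (weight k s \<xi>)) * (cmod (g \<xi>) * cmod (h \<xi>))"
        unfolding F_def H_def by (simp only: mult_ac)
      then show ?thesis by simp
    qed
    have ub: "weight k s \<xi> * (cmod (g \<xi> + h \<xi>))\<^sup>2 \<le> (F \<xi>)\<^sup>2 + 2 * (F \<xi> * H \<xi>) + (H \<xi>)\<^sup>2" for \<xi>
      using mult_left_mono[OF sq[of \<xi>], of "weight k s \<xi>"] unfolding F2 H2 FH by (simp add: algebra_simps)
    note i3 = integrable_mult_L2[OF m i]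
    have int: "integrable lborel (\<lambda>\<xi>. weight k s \<xi> * (cmod (g \<xi> + h \<xi>))\<^sup>2)"
    proof (rule Bochner_Integration.integrable_bound)
      show "integrable lborel (\<lambda>\<xi>. (F \<xi>)\<^sup>2 + 2 * (F \<xi> * H \<xi>) + (H \<xi>)\<^sup>2)" using i i3 by simp
      show "AE \<xi> in lborel. norm (weight k s \<xi> * (cmod (g \<xi> + h \<xi>))\<^sup>2) \<le> norm ((F \<xi>)\<^sup>2 + 2 * (F \<xi> * H \<xi>) + (H \<xi>)\<^sup>2)"
        using ub by (intro AE_I2) (simp only: real_norm_def, rule order_trans[OF _ abs_ge_self], simp)
    qed measurable
    have FH_le: "(\<integral>\<xi>. F \<xi> * H \<xi> \<partial>lborel) \<le> wnorm k s g * wnorm k s h"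
    proof -
      have "\<bar>F \<xi> * H \<xi>\<bar> = F \<xi> * H \<xi>" for \<xi>
        unfolding FH by simp
      then show ?thesis
        using Cauchy_Schwarz_L2[OF m i] by (simp only: wnorm_def F2 H2)
    qed
    have "(wnorm k s (\<lambda>\<xi>. g \<xi> + h \<xi>))\<^sup>2 \<le> (\<integral>\<xi>. (F \<xi>)\<^sup>2 + 2 * (F \<xi> * H \<xi>) + (H \<xi>)\<^sup>2 \<partial>lborel)"
      unfolding wnorm_square
      by (intro integral_mono int ub Bochner_Integration.integrable_add integrable_mult_right i i3)
    also have "\<dots> = (wnorm k s g)\<^sup>2 + 2 * (\<integral>\<xi>. F \<xi> * H \<xi> \<partial>lborel) + (wnorm k s h)\<^sup>2"
      using i i3 by (simp add: wnorm_square F2 H2)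
    finally have "(wnorm k s (\<lambda>\<xi>. g \<xi> + h \<xi>))\<^sup>2 \<le> (wnorm k s g + wnorm k s h)\<^sup>2"
      using FH_le unfolding power2_sum by linarith
    then have "wnorm k s (\<lambda>\<xi>. g \<xi> + h \<xi>) \<le> wnorm k s g + wnorm k s h"
      by (rule power2_le_imp_le) simp
    then show ?thesis using int by blast
  qed
  show "(\<lambda>\<xi>. g \<xi> + h \<xi>) \<in> wspace s" using main[of 1] by (simp add: wspace_def)
  show "k > 0 \<Longrightarrow> wnorm k s (\<lambda>\<xi>. g \<xi> + h \<xi>) \<le> wnorm k s g + wnorm k s h" using main by simp
qed

lemma wspace_cmult: "g \<in> wspace s \<Longrightarrow> (\<lambda>\<xi>. c * g \<xi>) \<in> wspace s"
  by (auto simp: wspace_def norm_mult power_mult_distrib mult.left_commute[of "weight 1 s _"])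

lemma wnorm_cmult: "wnorm k s (\<lambda>\<xi>. c * g \<xi>) = cmod c * wnorm k s g"
  by (simp add: wnorm_def norm_mult power_mult_distrib mult.left_commute[of "weight k s _"] real_sqrt_mult)

lemma borel_measurable_cnj [measurable]:
  "g \<in> borel_measurable M \<Longrightarrow> (\<lambda>x. cnj (g x)) \<in> borel_measurable M"
  by (rule borel_measurable_continuous_on[OF continuous_on_cnj[OF continuous_on_id]])

lemma wspace_cnj: "g \<in> wspace s \<Longrightarrow> (\<lambda>\<xi>. cnj (g \<xi>)) \<in> wspace s"
  by (simp add: wspace_def borel_measurable_cnj)

lemma wnorm_cnj: "wnorm k s (\<lambda>\<xi>. cnj (g \<xi>)) = wnorm k s g"
  by (simp add: wnorm_def)

text \<open>For s \<le> 0 the weight is at most 1, so square integrability is enough.\<close>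

lemma schwartz_wspace:
  assumes f: "f \<in> schwartz" and s: "s \<le> 0"
  shows "f \<in> wspace s"
proof -
  note [measurable] = schwartz_measurable[OF f]
  have "integrable lborel (\<lambda>\<xi>. weight 1 s \<xi> * (cmod (f \<xi>))\<^sup>2)"
  proof (rule Bochner_Integration.integrable_bound[OF schwartz_integrable_square[OF f]])
    have "weight 1 s \<xi> \<le> 1" for \<xi> :: "real^'a"
      unfolding weight_def using powr_mono[OF s, of "1 + (norm \<xi>)\<^sup>2"] by (simp split: if_splits)
    then show "AE \<xi> in lborel. norm (weight 1 s \<xi> * (cmod (f \<xi>))\<^sup>2) \<le> norm ((cmod (f \<xi>))\<^sup>2)"
      by (intro AE_I2) (simp add: abs_mult mult_left_le_one_le)
  qed measurable
  then show ?thesis using schwartz_measurable[OF f] by (simp add: wspace_def)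
qed

subsection \<open>Tempered distributions and Sobolev spaces\<close>

text \<open>The supremum in \<open>schwartz_seminorm\<close> is meaningful only over a set bounded
  above. There are finitely many lists of length at most N, each with its own decay constant, and
  the largest of these constants is a bound.\<close>

lemma schwartz_seminorm_upper:
  fixes f :: "real^'m::finite \<Rightarrow> complex"
  assumes f: "f \<in> schwartz" and js: "length js \<le> N"
  shows "(1 + norm x) ^ N * cmod (partials js f x) \<le> schwartz_seminorm N f"
proof -
  let ?J = "{js::'m list. length js \<le> N}"
  let ?F = "\<lambda>js x. (1 + norm x) ^ N * cmod (partials js f x)"
  have "\<forall>js. \<exists>C. \<forall>x. ?F js x \<le> C" using f unfolding schwartz_def by blast
  then obtain C where C: "\<And>js x. ?F js x \<le> C js" by metis
  have fin: "finite ?J" using finite_lists_length_le[of "UNIV::'m set" N] by simp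
  have "bdd_above ((\<lambda>(js, x). ?F js x) ` (?J \<times> UNIV))"
  proof (rule bdd_aboveI2)
    fix p assume "p \<in> ?J \<times> (UNIV :: (real^'m) set)"
    then have p: "fst p \<in> ?J" by auto
    have "?F (fst p) (snd p) \<le> C (fst p)" by (rule C)
    also have "\<dots> \<le> Max (C ` ?J)" using p fin by (intro Max_ge) auto
    finally show "(case p of (js, x) \<Rightarrow> ?F js x) \<le> Max (C ` ?J)" by (simp add: case_prod_beta)
  qed
  from cSUP_upper[OF _ this, of "(js, x)"] js show ?thesis
    unfolding schwartz_seminorm_def by simp
qed

lemma schwartz_seminorm_nonneg: "f \<in> schwartz \<Longrightarrow> schwartz_seminorm N f \<ge> 0"
  using schwartz_seminorm_upper[of f "[]" N 0] by (simp add: order_trans[OF norm_ge_zero])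

text \<open>Brings the continuity bounds of two distributions, given with seminorms of different
  orders, to a common one when the distributions are added.\<close>

lemma schwartz_seminorm_mono:
  fixes f :: "real^'m::finite \<Rightarrow> complex"
  assumes f: "f \<in> schwartz" and le: "N \<le> M"
  shows "schwartz_seminorm N f \<le> schwartz_seminorm M f"
  unfolding schwartz_seminorm_def[of N]
proof (rule cSUP_least)
  have "([], 0) \<in> {js::'m list. length js \<le> N} \<times> (UNIV :: (real^'m) set)" by simp
  then show "{js::'m list. length js \<le> N} \<times> (UNIV :: (real^'m) set) \<noteq> {}" by blast
  fix p assume p: "p \<in> {js::'m list. length js \<le> N} \<times> (UNIV :: (real^'m) set)"
  obtain js x where jx: "p = (js, x)" by (cases p)
  have "(1 + norm x) ^ N * cmod (partials js f x) \<le> (1 + norm x) ^ M * cmod (partials js f x)"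
    using le by (intro mult_right_mono power_increasing) auto
  also have "\<dots> \<le> schwartz_seminorm M f"
    using p le jx by (intro schwartz_seminorm_upper f) auto
  finally show "(case p of (js, x) \<Rightarrow> (1 + norm x) ^ N * cmod (partials js f x)) \<le> schwartz_seminorm M f"
    by (simp add: jx)
qed

section \<open>Tempered distributions as a vector space\<close>

lemma temperedI:
  assumes "\<And>f. f \<notin> schwartz \<Longrightarrow> u f = 0"
    and "\<And>f g. f \<in> schwartz \<Longrightarrow> g \<in> schwartz \<Longrightarrow> u (\<lambda>x. f x + g x) = u f + u g"
    and "\<And>c f. f \<in> schwartz \<Longrightarrow> u (\<lambda>x. c * f x) = c * u f"
    and "\<And>f. f \<in> schwartz \<Longrightarrow> cmod (u f) \<le> C * schwartz_seminorm N f"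
  shows "u \<in> tempered"
  unfolding tempered_def mem_Collect_eq
  by (intro conjI allI impI ballI assms exI[of _ N] exI[of _ C])

lemma tempered_off: "u \<in> tempered \<Longrightarrow> f \<notin> schwartz \<Longrightarrow> u f = 0"
  unfolding tempered_def by blast

lemma tempered_linear_add:
  "u \<in> tempered \<Longrightarrow> f \<in> schwartz \<Longrightarrow> g \<in> schwartz \<Longrightarrow> u (\<lambda>x. f x + g x) = u f + u g"
  unfolding tempered_def by blast

lemma tempered_linear_cmult: "u \<in> tempered \<Longrightarrow> f \<in> schwartz \<Longrightarrow> u (\<lambda>x. c * f x) = c * u f"
  unfolding tempered_def by blast

lemma tempered_bound:
  assumes "u \<in> tempered"
  obtains N C where "\<And>f. f \<in> schwartz \<Longrightarrow> cmod (u f) \<le> C * schwartz_seminorm N f"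
  using assms unfolding tempered_def by blast

lemma tempered_add:
  fixes u v :: "(real^'m::finite \<Rightarrow> complex) \<Rightarrow> complex"
  assumes u: "u \<in> tempered" and v: "v \<in> tempered"
  shows "(\<lambda>f. u f + v f) \<in> tempered"
proof -
  obtain N C where bu: "\<And>f. f \<in> schwartz \<Longrightarrow> cmod (u f) \<le> C * schwartz_seminorm N f"
    using tempered_bound[OF u] by blast
  obtain M D where bv: "\<And>f. f \<in> schwartz \<Longrightarrow> cmod (v f) \<le> D * schwartz_seminorm M f"
    using tempered_bound[OF v] by blast
  show ?thesis
  proof (rule temperedI)
    fix f :: "real^'m \<Rightarrow> complex" assume f: "f \<in> schwartz"
    have "cmod (u f + v f) \<le> C * schwartz_seminorm N f + D * schwartz_seminorm M f"
      using bu[OF f] bv[OF f] norm_triangle_ineq[of "u f" "v f"] by linarith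
    also have "\<dots> \<le> \<bar>C\<bar> * schwartz_seminorm (max N M) f + \<bar>D\<bar> * schwartz_seminorm (max N M) f"
      by (intro add_mono mult_mono schwartz_seminorm_mono schwartz_seminorm_nonneg f) auto
    finally show "cmod (u f + v f) \<le> (\<bar>C\<bar> + \<bar>D\<bar>) * schwartz_seminorm (max N M) f"
      by (simp add: distrib_right)
  qed (simp_all add: tempered_off[OF u] tempered_off[OF v] tempered_linear_add[OF u] tempered_linear_add[OF v]
      tempered_linear_cmult[OF u] tempered_linear_cmult[OF v] distrib_left)
qed

lemma tempered_cmult:
  fixes u :: "(real^'m::finite \<Rightarrow> complex) \<Rightarrow> complex"
  assumes u: "u \<in> tempered"
  shows "(\<lambda>f. c * u f) \<in> tempered"
proof -
  obtain N C where bu: "\<And>f. f \<in> schwartz \<Longrightarrow> cmod (u f) \<le> C * schwartz_seminorm N f"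
    using tempered_bound[OF u] by blast
  show ?thesis
  proof (rule temperedI)
    fix f :: "real^'m \<Rightarrow> complex" assume f: "f \<in> schwartz"
    show "cmod (c * u f) \<le> (cmod c * C) * schwartz_seminorm N f"
      using mult_left_mono[OF bu[OF f], of "cmod c"] by (simp add: norm_mult mult.assoc)
  qed (simp_all add: tempered_off[OF u] tempered_linear_add[OF u] tempered_linear_cmult[OF u] distrib_left mult.left_commute)
qed

section \<open>Representing functions and the Sobolev spaces\<close>

lemma represents_add:
  fixes g h :: "real^'m::finite \<Rightarrow> complex"
  assumes "represents g (fourier_dist u)" "represents h (fourier_dist v)"
  shows "represents (\<lambda>\<xi>. g \<xi> + h \<xi>) (fourier_dist (\<lambda>f. u f + v f))"
  unfolding represents_def
proof (intro conjI allI impI ballI)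
  fix K :: "(real^'m) set" assume "compact K"
  with assms show "set_integrable lborel K (\<lambda>\<xi>. g \<xi> + h \<xi>)"
    unfolding represents_def by (intro set_integral_add) blast+
next
  fix f :: "real^'m \<Rightarrow> complex" assume f: "f \<in> schwartz"
  have i: "integrable lborel (\<lambda>\<xi>. g \<xi> * f \<xi>)" "integrable lborel (\<lambda>\<xi>. h \<xi> * f \<xi>)"
    and e: "fourier_dist u f = (\<integral>\<xi>. g \<xi> * f \<xi> \<partial>lborel)" "fourier_dist v f = (\<integral>\<xi>. h \<xi> * f \<xi> \<partial>lborel)"
    using assms f unfolding represents_def by blast+
  show "integrable lborel (\<lambda>\<xi>. (g \<xi> + h \<xi>) * f \<xi>)"
    unfolding distrib_right by (rule Bochner_Integration.integrable_add[OF i])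
  have "fourier_dist (\<lambda>f. u f + v f) f = fourier_dist u f + fourier_dist v f"
    by (simp add: fourier_dist_def)
  also have "\<dots> = (\<integral>\<xi>. (g \<xi> + h \<xi>) * f \<xi> \<partial>lborel)"
    unfolding e distrib_right by (rule Bochner_Integration.integral_add[OF i, symmetric])
  finally show "fourier_dist (\<lambda>f. u f + v f) f = (\<integral>\<xi>. (g \<xi> + h \<xi>) * f \<xi> \<partial>lborel)" .
qed

lemma represents_cmult:
  fixes g :: "real^'m::finite \<Rightarrow> complex"
  assumes "represents g (fourier_dist u)"
  shows "represents (\<lambda>\<xi>. c * g \<xi>) (fourier_dist (\<lambda>f. c * u f))"
  unfolding represents_def
proof (intro conjI allI impI ballI)
  fix K :: "(real^'m) set" assume "compact K"
  with assms show "set_integrable lborel K (\<lambda>\<xi>. c * g \<xi>)"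
    unfolding represents_def by (intro set_integrable_mult_right) blast
next
  fix f :: "real^'m \<Rightarrow> complex" assume f: "f \<in> schwartz"
  have i: "integrable lborel (\<lambda>\<xi>. g \<xi> * f \<xi>)"
    and e: "fourier_dist u f = (\<integral>\<xi>. g \<xi> * f \<xi> \<partial>lborel)"
    using assms f unfolding represents_def by blast+
  show "integrable lborel (\<lambda>\<xi>. c * g \<xi> * f \<xi>)"
    unfolding mult.assoc by (rule integrable_mult_right[OF i])
  have "fourier_dist (\<lambda>f. c * u f) f = c * fourier_dist u f"
    by (simp add: fourier_dist_def)
  then show "fourier_dist (\<lambda>f. c * u f) f = (\<integral>\<xi>. c * g \<xi> * f \<xi> \<partial>lborel)"
    by (simp only: e mult.assoc integral_mult_right_zero)
qed

lemma fhat_represents: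
  "represents g (fourier_dist u) \<Longrightarrow> represents (fhat u) (fourier_dist u)"
  unfolding fhat_def by (rule someI[where P="\<lambda>g. represents g (fourier_dist u)"])

text \<open>\<open>fhat\<close> is an indefinite choice, and this is the means to compute with it:
  uniqueness of the representing function lets any known representative take its place under an
  integral.\<close>

lemma fhat_AE_eq:
  "represents g (fourier_dist u) \<Longrightarrow> AE \<xi> in lborel. fhat u \<xi> = g \<xi>"
  using represents_unique fhat_represents by blast

lemma sobolev_represents: "u \<in> sobolev s \<Longrightarrow> represents (fhat u) (fourier_dist u)"
  unfolding sobolev_def using fhat_represents by blast

lemma sobolev_wspace:
  assumes "u \<in> sobolev s"
  shows "fhat u \<in> wspace s"
proof -
  obtain g where g: "represents g (fourier_dist u)"
     "integrable lborel (\<lambda>\<xi>. weight 1 s \<xi> * (cmod (g \<xi>))\<^sup>2)"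
    using assms unfolding sobolev_def weight_def by auto
  show ?thesis
    by (rule wspace_cong_AE[OF fhat_AE_eq[OF g(1)]])
       (use g represents_measurable fhat_represents[OF g(1)] in \<open>auto simp: wspace_def\<close>)
qed

lemma sobolevI:
  assumes "u \<in> tempered" "represents g (fourier_dist u)" "g \<in> wspace s"
  shows "u \<in> sobolev s"
  using assms unfolding sobolev_def wspace_def weight_def by auto

lemma sobolev_norm_eq:
  assumes g: "represents g (fourier_dist u)"
  shows "sobolev_norm k s u = wnorm k s g"
  unfolding sobolev_norm_wnorm
  by (rule wnorm_cong_AE[OF fhat_AE_eq[OF g]])
     (use g represents_measurable fhat_represents[OF g] in auto)

lemma sobolev_tempered: "u \<in> sobolev s \<Longrightarrow> u \<in> tempered"
  by (simp add: sobolev_def)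

lemma sobolev_add:
  assumes "u \<in> sobolev s" "v \<in> sobolev s"
  shows "(\<lambda>f. u f + v f) \<in> sobolev s"
  by (rule sobolevI[OF tempered_add represents_add[OF sobolev_represents sobolev_represents]
        wspace_add[OF sobolev_wspace sobolev_wspace]])
     (use assms sobolev_tempered in auto)

lemma sobolev_cmult:
  assumes "u \<in> sobolev s"
  shows "(\<lambda>f. c * u f) \<in> sobolev s"
  by (rule sobolevI[OF tempered_cmult represents_cmult[OF sobolev_represents]
        wspace_cmult[OF sobolev_wspace]])
     (use assms sobolev_tempered in auto)

lemma sobolev_norm_add:
  assumes "u \<in> sobolev s" "v \<in> sobolev s" "k > 0"
  shows "sobolev_norm k s (\<lambda>f. u f + v f) \<le> sobolev_norm k s u + sobolev_norm k s v"
  using sobolev_norm_eq[OF represents_add[OF sobolev_represents sobolev_represents], OF assms(1,2)]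
    wnorm_triangle[OF sobolev_wspace sobolev_wspace, OF assms]
  by (simp add: sobolev_norm_wnorm)

lemma sobolev_norm_cmult:
  assumes "u \<in> sobolev s"
  shows "sobolev_norm k s (\<lambda>f. c * u f) = cmod c * sobolev_norm k s u"
  using sobolev_norm_eq[OF represents_cmult[OF sobolev_represents[OF assms]]]
  by (simp add: wnorm_cmult sobolev_norm_wnorm)

lemma schwartz_mult_integrable:
  assumes f: "f \<in> schwartz" and g: "integrable lborel g"
  shows "integrable lborel (\<lambda>x. g x * f x)"
proof -
  obtain C where C: "C \<ge> 0" "\<And>x. cmod (f x) \<le> C / (1 + norm x) ^ 0" using schwartz_decay_pos[OF f] by blast
  note [measurable] = schwartz_measurable[OF f]
  have [measurable]: "g \<in> borel_measurable borel" using g by simp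
  show ?thesis
  proof (rule Bochner_Integration.integrable_bound)
    show "integrable lborel (\<lambda>x. C * cmod (g x))" using g by simp
    show "AE x in lborel. cmod (g x * f x) \<le> norm (C * cmod (g x))"
      using C by (intro AE_I2) (simp add: norm_mult abs_mult mult.commute[of C] mult_left_mono)
  qed measurable
qed

lemma tempered_of_tempered:
  assumes "\<phi> \<in> schwartz"
  shows "tempered_of \<phi> \<in> tempered"
proof -
  note i = schwartz_mult_integrable[OF _ schwartz_integrable[OF assms]]
  have "cmod (tempered_of \<phi> f) \<le> (\<integral>x. cmod (\<phi> x) \<partial>lborel) * schwartz_seminorm 0 f" if f: "f \<in> schwartz" for f
  proof -
    have "cmod (tempered_of \<phi> f) \<le> (\<integral>x. cmod (\<phi> x) * schwartz_seminorm 0 f \<partial>lborel)"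
    proof -
      have e: "tempered_of \<phi> f = (\<integral>x. \<phi> x * f x \<partial>lborel)" using f by (simp add: tempered_of_def)
      show ?thesis unfolding e
    proof (rule Bochner_Integration.integral_norm_bound_integral[OF i[OF f]])
      show "integrable lborel (\<lambda>x. cmod (\<phi> x) * schwartz_seminorm 0 f)"
        using schwartz_integrable[OF assms] by simp
      show "cmod (\<phi> x * f x) \<le> cmod (\<phi> x) * schwartz_seminorm 0 f" for x
        unfolding norm_mult using schwartz_seminorm_upper[OF f, of "[]" 0 x] by (intro mult_left_mono) auto
    qed
    qed
    then show ?thesis by simp
  qed
  then show ?thesis
  proof (rule temperedI[rotated 3])
    show "tempered_of \<phi> f = 0" if "f \<notin> schwartz" for f using that by (simp add: tempered_of_def)
    show "tempered_of \<phi> (\<lambda>x. f x + g x) = tempered_of \<phi> f + tempered_of \<phi> g"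
      if "f \<in> schwartz" "g \<in> schwartz" for f g
      using that i by (simp add: tempered_of_def schwartz_add distrib_left)
    show "tempered_of \<phi> (\<lambda>x. c * f x) = c * tempered_of \<phi> f" if "f \<in> schwartz" for c f
      using that by (simp add: tempered_of_def schwartz_cmult mult.left_commute[of _ c])
  qed
qed

lemma tempered_of_represents:
  assumes "\<phi> \<in> schwartz"
  shows "represents (fourier \<phi>) (fourier_dist (tempered_of \<phi>))"
  unfolding represents_def
proof (intro conjI allI impI ballI)
  have F: "integrable lborel (fourier \<phi>)" by (intro schwartz_integrable fourier_schwartz assms)
  show "set_integrable lborel K (fourier \<phi>)" if "compact K" for K
    unfolding set_integrable_def using that F by (intro integrable_mult_indicator) (auto simp: borel_compact)
  fix f :: "real^'a \<Rightarrow> complex" assume f: "f \<in> schwartz"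
  show "integrable lborel (\<lambda>\<xi>. fourier \<phi> \<xi> * f \<xi>)" by (rule schwartz_mult_integrable[OF f F])
  show "fourier_dist (tempered_of \<phi>) f = (\<integral>\<xi>. fourier \<phi> \<xi> * f \<xi> \<partial>lborel)"
    using f assms by (simp add: fourier_dist_def tempered_of_def fourier_schwartz fourier_multiplication schwartz_integrable)
qed

lemma tempered_of_sobolev:
  assumes "\<phi> \<in> schwartz" "s \<le> 0"
  shows "tempered_of \<phi> \<in> sobolev s"
  by (rule sobolevI[OF tempered_of_tempered tempered_of_represents schwartz_wspace])
     (use assms fourier_schwartz in auto)


subsection \<open>The duality pairing\<close>

lemma test_functions_schwartz: "\<phi> \<in> test_functions \<Omega> \<Longrightarrow> \<phi> \<in> schwartz"
  using test_functions_subset_schwartz by blast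

lemma test_functions_eq_0: "\<phi> \<in> test_functions \<Omega> \<Longrightarrow> x \<notin> \<Omega> \<Longrightarrow> \<phi> x = 0"
  unfolding test_functions_def using closure_subset[of "{x. \<phi> x \<noteq> 0}"] by auto

lemma test_functionsI:
  assumes "f \<in> schwartz" "{x. f x \<noteq> 0} \<subseteq> K" "compact K" "K \<subseteq> \<Omega>"
  shows "f \<in> test_functions \<Omega>"
proof -
  have "closure {x. f x \<noteq> 0} \<subseteq> K"
    using assms by (simp add: closure_minimal compact_imp_closed)
  moreover have "compact (closure {x. f x \<noteq> 0})"
    using calculation assms(3) by (metis closed_closure compact_Int_closed inf.absorb_iff2)
  ultimately show ?thesis using assms unfolding test_functions_def schwartz_def by blast
qed

lemma test_functions_add:
  assumes "f \<in> test_functions \<Omega>" "g \<in> test_functions \<Omega>"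
  shows "(\<lambda>x. f x + g x) \<in> test_functions \<Omega>"
proof (rule test_functionsI)
  show "(\<lambda>x. f x + g x) \<in> schwartz" using assms by (intro schwartz_add test_functions_schwartz)
  show "{x. f x + g x \<noteq> 0} \<subseteq> closure {x. f x \<noteq> 0} \<union> closure {x. g x \<noteq> 0}"
  proof
    fix x assume "x \<in> {x. f x + g x \<noteq> 0}"
    then have "x \<in> {x. f x \<noteq> 0} \<or> x \<in> {x. g x \<noteq> 0}" by auto
    then show "x \<in> closure {x. f x \<noteq> 0} \<union> closure {x. g x \<noteq> 0}"
      by (elim disjE) (rule UnI1[OF subsetD[OF closure_subset]] UnI2[OF subsetD[OF closure_subset]], assumption)+
  qed
qed (use assms in \<open>auto simp: test_functions_def\<close>)

lemma test_functions_cmult: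
  assumes "f \<in> test_functions \<Omega>"
  shows "(\<lambda>x. c * f x) \<in> test_functions \<Omega>"
proof (rule test_functionsI)
  show "(\<lambda>x. c * f x) \<in> schwartz" using assms by (intro schwartz_cmult test_functions_schwartz)
  show "{x. c * f x \<noteq> 0} \<subseteq> closure {x. f x \<noteq> 0}"
    using closure_subset[of "{x. f x \<noteq> 0}"] by auto
qed (use assms in \<open>auto simp: test_functions_def\<close>)

lemma tempered_of_add:
  assumes "\<phi> \<in> schwartz" "\<psi> \<in> schwartz"
  shows "tempered_of (\<lambda>x. \<phi> x + \<psi> x) = (\<lambda>f. tempered_of \<phi> f + tempered_of \<psi> f)"
  using assms by (intro ext)
    (simp add: tempered_of_def distrib_right schwartz_mult_integrable schwartz_integrable)

lemma tempered_of_cmult: "tempered_of (\<lambda>x. c * \<phi> x) = (\<lambda>f. c * tempered_of \<phi> f)"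
  by (intro ext) (simp add: tempered_of_def mult.assoc)

lemma fun_diff_eq: "(\<lambda>f. u f - v f) = (\<lambda>f. u f + (-1) * v f)" for u v :: "'a \<Rightarrow> complex"
  by simp

lemma sobolev_diff:
  "u \<in> sobolev s \<Longrightarrow> v \<in> sobolev s \<Longrightarrow> (\<lambda>f. u f - v f) \<in> sobolev s"
  unfolding fun_diff_eq by (intro sobolev_add sobolev_cmult)

lemma sobolev_tilde_sobolev: "u \<in> sobolev_tilde s \<Omega> \<Longrightarrow> u \<in> sobolev s"
  by (simp add: sobolev_tilde_def)

lemma sobolev_tildeI:
  assumes "u \<in> sobolev s"
    and "\<And>\<epsilon>. \<epsilon> > 0 \<Longrightarrow> \<exists>\<phi>\<in>test_functions \<Omega>. sobolev_norm 1 s (\<lambda>f. u f - tempered_of \<phi> f) < \<epsilon>"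
  shows "u \<in> sobolev_tilde s \<Omega>"
  unfolding sobolev_tilde_def by (intro CollectI conjI allI impI assms)

lemma sobolev_tilde_approx:
  assumes "u \<in> sobolev_tilde s \<Omega>" "\<epsilon> > 0"
  obtains \<phi> where "\<phi> \<in> test_functions \<Omega>" "sobolev_norm 1 s (\<lambda>f. u f - tempered_of \<phi> f) < \<epsilon>"
  using assms unfolding sobolev_tilde_def by blast

lemma test_function_sobolev_tilde:
  assumes \<phi>: "\<phi> \<in> test_functions \<Omega>" and s: "s \<le> 0"
  shows "tempered_of \<phi> \<in> sobolev_tilde s \<Omega>"
proof -
  have sob: "tempered_of \<phi> \<in> sobolev s"
    by (intro tempered_of_sobolev test_functions_schwartz[OF \<phi>] s)
  have e: "(\<lambda>f. tempered_of \<phi> f - tempered_of \<phi> f) = (\<lambda>f. 0 * tempered_of \<phi> f)" by simp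
  have n0: "sobolev_norm 1 s (\<lambda>f. tempered_of \<phi> f - tempered_of \<phi> f) = 0"
    unfolding e sobolev_norm_cmult[OF sob] by simp
  have "\<exists>\<psi>\<in>test_functions \<Omega>. sobolev_norm 1 s (\<lambda>f. tempered_of \<phi> f - tempered_of \<psi> f) < \<epsilon>" if "\<epsilon> > 0" for \<epsilon>
    by (rule bexI[OF _ \<phi>]) (simp only: n0 that)
  with sob show ?thesis by (rule sobolev_tildeI)
qed

lemma sobolev_tilde_add:
  assumes u: "u \<in> sobolev_tilde s \<Omega>" and v: "v \<in> sobolev_tilde s \<Omega>" and s: "s \<le> 0"
  shows "(\<lambda>f. u f + v f) \<in> sobolev_tilde s \<Omega>"
proof -
  note us = sobolev_tilde_sobolev[OF u] and vs = sobolev_tilde_sobolev[OF v]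
  have "\<exists>\<phi>\<in>test_functions \<Omega>. sobolev_norm 1 s (\<lambda>f. u f + v f - tempered_of \<phi> f) < \<epsilon>" if e: "\<epsilon> > 0" for \<epsilon>
  proof -
    obtain \<phi> where \<phi>: "\<phi> \<in> test_functions \<Omega>" "sobolev_norm 1 s (\<lambda>f. u f - tempered_of \<phi> f) < \<epsilon> / 2"
      by (rule sobolev_tilde_approx[OF u half_gt_zero[OF e]])
    obtain \<psi> where \<psi>: "\<psi> \<in> test_functions \<Omega>" "sobolev_norm 1 s (\<lambda>f. v f - tempered_of \<psi> f) < \<epsilon> / 2"
      by (rule sobolev_tilde_approx[OF v half_gt_zero[OF e]])
    note sch = test_functions_schwartz[OF \<phi>(1)] test_functions_schwartz[OF \<psi>(1)]
    have d: "(\<lambda>f. u f - tempered_of \<phi> f) \<in> sobolev s" "(\<lambda>f. v f - tempered_of \<psi> f) \<in> sobolev s"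
      by (intro sobolev_diff us vs tempered_of_sobolev sch s)+
    have "(\<lambda>f. u f + v f - tempered_of (\<lambda>x. \<phi> x + \<psi> x) f) =
      (\<lambda>f. (u f - tempered_of \<phi> f) + (v f - tempered_of \<psi> f))"
      unfolding tempered_of_add[OF sch] by (simp add: algebra_simps)
    then have "sobolev_norm 1 s (\<lambda>f. u f + v f - tempered_of (\<lambda>x. \<phi> x + \<psi> x) f) < \<epsilon>"
      using sobolev_norm_add[OF d, of 1] \<phi>(2) \<psi>(2) by simp
    then show ?thesis using test_functions_add[OF \<phi>(1) \<psi>(1)] by blast
  qed
  with sobolev_add[OF us vs] show ?thesis by (rule sobolev_tildeI)
qed

lemma sobolev_tilde_cmult:
  assumes u: "u \<in> sobolev_tilde s \<Omega>" and s: "s \<le> 0"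
  shows "(\<lambda>f. c * u f) \<in> sobolev_tilde s \<Omega>"
proof -
  note us = sobolev_tilde_sobolev[OF u]
  have "\<exists>\<phi>\<in>test_functions \<Omega>. sobolev_norm 1 s (\<lambda>f. c * u f - tempered_of \<phi> f) < \<epsilon>" if e: "\<epsilon> > 0" for \<epsilon>
  proof -
    have c: "cmod c + 1 > 0" by (simp add: add_nonneg_pos)
    then have e': "\<epsilon> / (cmod c + 1) > 0" using e by simp
    obtain \<phi> where \<phi>: "\<phi> \<in> test_functions \<Omega>"
        "sobolev_norm 1 s (\<lambda>f. u f - tempered_of \<phi> f) < \<epsilon> / (cmod c + 1)"
      by (rule sobolev_tilde_approx[OF u e'])
    have d: "(\<lambda>f. u f - tempered_of \<phi> f) \<in> sobolev s"
      by (intro sobolev_diff us tempered_of_sobolev test_functions_schwartz[OF \<phi>(1)] s)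
    have "(\<lambda>f. c * u f - tempered_of (\<lambda>x. c * \<phi> x) f) = (\<lambda>f. c * (u f - tempered_of \<phi> f))"
      unfolding tempered_of_cmult by (simp add: algebra_simps)
    then have "sobolev_norm 1 s (\<lambda>f. c * u f - tempered_of (\<lambda>x. c * \<phi> x) f) =
        cmod c * sobolev_norm 1 s (\<lambda>f. u f - tempered_of \<phi> f)"
      using sobolev_norm_cmult[OF d] by simp
    also have "\<dots> \<le> (cmod c + 1) * sobolev_norm 1 s (\<lambda>f. u f - tempered_of \<phi> f)"
      by (intro mult_right_mono) (auto simp: sobolev_norm_wnorm)
    also have "\<dots> < \<epsilon>" using \<phi>(2) c by (simp add: pos_less_divide_eq mult.commute)
    finally show ?thesis using test_functions_cmult[OF \<phi>(1)] by blast
  qed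
  with sobolev_cmult[OF us] show ?thesis by (rule sobolev_tildeI)
qed

lemma sobolev_tilde_diff:
  assumes "u \<in> sobolev_tilde s \<Omega>" "v \<in> sobolev_tilde s \<Omega>" "s \<le> 0"
  shows "(\<lambda>f. u f - v f) \<in> sobolev_tilde s \<Omega>"
  unfolding fun_diff_eq by (intro sobolev_tilde_add sobolev_tilde_cmult assms)

lemma fhat_add_AE:
  assumes "u \<in> sobolev s" "v \<in> sobolev t"
  shows "AE \<xi> in lborel. fhat (\<lambda>f. u f + v f) \<xi> = fhat u \<xi> + fhat v \<xi>"
  using assms by (intro fhat_AE_eq represents_add sobolev_represents)

lemma fhat_cmult_AE:
  assumes "u \<in> sobolev s"
  shows "AE \<xi> in lborel. fhat (\<lambda>f. c * u f) \<xi> = c * fhat u \<xi>"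
  using assms by (intro fhat_AE_eq represents_cmult sobolev_represents)

lemma fhat_measurable: "u \<in> sobolev s \<Longrightarrow> fhat u \<in> borel_measurable borel"
  using sobolev_wspace wspace_measurable by blast

text \<open>Transforming the conjugate of \<open>fourier \<phi>\<close> gives back the conjugate of
  \<phi> by inversion, so the integral over frequencies is an evaluation of U. The conjugate remains
  because distributions are linear while the pairing is antilinear in its second argument.\<close>

lemma pairing_test_function:
  fixes \<phi> :: "real^'m::finite \<Rightarrow> complex"
  assumes U: "U \<in> sobolev t" and \<phi>: "\<phi> \<in> schwartz"
  shows "(\<integral>\<xi>. fhat U \<xi> * cnj (fourier \<phi> \<xi>) \<partial>lborel) = U (\<lambda>x. cnj (\<phi> x))"
proof -
  have f: "(\<lambda>\<xi>. cnj (fourier \<phi> \<xi>)) \<in> schwartz" by (intro schwartz_cnj fourier_schwartz \<phi>)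
  have "(\<integral>\<xi>. fhat U \<xi> * cnj (fourier \<phi> \<xi>) \<partial>lborel) = fourier_dist U (\<lambda>\<xi>. cnj (fourier \<phi> \<xi>))"
    using sobolev_represents[OF U] f unfolding represents_def by simp
  also have "\<dots> = U (fourier (\<lambda>\<xi>. cnj (fourier \<phi> \<xi>)))" using f by (simp add: fourier_dist_def)
  also have "fourier (\<lambda>\<xi>. cnj (fourier \<phi> \<xi>)) = (\<lambda>x. cnj (\<phi> x))"
    by (rule ext) (simp add: fourier_cnj fourier_inversion \<phi>)
  finally show ?thesis .
qed

context
  fixes s :: real and \<Omega> :: "(real^'m::finite) set"
  assumes s: "s \<le> 0"
begin

lemma pairing_AE_test:
  assumes U: "U \<in> sobolev (- s)" and \<phi>: "\<phi> \<in> schwartz"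
  shows "(\<integral>\<xi>. fhat U \<xi> * cnj (fhat (tempered_of \<phi>) \<xi>) \<partial>lborel) = U (\<lambda>x. cnj (\<phi> x))"
proof -
  have T: "tempered_of \<phi> \<in> sobolev s" by (rule tempered_of_sobolev[OF \<phi> s])
  note [measurable] = fhat_measurable[OF U] fhat_measurable[OF T] schwartz_measurable[OF fourier_schwartz[OF \<phi>]]
  have "(\<integral>\<xi>. fhat U \<xi> * cnj (fhat (tempered_of \<phi>) \<xi>) \<partial>lborel) = (\<integral>\<xi>. fhat U \<xi> * cnj (fourier \<phi> \<xi>) \<partial>lborel)"
    by (rule integral_cong_AE) (use fhat_AE_eq[OF tempered_of_represents[OF \<phi>]] in \<open>auto elim: eventually_mono\<close>)
  then show ?thesis by (simp add: pairing_test_function[OF U \<phi>])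
qed

lemma pairing_le:
  assumes "U \<in> sobolev (- s)" "v \<in> sobolev s"
  shows "cmod (\<integral>\<xi>. fhat U \<xi> * cnj (fhat v \<xi>) \<partial>lborel) \<le> sobolev_norm 1 (- s) U * sobolev_norm 1 s v"
  using wspace_pairing_le[OF sobolev_wspace[OF assms(1)], of "\<lambda>\<xi>. cnj (fhat v \<xi>)"]
    wspace_cnj[OF sobolev_wspace[OF assms(2)]]
  by (simp add: sobolev_norm_wnorm wnorm_cnj)

lemma pairing_integrable:
  assumes "U \<in> sobolev (- s)" "v \<in> sobolev s"
  shows "integrable lborel (\<lambda>\<xi>. fhat U \<xi> * cnj (fhat v \<xi>))"
  using wspace_integrable_mult[OF sobolev_wspace[OF assms(1)], of "\<lambda>\<xi>. cnj (fhat v \<xi>)"]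
    wspace_cnj[OF sobolev_wspace[OF assms(2)]] by simp

lemma pairing_add_left:
  assumes U: "U \<in> sobolev (- s)" "V \<in> sobolev (- s)" and v: "v \<in> sobolev s"
  shows "(\<integral>\<xi>. fhat (\<lambda>f. U f + V f) \<xi> * cnj (fhat v \<xi>) \<partial>lborel) =
    (\<integral>\<xi>. fhat U \<xi> * cnj (fhat v \<xi>) \<partial>lborel) + (\<integral>\<xi>. fhat V \<xi> * cnj (fhat v \<xi>) \<partial>lborel)"
proof -
  note [measurable] = fhat_measurable[OF U(1)] fhat_measurable[OF U(2)] fhat_measurable[OF v]
    fhat_measurable[OF sobolev_add[OF U]]
  have "(\<integral>\<xi>. fhat (\<lambda>f. U f + V f) \<xi> * cnj (fhat v \<xi>) \<partial>lborel) =
    (\<integral>\<xi>. fhat U \<xi> * cnj (fhat v \<xi>) + fhat V \<xi> * cnj (fhat v \<xi>) \<partial>lborel)"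
    by (rule integral_cong_AE)
       (use fhat_add_AE[OF U] in \<open>auto elim!: eventually_mono simp: distrib_right\<close>)
  also have "\<dots> = (\<integral>\<xi>. fhat U \<xi> * cnj (fhat v \<xi>) \<partial>lborel) + (\<integral>\<xi>. fhat V \<xi> * cnj (fhat v \<xi>) \<partial>lborel)"
    by (intro Bochner_Integration.integral_add pairing_integrable U v)
  finally show ?thesis .
qed

lemma pairing_add_right:
  assumes U: "U \<in> sobolev (- s)" and v: "v \<in> sobolev s" "w \<in> sobolev s"
  shows "(\<integral>\<xi>. fhat U \<xi> * cnj (fhat (\<lambda>f. v f + w f) \<xi>) \<partial>lborel) =
    (\<integral>\<xi>. fhat U \<xi> * cnj (fhat v \<xi>) \<partial>lborel) + (\<integral>\<xi>. fhat U \<xi> * cnj (fhat w \<xi>) \<partial>lborel)"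
proof -
  note [measurable] = fhat_measurable[OF U] fhat_measurable[OF v(1)] fhat_measurable[OF v(2)]
    fhat_measurable[OF sobolev_add[OF v]]
  have "(\<integral>\<xi>. fhat U \<xi> * cnj (fhat (\<lambda>f. v f + w f) \<xi>) \<partial>lborel) =
    (\<integral>\<xi>. fhat U \<xi> * cnj (fhat v \<xi>) + fhat U \<xi> * cnj (fhat w \<xi>) \<partial>lborel)"
    by (rule integral_cong_AE)
       (use fhat_add_AE[OF v] in \<open>auto elim!: eventually_mono simp: distrib_left\<close>)
  also have "\<dots> = (\<integral>\<xi>. fhat U \<xi> * cnj (fhat v \<xi>) \<partial>lborel) + (\<integral>\<xi>. fhat U \<xi> * cnj (fhat w \<xi>) \<partial>lborel)"
    by (intro Bochner_Integration.integral_add pairing_integrable U v)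
  finally show ?thesis .
qed

text \<open>On a test function the pairing is an evaluation and sees only the restriction to
  \<Omega>; on the small remainder of an approximation \<open>pairing_le\<close> controls it. This
  is what makes the choice inside \<open>dual_pairing\<close> harmless.\<close>

lemma pairing_extension_independent:
  assumes U: "U \<in> sobolev (- s)" "V \<in> sobolev (- s)" and eq: "restrict_dist \<Omega> U = restrict_dist \<Omega> V"
    and v: "v \<in> sobolev_tilde s \<Omega>"
  shows "(\<integral>\<xi>. fhat U \<xi> * cnj (fhat v \<xi>) \<partial>lborel) = (\<integral>\<xi>. fhat V \<xi> * cnj (fhat v \<xi>) \<partial>lborel)"
proof -
  let ?P = "\<lambda>U v. \<integral>\<xi>. fhat U \<xi> * cnj (fhat v \<xi>) \<partial>lborel"
  note vs = sobolev_tilde_sobolev[OF v]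
  define K where "K = sobolev_norm 1 (- s) U + sobolev_norm 1 (- s) V"
  have K: "K \<ge> 0" by (simp add: K_def sobolev_norm_wnorm)
  have "cmod (?P U v - ?P V v) \<le> \<epsilon>" if e: "\<epsilon> > 0" for \<epsilon>
  proof -
    have e': "\<epsilon> / (K + 1) > 0" using e K by simp
    obtain \<phi> where \<phi>: "\<phi> \<in> test_functions \<Omega>" "sobolev_norm 1 s (\<lambda>f. v f - tempered_of \<phi> f) < \<epsilon> / (K + 1)"
      by (rule sobolev_tilde_approx[OF v e'])
    let ?d = "\<lambda>f. v f - tempered_of \<phi> f"
    note sch = test_functions_schwartz[OF \<phi>(1)]
    have T: "tempered_of \<phi> \<in> sobolev s" by (rule tempered_of_sobolev[OF sch s])
    have d: "?d \<in> sobolev s" by (rule sobolev_diff[OF vs T])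
    have ve: "v = (\<lambda>f. ?d f + tempered_of \<phi> f)" by simp
    have split: "?P W v = ?P W ?d + W (\<lambda>x. cnj (\<phi> x))" if "W \<in> sobolev (- s)" for W
      by (subst ve) (simp only: pairing_add_right[OF that d T] pairing_AE_test[OF that sch])
    have "U (\<lambda>x. cnj (\<phi> x)) = V (\<lambda>x. cnj (\<phi> x))"
      using fun_cong[OF eq, of "\<lambda>x. cnj (\<phi> x)"] test_functions_cnj[OF \<phi>(1)]
      by (simp add: restrict_dist_def)
    then have "?P U v - ?P V v = ?P U ?d - ?P V ?d"
      unfolding split[OF U(1)] split[OF U(2)] by simp
    then have "cmod (?P U v - ?P V v) \<le> cmod (?P U ?d) + cmod (?P V ?d)"
      by (simp only: norm_triangle_ineq4)
    also have "\<dots> \<le> sobolev_norm 1 (- s) U * sobolev_norm 1 s ?d + sobolev_norm 1 (- s) V * sobolev_norm 1 s ?d"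
      by (intro add_mono pairing_le U d)
    also have "\<dots> = K * sobolev_norm 1 s ?d" by (simp add: K_def distrib_right)
    also have "\<dots> \<le> (K + 1) * sobolev_norm 1 s ?d"
      by (intro mult_right_mono) (auto simp: sobolev_norm_wnorm)
    also have "\<dots> \<le> \<epsilon>" using \<phi>(2) K by (simp add: pos_less_divide_eq mult.commute)
    finally show ?thesis .
  qed
  then have "cmod (?P U v - ?P V v) \<le> 0" by (rule field_le_epsilon[of _ 0, simplified]) simp
  then show ?thesis by simp
qed

lemma dual_pairing_eq:
  assumes U: "U \<in> sobolev (- s)" and v: "v \<in> sobolev_tilde s \<Omega>"
  shows "dual_pairing s \<Omega> (restrict_dist \<Omega> U) v = (\<integral>\<xi>. fhat U \<xi> * cnj (fhat v \<xi>) \<partial>lborel)"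
proof -
  define V where "V = (SOME V. V \<in> sobolev (- s) \<and> restrict_dist \<Omega> V = restrict_dist \<Omega> U)"
  have V: "V \<in> sobolev (- s)" "restrict_dist \<Omega> V = restrict_dist \<Omega> U"
    using someI[of "\<lambda>V. V \<in> sobolev (- s) \<and> restrict_dist \<Omega> V = restrict_dist \<Omega> U" U] U
    unfolding V_def[symmetric] by auto
  show ?thesis
    unfolding dual_pairing_def V_def[symmetric] Let_def
    by (rule pairing_extension_independent[OF V(1) U V(2) v])
qed

lemma dual_pairing_test:
  assumes w: "w \<in> sobolev_on (- s) \<Omega>" and \<phi>: "\<phi> \<in> test_functions \<Omega>"
  shows "dual_pairing s \<Omega> w (tempered_of \<phi>) = w (\<lambda>x. cnj (\<phi> x))"
proof -
  obtain U where U: "U \<in> sobolev (- s)" "w = restrict_dist \<Omega> U" using w unfolding sobolev_on_def by blast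
  show ?thesis
    unfolding U(2) dual_pairing_eq[OF U(1) test_function_sobolev_tilde[OF \<phi> s]]
      pairing_AE_test[OF U(1) test_functions_schwartz[OF \<phi>]]
    using test_functions_cnj[OF \<phi>] by (simp add: restrict_dist_def)
qed

lemma dual_pairing_add_left:
  assumes w: "w \<in> sobolev_on (- s) \<Omega>" "z \<in> sobolev_on (- s) \<Omega>" and v: "v \<in> sobolev_tilde s \<Omega>"
  shows "dual_pairing s \<Omega> (\<lambda>f. w f + z f) v = dual_pairing s \<Omega> w v + dual_pairing s \<Omega> z v"
proof -
  obtain U where U: "U \<in> sobolev (- s)" "w = restrict_dist \<Omega> U" using w unfolding sobolev_on_def by blast
  obtain V where V: "V \<in> sobolev (- s)" "z = restrict_dist \<Omega> V" using w unfolding sobolev_on_def by blast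
  have "(\<lambda>f. w f + z f) = restrict_dist \<Omega> (\<lambda>f. U f + V f)"
    unfolding U V by (auto simp: restrict_dist_def)
  then show ?thesis
    by (simp only: U(2) V(2) dual_pairing_eq[OF U(1) v] dual_pairing_eq[OF V(1) v]
        dual_pairing_eq[OF sobolev_add[OF U(1) V(1)] v] pairing_add_left[OF U(1) V(1) sobolev_tilde_sobolev[OF v]])
qed

lemma dual_pairing_add_right:
  assumes w: "w \<in> sobolev_on (- s) \<Omega>" and v: "v \<in> sobolev_tilde s \<Omega>" "z \<in> sobolev_tilde s \<Omega>"
  shows "dual_pairing s \<Omega> w (\<lambda>f. v f + z f) = dual_pairing s \<Omega> w v + dual_pairing s \<Omega> w z"
proof -
  obtain U where U: "U \<in> sobolev (- s)" "w = restrict_dist \<Omega> U" using w unfolding sobolev_on_def by blast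
  show ?thesis
    by (simp only: U(2) dual_pairing_eq[OF U(1) v(1)] dual_pairing_eq[OF U(1) v(2)]
        dual_pairing_eq[OF U(1) sobolev_tilde_add[OF v s]]
        pairing_add_right[OF U(1) sobolev_tilde_sobolev[OF v(1)] sobolev_tilde_sobolev[OF v(2)]])
qed

text \<open>The pairing may be computed with any extension, so its bound holds for all of them and
  passes to the infimum, which is the norm on \<Omega>. The infimum is reached after dividing by the
  norm of v; if that norm is 0, a single extension already shows that the pairing vanishes.\<close>

lemma dual_pairing_le:
  assumes w: "w \<in> sobolev_on (- s) \<Omega>" and v: "v \<in> sobolev_tilde s \<Omega>"
  shows "cmod (dual_pairing s \<Omega> w v) \<le> sobolev_on_norm 1 (- s) \<Omega> w * sobolev_norm 1 s v"
proof -
  let ?E = "{U \<in> sobolev (- s). restrict_dist \<Omega> U = w}"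
  let ?n = "sobolev_norm 1 s v"
  have ne: "?E \<noteq> {}" using w unfolding sobolev_on_def by blast
  have n: "?n \<ge> 0" by (simp add: sobolev_norm_wnorm)
  have le: "cmod (dual_pairing s \<Omega> w v) \<le> sobolev_norm 1 (- s) U * ?n" if "U \<in> ?E" for U
    using that dual_pairing_eq[of U v] v pairing_le[of U v] sobolev_tilde_sobolev[OF v] by auto
  show ?thesis
  proof (cases "?n = 0")
    case True
    then show ?thesis using ne le by auto
  next
    case False
    then have pos: "?n > 0" using n by simp
    have "cmod (dual_pairing s \<Omega> w v) / ?n \<le> sobolev_on_norm 1 (- s) \<Omega> w"
      unfolding sobolev_on_norm_def
      by (rule cINF_greatest[OF ne]) (use le pos in \<open>simp add: pos_divide_le_eq\<close>)
    then show ?thesis using pos by (simp add: pos_divide_le_eq)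
  qed
qed

end

lemma sobolev_on_norm_le:
  assumes "U \<in> sobolev s"
  shows "sobolev_on_norm k s \<Omega> (restrict_dist \<Omega> U) \<le> sobolev_norm k s U"
  unfolding sobolev_on_norm_def
  by (rule cINF_lower) (use assms in \<open>auto intro!: bdd_belowI2[where m=0] simp: sobolev_norm_wnorm\<close>)

text \<open>With t the approximating test function and d = u - t, the difference of the two values
  of the form is D (A u) d + D (A d) t, and each term contains d once. The operator \<open>A\<close>
  is arbitrary among the extensions, so that the result applies to the chosen one.\<close>

lemma form_approx:
  fixes \<Gamma> :: "((real^'m::finite) \<times> real) set"
  assumes A: "extends_single_layer k \<Gamma> A" and u: "u \<in> sobolev_tilde (- 1/2) (flat \<Gamma>)" and e: "\<epsilon> > 0"
  obtains \<phi> where "\<phi> \<in> test_functions (flat \<Gamma>)"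
    "sobolev_norm 1 (- 1/2) (\<lambda>f. u f - tempered_of \<phi> f) < \<epsilon>"
    "cmod (dual_pairing (- 1/2) (flat \<Gamma>) (A u) u
       - dual_pairing (- 1/2) (flat \<Gamma>) (A (tempered_of \<phi>)) (tempered_of \<phi>)) < \<epsilon>"
proof -
  let ?H = "sobolev_tilde (- 1/2) (flat \<Gamma>)" and ?N = "sobolev_norm 1 (- 1/2)"
  let ?D = "dual_pairing (- 1/2) (flat \<Gamma>)"
  have s: "- 1/2 \<le> (0::real)" by simp
  have on: "A v \<in> sobolev_on (- (- 1/2)) (flat \<Gamma>)" if "v \<in> ?H" for v
    using A that unfolding extends_single_layer_def by simp
  have add: "A (\<lambda>f. v f + w f) = (\<lambda>f. A v f + A w f)" if "v \<in> ?H" "w \<in> ?H" for v w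
    using A that unfolding extends_single_layer_def by blast
  obtain C where C: "\<And>v. v \<in> ?H \<Longrightarrow> sobolev_on_norm 1 (1/2) (flat \<Gamma>) (A v) \<le> C * ?N v"
    using A unfolding extends_single_layer_def by blast
  have bd: "sobolev_on_norm 1 (- (- 1/2)) (flat \<Gamma>) (A v) \<le> \<bar>C\<bar> * ?N v" if "v \<in> ?H" for v
  proof -
    have "C * ?N v \<le> \<bar>C\<bar> * ?N v" by (intro mult_right_mono) (auto simp: sobolev_norm_wnorm)
    then show ?thesis using C[OF that] by simp
  qed
  have N0: "?N v \<ge> 0" for v by (simp add: sobolev_norm_wnorm)
  have dle: "cmod (?D (A v) w) \<le> \<bar>C\<bar> * ?N v * ?N w" if "v \<in> ?H" "w \<in> ?H" for v w
    using dual_pairing_le[OF s on[OF that(1)] that(2)] mult_right_mono[OF bd[OF that(1)] N0[of w]] by linarith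
  \<comment> \<open>Since \<delta> \<le> 1, the norms of u and of its approximation add up to at
    most 2 N(u) + 1; the last summand keeps \<open>K\<close> positive.\<close>
  define K where "K = \<bar>C\<bar> * (2 * ?N u + 1) + 1"
  have K: "K > 0" unfolding K_def using N0[of u] by (simp add: add_nonneg_pos)
  define \<delta> where "\<delta> = min (min \<epsilon> 1) (\<epsilon> / K)"
  have \<delta>: "\<delta> > 0" using e K by (simp add: \<delta>_def)
  obtain \<phi> where \<phi>: "\<phi> \<in> test_functions (flat \<Gamma>)" "?N (\<lambda>f. u f - tempered_of \<phi> f) < \<delta>"
    by (rule sobolev_tilde_approx[OF u \<delta>])
  let ?t = "tempered_of \<phi>" and ?d = "\<lambda>f. u f - tempered_of \<phi> f"
  have t: "?t \<in> ?H" by (rule test_function_sobolev_tilde[OF \<phi>(1) s])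
  have d: "?d \<in> ?H" by (rule sobolev_tilde_diff[OF u t s])
  have ue: "u = (\<lambda>f. ?d f + ?t f)" by simp
  have m: "(\<lambda>f. (-1) * ?d f) \<in> ?H" by (rule sobolev_tilde_cmult[OF d s])
  have Nt: "?N ?t \<le> ?N u + ?N ?d"
  proof -
    have te: "?t = (\<lambda>f. u f + (-1) * ?d f)" by (simp add: fun_eq_iff)
    have "?N ?t \<le> ?N u + ?N (\<lambda>f. (-1) * ?d f)"
      by (subst te, rule sobolev_norm_add) (use u m sobolev_tilde_sobolev in auto)
    then show ?thesis using sobolev_norm_cmult[OF sobolev_tilde_sobolev[OF d], of 1 "-1"] by simp
  qed
  have "?D (A u) u = ?D (A u) ?d + ?D (A u) ?t"
    by (subst (2) ue) (rule dual_pairing_add_right[OF s on[OF u] d t])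
  also have "?D (A u) ?t = ?D (A ?d) ?t + ?D (A ?t) ?t"
    by (subst ue) (simp only: add[OF d t] dual_pairing_add_left[OF s on[OF d] on[OF t] t])
  finally have "?D (A u) u - ?D (A ?t) ?t = ?D (A u) ?d + ?D (A ?d) ?t" by simp
  then have "cmod (?D (A u) u - ?D (A ?t) ?t) \<le> cmod (?D (A u) ?d) + cmod (?D (A ?d) ?t)"
    by (simp only: norm_triangle_ineq)
  also have "\<dots> \<le> \<bar>C\<bar> * ?N u * ?N ?d + \<bar>C\<bar> * ?N ?d * ?N ?t"
    by (intro add_mono dle u d t)
  also have "\<dots> = \<bar>C\<bar> * (?N u + ?N ?t) * ?N ?d" by (simp add: algebra_simps)
  also have "\<dots> \<le> \<bar>C\<bar> * (2 * ?N u + 1) * ?N ?d"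
    using Nt \<phi>(2) N0[of ?d] by (intro mult_right_mono mult_left_mono) (auto simp: \<delta>_def)
  also have "\<dots> \<le> K * ?N ?d" using N0[of ?d] by (intro mult_right_mono) (auto simp: K_def)
  also have "\<dots> < K * \<delta>" using \<phi>(2) K by simp
  also have "\<dots> \<le> K * (\<epsilon> / K)" using K by (intro mult_left_mono) (auto simp: \<delta>_def)
  also have "\<dots> = \<epsilon>" using K by simp
  finally have "cmod (?D (A u) u - ?D (A ?t) ?t) < \<epsilon>" .
  with \<phi> show thesis by (intro that) (auto simp: \<delta>_def)
qed


subsection \<open>Convolution operators as Fourier multipliers\<close>

text \<open>The transform without its normalising factor: in this form the transform of a
  convolution is the product, with no power of 2 pi left over.\<close>

definition multiplier :: "(real^'m::finite \<Rightarrow> complex) \<Rightarrow> real^'m \<Rightarrow> complex" where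
  "multiplier K \<xi> = (\<integral>z. exp (- \<i> * complex_of_real (\<xi> \<bullet> z)) * K z \<partial>lborel)"

lemma multiplier_measurable [measurable]:
  assumes [measurable]: "K \<in> borel_measurable borel"
  shows "multiplier K \<in> borel_measurable borel"
  unfolding multiplier_def by measurable

lemma multiplier_add:
  assumes "integrable lborel K" "integrable lborel L"
  shows "multiplier (\<lambda>z. K z + L z) \<xi> = multiplier K \<xi> + multiplier L \<xi>"
  unfolding multiplier_def distrib_left
  by (intro Bochner_Integration.integral_add fourier_kernel_integrable assms)

lemma multiplier_norm_le: "cmod (multiplier K \<xi>) \<le> (\<integral>z. cmod (K z) \<partial>lborel)"
  unfolding multiplier_def
  using integral_norm_bound[of lborel "\<lambda>z. exp (- \<i> * complex_of_real (\<xi> \<bullet> z)) * K z"] by (simp add: norm_mult)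

lemma
  fixes K \<phi> :: "real^'m::finite \<Rightarrow> complex"
  assumes K: "integrable lborel K" and \<phi>: "integrable lborel \<phi>"
  shows convolution_integrable_pair: "integrable (lborel \<Otimes>\<^sub>M lborel) (\<lambda>(x, y). K (x - y) * \<phi> y)"
    and convolution_integrable: "integrable lborel (\<lambda>x. \<integral>y. K (x - y) * \<phi> y \<partial>lborel)"
    and fourier_convolution: "fourier (\<lambda>x. \<integral>y. K (x - y) * \<phi> y \<partial>lborel) \<xi> = multiplier K \<xi> * fourier \<phi> \<xi>"
proof -
  have [measurable]: "K \<in> borel_measurable borel" "\<phi> \<in> borel_measurable borel" using K \<phi> by simp_all
  have sh: "integrable lborel (\<lambda>x. K (x - y))" for y
    using lborel_integrable_affine[of 1 K "- y", OF _ K] by simp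
  have shv: "(\<integral>x. cmod (K (x - y)) \<partial>lborel) = (\<integral>x. cmod (K x) \<partial>lborel)" for y
    using lborel_integral_affine[of 1 "\<lambda>x. cmod (K x)" "- y"] by simp
  \<comment> \<open>Fubini with y outermost: by translation invariance the inner integral of |K(x -
    y)| over x does not depend on y. The coordinates are swapped back afterwards.\<close>
  have "integrable (lborel \<Otimes>\<^sub>M lborel) (\<lambda>(y, x). K (x - y) * \<phi> y)"
  proof (rule lborel_pair.Fubini_integrable)
    show "(\<lambda>(y, x). K (x - y) * \<phi> y) \<in> borel_measurable (lborel \<Otimes>\<^sub>M lborel)" by measurable
    have "integrable lborel (\<lambda>y. (\<integral>x. cmod (K x) \<partial>lborel) * cmod (\<phi> y))"
      by (intro integrable_mult_right integrable_norm \<phi>)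
    then show "integrable lborel (\<lambda>y. \<integral>x. norm (case (y, x) of (y, x) \<Rightarrow> K (x - y) * \<phi> y) \<partial>lborel)"
      by (simp add: norm_mult shv)
    show "AE y in lborel. integrable lborel (\<lambda>x. case (y, x) of (y, x) \<Rightarrow> K (x - y) * \<phi> y)"
      using sh by (intro AE_I2) simp
  qed
  from lborel_pair.integrable_product_swap[OF this]
  show int: "integrable (lborel \<Otimes>\<^sub>M lborel) (\<lambda>(x, y). K (x - y) * \<phi> y)"
    by (simp add: case_prod_beta)
  show "integrable lborel (\<lambda>x. \<integral>y. K (x - y) * \<phi> y \<partial>lborel)"
    using lborel_pair.integrable_fst[OF int] by simp
  let ?e = "\<lambda>x. exp (- \<i> * complex_of_real (\<xi> \<bullet> x))"
  have int': "integrable (lborel \<Otimes>\<^sub>M lborel) (\<lambda>(x, y). ?e x * (K (x - y) * \<phi> y))"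
    by (rule Bochner_Integration.integrable_bound[OF int]) (auto simp: norm_mult)
  have "(\<integral>x. ?e x * (\<integral>y. K (x - y) * \<phi> y \<partial>lborel) \<partial>lborel) = (\<integral>x. \<integral>y. ?e x * (K (x - y) * \<phi> y) \<partial>lborel \<partial>lborel)"
    by simp
  also have "\<dots> = (\<integral>y. \<integral>x. ?e x * (K (x - y) * \<phi> y) \<partial>lborel \<partial>lborel)"
    by (rule lborel_pair.Fubini_integral[OF int', symmetric])
  also have "\<dots> = (\<integral>y. multiplier K \<xi> * (?e y * \<phi> y) \<partial>lborel)"
  proof (rule Bochner_Integration.integral_cong[OF refl])
    fix y
    have "?e x * (K (x - y) * \<phi> y) = (?e y * \<phi> y) * (?e (- y + 1 *\<^sub>R x) * K (- y + 1 *\<^sub>R x))" for x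
    proof -
      have "- \<i> * complex_of_real (\<xi> \<bullet> x) = - \<i> * complex_of_real (\<xi> \<bullet> y) + - \<i> * complex_of_real (\<xi> \<bullet> (- y + 1 *\<^sub>R x))"
        by (simp add: inner_diff_right algebra_simps)
      then have "?e x = ?e y * ?e (- y + 1 *\<^sub>R x)" by (simp only: exp_add[symmetric])
      then show ?thesis by (simp add: mult_ac)
    qed
    then have "(\<integral>x. ?e x * (K (x - y) * \<phi> y) \<partial>lborel) = (?e y * \<phi> y) * (\<integral>x. ?e (- y + 1 *\<^sub>R x) * K (- y + 1 *\<^sub>R x) \<partial>lborel)"
      by (simp only: integral_mult_right_zero)
    also have "(\<integral>x. ?e (- y + 1 *\<^sub>R x) * K (- y + 1 *\<^sub>R x) \<partial>lborel) = multiplier K \<xi>"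
      unfolding multiplier_def
      by (subst lborel_integral_affine[of 1 "\<lambda>x. ?e x * K x" "- y"]) simp_all
    finally show "(\<integral>x. ?e x * (K (x - y) * \<phi> y) \<partial>lborel) = multiplier K \<xi> * (?e y * \<phi> y)" by (simp only: mult.commute)
  qed
  finally show "fourier (\<lambda>x. \<integral>y. K (x - y) * \<phi> y \<partial>lborel) \<xi> = multiplier K \<xi> * fourier \<phi> \<xi>"
    by (simp add: fourier_def)
qed

text \<open>Multiplication formula with \<psi> written as a transform. The form is kept bilinear
  because \<psi> has two uses: the argument of a distribution when the operator is constructed, and
  the conjugate of \<phi> when its quadratic form is estimated.\<close>

lemma convolution_form:
  fixes K \<phi> \<psi> :: "real^'m::finite \<Rightarrow> complex"
  assumes K: "integrable lborel K" and \<phi>: "integrable lborel \<phi>" and \<psi>: "\<psi> \<in> schwartz"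
  shows "(\<integral>x. (\<integral>y. K (x - y) * \<phi> y \<partial>lborel) * \<psi> x \<partial>lborel) =
    (\<integral>\<xi>. multiplier K \<xi> * fourier \<phi> \<xi> * fourier \<psi> (- \<xi>) \<partial>lborel)"
proof -
  have "(\<integral>x. (\<integral>y. K (x - y) * \<phi> y \<partial>lborel) * \<psi> x \<partial>lborel) =
    (\<integral>x. (\<integral>y. K (x - y) * \<phi> y \<partial>lborel) * fourier (\<lambda>\<xi>. fourier \<psi> (- \<xi>)) x \<partial>lborel)"
    by (simp add: fourier_inverse_fourier[OF \<psi>])
  also have "\<dots> = (\<integral>\<xi>. fourier (\<lambda>x. \<integral>y. K (x - y) * \<phi> y \<partial>lborel) \<xi> * fourier \<psi> (- \<xi>) \<partial>lborel)"
    by (rule fourier_multiplication[symmetric, OF convolution_integrable[OF K \<phi>]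
          schwartz_integrable[OF inverse_fourier_schwartz[OF \<psi>]]])
  finally show ?thesis by (simp add: fourier_convolution[OF K \<phi>])
qed

text \<open>Translating by \<open>h = \<pi> \<xi> / \<bar>\<xi>\<bar>\<^sup>2\<close> changes the sign of the exponential, so the multiplier is half
  the integral of \<open>K - K(\<cdot> + h)\<close> against it.\<close>

lemma lipschitz_multiplier_decay:
  fixes K :: "real^'m::finite \<Rightarrow> complex"
  assumes lip: "\<And>x y. cmod (K x - K y) \<le> L * norm (x - y)" and supp: "\<And>x. norm x > R \<Longrightarrow> K x = 0"
  shows "integrable lborel K" and "\<exists>C\<ge>0. \<forall>\<xi>. cmod (multiplier K \<xi>) \<le> C * weight 1 (- 1/2) \<xi>"
proof -
  have L: "L \<ge> 0"
    using order_trans[OF norm_ge_zero lip[of "axis undefined 1" 0]] by simp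
  have cont: "continuous_on UNIV K"
  proof -
    have "L-lipschitz_on UNIV K" using lip L by (auto simp: lipschitz_on_def dist_norm)
    then show ?thesis by (rule lipschitz_on_continuous_on)
  qed
  have [measurable]: "K \<in> borel_measurable borel" by (rule borel_measurable_continuous_onI[OF cont])
  have "integrable lborel (\<lambda>x. indicator (cball 0 (max R 0)) x *\<^sub>R K x)"
    using borel_integrable_compact[of "cball 0 (max R 0)" K] cont
    by (auto simp: set_integrable_def intro: continuous_on_subset)
  moreover have "indicator (cball 0 (max R 0)) x *\<^sub>R K x = K x" for x
    using supp[of x] by (auto split: split_indicator)
  ultimately show int: "integrable lborel K" by simp
  \<comment> \<open>K and its translate by h both vanish outside the ball of radius |R| + pi,
    because norm h = pi / norm \<xi> is at most pi as soon as norm \<xi> \<ge> 1.\<close>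
  define V where "V = measure lborel (cball (0::real^'m) (\<bar>R\<bar> + pi))"
  have V: "V \<ge> 0" by (simp add: V_def)
  let ?B = "\<integral>z. cmod (K z) \<partial>lborel"
  have B: "?B \<ge> 0" by simp
  have far: "cmod (multiplier K \<xi>) * norm \<xi> \<le> L * pi * V" if \<xi>: "norm \<xi> \<ge> 1" for \<xi>
  proof -
    let ?e = "\<lambda>z. exp (- \<i> * complex_of_real (\<xi> \<bullet> z))"
    define h where "h = (pi / (norm \<xi>)\<^sup>2) *\<^sub>R \<xi>"
    have \<xi>0: "norm \<xi> > 0" using \<xi> by linarith
    have nh: "norm h = pi / norm \<xi>" using \<xi>0 by (simp add: h_def power2_eq_square)
    have "pi / norm \<xi> \<le> pi / 1" using \<xi> \<xi>0 by (intro divide_left_mono) auto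
    then have nh_le: "norm h \<le> pi" unfolding nh by simp
    have \<xi>h: "\<xi> \<bullet> h = pi" using \<xi>0 by (simp add: h_def power2_norm_eq_inner)
    have ish: "integrable lborel (\<lambda>z. K (h + 1 *\<^sub>R z))" by (rule lborel_integrable_affine[OF _ int]) simp
    have "(\<integral>z. ?e z * K (h + 1 *\<^sub>R z) \<partial>lborel) = (\<integral>z. - (?e (h + 1 *\<^sub>R z) * K (h + 1 *\<^sub>R z)) \<partial>lborel)"
    proof (rule Bochner_Integration.integral_cong[OF refl])
      fix z
      have "- \<i> * complex_of_real (\<xi> \<bullet> (h + 1 *\<^sub>R z)) = - (\<i> * pi) + - \<i> * complex_of_real (\<xi> \<bullet> z)"
        by (simp add: inner_add_right \<xi>h algebra_simps)
      then have "?e (h + 1 *\<^sub>R z) = exp (- (\<i> * pi)) * ?e z" by (simp only: exp_add)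
      also have "exp (- (\<i> * pi)) = - 1" by (simp add: exp_minus)
      finally show "?e z * K (h + 1 *\<^sub>R z) = - (?e (h + 1 *\<^sub>R z) * K (h + 1 *\<^sub>R z))" by simp
    qed
    also have "\<dots> = - (\<integral>z. ?e (h + 1 *\<^sub>R z) * K (h + 1 *\<^sub>R z) \<partial>lborel)" by (rule Bochner_Integration.integral_minus)
    also have "(\<integral>z. ?e (h + 1 *\<^sub>R z) * K (h + 1 *\<^sub>R z) \<partial>lborel) = multiplier K \<xi>"
      unfolding multiplier_def by (subst lborel_integral_affine[of 1 "\<lambda>z. ?e z * K z" h]) simp_all
    finally have "(\<integral>z. ?e z * K z \<partial>lborel) - (\<integral>z. ?e z * K (h + 1 *\<^sub>R z) \<partial>lborel) = 2 * multiplier K \<xi>"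
      by (simp add: multiplier_def)
    moreover have "(\<integral>z. ?e z * K z \<partial>lborel) - (\<integral>z. ?e z * K (h + 1 *\<^sub>R z) \<partial>lborel) =
      (\<integral>z. ?e z * (K z - K (h + 1 *\<^sub>R z)) \<partial>lborel)"
      unfolding right_diff_distrib
      by (rule Bochner_Integration.integral_diff[symmetric]) (intro fourier_kernel_integrable int ish)+
    ultimately have "cmod (2 * multiplier K \<xi>) = cmod (\<integral>z. ?e z * (K z - K (h + 1 *\<^sub>R z)) \<partial>lborel)" by simp
    also have "\<dots> \<le> (\<integral>z. L * norm h * indicator (cball (0::real^'m) (\<bar>R\<bar> + pi)) z \<partial>lborel)"
    proof (rule Bochner_Integration.integral_norm_bound_integral)
      show "integrable lborel (\<lambda>z. ?e z * (K z - K (h + 1 *\<^sub>R z)))"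
        by (intro fourier_kernel_integrable Bochner_Integration.integrable_diff int ish)
      show "integrable lborel (\<lambda>z. L * norm h * indicator (cball (0::real^'m) (\<bar>R\<bar> + pi)) z)"
        using emeasure_lborel_cball_finite[of "0::real^'m" "\<bar>R\<bar> + pi"]
        by (intro integrable_mult_right integrable_real_indicator) auto
      fix z :: "real^'m"
      show "cmod (?e z * (K z - K (h + 1 *\<^sub>R z))) \<le> L * norm h * indicator (cball 0 (\<bar>R\<bar> + pi)) z"
      proof (cases "norm z \<le> \<bar>R\<bar> + pi")
        case True
        then show ?thesis using lip[of z "h + 1 *\<^sub>R z"] by (simp add: norm_mult)
      next
        case False
        then have "norm z > \<bar>R\<bar> + pi" by simp
        moreover have "norm z \<le> norm (h + z) + norm h" using norm_triangle_ineq4[of "h + z" h] by simp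
        ultimately have "norm z > R" "norm (h + z) > R" using nh_le pi_gt_zero by linarith+
        then show ?thesis using False supp by simp
      qed
    qed
    also have "\<dots> = L * norm h * V" by (simp add: V_def)
    finally have "2 * cmod (multiplier K \<xi>) \<le> L * (pi / norm \<xi>) * V" by (simp add: norm_mult nh)
    then have "2 * cmod (multiplier K \<xi>) * norm \<xi> \<le> L * (pi / norm \<xi>) * V * norm \<xi>"
      using \<xi>0 by (intro mult_right_mono) auto
    also have "\<dots> = L * pi * V" using \<xi>0 by simp
    finally have "2 * (cmod (multiplier K \<xi>) * norm \<xi>) \<le> L * pi * V" by (simp add: mult.assoc)
    moreover have "0 \<le> cmod (multiplier K \<xi>) * norm \<xi>" by simp
    ultimately show ?thesis by linarith
  qed
  have w: "weight 1 (- 1/2) \<xi> = 1 / sqrt (1 + (norm \<xi>)\<^sup>2)" for \<xi> :: "real^'m"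
    unfolding weight_def using powr_half_sqrt[of "1 + (norm \<xi>)\<^sup>2"]
    by (simp add: powr_minus_divide add_nonneg_nonneg)
  \<comment> \<open>The square root of 1 + (norm \<xi>)^2 is at most 2 norm \<xi> when norm \<xi>
    \<ge> 1, and at most 2 otherwise; the decay estimate serves the first case and the L1 bound
    \<open>?B\<close> the second.\<close>
  define C where "C = 2 * (?B + L * pi * V)"
  have C0: "?B + L * pi * V \<ge> 0" using L V B by simp
  have "cmod (multiplier K \<xi>) \<le> C * weight 1 (- 1/2) \<xi>" for \<xi>
  proof -
    have pos: "sqrt (1 + (norm \<xi>)\<^sup>2) > 0" by (simp add: add_pos_nonneg)
    have "cmod (multiplier K \<xi>) * sqrt (1 + (norm \<xi>)\<^sup>2) \<le> C"
    proof (cases "norm \<xi> \<ge> 1")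
      case True
      have "sqrt (1 + (norm \<xi>)\<^sup>2) \<le> 2 * norm \<xi>"
      proof (rule real_le_lsqrt)
        have "1 \<le> (norm \<xi>)\<^sup>2" using True by (simp add: one_le_power)
        then show "1 + (norm \<xi>)\<^sup>2 \<le> (2 * norm \<xi>)\<^sup>2" by (simp add: power_mult_distrib)
      qed simp
      then have "cmod (multiplier K \<xi>) * sqrt (1 + (norm \<xi>)\<^sup>2) \<le> cmod (multiplier K \<xi>) * (2 * norm \<xi>)"
        by (intro mult_left_mono) auto
      also have "\<dots> = 2 * (cmod (multiplier K \<xi>) * norm \<xi>)" by simp
      also have "\<dots> \<le> C"
        unfolding C_def using far[OF True] B by (intro mult_left_mono) linarith+
      finally show ?thesis .
    next
      case False
      have "sqrt (1 + (norm \<xi>)\<^sup>2) \<le> 2"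
      proof (rule real_le_lsqrt)
        have "(norm \<xi>)\<^sup>2 \<le> 1" using False by (simp add: power_le_one)
        then show "1 + (norm \<xi>)\<^sup>2 \<le> 2\<^sup>2" by simp
      qed simp
      then have "cmod (multiplier K \<xi>) * sqrt (1 + (norm \<xi>)\<^sup>2) \<le> ?B * 2"
        by (intro mult_mono multiplier_norm_le) auto
      also have "\<dots> \<le> C" using L V by (simp add: C_def)
      finally show ?thesis .
    qed
    then show ?thesis unfolding w using pos by (simp add: pos_le_divide_eq)
  qed
  then show "\<exists>C\<ge>0. \<forall>\<xi>. cmod (multiplier K \<xi>) \<le> C * weight 1 (- 1/2) \<xi>"
    using C0 by (intro exI[of _ C]) (simp add: C_def)
qed


subsection \<open>Differentiation under the integral sign\<close>

text \<open>The majorant is asked of the derivative on a whole ball; the mean value inequality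
  passes it on to the difference quotients, and dominated convergence finishes. The parameter field
  is left open because both real parameters (the Bessel integrals) and complex ones (the wave
  number) occur.\<close>

lemma has_field_derivative_integral:
  fixes f :: "'k::{real_normed_field,banach,second_countable_topology} \<Rightarrow> 'a \<Rightarrow> 'k"
  assumes \<delta>: "\<delta> > 0" and int: "\<And>z. z \<in> ball z0 \<delta> \<Longrightarrow> integrable M (f z)"
    and der: "\<And>z x. z \<in> ball z0 \<delta> \<Longrightarrow> x \<in> space M \<Longrightarrow> ((\<lambda>z. f z x) has_field_derivative f' z x) (at z)"
    and bd: "\<And>z x. z \<in> ball z0 \<delta> \<Longrightarrow> x \<in> space M \<Longrightarrow> norm (f' z x) \<le> h x"
    and h: "integrable M h"
  shows "((\<lambda>z. \<integral>x. f z x \<partial>M) has_field_derivative (\<integral>x. f' z0 x \<partial>M)) (at z0)"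
proof -
  let ?Q = "\<lambda>z x. (f z x - f z0 x) / (z - z0)"
  have z0: "z0 \<in> ball z0 \<delta>" using \<delta> by simp
  have lim: "(\<lambda>n. ?Q (X n) x) \<longlonglongrightarrow> f' z0 x"
    if X: "\<forall>n. X n \<in> UNIV - {z0}" "X \<longlonglongrightarrow> z0" and x: "x \<in> space M" for X x
    using der[OF z0 x] X unfolding has_field_derivative_iff tendsto_at_iff_sequentially comp_def by blast
  have evb: "eventually (\<lambda>n. X n \<in> ball z0 \<delta>) sequentially" if "X \<longlonglongrightarrow> z0" for X :: "nat \<Rightarrow> 'k"
    using topological_tendstoD[OF that, of "ball z0 \<delta>"] z0 by simp
  have Qm: "?Q z \<in> borel_measurable M" if "z \<in> ball z0 \<delta>" for z
    using int[OF that] int[OF z0] by (intro borel_measurable_divide borel_measurable_diff) auto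
  have dm: "f' z0 \<in> borel_measurable M"
  proof -
    \<comment> \<open>Measurability of the derivative in x comes from its being a pointwise limit of
      measurable difference quotients, taken along an explicit sequence that stays inside the
      ball.\<close>
    define X where "X n = z0 + of_real (\<delta> / (real n + 2))" for n
    have "(\<lambda>n. \<delta> / (real n + 2)) \<longlonglongrightarrow> 0" by real_asymp
    from tendsto_of_real[OF this] have "(\<lambda>n. z0 + of_real (\<delta> / (real n + 2))) \<longlonglongrightarrow> z0 + of_real 0"
      by (intro tendsto_add tendsto_const)
    then have X: "X \<longlonglongrightarrow> z0" by (simp add: X_def[abs_def])
    have "\<delta> / (real n + 2) \<noteq> 0" for n
      using \<delta> by (simp add: add_nonneg_eq_0_iff)
    then have X0: "\<forall>n. X n \<in> UNIV - {z0}"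
      by (simp add: X_def del: of_real_divide of_real_add)
    have Xb: "X n \<in> ball z0 \<delta>" for n
    proof -
      have "dist z0 (X n) = \<delta> / (real n + 2)"
        using \<delta> by (simp add: X_def dist_norm del: of_real_divide of_real_add)
      also have "\<dots> < \<delta>" using \<delta> by (simp add: divide_less_eq)
      finally show ?thesis by simp
    qed
    show ?thesis
      by (rule borel_measurable_LIMSEQ_metric[of "\<lambda>n. ?Q (X n)", OF Qm[OF Xb] lim[OF X0 X]])
  qed
  show ?thesis
    unfolding has_field_derivative_iff tendsto_at_iff_sequentially comp_def
  proof (intro allI impI)
    fix X assume X: "\<forall>n. X n \<in> UNIV - {z0}" "X \<longlonglongrightarrow> z0"
    obtain N where N: "\<And>n. n \<ge> N \<Longrightarrow> X n \<in> ball z0 \<delta>"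
      using evb[OF X(2)] unfolding eventually_sequentially by auto
    have X': "\<forall>n. X (n + N) \<in> UNIV - {z0}" using X(1) by simp
    have lim': "(\<lambda>n. X (n + N)) \<longlonglongrightarrow> z0" using X(2) by (rule LIMSEQ_ignore_initial_segment)
    have Nb: "X (n + N) \<in> ball z0 \<delta>" for n by (rule N) simp
    have L: "(\<lambda>n. \<integral>x. ?Q (X (n + N)) x \<partial>M) \<longlonglongrightarrow> (\<integral>x. f' z0 x \<partial>M)"
    proof (rule integral_dominated_convergence[OF dm Qm[OF Nb] h])
      show "AE x in M. (\<lambda>n. ?Q (X (n + N)) x) \<longlonglongrightarrow> f' z0 x"
        using lim[OF X' lim'] by (intro AE_I2)
      show "AE x in M. norm (?Q (X (n + N)) x) \<le> h x" for n
      proof (rule AE_I2)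
        fix x assume x: "x \<in> space M"
        have "norm (f (X (n + N)) x - f z0 x) \<le> h x * norm (X (n + N) - z0)"
        proof (rule field_differentiable_bound[of "ball z0 \<delta>" "\<lambda>z. f z x" "\<lambda>z. f' z x"])
          show "((\<lambda>z. f z x) has_field_derivative f' z x) (at z within ball z0 \<delta>)" if "z \<in> ball z0 \<delta>" for z
            by (rule has_field_derivative_at_within[OF der[OF that x]])
        qed (use bd x Nb z0 in auto)
        then show "norm (?Q (X (n + N)) x) \<le> h x"
          using X'[rule_format, of n] by (simp add: norm_divide pos_divide_le_eq)
      qed
    qed
    have "(\<integral>x. ?Q (X (n + N)) x \<partial>M) = ((\<integral>x. f (X (n + N)) x \<partial>M) - (\<integral>x. f z0 x \<partial>M)) / (X (n + N) - z0)" for n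
      using int[OF Nb] int[OF z0] by simp
    with L have "(\<lambda>n. ((\<integral>x. f (X (n + N)) x \<partial>M) - (\<integral>x. f z0 x \<partial>M)) / (X (n + N) - z0)) \<longlonglongrightarrow> (\<integral>x. f' z0 x \<partial>M)"
      by (simp only:)
    then show "(\<lambda>n. ((\<integral>x. f (X n) x \<partial>M) - (\<integral>x. f z0 x \<partial>M)) / (X n - z0)) \<longlonglongrightarrow> (\<integral>x. f' z0 x \<partial>M)"
      by (rule LIMSEQ_offset)
  qed
qed

subsection \<open>Integrals of Bessel type\<close>

text \<open>A measure space of its own, so that dominated convergence, Fubini and differentiation
  under the integral apply directly and pointwise claims are required for t > 0 only.\<close>

abbreviation half_line :: "real measure" where "half_line \<equiv> restrict_space lborel {0<..}"

lemma space_half_line [simp]: "space half_line = {0<..}"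
  by (simp add: space_restrict_space)

lemma half_line_measurable [measurable]:
  "f \<in> borel_measurable borel \<Longrightarrow> f \<in> borel_measurable half_line"
  by (rule measurable_restrict_space1) simp

lemma half_line_integrable_iff:
  fixes f :: "real \<Rightarrow> 'b::{banach,second_countable_topology}"
  shows "integrable half_line f \<longleftrightarrow> set_integrable lborel {0<..} f"
  by (subst integrable_restrict_space) (auto simp: set_integrable_def)

lemma half_line_integral_eq:
  fixes f :: "real \<Rightarrow> 'b::{banach,second_countable_topology}"
  shows "integral\<^sup>L half_line f = (LINT t:{0<..}|lborel. f t)"
  by (subst integral_restrict_space) (auto simp: set_lebesgue_integral_def)

section \<open>Gamma integrals and the Bessel integrals\<close>

lemma
  assumes a: "a > -1"
  shows Gamma_integrable: "integrable half_line (\<lambda>t. t powr a * exp (- t))"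
    and Gamma_integral: "(\<integral>t. t powr a * exp (- t) \<partial>half_line) = Gamma (a + 1)"
proof -
  have "ennreal (Gamma (a + 1)) = (\<integral>\<^sup>+t. ennreal (indicator {0..} t * t powr (a + 1 - 1) / exp t) \<partial>lborel)"
    using Gamma_conv_nn_integral_real[of "a + 1"] a by simp
  also have "\<dots> = (\<integral>\<^sup>+t. ennreal (indicator {0<..} t *\<^sub>R (t powr a * exp (- t))) \<partial>lborel)"
  proof (rule nn_integral_cong_AE)
    have "AE t in lborel. t \<noteq> (0::real)" by (rule AE_lborel_singleton)
    then show "AE t in lborel. ennreal (indicator {0..} t * t powr (a + 1 - 1) / exp t) =
        ennreal (indicator {0<..} t *\<^sub>R (t powr a * exp (- t)))"
      by eventually_elim (auto split: split_indicator simp: exp_minus field_simps)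
  qed
  finally have nn: "(\<integral>\<^sup>+t. ennreal (indicator {0<..} t *\<^sub>R (t powr a * exp (- t))) \<partial>lborel) = ennreal (Gamma (a + 1))" ..
  have G: "Gamma (a + 1) \<ge> 0" using a Gamma_real_pos[of "a + 1"] by simp
  have i: "integrable lborel (\<lambda>t. indicator {0<..} t *\<^sub>R (t powr a * exp (- t)))"
    by (rule integrableI_nn_integral_finite[OF _ _ nn]) auto
  then show "integrable half_line (\<lambda>t. t powr a * exp (- t))"
    by (simp add: half_line_integrable_iff set_integrable_def)
  have "ennreal (\<integral>t. indicator {0<..} t *\<^sub>R (t powr a * exp (- t)) \<partial>lborel) = ennreal (Gamma (a + 1))"
    using nn_integral_eq_integral[OF i] nn by simp
  then show "(\<integral>t. t powr a * exp (- t) \<partial>half_line) = Gamma (a + 1)"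
    using G by (simp add: half_line_integral_eq set_lebesgue_integral_def integral_nonneg_AE)
qed

text \<open>In terms of modified Bessel functions of the second kind this is 2 q^((a+1)/2) K_(a+1)(2
  sqrt q). The exponent - 3/2 is needed for n = 3, the exponent - 1 for n = 2.\<close>

definition bessel_integral :: "real \<Rightarrow> real \<Rightarrow> real" where
  "bessel_integral a q = (\<integral>t. t powr a * exp (- t - q / t) \<partial>half_line)"

text \<open>A majorant that is uniform for q away from 0 and integrable by the Gamma function. For
  negative a the singularity of t^a at the origin is absorbed by exp (- q0 / t).\<close>

lemma bessel_kernel_bound:
  fixes q0 a :: real
  assumes q0: "q0 > 0"
  obtains C where "C > 0" "\<And>q t. q \<ge> q0 \<Longrightarrow> t > 0 \<Longrightarrow> t powr a * exp (- t - q / t) \<le> C * (t powr \<bar>a\<bar> * exp (- t))"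
proof -
  \<comment> \<open>For a < 0 one has t^a = (1/t)^m t^|a| with this \<open>m\<close>, and (1/t)^m
    exp (- q0 / t) is bounded.\<close>
  define m where "m = 2 * \<bar>a\<bar>"
  have "((\<lambda>u::real. u powr m * exp (- q0 * u)) \<longlongrightarrow> 0) at_top"
    using q0 by real_asymp
  then have "eventually (\<lambda>u::real. u powr m * exp (- q0 * u) < 1) at_top"
    by (rule order_tendstoD) simp
  then obtain T where T: "\<And>u::real. u \<ge> T \<Longrightarrow> u powr m * exp (- q0 * u) < 1"
    by (auto simp: eventually_at_top_linorder)
  define C where "C = 1 + (max T 1) powr m"
  have C: "C > 1" by (simp add: C_def)
  have u: "u powr m * exp (- q0 * u) \<le> C" if "u > 0" for u :: real
  proof (cases "u \<ge> T")
    case True then show ?thesis using T[OF True] C by linarith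
  next
    case False
    have "u powr m * exp (- q0 * u) \<le> (max T 1) powr m * 1"
      using False that q0 by (intro mult_mono powr_mono2) (auto simp: m_def)
    then show ?thesis by (simp add: C_def)
  qed
  show thesis
  proof
    show "C > 0" using C by simp
    fix q t :: real assume q: "q \<ge> q0" and t: "t > 0"
    have "t powr a * exp (- q / t) \<le> C * t powr \<bar>a\<bar>"
    proof (cases "a \<ge> 0")
      case True
      have "t powr a * exp (- q / t) \<le> t powr a * 1"
        using q q0 t by (intro mult_left_mono) auto
      also have "\<dots> \<le> C * t powr \<bar>a\<bar>" using True C mult_right_mono[of 1 C "t powr a"] by simp
      finally show ?thesis .
    next
      case False
      have ta: "t powr a = (1 / t) powr m * t powr \<bar>a\<bar>"
      proof -
        have "(1 / t) powr m = t powr (- m)" using t by (simp add: powr_minus_divide powr_divide)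
        then show ?thesis using False by (simp add: m_def flip: powr_add)
      qed
      have "exp (- q / t) \<le> exp (- q0 * (1 / t))" using q t by (simp add: divide_right_mono)
      then have "t powr a * exp (- q / t) \<le> t powr a * exp (- q0 * (1 / t))"
        by (intro mult_left_mono) auto
      also have "\<dots> = ((1 / t) powr m * exp (- q0 * (1 / t))) * t powr \<bar>a\<bar>"
        unfolding ta by (simp only: mult_ac)
      also have "\<dots> \<le> C * t powr \<bar>a\<bar>" using u[of "1 / t"] t by (intro mult_right_mono) auto
      finally show ?thesis .
    qed
    then have "t powr a * exp (- q / t) * exp (- t) \<le> C * t powr \<bar>a\<bar> * exp (- t)"
      by (intro mult_right_mono) auto
    moreover have "exp (- t - q / t) = exp (- q / t) * exp (- t)" by (simp flip: exp_add)
    ultimately show "t powr a * exp (- t - q / t) \<le> C * (t powr \<bar>a\<bar> * exp (- t))"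
      by (simp add: mult_ac)
  qed
qed

lemma bessel_integrable:
  assumes "q > 0"
  shows "integrable half_line (\<lambda>t. t powr a * exp (- t - q / t))"
proof -
  obtain C where C: "C > 0" "\<And>q' t. q' \<ge> q \<Longrightarrow> t > 0 \<Longrightarrow> t powr a * exp (- t - q' / t) \<le> C * (t powr \<bar>a\<bar> * exp (- t))"
    using bessel_kernel_bound[OF assms] by blast
  show ?thesis
  proof (rule Bochner_Integration.integrable_bound)
    show "integrable half_line (\<lambda>t. C * (t powr \<bar>a\<bar> * exp (- t)))"
      by (intro integrable_mult_right Gamma_integrable) simp
    show "AE t in half_line. norm (t powr a * exp (- t - q / t)) \<le> norm (C * (t powr \<bar>a\<bar> * exp (- t)))"
      using C by (intro AE_I2) (simp add: abs_mult)
  qed measurable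
qed

lemma bessel_integral_deriv:
  assumes q: "q > 0"
  shows "(bessel_integral a has_field_derivative - bessel_integral (a - 1) q) (at q)"
proof -
  obtain C where C: "C > 0" "\<And>q' t. q' \<ge> q / 2 \<Longrightarrow> t > 0 \<Longrightarrow>
      t powr (a - 1) * exp (- t - q' / t) \<le> C * (t powr \<bar>a - 1\<bar> * exp (- t))"
    using bessel_kernel_bound[of "q / 2" "a - 1"] q by auto
  have b: "z > 0 \<and> z \<ge> q / 2" if "z \<in> ball q (q / 2)" for z
    using that q by (auto simp: dist_real_def abs_if split: if_splits)
  have "((\<lambda>z. \<integral>t. t powr a * exp (- t - z / t) \<partial>half_line) has_field_derivative
     (\<integral>t. - (t powr (a - 1) * exp (- t - q / t)) \<partial>half_line)) (at q)"
  proof (rule has_field_derivative_integral[where \<delta> = "q / 2" and h = "\<lambda>t. C * (t powr \<bar>a - 1\<bar> * exp (- t))"])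
    fix z t :: real assume z: "z \<in> ball q (q / 2)" and t: "t \<in> space half_line"
    have t0: "t > 0" using t by simp
    have "t powr a = t powr (a - 1) * t" using t0 by (simp add: powr_diff)
    then show "((\<lambda>z. t powr a * exp (- t - z / t)) has_field_derivative - (t powr (a - 1) * exp (- t - z / t))) (at z)"
      using t0 by (auto intro!: derivative_eq_intros simp: field_simps)
    show "norm (- (t powr (a - 1) * exp (- t - z / t))) \<le> C * (t powr \<bar>a - 1\<bar> * exp (- t))"
      using C(2)[of z t] b[OF z] t0 by (simp add: abs_mult)
  next
    show "integrable half_line (\<lambda>t. t powr a * exp (- t - z / t))" if "z \<in> ball q (q / 2)" for z
      using b[OF that] by (intro bessel_integrable) simp
    show "integrable half_line (\<lambda>t. C * (t powr \<bar>a - 1\<bar> * exp (- t)))"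
      by (intro integrable_mult_right Gamma_integrable) simp
  qed (use q in auto)
  then show ?thesis by (simp add: bessel_integral_def[abs_def])
qed

text \<open>The substitution t = q / s maps the half line onto itself and exchanges the two terms of
  the exponent t + q / t; it is the source of every symmetry of the Bessel integrals used
  below.\<close>

lemma half_line_substitution:
  fixes g :: "real \<Rightarrow> real"
  assumes q: "q > 0" and g: "integrable half_line g" and gm: "g \<in> borel_measurable borel"
  shows "(\<integral>s. q / s\<^sup>2 * g (q / s) \<partial>half_line) = (\<integral>t. g t \<partial>half_line)"
    and "integrable half_line (\<lambda>s. q / s\<^sup>2 * g (q / s))"
proof -
  have si: "set_integrable lborel {0<..} g" using g by (simp add: half_line_integrable_iff)
  \<comment> \<open>The change of variables is a statement about the completed measure;
    integrability is carried there and, by Borel measurability of the transformed integrand, back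
    again.\<close>
  then have ai: "g absolutely_integrable_on {0<..}"
    unfolding set_integrable_def by (intro integrable_completion[THEN iffD2]) auto
  have img: "(\<lambda>s. q / s) ` {0<..} = {0<..}"
  proof
    show "{0<..} \<subseteq> (\<lambda>s. q / s) ` {0<..}"
    proof
      fix t :: real assume "t \<in> {0<..}"
      then show "t \<in> (\<lambda>s. q / s) ` {0<..}" using q by (intro image_eqI[of _ _ "q / t"]) auto
    qed
  qed (use q in auto)
  have "(\<lambda>s. \<bar>- q / s\<^sup>2\<bar> * g (q / s)) absolutely_integrable_on {0<..} \<and>
      integral {0<..} (\<lambda>s. \<bar>- q / s\<^sup>2\<bar> * g (q / s)) = integral {0<..} g"
  proof (rule has_absolute_integral_change_of_variables_1'[where f = g and g = "\<lambda>s. q / s"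
        and g' = "\<lambda>s. - q / s\<^sup>2", THEN iffD2])
    show "((\<lambda>s. q / s) has_real_derivative - q / s\<^sup>2) (at s within {0<..})" if "s \<in> {0<..}" for s
      using that by (auto intro!: derivative_eq_intros simp: power2_eq_square)
    show "inj_on (\<lambda>s. q / s) {0<..}" using q by (auto simp: inj_on_def)
    show "g absolutely_integrable_on (\<lambda>s. q / s) ` {0<..} \<and> integral ((\<lambda>s. q / s) ` {0<..}) g = integral {0<..} g"
      unfolding img using ai by simp
  qed simp
  moreover have "\<bar>- q / s\<^sup>2\<bar> = q / s\<^sup>2" for s using q by simp
  ultimately have *: "(\<lambda>s. q / s\<^sup>2 * g (q / s)) absolutely_integrable_on {0<..}"
      "integral {0<..} (\<lambda>s. q / s\<^sup>2 * g (q / s)) = integral {0<..} g"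
    by (simp_all only:)
  define G where "G s = q / s\<^sup>2 * g (q / s)" for s
  have Gm: "(\<lambda>s. indicator {0<..} s *\<^sub>R G s) \<in> borel_measurable lborel"
    unfolding G_def
    by (intro borel_measurable_scaleR borel_measurable_times measurable_compose[OF _ gm]) simp_all
  have si': "set_integrable lborel {0<..} (\<lambda>s. q / s\<^sup>2 * g (q / s))"
    unfolding set_integrable_def G_def[symmetric]
    by (rule integrable_completion[THEN iffD1, OF Gm])
       (use *(1) in \<open>simp only: set_integrable_def G_def\<close>)
  then show "integrable half_line (\<lambda>s. q / s\<^sup>2 * g (q / s))" by (simp add: half_line_integrable_iff)
  show "(\<integral>s. q / s\<^sup>2 * g (q / s) \<partial>half_line) = (\<integral>t. g t \<partial>half_line)"
    unfolding half_line_integral_eq using *(2) set_borel_integral_eq_integral(2)[OF si] set_borel_integral_eq_integral(2)[OF si']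
    by simp
qed

text \<open>For Bessel functions this is the symmetry of K_\<nu> in its order.\<close>

lemma bessel_integral_reflect:
  assumes q: "q > 0"
  shows "bessel_integral a q = q powr (a + 1) * bessel_integral (- a - 2) q"
proof -
  have "bessel_integral a q = (\<integral>s. q / s\<^sup>2 * ((q / s) powr a * exp (- (q / s) - q / (q / s))) \<partial>half_line)"
    unfolding bessel_integral_def by (rule half_line_substitution(1)[symmetric, OF q bessel_integrable[OF q]]) measurable
  also have "\<dots> = (\<integral>s. q powr (a + 1) * (s powr (- a - 2) * exp (- s - q / s)) \<partial>half_line)"
  proof (rule Bochner_Integration.integral_cong[OF refl])
    fix s assume "s \<in> space half_line"
    then have s: "s > 0" by simp
    have "q / s\<^sup>2 * (q / s) powr a = q powr (a + 1) * s powr (- a - 2)"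
      using s q by (simp add: powr_divide powr_add powr_diff powr_minus power2_eq_square field_simps)
    moreover have "exp (- (q / s) - q / (q / s)) = exp (- s - q / s)" using s q by simp
    ultimately show "q / s\<^sup>2 * ((q / s) powr a * exp (- (q / s) - q / (q / s))) =
        q powr (a + 1) * (s powr (- a - 2) * exp (- s - q / s))" by (simp only: mult.assoc[symmetric])
  qed
  finally show ?thesis by (simp add: bessel_integral_def)
qed

lemma bessel_integral_limit_0:
  assumes a: "a > -1"
  shows "(bessel_integral a \<longlongrightarrow> Gamma (a + 1)) (at_right 0)"
  unfolding tendsto_at_iff_sequentially comp_def
proof (intro allI impI)
  fix X assume X: "\<forall>n. X n \<in> {0<..} - {0::real}" "X \<longlonglongrightarrow> 0"
  have "(\<lambda>n. \<integral>t. t powr a * exp (- t - X n / t) \<partial>half_line) \<longlonglongrightarrow> (\<integral>t. t powr a * exp (- t) \<partial>half_line)"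
  proof (rule integral_dominated_convergence)
    show "integrable half_line (\<lambda>t. t powr a * exp (- t))" by (rule Gamma_integrable[OF a])
    show "AE t in half_line. (\<lambda>n. t powr a * exp (- t - X n / t)) \<longlonglongrightarrow> t powr a * exp (- t)"
    proof (rule AE_I2)
      fix t assume t: "t \<in> space half_line"
      have "(\<lambda>n. t powr a * exp (- t - X n / t)) \<longlonglongrightarrow> t powr a * exp (- t - 0 / t)"
        using t by (intro tendsto_intros X) auto
      then show "(\<lambda>n. t powr a * exp (- t - X n / t)) \<longlonglongrightarrow> t powr a * exp (- t)" by simp
    qed
    show "AE t in half_line. norm (t powr a * exp (- t - X n / t)) \<le> t powr a * exp (- t)" for n
      using X(1) by (intro AE_I2) (auto simp: abs_mult intro!: mult_left_mono divide_nonneg_pos less_imp_le)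
  qed measurable
  then show "(\<lambda>n. bessel_integral a (X n)) \<longlonglongrightarrow> Gamma (a + 1)"
    by (simp add: bessel_integral_def Gamma_integral[OF a])
qed

text \<open>The reflection turns the derivative formula into \<open>j' = - q\<^sup>-\<^sup>1\<^sup>/\<^sup>2 j\<close> for the exponent \<open>-1/2\<close>.\<close>

lemma bessel_integral_half:
  assumes q: "q > 0"
  shows "bessel_integral (- 1/2) q = sqrt pi * exp (- 2 * sqrt q)"
proof -
  define j where "j x = bessel_integral (- 1/2) x * exp (2 * sqrt x)" for x
  have "(j has_field_derivative 0) (at x)" if x: "x > 0" for x
  proof -
    have r: "bessel_integral (- 1/2 - 1) x = bessel_integral (- 1/2) x / sqrt x"
      using bessel_integral_reflect[OF x, of "- 1/2 - 1"] x
      by (simp add: powr_minus_divide powr_half_sqrt)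
    have "(j has_field_derivative - bessel_integral (- 1/2 - 1) x * exp (2 * sqrt x)
        + bessel_integral (- 1/2) x * (exp (2 * sqrt x) * (1 / sqrt x))) (at x)"
      unfolding j_def using x
      by (auto intro!: derivative_eq_intros bessel_integral_deriv simp: divide_simps)
    moreover have "- bessel_integral (- 1/2 - 1) x * exp (2 * sqrt x)
        + bessel_integral (- 1/2) x * (exp (2 * sqrt x) * (1 / sqrt x)) = 0"
      unfolding r by simp
    ultimately show ?thesis by simp
  qed
  then have const: "j x = j q" if "x > 0" for x
    using DERIV_isconst3[of 0 "max x q + 1" x q j] that q by auto
  \<comment> \<open>The constant value of \<open>j\<close> is read off at the origin, where the
    integral degenerates to Gamma (1/2).\<close>
  have A: "(j \<longlongrightarrow> Gamma (1/2) * exp (2 * sqrt 0)) (at_right 0)"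
    unfolding j_def
    by (intro tendsto_mult tendsto_exp tendsto_const tendsto_real_sqrt tendsto_ident_at)
       (use bessel_integral_limit_0[of "- 1/2"] in simp)
  have B: "(j \<longlongrightarrow> j q) (at_right 0)"
    by (rule tendsto_eventually) (auto simp: eventually_at_right_field intro!: exI[of _ 1] const)
  have "j q = sqrt pi"
    using tendsto_unique[OF trivial_limit_at_right_real B A] by (simp add: Gamma_one_half_real)
  moreover have "bessel_integral (- 1/2) q = j q * exp (- 2 * sqrt q)"
    unfolding j_def mult.assoc exp_add[symmetric] by simp
  ultimately show ?thesis by simp
qed

corollary bessel_integral_minus_three_half:
  assumes q: "q > 0"
  shows "bessel_integral (- 3/2) q = sqrt pi * exp (- 2 * sqrt q) / sqrt q"
  using bessel_integral_reflect[OF q, of "- 3/2"] bessel_integral_half[OF q] q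
  by (simp add: powr_minus_divide powr_half_sqrt)


subsection \<open>The power series of the Bessel functions of order zero\<close>

text \<open>The value at z^2 / 4 is the modified Bessel function I_0(z), and at - z^2 / 4 it is
  J_0(z). In the variable q the series is entire without parity conditions; the general type serves
  the real differential equation as well as the complex continuation.\<close>

definition bessel_E :: "'a::{real_normed_field,banach} \<Rightarrow> 'a" where
  "bessel_E q = (\<Sum>n. 1 / (fact n)\<^sup>2 * q ^ n)"

definition bessel_E' :: "'a::{real_normed_field,banach} \<Rightarrow> 'a" where
  "bessel_E' q = (\<Sum>n. diffs (\<lambda>n. 1 / (fact n)\<^sup>2) n * q ^ n)"

text \<open>The regular part of the second solution: with q = z^2 / 4, K_0(z) = W(q) - (ln (z/2) +
  \<gamma>) E(q), where W and E are this series and \<open>bessel_E\<close>.\<close>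

definition bessel_W :: "'a::{real_normed_field,banach} \<Rightarrow> 'a" where
  "bessel_W q = (\<Sum>n. harm n / (fact n)\<^sup>2 * q ^ n)"

definition bessel_W' :: "'a::{real_normed_field,banach} \<Rightarrow> 'a" where
  "bessel_W' q = (\<Sum>n. diffs (\<lambda>n. harm n / (fact n)\<^sup>2) n * q ^ n)"

lemma harm_le_fact: "harm n \<le> (fact n :: real)"
proof -
  have "harm n \<le> real n"
  proof (induction n)
    case (Suc n)
    have "inverse (real (Suc n)) \<le> 1" by (simp add: inverse_eq_divide)
    with Suc show ?case by (simp add: harm_Suc)
  qed (simp add: harm_expand)
  also have "real n \<le> fact n" using fact_ge_self[of n] by (metis of_nat_fact of_nat_le_iff)
  finally show ?thesis .
qed

text \<open>The coefficients of both series are at most 1 / n!, since the harmonic numbers are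
  dominated by n!, so comparison with the exponential series gives convergence everywhere.\<close>

lemma summable_exp_bound:
  fixes c :: "nat \<Rightarrow> 'a::{real_normed_field,banach}"
  assumes "\<And>n. norm (c n) \<le> 1 / fact n"
  shows "summable (\<lambda>n. norm (c n * q ^ n))"
proof (rule summable_comparison_test')
  show "summable (\<lambda>n. (norm q) ^ n /\<^sub>R fact n)" by (rule summable_exp_generic)
  show "norm (norm (c n * q ^ n)) \<le> (norm q) ^ n /\<^sub>R fact n" if "n \<ge> 0" for n
    using mult_right_mono[OF assms[of n], of "norm q ^ n"]
    by (simp add: norm_mult norm_power divide_inverse)
qed

lemma bessel_E_coeff: "norm (1 / (fact n)\<^sup>2 :: 'a::real_normed_field) \<le> 1 / fact n"
proof -
  have "(fact n :: real) ^ 1 \<le> fact n ^ 2" by (intro power_increasing) (auto simp: fact_ge_1)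
  then have "1 / (fact n)\<^sup>2 \<le> 1 / (fact n :: real)" by (intro frac_le) auto
  then show ?thesis by (simp add: norm_divide norm_power)
qed

lemma bessel_W_coeff: "norm (harm n / (fact n)\<^sup>2 :: 'a::real_normed_field) \<le> 1 / fact n"
proof -
  have "norm (harm n / (fact n)\<^sup>2 :: 'a) = harm n / (fact n)\<^sup>2"
    by (simp add: norm_divide norm_power norm_harm)
  also have "\<dots> \<le> fact n / (fact n)\<^sup>2" by (intro divide_right_mono harm_le_fact) simp
  also have "\<dots> = 1 / fact n" by (simp add: power2_eq_square)
  finally show ?thesis .
qed

lemma bessel_E_summable: "summable (\<lambda>n. 1 / (fact n)\<^sup>2 * (q::'a::{real_normed_field,banach}) ^ n)"
  by (rule summable_norm_cancel[OF summable_exp_bound[OF bessel_E_coeff]])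

lemma bessel_W_summable: "summable (\<lambda>n. harm n / (fact n)\<^sup>2 * (q::'a::{real_normed_field,banach}) ^ n)"
  by (rule summable_norm_cancel[OF summable_exp_bound[OF bessel_W_coeff]])

lemma bessel_E_deriv: "(bessel_E has_field_derivative bessel_E' q) (at q)"
  unfolding bessel_E_def[abs_def] bessel_E'_def
  by (rule termdiffs_strong_converges_everywhere[OF bessel_E_summable])

lemma bessel_W_deriv: "(bessel_W has_field_derivative bessel_W' q) (at q)"
  unfolding bessel_W_def[abs_def] bessel_W'_def
  by (rule termdiffs_strong_converges_everywhere[OF bessel_W_summable])

text \<open>The operator x d/dx multiplies the n-th coefficient by n. Written with it, the Bessel
  equation of order zero is (q u')' = u, a recurrence with factor (n + 1)^2, and no second
  derivative of a series has to be formed.\<close>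

lemma theta_series:
  fixes c :: "nat \<Rightarrow> 'a::{real_normed_field,banach}"
  assumes "\<And>x. summable (\<lambda>n. c n * x ^ n)"
  shows "summable (\<lambda>n. of_nat n * c n * x ^ n)"
    and "x * (\<Sum>n. diffs c n * x ^ n) = (\<Sum>n. of_nat n * c n * x ^ n)"
proof -
  have s: "summable (\<lambda>n. diffs c n * x ^ n)" by (rule termdiff_converges_all[OF assms])
  have e: "of_nat (Suc n) * c (Suc n) * x ^ Suc n = x * (diffs c n * x ^ n)" for n
    by (simp add: diffs_def mult_ac)
  have s': "summable (\<lambda>n. of_nat (Suc n) * c (Suc n) * x ^ Suc n)"
    unfolding e by (rule summable_mult[OF s])
  then show sm: "summable (\<lambda>n. of_nat n * c n * x ^ n)"
    by (subst (asm) summable_Suc_iff[of "\<lambda>n. of_nat n * c n * x ^ n"])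
  have "(\<Sum>n. of_nat n * c n * x ^ n) = (\<Sum>n. of_nat (Suc n) * c (Suc n) * x ^ Suc n)"
    using suminf_split_head[OF sm] by simp
  also have "\<dots> = x * (\<Sum>n. diffs c n * x ^ n)" unfolding e by (rule suminf_mult[OF s])
  finally show "x * (\<Sum>n. diffs c n * x ^ n) = (\<Sum>n. of_nat n * c n * x ^ n)" ..
qed

lemma theta_series_deriv:
  fixes c :: "nat \<Rightarrow> 'a::{real_normed_field,banach}"
  assumes "\<And>x. summable (\<lambda>n. c n * x ^ n)"
  shows "((\<lambda>x. x * (\<Sum>n. diffs c n * x ^ n)) has_field_derivative
    (\<Sum>n. (of_nat (Suc n))\<^sup>2 * c (Suc n) * x ^ n)) (at x)"
proof -
  have e: "diffs (\<lambda>n. of_nat n * c n) n = (of_nat (Suc n))\<^sup>2 * c (Suc n)" for n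
    by (simp add: diffs_def power2_eq_square mult.assoc)
  show ?thesis
    unfolding theta_series(2)[OF assms]
    using termdiffs_strong_converges_everywhere[of "\<lambda>n. of_nat n * c n", OF theta_series(1)[OF assms]]
    unfolding e .
qed

lemma bessel_E_theta_deriv: "((\<lambda>q. q * bessel_E' q) has_field_derivative bessel_E q) (at q)"
proof -
  have "(of_nat (Suc n))\<^sup>2 * (1 / (fact (Suc n))\<^sup>2) = (1 / (fact n)\<^sup>2 :: 'a)" for n
    by (simp add: power_mult_distrib del: of_nat_Suc)
  then show ?thesis
    using theta_series_deriv[of "\<lambda>n. 1 / (fact n)\<^sup>2" q, OF bessel_E_summable]
    by (simp only: bessel_E'_def bessel_E_def)
qed

text \<open>The increment 1 / (n + 1) of the harmonic numbers produces the extra term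
  \<open>bessel_E'\<close>, which is exactly what the logarithm times \<open>bessel_E\<close>
  produces as well; in the combination for K_0 the two cancel.\<close>

lemma bessel_W_theta_deriv: "((\<lambda>q. q * bessel_W' q) has_field_derivative bessel_W q + bessel_E' q) (at q)"
proof -
  have c: "(of_nat (Suc n))\<^sup>2 * (harm (Suc n) / (fact (Suc n))\<^sup>2) * q ^ n =
      harm n / (fact n)\<^sup>2 * q ^ n + diffs (\<lambda>n. 1 / (fact n)\<^sup>2) n * q ^ n" for n
  proof -
    have nz: "(of_nat (Suc n) :: 'a) \<noteq> 0" by (rule of_nat_neq_0)
    have f: "(fact (Suc n) :: 'a) = of_nat (Suc n) * fact n" by (rule fact_Suc)
    show ?thesis
      unfolding diffs_def harm_Suc f using nz
      by (simp add: power_mult_distrib power2_eq_square field_simps del: of_nat_Suc)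
  qed
  have "(\<Sum>n. (of_nat (Suc n))\<^sup>2 * (harm (Suc n) / (fact (Suc n))\<^sup>2) * q ^ n) = bessel_W q + bessel_E' q"
    unfolding c bessel_W_def bessel_E'_def
    by (rule suminf_add[symmetric, OF bessel_W_summable termdiff_converges_all[OF bessel_E_summable]])
  then show ?thesis
    using theta_series_deriv[of "\<lambda>n. harm n / (fact n)\<^sup>2" q, OF bessel_W_summable]
    by (simp only: bessel_W'_def)
qed

lemma bessel_E_0 [simp]: "bessel_E 0 = 1"
  unfolding bessel_E_def by (subst powser_zero) simp

lemma bessel_W_0 [simp]: "bessel_W 0 = 0"
  unfolding bessel_W_def by (subst powser_zero) (simp add: harm_expand)

lemma bessel_E_of_real: "bessel_E (of_real q) = (of_real (bessel_E q) :: 'a::{real_normed_field,banach})"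
  unfolding bessel_E_def by (subst suminf_of_real[OF bessel_E_summable]) simp

lemma bessel_W_of_real: "bessel_W (of_real q) = (of_real (bessel_W q) :: 'a::{real_normed_field,banach})"
  unfolding bessel_W_def by (subst suminf_of_real[OF bessel_W_summable]) (simp add: of_real_harm)

lemma bessel_E_ge_1: "q \<ge> 0 \<Longrightarrow> bessel_E q \<ge> (1::real)"
  unfolding bessel_E_def using sum_le_suminf[OF bessel_E_summable, of "{0}" q] by simp

lemma bessel_E_mono: "0 \<le> p \<Longrightarrow> p \<le> q \<Longrightarrow> bessel_E p \<le> (bessel_E q :: real)"
  unfolding bessel_E_def by (intro suminf_le bessel_E_summable mult_left_mono power_mono) auto

lemma bessel_E_norm_le: "norm (bessel_E q) \<le> bessel_E (norm q)"
  unfolding bessel_E_def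
  using summable_norm[OF summable_exp_bound[OF bessel_E_coeff, of q]] by (simp add: norm_mult norm_power norm_divide)

lemma bessel_W_norm_le: "norm (bessel_W q) \<le> bessel_W (norm q)"
  unfolding bessel_W_def
  using summable_norm[OF summable_exp_bound[OF bessel_W_coeff, of q]] by (simp add: norm_mult norm_power norm_divide norm_harm)

lemma bessel_W_mono: "0 \<le> p \<Longrightarrow> p \<le> q \<Longrightarrow> bessel_W p \<le> (bessel_W q :: real)"
  unfolding bessel_W_def by (intro suminf_le bessel_W_summable mult_left_mono power_mono) (auto simp: harm_nonneg)

subsection \<open>The modified Bessel function of the second kind\<close>

text \<open>The Wronskian of \<open>D\<close> with the solution \<open>bessel_E\<close> is constant; were it not zero, \<open>D\<close> would have
  a logarithmic singularity at the origin.\<close>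

lemma bessel_equation_unique:
  fixes D D1 :: "real \<Rightarrow> real"
  assumes d: "\<And>q. q > 0 \<Longrightarrow> (D has_field_derivative D1 q) (at q)"
    and dd: "\<And>q. q > 0 \<Longrightarrow> ((\<lambda>q. q * D1 q) has_field_derivative D q) (at q)"
    and lim: "(D \<longlongrightarrow> 0) (at_right 0)"
    and q: "q > 0"
  shows "D q = 0"
proof -
  define V where "V q = (q * D1 q) * bessel_E q - D q * (q * bessel_E' q)" for q
  have "(V has_field_derivative 0) (at x)" if x: "x > 0" for x
    unfolding V_def
    by (rule DERIV_cong[OF DERIV_diff[OF DERIV_mult[OF dd[OF x] bessel_E_deriv] DERIV_mult[OF d[OF x] bessel_E_theta_deriv]]])
       (simp add: algebra_simps)
  then have V: "V x = V 1" if "x > 0" for x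
    using DERIV_isconst3[of 0 "max x 1 + 1" x 1 V] that by auto
  define c where "c = V 1"
  \<comment> \<open>Reduction of order: dividing by the known solution turns the constant Wronskian
    \<open>c\<close> into the explicit derivative c / (x E^2).\<close>
  define R where "R x = D x / bessel_E x" for x
  have E0: "bessel_E x > (0::real)" if "x > 0" for x using bessel_E_ge_1[of x] that by linarith
  have R: "(R has_field_derivative c / (x * (bessel_E x)\<^sup>2)) (at x)" if x: "x > 0" for x
  proof -
    have "(R has_field_derivative (D1 x * bessel_E x - D x * bessel_E' x) / (bessel_E x * bessel_E x)) (at x)"
      unfolding R_def by (rule DERIV_divide[OF d[OF x] bessel_E_deriv]) (use E0[OF x] in simp)
    moreover have "x * (D1 x * bessel_E x - D x * bessel_E' x) = c"
      using V[OF x] by (simp add: V_def c_def algebra_simps)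
    then have "D1 x * bessel_E x - D x * bessel_E' x = c / x" using x by (simp add: field_simps)
    ultimately show ?thesis using x by (simp add: power2_eq_square)
  qed
  have limR: "(R \<longlongrightarrow> 0) (at_right 0)"
  proof -
    have "(bessel_E \<longlongrightarrow> bessel_E 0) (at (0::real))"
      using DERIV_isCont[OF bessel_E_deriv, of "0::real"] by (simp add: isCont_def)
    then have "(bessel_E \<longlongrightarrow> (1::real)) (at_right 0)" by (rule filterlim_mono) (auto simp: at_le)
    from tendsto_divide[OF lim this] show ?thesis by (simp add: R_def[abs_def])
  qed
  \<comment> \<open>\<open>e\<close> is the sign of c, so both signs are refuted together. On (0, 1)
    the derivative of e R is at least K / x because E is increasing; integrated from x to 1 this
    drives e R to minus infinity at the origin, against its limit 0.\<close>
  have contra: False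
    if c: "e * c > 0" and e: "e = 1 \<or> e = -1" for e :: real
  proof -
    define K where "K = e * c / (bessel_E 1)\<^sup>2"
    have K: "K > 0" using c E0[of 1] by (simp add: K_def)
    have le: "e * R x \<le> e * R 1 + K * ln x" if x: "0 < x" "x < 1" for x
    proof -
      have "e * R x - K * ln x \<le> e * R 1 - K * ln 1"
      proof (rule DERIV_nonneg_imp_nondecreasing[where f = "\<lambda>x. e * R x - K * ln x"])
        show "x \<le> 1" using x by simp
        fix y assume y: "x \<le> y" "y \<le> 1"
        then have y0: "y > 0" using x by linarith
        have "((\<lambda>x. e * R x - K * ln x) has_real_derivative e * (c / (y * (bessel_E y)\<^sup>2)) - K * (1 / y)) (at y)"
          using y0 by (auto intro!: derivative_eq_intros R)
        moreover have "K * (1 / y) \<le> e * (c / (y * (bessel_E y)\<^sup>2))"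
        proof -
          have "(bessel_E y)\<^sup>2 \<le> (bessel_E 1)\<^sup>2"
            using bessel_E_mono[of y 1] E0[OF y0] y y0 by (intro power_mono) auto
          then have "e * c / (bessel_E 1)\<^sup>2 \<le> e * c / (bessel_E y)\<^sup>2"
            using c E0[OF y0] E0[of 1] by (intro divide_left_mono) auto
          then have "K * (1 / y) \<le> e * c / (bessel_E y)\<^sup>2 * (1 / y)"
            unfolding K_def using y0 by (intro mult_right_mono) auto
          then show ?thesis by (simp add: mult.commute)
        qed
        ultimately show "\<exists>z. ((\<lambda>x. e * R x - K * ln x) has_real_derivative z) (at y) \<and> 0 \<le> z"
          by (intro exI conjI) auto
      qed
      then show ?thesis by simp
    qed
    have "filterlim (\<lambda>x. e * R 1 + K * ln x) at_bot (at_right 0)"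
      using K by real_asymp
    then have "eventually (\<lambda>x. e * R 1 + K * ln x < - 1) (at_right 0)"
      by (simp add: filterlim_at_bot_dense)
    moreover have "eventually (\<lambda>x. e * R x > - 1) (at_right 0)"
      by (rule order_tendstoD[OF tendsto_mult[OF tendsto_const limR]]) simp
    moreover have "eventually (\<lambda>x. x \<in> {0<..<1}) (at_right (0::real))"
      by (rule eventually_at_right_real) simp
    ultimately have "eventually (\<lambda>x. False) (at_right (0::real))"
    proof eventually_elim
      case (elim x)
      then show ?case using le[of x] by auto
    qed
    then show False by simp
  qed
  have "c = 0"
    using contra[of 1] contra[of "-1"] by (cases c "0::real" rule: linorder_cases) auto
  then have "(R has_field_derivative 0) (at x)" if "x > 0" for x using R[OF that] by simp
  then have Rc: "R x = R q" if "x > 0" for x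
    using DERIV_isconst3[of 0 "max x q + 1" x q R] that q by auto
  have "(R \<longlongrightarrow> R q) (at_right 0)"
    by (rule tendsto_eventually) (auto simp: eventually_at_right_field intro!: exI[of _ 1] Rc)
  from tendsto_unique[OF trivial_limit_at_right_real this limR] have "R q = 0" .
  then show ?thesis using E0[OF q] by (simp add: R_def)
qed

section \<open>Recurrence and logarithmic integrals\<close>

lemma half_line_FTC:
  fixes F f :: "real \<Rightarrow> real"
  assumes F: "\<And>t. t > 0 \<Longrightarrow> (F has_field_derivative f t) (at t)"
    and cont: "\<And>t. t > 0 \<Longrightarrow> isCont f t"
    and int: "integrable half_line f"
    and lim: "(F \<longlongrightarrow> 0) (at_right 0)" "(F \<longlongrightarrow> 0) at_top"
  shows "(\<integral>t. f t \<partial>half_line) = 0"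
proof -
  have e: "einterval 0 \<infinity> = {0<..}" by (auto simp: einterval_def zero_ereal_def)
  have "(LBINT t=0..\<infinity>. f t) = 0 - 0"
  proof (rule interval_integral_FTC_integrable[where F = F])
    show "(F has_vector_derivative f x) (at x)" if "0 < ereal x" for x
      using F[of x] that by (simp add: has_real_derivative_iff_has_vector_derivative)
    show "isCont f x" if "0 < ereal x" for x using cont[of x] that by simp
    show "set_integrable lborel (einterval 0 \<infinity>) f" using int by (simp add: e half_line_integrable_iff)
    show "((F \<circ> real_of_ereal) \<longlongrightarrow> 0) (at_right 0)"
      using lim(1) by (simp add: zero_ereal_def ereal_tendsto_simps1)
    show "((F \<circ> real_of_ereal) \<longlongrightarrow> 0) (at_left \<infinity>)"
      using lim(2) by (simp add: ereal_tendsto_simps1)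
  qed simp_all
  then show ?thesis
    by (simp add: interval_lebesgue_integral_def e half_line_integral_eq)
qed

text \<open>Integrate the exact derivative of exp (- t - q/t) / t. As differentiation in q lowers
  the exponent by 1 and changes the sign, this says (q u')' = u for u =
  \<open>bessel_integral (- 1)\<close>.\<close>

lemma bessel_integral_recurrence:
  assumes q: "q > 0"
  shows "q * bessel_integral (- 3) q - bessel_integral (- 2) q = bessel_integral (- 1) q"
proof -
  let ?e = "\<lambda>t. exp (- t - q / t)"
  let ?f = "\<lambda>t. q * (t powr (- 3) * ?e t) - t powr (- 2) * ?e t - t powr (- 1) * ?e t"
  have i: "integrable half_line (\<lambda>t. t powr a * ?e t)" for a by (rule bessel_integrable[OF q])
  have "(\<integral>t. ?f t \<partial>half_line) = 0"
  proof (rule half_line_FTC[where F = "\<lambda>t. ?e t / t"])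
    show "((\<lambda>t. ?e t / t) has_field_derivative ?f t) (at t)" if "t > 0" for t
      using that by (auto intro!: derivative_eq_intros simp: powr_minus_divide powr_numeral field_simps power2_eq_square power3_eq_cube)
    show "isCont ?f t" if "t > 0" for t using that by (intro continuous_intros) auto
    show "integrable half_line ?f" by (intro Bochner_Integration.integrable_diff integrable_mult_right i)
    show "((\<lambda>t. ?e t / t) \<longlongrightarrow> 0) (at_right 0)" using q by real_asymp
    show "((\<lambda>t. ?e t / t) \<longlongrightarrow> 0) at_top" using q by real_asymp
  qed
  moreover have "(\<integral>t. ?f t \<partial>half_line) = q * bessel_integral (- 3) q - bessel_integral (- 2) q - bessel_integral (- 1) q"
    unfolding bessel_integral_def
    by (simp only: Bochner_Integration.integral_diff integral_mult_right_zero i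
        Bochner_Integration.integrable_diff integrable_mult_right)
  ultimately show ?thesis by simp
qed

text \<open>The bound ln u \<le> u at u = t^(1/4) and at its reciprocal. A logarithm thus costs a
  quarter power on either side, which explains the threshold - 3/4 in
  \<open>log_Gamma_integrable\<close>.\<close>

lemma abs_ln_le:
  assumes "t > (0::real)"
  shows "\<bar>ln t\<bar> \<le> 4 * (t powr (1/4) + t powr (- 1/4))"
proof -
  have "ln (t powr (1/4)) \<le> t powr (1/4)" "ln (t powr (- 1/4)) \<le> t powr (- 1/4)"
    using assms by (intro ln_bound; simp)+
  then have "ln t \<le> 4 * t powr (1/4)" "- ln t \<le> 4 * t powr (- 1/4)"
    using assms by (simp_all add: ln_powr)
  moreover have "0 \<le> t powr (1/4)" "0 \<le> t powr (- 1/4)" by simp_all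
  ultimately show ?thesis unfolding abs_le_iff distrib_left by linarith
qed

lemma log_Gamma_integrable:
  assumes "a > - 3/4"
  shows "integrable half_line (\<lambda>t. \<bar>ln t\<bar> * (t powr a * exp (- t)))"
proof (rule Bochner_Integration.integrable_bound)
  show "integrable half_line (\<lambda>t. 4 * (t powr (a + 1/4) * exp (- t) + t powr (a - 1/4) * exp (- t)))"
    using assms by (intro integrable_mult_right Bochner_Integration.integrable_add Gamma_integrable) auto
  show "AE t in half_line. norm (\<bar>ln t\<bar> * (t powr a * exp (- t))) \<le>
      norm (4 * (t powr (a + 1/4) * exp (- t) + t powr (a - 1/4) * exp (- t)))"
  proof (rule AE_I2)
    fix t assume "t \<in> space half_line"
    then have t: "t > 0" by simp
    have "\<bar>ln t\<bar> * (t powr a * exp (- t)) \<le> 4 * (t powr (1/4) + t powr (- 1/4)) * (t powr a * exp (- t))"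
      by (intro mult_right_mono abs_ln_le t) auto
    also have "\<dots> = 4 * (t powr (a + 1/4) * exp (- t) + t powr (a - 1/4) * exp (- t))"
      using t by (simp add: powr_add powr_diff powr_minus_divide algebra_simps)
    finally show "norm (\<bar>ln t\<bar> * (t powr a * exp (- t))) \<le>
      norm (4 * (t powr (a + 1/4) * exp (- t) + t powr (a - 1/4) * exp (- t)))"
      by (simp add: abs_mult)
  qed
qed measurable

text \<open>Differentiate the Gamma integral in its parameter at 1, where the derivative of Gamma is
  - \<gamma>. For parameters in (1/2, 3/2) the powers of t are dominated by t^(1/2) + t^(-
  1/2).\<close>

lemma log_Gamma_integral: "(\<integral>t. ln t * exp (- t) \<partial>half_line) = - euler_mascheroni"
proof -
  let ?h = "\<lambda>t. \<bar>ln t\<bar> * (t powr (1/2) * exp (- t)) + \<bar>ln t\<bar> * (t powr (- 1/2) * exp (- t))"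
  have "((\<lambda>s. \<integral>t. t powr (s - 1) * exp (- t) \<partial>half_line) has_field_derivative
      (\<integral>t. ln t * (t powr (1 - 1) * exp (- t)) \<partial>half_line)) (at 1)"
  proof (rule has_field_derivative_integral[where \<delta> = "1/2" and h = ?h
        and f = "\<lambda>s t. t powr (s - 1) * exp (- t)" and f' = "\<lambda>s t. ln t * (t powr (s - 1) * exp (- t))"])
    fix s t :: real assume s: "s \<in> ball 1 (1/2)" and t: "t \<in> space half_line"
    then have t0: "t > 0" and s0: "- 1/2 \<le> s - 1" "s - 1 \<le> 1/2"
      by (auto simp: dist_real_def abs_if split: if_splits)
    show "((\<lambda>s. t powr (s - 1) * exp (- t)) has_field_derivative ln t * (t powr (s - 1) * exp (- t))) (at s)"
      using t0 by (auto intro!: derivative_eq_intros)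
    have "t powr (s - 1) \<le> t powr (1/2) + t powr (- 1/2)"
    proof (cases "t \<ge> 1")
      case True
      have "t powr (s - 1) \<le> t powr (1/2)" using True s0 by (intro powr_mono) auto
      then show ?thesis using powr_ge_zero[of t "- 1/2"] by linarith
    next
      case False
      have "t powr (s - 1) \<le> t powr (- 1/2)" using False t0 s0 by (intro powr_mono') auto
      then show ?thesis using powr_ge_zero[of t "1/2"] by linarith
    qed
    then have "\<bar>ln t\<bar> * (t powr (s - 1) * exp (- t)) \<le> \<bar>ln t\<bar> * ((t powr (1/2) + t powr (- 1/2)) * exp (- t))"
      by (intro mult_left_mono mult_right_mono) auto
    then show "norm (ln t * (t powr (s - 1) * exp (- t))) \<le> ?h t"
      by (simp add: abs_mult algebra_simps)
  next
    show "integrable half_line ?h"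
      by (intro Bochner_Integration.integrable_add log_Gamma_integrable) auto
    show "integrable half_line (\<lambda>t. t powr (s - 1) * exp (- t))" if "s \<in> ball 1 (1/2)" for s
      using that by (intro Gamma_integrable) (auto simp: dist_real_def abs_if split: if_splits)
  qed simp
  moreover have "eventually (\<lambda>s. (\<integral>t. t powr (s - 1) * exp (- t) \<partial>half_line) = Gamma s) (nhds (1::real))"
  proof -
    have "eventually (\<lambda>s. s \<in> {0<..}) (nhds (1::real))" by (rule eventually_nhds_in_open) auto
    then show ?thesis by eventually_elim (use Gamma_integral in simp)
  qed
  ultimately have "(Gamma has_field_derivative (\<integral>t. ln t * (t powr (1 - 1) * exp (- t)) \<partial>half_line)) (at 1)"
    by (subst (asm) DERIV_cong_ev[OF refl _ refl])
  moreover have "(Gamma has_field_derivative - euler_mascheroni) (at (1::real))"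
    using has_field_derivative_Gamma[of "1::real" UNIV] by simp
  ultimately have "(\<integral>t. ln t * (t powr (1 - 1) * exp (- t)) \<partial>half_line) = - euler_mascheroni"
    by (rule DERIV_unique)
  moreover have "(\<integral>t. ln t * (t powr (1 - 1) * exp (- t)) \<partial>half_line) = (\<integral>t. ln t * exp (- t) \<partial>half_line)"
    by (rule Bochner_Integration.integral_cong) auto
  ultimately show ?thesis by simp
qed


section \<open>The logarithmic singularity at the origin\<close>

definition log_bessel_integral :: "real \<Rightarrow> real" where
  "log_bessel_integral q = (\<integral>t. ln t * exp (- t - q / t) \<partial>half_line)"

lemma log_bessel_bound:
  fixes q t :: real
  assumes "q \<ge> 0" "t > 0"
  shows "\<bar>ln t * exp (- t - q / t)\<bar> \<le> \<bar>ln t\<bar> * (t powr 0 * exp (- t))"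
proof -
  have "exp (- t - q / t) \<le> exp (- t)" using divide_nonneg_pos[OF assms] by simp
  then have "\<bar>ln t\<bar> * exp (- t - q / t) \<le> \<bar>ln t\<bar> * exp (- t)" by (rule mult_left_mono) simp
  then show ?thesis using assms by (simp add: abs_mult)
qed

lemma log_bessel_integrable:
  assumes "q \<ge> 0"
  shows "integrable half_line (\<lambda>t. ln t * exp (- t - q / t))"
proof (rule Bochner_Integration.integrable_bound)
  show "integrable half_line (\<lambda>t. \<bar>ln t\<bar> * (t powr 0 * exp (- t)))"
    by (rule log_Gamma_integrable) simp
  show "AE t in half_line. norm (ln t * exp (- t - q / t)) \<le> norm (\<bar>ln t\<bar> * (t powr 0 * exp (- t)))"
  proof (rule AE_I2)
    fix t assume "t \<in> space half_line"
    then show "norm (ln t * exp (- t - q / t)) \<le> norm (\<bar>ln t\<bar> * (t powr 0 * exp (- t)))"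
      using log_bessel_bound[OF assms, of t] unfolding real_norm_def
      by (auto simp: abs_mult)
  qed
qed measurable

text \<open>Integrating the derivative of \<open>ln t exp (- t - q / t)\<close> and reflecting \<open>t \<mapsto> q / t\<close> isolates the
  logarithmic singularity of the integral at \<open>q = 0\<close>.\<close>

lemma bessel_integral_log:
  assumes q: "q > 0"
  shows "bessel_integral (- 1) q = 2 * log_bessel_integral q - ln q * bessel_integral 0 q"
proof -
  let ?e = "\<lambda>t. exp (- t - q / t)"
  have i: "integrable half_line (\<lambda>t. t powr a * ?e t)" for a by (rule bessel_integrable[OF q])
  have il: "integrable half_line (\<lambda>t. ln t * ?e t)" using q by (intro log_bessel_integrable) simp
  have m: "(\<lambda>t. ln t * ?e t) \<in> borel_measurable borel" by measurable
  have pt: "q / s\<^sup>2 * (ln (q / s) * exp (- (q / s) - q / (q / s))) =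
      q * ln q * (s powr (- 2) * ?e s) - q * (ln s * (s powr (- 2) * ?e s))" if "s \<in> space half_line" for s
  proof -
    have s: "s > 0" using that by simp
    have p: "s powr (- 2) = 1 / s\<^sup>2" using s by (simp add: powr_minus_divide)
    have e: "exp (- (q / s) - q / (q / s)) = ?e s" using s q by simp
    have l: "ln (q / s) = ln q - ln s" using s q by (simp add: ln_div)
    show ?thesis unfolding p e l by (simp add: algebra_simps)
  qed
  have e1: "(\<integral>s. q * ln q * (s powr (- 2) * ?e s) - q * (ln s * (s powr (- 2) * ?e s)) \<partial>half_line) = log_bessel_integral q"
    unfolding log_bessel_integral_def half_line_substitution(1)[OF q il m, symmetric]
    by (rule Bochner_Integration.integral_cong[OF refl]) (rule pt[symmetric])
  have i1: "integrable half_line (\<lambda>s. q * ln q * (s powr (- 2) * ?e s) - q * (ln s * (s powr (- 2) * ?e s)))"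
    using half_line_substitution(2)[OF q il m]
    by (rule Bochner_Integration.integrable_cong[THEN iffD1, rotated -1]) (use pt in auto)
  have i2: "integrable half_line (\<lambda>s. q * (ln s * (s powr (- 2) * ?e s)))"
    using Bochner_Integration.integrable_diff[OF integrable_mult_right[OF i[of "- 2"], of "q * ln q"] i1] by simp
  \<comment> \<open>This moment occurs in the reflected integral and in the integrated exact
    derivative; it is eliminated between the two equations.\<close>
  define M where "M = (\<integral>s. q * (ln s * (s powr (- 2) * ?e s)) \<partial>half_line)"
  have e2: "log_bessel_integral q = q * ln q * bessel_integral (- 2) q - M"
    unfolding e1[symmetric] M_def bessel_integral_def
    by (simp only: Bochner_Integration.integral_diff[OF integrable_mult_right[OF i] i2] integral_mult_right_zero)
  let ?f = "\<lambda>t. t powr (- 1) * ?e t - ln t * ?e t + q * (ln t * (t powr (- 2) * ?e t))"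
  have "(\<integral>t. ?f t \<partial>half_line) = 0"
  proof (rule half_line_FTC[where F = "\<lambda>t. ln t * ?e t"])
    show "((\<lambda>t. ln t * ?e t) has_field_derivative ?f t) (at t)" if "t > 0" for t
      using that by (auto intro!: derivative_eq_intros simp: powr_minus_divide field_simps power2_eq_square)
    show "isCont ?f t" if "t > 0" for t using that by (intro continuous_intros) auto
    show "integrable half_line ?f"
      by (intro Bochner_Integration.integrable_add Bochner_Integration.integrable_diff i il i2)
    show "((\<lambda>t. ln t * ?e t) \<longlongrightarrow> 0) (at_right 0)" using q by real_asymp
    show "((\<lambda>t. ln t * ?e t) \<longlongrightarrow> 0) at_top" using q by real_asymp
  qed
  moreover have "(\<integral>t. ?f t \<partial>half_line) = bessel_integral (- 1) q - log_bessel_integral q + M"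
    unfolding bessel_integral_def log_bessel_integral_def M_def
    by (simp only: Bochner_Integration.integral_diff Bochner_Integration.integral_add i il i2
        Bochner_Integration.integrable_diff)
  moreover have "q * bessel_integral (- 2) q = bessel_integral 0 q"
    using bessel_integral_reflect[OF q, of "- 2"] q by (simp add: powr_minus_divide)
  then have "q * ln q * bessel_integral (- 2) q = ln q * bessel_integral 0 q" by (simp add: mult_ac)
  ultimately show ?thesis using e2 by linarith
qed

lemma log_bessel_integral_limit: "(log_bessel_integral \<longlongrightarrow> - euler_mascheroni) (at_right 0)"
  unfolding tendsto_at_iff_sequentially comp_def
proof (intro allI impI)
  fix X assume X: "\<forall>n. X n \<in> {0<..} - {0::real}" "X \<longlonglongrightarrow> 0"
  have "(\<lambda>n. \<integral>t. ln t * exp (- t - X n / t) \<partial>half_line) \<longlonglongrightarrow> (\<integral>t. ln t * exp (- t) \<partial>half_line)"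
  proof (rule integral_dominated_convergence)
    show "integrable half_line (\<lambda>t. \<bar>ln t\<bar> * (t powr 0 * exp (- t)))"
      by (rule log_Gamma_integrable) simp
    show "AE t in half_line. (\<lambda>n. ln t * exp (- t - X n / t)) \<longlonglongrightarrow> ln t * exp (- t)"
    proof (rule AE_I2)
      fix t assume t: "t \<in> space half_line"
      have "(\<lambda>n. ln t * exp (- t - X n / t)) \<longlonglongrightarrow> ln t * exp (- t - 0 / t)"
        using t by (intro tendsto_intros X) auto
      then show "(\<lambda>n. ln t * exp (- t - X n / t)) \<longlonglongrightarrow> ln t * exp (- t)" by simp
    qed
    show "AE t in half_line. norm (ln t * exp (- t - X n / t)) \<le> \<bar>ln t\<bar> * (t powr 0 * exp (- t))" for n
      using X(1) unfolding real_norm_def by (intro AE_I2 log_bessel_bound) (auto intro: less_imp_le)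
  qed measurable
  then show "(\<lambda>n. log_bessel_integral (X n)) \<longlonglongrightarrow> - euler_mascheroni"
    by (simp add: log_bessel_integral_def log_Gamma_integral)
qed

text \<open>Convergence to 1 alone would not survive multiplication by ln q; a rate is needed. The
  inequality 1 - exp (- x) \<le> sqrt x is applied to x = q / t, because the linear bound would
  leave 1 / t, which is not integrable at the origin.\<close>

lemma bessel_integral_0_near:
  assumes q: "q > 0"
  shows "\<bar>bessel_integral 0 q - 1\<bar> \<le> sqrt q * Gamma (1/2)"
proof -
  have i: "integrable half_line (\<lambda>t. t powr 0 * exp (- t - q / t))" by (rule bessel_integrable[OF q])
  have i0: "integrable half_line (\<lambda>t. t powr 0 * exp (- t))" by (rule Gamma_integrable) simp
  have ih: "integrable half_line (\<lambda>t. sqrt q * (t powr (- 1/2) * exp (- t)))"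
    by (intro integrable_mult_right Gamma_integrable) simp
  have "(\<integral>t. t powr 0 * exp (- t) \<partial>half_line) = 1" using Gamma_integral[of 0] by simp
  then have "bessel_integral 0 q - 1 = (\<integral>t. t powr 0 * exp (- t - q / t) - t powr 0 * exp (- t) \<partial>half_line)"
    unfolding bessel_integral_def by (simp only: Bochner_Integration.integral_diff[OF i i0])
  also have "\<bar>\<dots>\<bar> \<le> (\<integral>t. sqrt q * (t powr (- 1/2) * exp (- t)) \<partial>half_line)"
    unfolding real_norm_def[symmetric]
  proof (rule Bochner_Integration.integral_norm_bound_integral[OF Bochner_Integration.integrable_diff[OF i i0] ih])
    fix t assume "t \<in> space half_line"
    then have t: "t > 0" by simp
    define x where "x = q / t"
    have x: "x > 0" using q t by (simp add: x_def)
    have "1 - exp (- x) \<le> sqrt x"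
    proof (cases "x \<le> 1")
      case True
      have "1 - exp (- x) \<le> x" using exp_ge_add_one_self[of "- x"] by simp
      also have "x = sqrt x * sqrt x" using x by simp
      also have "\<dots> \<le> sqrt x * 1" using True x by (intro mult_left_mono) auto
      finally show ?thesis by simp
    next
      case False
      then have "1 \<le> sqrt x" by simp
      then show ?thesis using exp_gt_zero[of "- x"] by linarith
    qed
    then have "(1 - exp (- x)) * exp (- t) \<le> sqrt x * exp (- t)" by (intro mult_right_mono) auto
    also have "sqrt x = sqrt q * t powr (- 1/2)"
      using t q by (simp add: x_def real_sqrt_divide powr_minus_divide powr_half_sqrt)
    finally have "(1 - exp (- x)) * exp (- t) \<le> sqrt q * (t powr (- 1/2) * exp (- t))" by (simp only: mult.assoc)
    moreover have "exp (- t - x) = exp (- x) * exp (- t)" by (simp flip: exp_add)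
    then have "(1 - exp (- x)) * exp (- t) = exp (- t) - exp (- t - x)" by (simp add: algebra_simps)
    moreover have "exp (- t - x) \<le> exp (- t)" using x by simp
    ultimately show "norm (t powr 0 * exp (- t - q / t) - t powr 0 * exp (- t)) \<le> sqrt q * (t powr (- 1/2) * exp (- t))"
      using t unfolding x_def[symmetric] by simp
  qed
  also have "\<dots> = sqrt q * Gamma (1/2)" using Gamma_integral[of "- 1/2"] by simp
  finally show ?thesis .
qed

text \<open>In Bessel terms: K_0(z) + ln (z/2) tends to - \<gamma> as z tends to 0. The logarithm
  comes with a factor tending to 1, which the rate just obtained permits to replace by 1.\<close>

lemma bessel_integral_asymptotic:
  "((\<lambda>q. bessel_integral (- 1) q + ln q) \<longlongrightarrow> - 2 * euler_mascheroni) (at_right 0)"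
proof -
  have ev: "eventually (\<lambda>q. q \<in> {0<..<1}) (at_right (0::real))"
    by (rule eventually_at_right_real) simp
  have small: "((\<lambda>q. ln q * (bessel_integral 0 q - 1)) \<longlongrightarrow> 0) (at_right 0)"
  proof (rule Lim_null_comparison)
    show "eventually (\<lambda>q. norm (ln q * (bessel_integral 0 q - 1)) \<le> \<bar>ln q\<bar> * (sqrt q * Gamma (1/2))) (at_right 0)"
      using ev by eventually_elim (simp add: abs_mult mult_left_mono bessel_integral_0_near)
    have "((\<lambda>q::real. \<bar>ln q\<bar> * sqrt q) \<longlongrightarrow> 0) (at_right 0)" by real_asymp
    from tendsto_mult_right[OF this, of "Gamma (1/2)"]
    show "((\<lambda>q::real. \<bar>ln q\<bar> * (sqrt q * Gamma (1/2))) \<longlongrightarrow> 0) (at_right 0)" by (simp add: mult.assoc)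
  qed
  have "((\<lambda>q. 2 * log_bessel_integral q - ln q * (bessel_integral 0 q - 1)) \<longlongrightarrow> 2 * (- euler_mascheroni) - 0) (at_right 0)"
    by (intro tendsto_diff tendsto_mult tendsto_const log_bessel_integral_limit small)
  moreover have "eventually (\<lambda>q. 2 * log_bessel_integral q - ln q * (bessel_integral 0 q - 1) = bessel_integral (- 1) q + ln q) (at_right 0)"
    using ev by eventually_elim (simp add: bessel_integral_log right_diff_distrib)
  ultimately show ?thesis by (simp add: tendsto_cong)
qed

text \<open>The integral and the series representation of K_0(2 sqrt q). Their difference
  \<open>D\<close> solves the Bessel equation and tends to 0 at the origin, since the asymptotics of
  the integral match the logarithm and the constant of the series;
  \<open>bessel_equation_unique\<close> then leaves only 0.\<close>

theorem bessel_integral_series: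
  assumes q: "q > 0"
  shows "bessel_integral (- 1) q / 2 = bessel_W q - (ln q / 2 + euler_mascheroni) * bessel_E q"
proof -
  let ?\<gamma> = "euler_mascheroni :: real"
  define D where "D x = bessel_integral (- 1) x / 2 - (bessel_W x - (ln x / 2 + ?\<gamma>) * bessel_E x)" for x
  define D1 where "D1 x = - bessel_integral (- 2) x / 2 - (bessel_W' x - (1 / (2 * x) * bessel_E x + (ln x / 2 + ?\<gamma>) * bessel_E' x))" for x
  have "D q = 0"
  proof (rule bessel_equation_unique[OF _ _ _ q])
    fix x :: real assume x: "x > 0"
    have b: "(bessel_integral (- 1) has_real_derivative - bessel_integral (- 2) x) (at x)"
      "(bessel_integral (- 2) has_real_derivative - bessel_integral (- 3) x) (at x)"
      using bessel_integral_deriv[OF x, of "- 1"] bessel_integral_deriv[OF x, of "- 2"] by simp_all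
    show "(D has_field_derivative D1 x) (at x)"
      unfolding D_def D1_def using x
      by (auto intro!: derivative_eq_intros b bessel_E_deriv bessel_W_deriv)
    \<comment> \<open>The products x E' and x W' have known derivatives, whereas E' and W' by
      themselves do not; naming the products keeps the differentiation from splitting them.\<close>
    define e where "e y = y * bessel_E' y" for y :: real
    define w where "w y = y * bessel_W' y" for y :: real
    have de: "(e has_real_derivative bessel_E x) (at x)"
      unfolding e_def[abs_def] by (rule bessel_E_theta_deriv)
    have ee: "bessel_E' x = e x / x" using x by (simp add: e_def)
    have dw: "(w has_real_derivative bessel_W x + bessel_E' x) (at x)"
      unfolding w_def[abs_def] by (rule bessel_W_theta_deriv)
    have "((\<lambda>x. - (x * bessel_integral (- 2) x) / 2 - (w x - (bessel_E x / 2 + (ln x / 2 + ?\<gamma>) * e x)))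
      has_field_derivative D x) (at x)"
      unfolding D_def bessel_integral_recurrence[OF x, symmetric] using x
      by (auto intro!: derivative_eq_intros b bessel_E_deriv de dw simp: ee field_simps)
    then have "((\<lambda>x. - (x * bessel_integral (- 2) x) / 2 - (x * bessel_W' x - (bessel_E x / 2 + (ln x / 2 + ?\<gamma>) * (x * bessel_E' x))))
      has_field_derivative D x) (at x)"
      by (simp only: e_def w_def)
    moreover have "eventually (\<lambda>x. - (x * bessel_integral (- 2) x) / 2 - (x * bessel_W' x - (bessel_E x / 2 + (ln x / 2 + ?\<gamma>) * (x * bessel_E' x)))
       = x * D1 x) (nhds x)"
    proof -
      have "eventually (\<lambda>y. y \<in> {0<..}) (nhds x)" using x by (intro eventually_nhds_in_open) auto
      then show ?thesis by eventually_elim (simp add: D1_def field_simps)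
    qed
    ultimately show "((\<lambda>x. x * D1 x) has_field_derivative D x) (at x)"
      by (subst (asm) DERIV_cong_ev[OF refl _ refl])
  next
    \<comment> \<open>The logarithm tends to infinity while E - 1 tends to 0; their product is
      written as x (ln x / 2 + \<gamma>), which vanishes in the limit, times the difference quotient
      of E at 0.\<close>
    have E: "((\<lambda>x. (bessel_E x - 1) / x) \<longlongrightarrow> bessel_E' 0) (at_right (0::real))"
      by (rule tendsto_mono[OF at_le[OF subset_UNIV]])
         (use bessel_E_deriv[of "0::real"] in \<open>simp add: has_field_derivative_iff\<close>)
    have xl: "((\<lambda>x::real. x * (ln x / 2 + ?\<gamma>)) \<longlongrightarrow> 0) (at_right 0)" by real_asymp
    have W: "(bessel_W \<longlongrightarrow> (0::real)) (at_right 0)"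
      by (rule tendsto_mono[OF at_le[OF subset_UNIV]])
         (use DERIV_isCont[OF bessel_W_deriv, of "0::real"] in \<open>simp add: isCont_def\<close>)
    have "((\<lambda>x. (bessel_integral (- 1) x + ln x) / 2 + ?\<gamma> - bessel_W x + (x * (ln x / 2 + ?\<gamma>)) * ((bessel_E x - 1) / x))
       \<longlongrightarrow> (- 2 * ?\<gamma>) / 2 + ?\<gamma> - 0 + 0 * bessel_E' 0) (at_right 0)"
      by (intro tendsto_add tendsto_diff tendsto_mult tendsto_const tendsto_divide bessel_integral_asymptotic W E xl) simp
    moreover have "eventually (\<lambda>x. (bessel_integral (- 1) x + ln x) / 2 + ?\<gamma> - bessel_W x + (x * (ln x / 2 + ?\<gamma>)) * ((bessel_E x - 1) / x) = D x)
       (at_right 0)"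
    proof -
      have "eventually (\<lambda>q. q \<in> {0<..<1}) (at_right (0::real))"
        by (rule eventually_at_right_real) simp
      then show ?thesis by eventually_elim (simp add: D_def field_simps)
    qed
    ultimately show "(D \<longlongrightarrow> 0) (at_right 0)" by (simp add: tendsto_cong)
  qed
  then show ?thesis by (simp add: D_def)
qed

subsection \<open>The heat kernel representation\<close>

lemma half_line_scale:
  fixes g :: "real \<Rightarrow> real"
  assumes c: "c > 0"
  shows "(\<integral>t. g t \<partial>half_line) = c * (\<integral>s. g (c * s) \<partial>half_line)"
proof -
  have "indicator {0<..} (0 + c * s) = (indicator {0<..} s :: real)" for s
    using c by (auto simp: indicator_def zero_less_mult_iff)
  then show ?thesis
    unfolding half_line_integral_eq set_lebesgue_integral_def
    using lborel_integral_real_affine[of c "\<lambda>t. indicator {0<..} t *\<^sub>R g t" 0] c by simp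
qed

text \<open>The Gaussian heat kernel of R^p at distance r, damped by exp (- \<kappa>^2 t) and
  integrated over time: the fundamental solution of \<kappa>^2 - Laplacian in R^p.\<close>

definition heat_kernel :: "real \<Rightarrow> real \<Rightarrow> real \<Rightarrow> real" where
  "heat_kernel p \<kappa> r = (\<integral>t. (4 * pi * t) powr (- p / 2) * exp (- \<kappa>\<^sup>2 * t - r\<^sup>2 / (4 * t)) \<partial>half_line)"

lemma heat_kernel_nonneg: "heat_kernel p \<kappa> r \<ge> 0"
  unfolding heat_kernel_def by (rule integral_nonneg_AE) simp

lemma heat_kernel_bessel:
  assumes \<kappa>: "\<kappa> > 0"
  shows "heat_kernel p \<kappa> r = \<kappa> powr (p - 2) * (4 * pi) powr (- p / 2) * bessel_integral (- p / 2) ((\<kappa> * r / 2)\<^sup>2)"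
proof -
  \<comment> \<open>Measuring time in units of 1 / \<kappa>^2 leaves (\<kappa> r / 2)^2 as the only
    parameter in the exponent.\<close>
  let ?c = "1 / \<kappa>\<^sup>2"
  have c: "?c > 0" using \<kappa> by simp
  have "heat_kernel p \<kappa> r = ?c * (\<integral>s. (4 * pi * (?c * s)) powr (- p / 2) * exp (- \<kappa>\<^sup>2 * (?c * s) - r\<^sup>2 / (4 * (?c * s))) \<partial>half_line)"
    unfolding heat_kernel_def by (rule half_line_scale[OF c])
  also have "(\<integral>s. (4 * pi * (?c * s)) powr (- p / 2) * exp (- \<kappa>\<^sup>2 * (?c * s) - r\<^sup>2 / (4 * (?c * s))) \<partial>half_line) =
     (\<integral>s. (4 * pi) powr (- p / 2) * \<kappa> powr p * (s powr (- p / 2) * exp (- s - (\<kappa> * r / 2)\<^sup>2 / s)) \<partial>half_line)"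
  proof (rule Bochner_Integration.integral_cong[OF refl])
    fix s assume "s \<in> space half_line"
    then have s: "s > 0" by simp
    have "?c powr (- p / 2) = \<kappa> powr p"
    proof -
      have "?c = \<kappa> powr (- 2)" using \<kappa> by (simp add: powr_minus_divide)
      then have "?c powr (- p / 2) = \<kappa> powr (- 2 * (- p / 2))" by (simp only: powr_powr)
      then show ?thesis by simp
    qed
    then have "(4 * pi * (?c * s)) powr (- p / 2) = (4 * pi) powr (- p / 2) * \<kappa> powr p * s powr (- p / 2)"
      using s c by (simp only: powr_mult mult.assoc)
    moreover have "- \<kappa>\<^sup>2 * (?c * s) - r\<^sup>2 / (4 * (?c * s)) = - s - (\<kappa> * r / 2)\<^sup>2 / s"
      using \<kappa> s by (simp add: power_mult_distrib power_divide field_simps)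
    ultimately show "(4 * pi * (?c * s)) powr (- p / 2) * exp (- \<kappa>\<^sup>2 * (?c * s) - r\<^sup>2 / (4 * (?c * s))) =
        (4 * pi) powr (- p / 2) * \<kappa> powr p * (s powr (- p / 2) * exp (- s - (\<kappa> * r / 2)\<^sup>2 / s))"
      by (simp only: mult.assoc)
  qed
  also have "?c * \<dots> = \<kappa> powr (p - 2) * (4 * pi) powr (- p / 2) * bessel_integral (- p / 2) ((\<kappa> * r / 2)\<^sup>2)"
    using \<kappa> unfolding integral_mult_right_zero bessel_integral_def by (simp add: powr_diff)
  finally show ?thesis .
qed

lemma heat_kernel_3:
  assumes "\<kappa> > 0" "r > 0"
  shows "heat_kernel 3 \<kappa> r = exp (- \<kappa> * r) / (4 * pi * r)"
proof -
  have q: "(\<kappa> * r / 2)\<^sup>2 > 0" "sqrt ((\<kappa> * r / 2)\<^sup>2) = \<kappa> * r / 2" using assms by simp_all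
  have "(4 * pi) powr (- 3 / 2) = 1 / (4 * pi * sqrt (4 * pi))"
  proof -
    have "(4 * pi) powr (- 3 / 2) = 1 / (4 * pi) powr (1 + 1 / 2)" by (simp add: powr_minus_divide)
    also have "(4 * pi) powr (1 + 1 / 2) = 4 * pi * sqrt (4 * pi)" unfolding powr_add by (simp add: powr_half_sqrt)
    finally show ?thesis .
  qed
  then have "heat_kernel 3 \<kappa> r = \<kappa> * (1 / (4 * pi * sqrt (4 * pi))) * (sqrt pi * exp (- 2 * (\<kappa> * r / 2)) / (\<kappa> * r / 2))"
    unfolding heat_kernel_bessel[OF assms(1), of 3 r] bessel_integral_minus_three_half[OF q(1)] q(2)
    using assms by simp
  also have "\<dots> = exp (- \<kappa> * r) / (4 * pi * r)"
    using assms by (simp add: real_sqrt_mult)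
  finally show ?thesis .
qed

lemma heat_kernel_2:
  assumes "\<kappa> > 0" "r > 0"
  shows "heat_kernel 2 \<kappa> r = (bessel_W ((\<kappa> * r / 2)\<^sup>2)
     - (ln (\<kappa> / 2) + ln r + euler_mascheroni) * bessel_E ((\<kappa> * r / 2)\<^sup>2)) / (2 * pi)"
proof -
  have q: "(\<kappa> * r / 2)\<^sup>2 > 0" using assms by simp
  have "ln ((\<kappa> * r / 2)\<^sup>2) / 2 = ln (\<kappa> / 2 * r)" using assms by (simp add: ln_realpow)
  also have "\<dots> = ln (\<kappa> / 2) + ln r" using assms ln_mult_pos[of "\<kappa> / 2" r] by simp
  finally have "bessel_integral (- 1) ((\<kappa> * r / 2)\<^sup>2) / 2 = bessel_W ((\<kappa> * r / 2)\<^sup>2)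
     - (ln (\<kappa> / 2) + ln r + euler_mascheroni) * bessel_E ((\<kappa> * r / 2)\<^sup>2)"
    using bessel_integral_series[OF q] by simp
  moreover have "heat_kernel 2 \<kappa> r = bessel_integral (- 1) ((\<kappa> * r / 2)\<^sup>2) / 2 / (2 * pi)"
    using heat_kernel_bessel[OF assms(1), of 2 r] assms by (simp add: powr_minus_divide)
  ultimately show ?thesis by (simp only:)
qed


subsection \<open>The screen kernel for complex wave numbers\<close>

text \<open>The fundamental solution restricted to the screen of dimension \<open>m\<close>, for \<open>\<mu> = - i k\<close>, continued
  analytically in \<open>\<mu>\<close> to the half plane of positive real part.\<close>

definition screen_kernel :: "nat \<Rightarrow> complex \<Rightarrow> real \<Rightarrow> complex" where
  "screen_kernel m \<mu> r =
     (if m = 2 then exp (- \<mu> * of_real r) / of_real (4 * pi * r)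
      else (bessel_W ((\<mu> * of_real r / 2)\<^sup>2)
        - (Ln (\<mu> / 2) + of_real (ln r) + euler_mascheroni) * bessel_E ((\<mu> * of_real r / 2)\<^sup>2)) / of_real (2 * pi))"

text \<open>On the positive real axis the closed formula coincides with the time integral of heat
  kernels. The continuation in \<mu> starts from this identity, and the case \<kappa> = 1 supplies
  the reference kernel for the mapping properties.\<close>

lemma screen_kernel_heat:
  assumes m: "m \<in> {1, 2}" and \<kappa>: "\<kappa> > 0" and r: "r > 0"
  shows "screen_kernel m (of_real \<kappa>) r = of_real (heat_kernel (real m + 1) \<kappa> r)"
proof (cases "m = 2")
  case True
  have "exp (- complex_of_real \<kappa> * of_real r) = of_real (exp (- \<kappa> * r))"
    by (simp add: exp_of_real[symmetric])
  then show ?thesis using True heat_kernel_3[OF \<kappa> r] by (simp add: screen_kernel_def)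
next
  case False
  then have m1: "m = 1" using m by simp
  have L: "Ln (complex_of_real \<kappa> / 2) = of_real (ln (\<kappa> / 2))"
    using Ln_of_real[of "\<kappa> / 2"] \<kappa> by simp
  have q: "(complex_of_real \<kappa> * of_real r / 2)\<^sup>2 = of_real ((\<kappa> * r / 2)\<^sup>2)" by simp
  show ?thesis
    using heat_kernel_2[OF \<kappa> r] m1 False
    unfolding screen_kernel_def L q bessel_E_of_real bessel_W_of_real by simp
qed

lemma bessel_E_holomorphic: "bessel_E holomorphic_on S"
  unfolding holomorphic_on_def field_differentiable_def
  by (intro ballI exI, rule has_field_derivative_at_within[OF bessel_E_deriv])

lemma bessel_W_holomorphic: "bessel_W holomorphic_on S"
  unfolding holomorphic_on_def field_differentiable_def
  by (intro ballI exI, rule has_field_derivative_at_within[OF bessel_W_deriv])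

lemma bessel_E_holomorphic_compose [holomorphic_intros]:
  "f holomorphic_on S \<Longrightarrow> (\<lambda>z. bessel_E (f z)) holomorphic_on S"
  using holomorphic_on_compose[OF _ bessel_E_holomorphic] by (simp add: o_def)

lemma bessel_W_holomorphic_compose [holomorphic_intros]:
  "f holomorphic_on S \<Longrightarrow> (\<lambda>z. bessel_W (f z)) holomorphic_on S"
  using holomorphic_on_compose[OF _ bessel_W_holomorphic] by (simp add: o_def)

lemma screen_kernel_holomorphic: "(\<lambda>\<mu>. screen_kernel m \<mu> r) holomorphic_on (- \<real>\<^sub>\<le>\<^sub>0)"
proof (cases "m = 2")
  case True
  show ?thesis
  proof (cases "r = 0")
    case False
    then show ?thesis unfolding screen_kernel_def using True
      by (simp, intro holomorphic_intros) auto
  qed (simp add: screen_kernel_def True)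
next
  case False
  have L: "(\<lambda>\<mu>. Ln (\<mu> / 2)) holomorphic_on (- \<real>\<^sub>\<le>\<^sub>0)"
    by (intro holomorphic_intros) (auto simp: complex_nonpos_Reals_iff)
  show ?thesis
    unfolding screen_kernel_def using False
    by (simp, intro holomorphic_intros L) auto
qed

lemma screen_kernel_measurable [measurable]: "screen_kernel m \<mu> \<in> borel_measurable borel"
proof -
  have "bessel_E \<in> borel_measurable (borel :: complex measure)"
    by (intro borel_measurable_continuous_onI holomorphic_on_imp_continuous_on bessel_E_holomorphic)
  moreover have "bessel_W \<in> borel_measurable (borel :: complex measure)"
    by (intro borel_measurable_continuous_onI holomorphic_on_imp_continuous_on bessel_W_holomorphic)
  ultimately have m: "(\<lambda>r. bessel_E ((\<mu> * complex_of_real r / 2)\<^sup>2)) \<in> borel_measurable borel"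
    "(\<lambda>r. bessel_W ((\<mu> * complex_of_real r / 2)\<^sup>2)) \<in> borel_measurable borel"
    by (auto intro!: measurable_compose[of _ borel borel bessel_E] measurable_compose[of _ borel borel bessel_W])
  have m2: "(\<lambda>r. exp (- \<mu> * complex_of_real r) / of_real (4 * pi * r)) \<in> borel_measurable borel" by measurable
  have m1: "(\<lambda>r. (bessel_W ((\<mu> * of_real r / 2)\<^sup>2)
      - (Ln (\<mu> / 2) + of_real (ln r) + euler_mascheroni) * bessel_E ((\<mu> * of_real r / 2)\<^sup>2)) / of_real (2 * pi))
      \<in> borel_measurable borel"
    by (intro borel_measurable_divide borel_measurable_diff borel_measurable_times borel_measurable_add m) measurable
  have eq: "screen_kernel m \<mu> = (if m = 2 then (\<lambda>r. exp (- \<mu> * complex_of_real r) / of_real (4 * pi * r))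
    else (\<lambda>r. (bessel_W ((\<mu> * of_real r / 2)\<^sup>2)
      - (Ln (\<mu> / 2) + of_real (ln r) + euler_mascheroni) * bessel_E ((\<mu> * of_real r / 2)\<^sup>2)) / of_real (2 * pi)))"
    by (rule ext) (simp only: screen_kernel_def if_distribR split: if_split)
  show ?thesis
  proof (cases "m = 2")
    case True
    show ?thesis unfolding eq if_P[OF True] by (rule m2)
  next
    case False
    show ?thesis unfolding eq if_not_P[OF False] by (rule m1)
  qed
qed

lemma screen_kernel_2_bound:
  assumes "Re \<mu> \<ge> 0" "0 < r" "r \<le> R"
  shows "cmod (screen_kernel 2 \<mu> r) \<le> exp R * (1 + heat_kernel 3 1 r)"
proof -
  have "cmod (screen_kernel 2 \<mu> r) = exp (- Re \<mu> * r) / (4 * pi * r)"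
    using assms by (simp add: screen_kernel_def norm_divide norm_mult)
  also have "\<dots> \<le> 1 / (4 * pi * r)"
    using assms by (intro divide_right_mono) auto
  also have "\<dots> = exp r * heat_kernel 3 1 r"
    using heat_kernel_3[of 1 r] assms by (simp flip: exp_add)
  also have "\<dots> \<le> exp R * (1 + heat_kernel 3 1 r)"
    using assms heat_kernel_nonneg[of 3 1 r] by (intro mult_mono) auto
  finally show ?thesis .
qed

text \<open>The logarithmic singularity is measured by the heat kernel itself, so that 1 +
  \<open>heat_kernel\<close> can be the common majorant in both dimensions. For r < 1 the bound is
  read off the series, where E \<ge> 1 and W \<ge> 0; for r \<ge> 1 the logarithm is at most ln
  R.\<close>

lemma abs_ln_le_heat_kernel:
  assumes "R > 0"
  obtains c where "c \<ge> 0" "\<And>r. 0 < r \<Longrightarrow> r \<le> R \<Longrightarrow> \<bar>ln r\<bar> \<le> 2 * pi * heat_kernel 2 1 r + c"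
proof -
  define c where "c = \<bar>ln R\<bar> + \<bar>euler_mascheroni - ln 2\<bar> * bessel_E ((R / 2)\<^sup>2)"
  have E1: "bessel_E ((R / 2)\<^sup>2) \<ge> 1" by (rule bessel_E_ge_1) simp
  show thesis
  proof
    show "c \<ge> 0" using E1 by (simp add: c_def)
    fix r assume r: "0 < r" "r \<le> R"
    define q where "q = (r / 2)\<^sup>2"
    have q: "0 \<le> q" "q \<le> (R / 2)\<^sup>2" using r by (auto simp: q_def intro!: power_mono)
    have E: "1 \<le> bessel_E q" "bessel_E q \<le> bessel_E ((R / 2)\<^sup>2)"
      using q by (auto intro: bessel_E_ge_1 bessel_E_mono)
    have W: "0 \<le> bessel_W q" using bessel_W_mono[of 0 q] q by simp
    have hk: "2 * pi * heat_kernel 2 1 r = bessel_W q - ln r * bessel_E q - (euler_mascheroni - ln 2) * bessel_E q"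
    proof -
      have "2 * pi * heat_kernel 2 1 r = bessel_W q - (ln (1 / 2) + ln r + euler_mascheroni) * bessel_E q"
        using heat_kernel_2[of 1 r] r by (simp add: q_def)
      also have "ln (1 / 2 :: real) = - ln 2" by (simp add: ln_div)
      finally show ?thesis by (simp add: algebra_simps)
    qed
    have hk0: "2 * pi * heat_kernel 2 1 r \<ge> 0" using heat_kernel_nonneg[of 2 1 r] by simp
    show "\<bar>ln r\<bar> \<le> 2 * pi * heat_kernel 2 1 r + c"
    proof (cases "ln r \<ge> 0")
      case True
      then have "\<bar>ln r\<bar> \<le> \<bar>ln R\<bar>" using r by simp
      moreover have "0 \<le> \<bar>euler_mascheroni - ln 2\<bar> * bessel_E ((R / 2)\<^sup>2)" using E1 by simp
      ultimately show ?thesis using hk0 unfolding c_def by linarith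
    next
      case False
      have "- ln r * 1 \<le> - ln r * bessel_E q" using False E(1) by (intro mult_left_mono) auto
      moreover have "(euler_mascheroni - ln 2) * bessel_E q \<le> \<bar>euler_mascheroni - ln 2\<bar> * bessel_E ((R / 2)\<^sup>2)"
        using E by (intro mult_mono) auto
      moreover have "0 \<le> \<bar>ln R\<bar>" by simp
      ultimately show ?thesis using False W hk unfolding c_def by linarith
    qed
  qed
qed

text \<open>Uniform on half annuli that include the imaginary axis: the same bound serves holomorphy
  inside the half plane and the limit \<mu> to - i k. The lower bound on |\<mu>| is there for the
  logarithm of \<mu> in the case m = 1.\<close>

lemma screen_kernel_bound:
  assumes m: "m \<in> {1, 2}" and a: "0 < a" "a \<le> b" and R: "R > 0"
  obtains C where "C \<ge> 0" "\<And>\<mu> r. a \<le> cmod \<mu> \<Longrightarrow> cmod \<mu> \<le> b \<Longrightarrow> Re \<mu> \<ge> 0 \<Longrightarrow> 0 < r \<Longrightarrow> r \<le> R \<Longrightarrow>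
    cmod (screen_kernel m \<mu> r) \<le> C * (1 + heat_kernel (real m + 1) 1 r)"
proof (cases "m = 2")
  case True
  show thesis
    by (rule that[of "exp R"]) (use screen_kernel_2_bound True in auto)
next
  case False
  then have m1: "m = 1" using m by simp
  obtain c where c: "c \<ge> 0" "\<And>r. 0 < r \<Longrightarrow> r \<le> R \<Longrightarrow> \<bar>ln r\<bar> \<le> 2 * pi * heat_kernel 2 1 r + c"
    using abs_ln_le_heat_kernel[OF R] by blast
  define Q where "Q = (b * R / 2)\<^sup>2"
  define l where "l = \<bar>ln (a / 2)\<bar> + \<bar>ln (b / 2)\<bar> + pi"
  define g where "g = \<bar>euler_mascheroni :: real\<bar>"
  define EQ where "EQ = bessel_E Q"
  define WQ where "WQ = bessel_W Q"
  have Q0: "Q \<ge> 0" by (simp add: Q_def)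
  have EQ: "EQ \<ge> 1" unfolding EQ_def by (rule bessel_E_ge_1[OF Q0])
  have WQ: "WQ \<ge> 0" unfolding WQ_def using bessel_W_mono[of 0 Q] Q0 by simp
  have l0: "l \<ge> 0" "g \<ge> 0" by (simp_all add: l_def g_def)
  define C where "C = WQ + (l + g + c) * EQ + 2 * pi * EQ"
  have C0: "C \<ge> 0" using WQ EQ l0 c(1) by (simp add: C_def)
  show thesis
  proof (rule that[OF C0])
    fix \<mu> :: complex and r :: real
    assume \<mu>: "a \<le> cmod \<mu>" "cmod \<mu> \<le> b" "Re \<mu> \<ge> 0" and r: "0 < r" "r \<le> R"
    let ?z = "(\<mu> * of_real r / 2)\<^sup>2"
    have \<mu>0: "cmod \<mu> > 0" using \<mu> a by linarith
    have z: "cmod ?z \<le> Q"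
    proof -
      have "cmod \<mu> * r / 2 \<le> b * R / 2" using \<mu> r a by (intro divide_right_mono mult_mono) auto
      then have "(cmod \<mu> * r / 2)\<^sup>2 \<le> Q" unfolding Q_def using r by (intro power_mono) auto
      then show ?thesis using r by (simp add: norm_power norm_mult norm_divide)
    qed
    have E: "cmod (bessel_E ?z) \<le> EQ"
      unfolding EQ_def by (rule order_trans[OF bessel_E_norm_le bessel_E_mono[OF norm_ge_zero z]])
    have W: "cmod (bessel_W ?z) \<le> WQ"
      unfolding WQ_def by (rule order_trans[OF bessel_W_norm_le bessel_W_mono[OF norm_ge_zero z]])
    have L: "cmod (Ln (\<mu> / 2)) \<le> l"
    proof -
      have nz: "\<mu> / 2 \<noteq> 0" using \<mu>0 by auto
      have "cmod (Ln (\<mu> / 2)) \<le> \<bar>Re (Ln (\<mu> / 2))\<bar> + \<bar>Im (Ln (\<mu> / 2))\<bar>" by (rule cmod_le)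
      moreover have "\<bar>Im (Ln (\<mu> / 2))\<bar> \<le> pi" using mpi_less_Im_Ln[OF nz] Im_Ln_le_pi[OF nz] by linarith
      moreover have "Re (Ln (\<mu> / 2)) = ln (cmod \<mu> / 2)" using Re_Ln[OF nz] by (simp add: norm_divide)
      moreover have "ln (a / 2) \<le> ln (cmod \<mu> / 2)" "ln (cmod \<mu> / 2) \<le> ln (b / 2)"
        using \<mu> a \<mu>0 by simp_all
      ultimately show ?thesis unfolding l_def by linarith
    qed
    have h0: "heat_kernel 2 1 r \<ge> 0" by (rule heat_kernel_nonneg)
    have LL: "cmod (Ln (\<mu> / 2) + of_real (ln r) + euler_mascheroni) \<le> l + (2 * pi * heat_kernel 2 1 r + c) + g"
    proof -
      have "cmod (Ln (\<mu> / 2) + of_real (ln r) + euler_mascheroni) \<le>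
        cmod (Ln (\<mu> / 2)) + cmod (of_real (ln r)) + cmod euler_mascheroni"
        by (intro order_trans[OF norm_triangle_ineq] add_mono norm_triangle_ineq order_refl)
      moreover have "cmod (euler_mascheroni :: complex) = g"
        unfolding g_def of_real_euler_mascheroni[symmetric, where 'a = complex] by (simp only: norm_of_real)
      ultimately show ?thesis using L c(2)[OF r] by simp
    qed
    have "cmod (screen_kernel m \<mu> r) * (2 * pi) = cmod (bessel_W ?z - (Ln (\<mu> / 2) + of_real (ln r) + euler_mascheroni) * bessel_E ?z)"
      using m1 by (simp add: screen_kernel_def norm_divide)
    also have "\<dots> \<le> cmod (bessel_W ?z) + cmod (Ln (\<mu> / 2) + of_real (ln r) + euler_mascheroni) * cmod (bessel_E ?z)"
      unfolding norm_mult[symmetric] by (rule norm_triangle_ineq4)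
    also have "\<dots> \<le> WQ + (l + (2 * pi * heat_kernel 2 1 r + c) + g) * EQ"
      using l0 c(1) h0 by (intro add_mono W mult_mono LL E) auto
    also have "\<dots> = (WQ + (l + g + c) * EQ) + (2 * pi * EQ) * heat_kernel 2 1 r" by (simp add: algebra_simps)
    also have "\<dots> \<le> C * 1 + C * heat_kernel 2 1 r"
      using h0 WQ EQ l0 c(1) by (intro add_mono mult_right_mono) (auto simp: C_def)
    finally have "cmod (screen_kernel m \<mu> r) * (2 * pi) \<le> C * (1 + heat_kernel 2 1 r)" by (simp add: distrib_left)
    moreover have "cmod (screen_kernel m \<mu> r) * 1 \<le> cmod (screen_kernel m \<mu> r) * (2 * pi)"
      using pi_ge_two by (intro mult_left_mono) auto
    ultimately show "cmod (screen_kernel m \<mu> r) \<le> C * (1 + heat_kernel (real m + 1) 1 r)"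
      using m1 by simp
  qed
qed

section \<open>Identification with the Helmholtz fundamental solution\<close>

lemma bessel_J0_eq: "complex_of_real (bessel_J0 x) = bessel_E (- (of_real x / 2)\<^sup>2)"
proof -
  have "bessel_J0 x = bessel_E (- (x / 2)\<^sup>2)"
    unfolding bessel_J0_def bessel_E_def
  proof (rule suminf_cong)
    fix n
    have "(- (x / 2)\<^sup>2) ^ n = (-1) ^ n * (x / 2) ^ (2 * n)"
      by (subst power_minus) (simp only: power_mult)
    then show "(-1) ^ n * (x / 2) ^ (2 * n) / (fact n)\<^sup>2 = 1 / (fact n)\<^sup>2 * (- (x / 2)\<^sup>2) ^ n"
      by simp
  qed
  then show ?thesis
    using bessel_E_of_real[of "- (x / 2)\<^sup>2", where 'a = complex] by simp
qed

lemma bessel_W_neg: "complex_of_real (\<Sum>j. (-1) ^ j * harm j * (x / 2) ^ (2 * j) / (fact j)\<^sup>2) = bessel_W (- (of_real x / 2)\<^sup>2)"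
proof -
  have "(\<Sum>j. (-1) ^ j * harm j * (x / 2) ^ (2 * j) / (fact j)\<^sup>2) = bessel_W (- (x / 2)\<^sup>2)"
    unfolding bessel_W_def
  proof (rule suminf_cong)
    fix n
    have "(- (x / 2)\<^sup>2) ^ n = (-1) ^ n * (x / 2) ^ (2 * n)"
      by (subst power_minus) (simp only: power_mult)
    then show "(-1) ^ n * harm n * (x / 2) ^ (2 * n) / (fact n)\<^sup>2 = harm n / (fact n)\<^sup>2 * (- (x / 2)\<^sup>2) ^ n"
      by simp
  qed
  then show ?thesis
    using bessel_W_of_real[of "- (x / 2)\<^sup>2", where 'a = complex] by simp
qed

text \<open>For n = 2 the principal logarithm of - i k / 2 contributes - i pi / 2, and this term is
  precisely the J_0 part of the Hankel function; the remaining terms make up the Y_0 part. For n = 3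
  only the sign convention \<mu> = - i k is involved.\<close>

lemma screen_kernel_fundamental_solution:
  fixes x y :: "real^'m::finite"
  assumes m: "CARD('m) \<in> {1, 2}" and k: "k > 0" and xy: "x \<noteq> y"
  shows "screen_kernel CARD('m) (- \<i> * of_real k) (norm (x - y)) = fundamental_solution k (x, 0 :: real) (y, 0)"
proof -
  have n: "norm ((x, 0 :: real) - (y, 0)) = norm (x - y)" by (simp add: norm_Pair)
  define r where "r = norm (x - y)"
  have r: "r > 0" using xy by (simp add: r_def)
  have D: "DIM((real^'m) \<times> real) = CARD('m) + 1" by simp
  show ?thesis
  proof (cases "CARD('m) = 2")
    case True
    then show ?thesis
      unfolding screen_kernel_def fundamental_solution_def n D by (simp add: mult_ac)
  next
    case False
    then have m1: "CARD('m) = 1" using m by simp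
    have L: "Ln (- \<i> * of_real k / 2) = of_real (ln (k / 2)) - \<i> * of_real pi / 2"
    proof -
      have "Ln (- \<i> * of_real k / 2) = Ln (of_real (k / 2) * (- \<i>))" by (simp add: mult.commute)
      also have "\<dots> = of_real (ln (k / 2)) + Ln (- \<i>)" using k Ln_times_of_real[of "k / 2" "- \<i>"] Ln_of_real[of "k / 2"] by (simp only: half_gt_zero neg_equal_0_iff_equal complex_i_not_zero not_False_eq_True simp_thms)
      also have "Ln (- \<i>) = - (\<i> * of_real pi / 2)" using Ln_minus_ii by simp
      finally show ?thesis by simp
    qed
    have z: "(- \<i> * of_real k * of_real r / 2)\<^sup>2 = - (complex_of_real (k * r) / 2)\<^sup>2"
      by (simp add: power_mult_distrib power_divide)
    have ln: "ln (k * r / 2) = ln (k / 2) + ln r" using k r ln_mult_pos[of "k / 2" r] by simp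
    have g: "(euler_mascheroni :: complex) = of_real euler_mascheroni" by simp
    define J where "J = bessel_E (- (complex_of_real (k * r) / 2)\<^sup>2)"
    define W where "W = bessel_W (- (complex_of_real (k * r) / 2)\<^sup>2)"
    define l where "l = complex_of_real (ln (k / 2) + ln r)"
    have Y: "complex_of_real (bessel_Y0 (k * r)) = 2 / of_real pi * ((l + euler_mascheroni) * J - W)"
      unfolding bessel_Y0_def J_def W_def l_def bessel_W_neg[symmetric] bessel_J0_eq[symmetric] ln
      by simp
    have "fundamental_solution k (x, 0 :: real) (y, 0) = \<i> / 4 * (J + \<i> * (2 / of_real pi * ((l + euler_mascheroni) * J - W)))"
      using m1 unfolding fundamental_solution_def n D r_def[symmetric] hankel1_0_def Y
      by (simp add: bessel_J0_eq J_def)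
    also have "\<dots> = (W - (l - \<i> * of_real pi / 2 + euler_mascheroni) * J) / of_real (2 * pi)"
      by (simp add: field_simps)
    also have "\<dots> = screen_kernel CARD('m) (- \<i> * of_real k) r"
      using m1 unfolding screen_kernel_def L z J_def W_def l_def by simp
    finally show ?thesis by (simp only: r_def)
  qed
qed

section \<open>Lipschitz continuity of kernel differences\<close>

lemma entire_lipschitz:
  fixes f :: "complex \<Rightarrow> complex"
  assumes "f holomorphic_on UNIV"
  obtains C where "C \<ge> 0" "\<And>z w. cmod z \<le> R \<Longrightarrow> cmod w \<le> R \<Longrightarrow> cmod (f z - f w) \<le> C * cmod (z - w)"
proof -
  have "continuous_on (cball 0 R) (deriv f)"
    by (intro holomorphic_on_imp_continuous_on holomorphic_on_subset[OF holomorphic_deriv[OF assms]]) auto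
  then have "bounded (deriv f ` cball 0 R)" by (intro compact_imp_bounded compact_continuous_image) auto
  then obtain B where "\<forall>y\<in>deriv f ` cball 0 R. cmod y \<le> B" unfolding bounded_iff by blast
  then have B: "cmod (deriv f z) \<le> B" if "z \<in> cball 0 R" for z using that by blast
  show thesis
  proof (rule that[of "max B 0"])
    fix z w assume zw: "cmod z \<le> R" "cmod w \<le> R"
    show "cmod (f z - f w) \<le> max B 0 * cmod (z - w)"
    proof (rule field_differentiable_bound[of "cball 0 R" f "deriv f"])
      show "(f has_field_derivative deriv f u) (at u within cball 0 R)" for u
        by (rule has_field_derivative_at_within[OF holomorphic_derivI[OF assms open_UNIV UNIV_I]])
      show "cmod (deriv f u) \<le> max B 0" if "u \<in> cball 0 R" for u using B[OF that] by simp
    qed (use zw in auto)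
  qed simp
qed

text \<open>The numerator vanishes at 0, so the quotient extends to an entire function; the
  singularities 1 / r of the two kernels cancel.\<close>

lemma exp_difference_quotient_lipschitz:
  obtains C where "C \<ge> 0" "\<And>r s. 0 < r \<Longrightarrow> r \<le> R \<Longrightarrow> 0 < s \<Longrightarrow> s \<le> R \<Longrightarrow>
    cmod ((exp (a * of_real r) - exp (b * of_real r)) / of_real r - (exp (a * of_real s) - exp (b * of_real s)) / of_real s)
      \<le> C * \<bar>r - s\<bar>"
proof -
  define g where "g z = exp (a * z) - exp (b * z)" for z :: complex
  define f where "f z = (if z = 0 then deriv g 0 else g z / z)" for z :: complex
  have g: "g holomorphic_on UNIV" unfolding g_def by (intro holomorphic_intros)
  have "f holomorphic_on UNIV"
    by (rule pole_theorem_0[OF g, of 0]) (auto simp: f_def g_def)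
  then obtain C where C: "C \<ge> 0" "\<And>z w. cmod z \<le> R \<Longrightarrow> cmod w \<le> R \<Longrightarrow> cmod (f z - f w) \<le> C * cmod (z - w)"
    using entire_lipschitz[of f R] by blast
  show thesis
  proof (rule that[OF C(1)])
    fix r s assume "0 < r" "r \<le> R" "0 < s" "s \<le> R"
    then show "cmod ((exp (a * of_real r) - exp (b * of_real r)) / of_real r - (exp (a * of_real s) - exp (b * of_real s)) / of_real s)
      \<le> C * \<bar>r - s\<bar>"
      using C(2)[of "of_real r" "of_real s"] by (simp add: f_def g_def flip: of_real_diff)
  qed
qed

text \<open>The factor of the logarithm is even and vanishes at 0, so it is O(r^2) and its
  derivative O(r). In the derivative Q / r + ln r Q' of the product both terms are then bounded, the
  second because r ln r is.\<close>

lemma log_times_even_lipschitz: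
  assumes R: "R > 0"
  obtains C where "C \<ge> 0" "\<And>r s. 0 < r \<Longrightarrow> r \<le> R \<Longrightarrow> 0 < s \<Longrightarrow> s \<le> R \<Longrightarrow>
    cmod (of_real (ln r) * (bessel_E ((a * of_real r)\<^sup>2) - bessel_E ((b * of_real r)\<^sup>2))
       - of_real (ln s) * (bessel_E ((a * of_real s)\<^sup>2) - bessel_E ((b * of_real s)\<^sup>2))) \<le> C * \<bar>r - s\<bar>"
proof -
  define Q where "Q z = bessel_E ((a * z)\<^sup>2) - bessel_E ((b * z)\<^sup>2)" for z :: complex
  define Q' where "Q' z = bessel_E' ((a * z)\<^sup>2) * (2 * a\<^sup>2 * z) - bessel_E' ((b * z)\<^sup>2) * (2 * b\<^sup>2 * z)" for z :: complex
  have Qh: "Q holomorphic_on UNIV" unfolding Q_def by (intro holomorphic_intros)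
  have Qd: "(Q has_field_derivative Q' z) (at z)" for z
    unfolding Q_def Q'_def
    by (auto intro!: derivative_eq_intros DERIV_chain2[OF bessel_E_deriv] simp: power2_eq_square)
  have dQ: "deriv Q = Q'" by (rule ext) (rule DERIV_imp_deriv[OF Qd])
  have Q'h: "Q' holomorphic_on UNIV" using holomorphic_deriv[OF Qh] unfolding dQ by simp
  obtain A where A: "A \<ge> 0" "\<And>z w. cmod z \<le> R \<Longrightarrow> cmod w \<le> R \<Longrightarrow> cmod (Q' z - Q' w) \<le> A * cmod (z - w)"
    using entire_lipschitz[OF Q'h, of R] by blast
  have Q'b: "cmod (Q' (of_real r)) \<le> A * r" if "0 \<le> r" "r \<le> R" for r
    using A(2)[of "of_real r" 0] that R by (simp add: Q'_def)
  have Qb: "cmod (Q (of_real r)) \<le> A * r * r" if r: "0 \<le> r" "r \<le> R" for r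
  proof -
    have "cmod (Q (of_real r) - Q 0) \<le> A * r * cmod (of_real r - 0)"
    proof (rule field_differentiable_bound[of "closed_segment 0 (of_real r)" Q Q'])
      show "(Q has_field_derivative Q' z) (at z within closed_segment 0 (of_real r))" for z
        using Qd by (rule has_field_derivative_at_within)
      show "cmod (Q' z) \<le> A * r" if "z \<in> closed_segment 0 (of_real r)" for z
      proof -
        have "cmod z \<le> r" using segment_bound(1)[OF that] r by simp
        then have "cmod (Q' z) \<le> A * cmod z" using A(2)[of z 0] r R by (simp add: Q'_def)
        also have "\<dots> \<le> A * r" using \<open>cmod z \<le> r\<close> A(1) by (intro mult_left_mono)
        finally show ?thesis .
      qed
    qed auto
    then show ?thesis using r by (simp add: Q_def)
  qed
  obtain B where B: "\<And>r. 0 < r \<Longrightarrow> r \<le> R \<Longrightarrow> \<bar>ln r\<bar> * r \<le> B"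
  proof
    fix r assume r: "0 < r" "r \<le> R"
    have "\<bar>ln r\<bar> * r \<le> 4 * (r powr (1/4) + r powr (- 1/4)) * r"
      using r by (intro mult_right_mono abs_ln_le) auto
    also have "\<dots> = 4 * (r powr (5/4) + r powr (3/4))"
    proof -
      have "r powr (1/4) * r = r powr (1/4 + 1)" "r powr (- 1/4) * r = r powr (- 1/4 + 1)"
        unfolding powr_add using r by simp_all
      then show ?thesis by (simp add: algebra_simps)
    qed
    also have "\<dots> \<le> 4 * (R powr (5/4) + R powr (3/4))"
      using r by (intro mult_left_mono add_mono powr_mono2) auto
    finally show "\<bar>ln r\<bar> * r \<le> 4 * (R powr (5/4) + R powr (3/4))" .
  qed
  define C where "C = A * R + \<bar>B\<bar> * A"
  have C0: "C \<ge> 0" using A(1) R by (simp add: C_def)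
  define F where "F r = complex_of_real (ln r) * Q (of_real r)" for r
  define F' where "F' r = complex_of_real (1 / r) * Q (of_real r) + of_real (ln r) * Q' (of_real r)" for r
  have Fd: "(F has_vector_derivative F' r) (at r within S)" if r: "r > 0" for r S
  proof -
    have 1: "((\<lambda>r. complex_of_real (ln r)) has_vector_derivative of_real (1 / r)) (at r within S)"
    proof -
      have "(ln has_vector_derivative 1 / r) (at r within S)"
        using has_field_derivative_at_within[OF DERIV_ln_divide[OF r]]
        by (simp only: has_real_derivative_iff_has_vector_derivative)
      then show ?thesis by (rule bounded_linear.has_vector_derivative[OF bounded_linear_of_real])
    qed
    have 2: "((\<lambda>r. Q (of_real r)) has_vector_derivative Q' (of_real r)) (at r within S)"
      by (rule has_vector_derivative_at_within[OF has_vector_derivative_real_field[OF Qd]])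
    show ?thesis
      unfolding F_def F'_def using has_vector_derivative_mult[OF 1 2] by (simp add: add.commute)
  qed
  have F'b: "cmod (F' r) \<le> C" if r: "0 < r" "r \<le> R" for r
  proof -
    have "cmod (F' r) \<le> 1 / r * cmod (Q (of_real r)) + \<bar>ln r\<bar> * cmod (Q' (of_real r))"
      unfolding F'_def using r
      by (intro order_trans[OF norm_triangle_ineq]) (simp add: norm_mult norm_divide)
    also have "\<dots> \<le> 1 / r * (A * r * r) + \<bar>ln r\<bar> * (A * r)"
      using r by (intro add_mono mult_left_mono Qb Q'b) auto
    also have "\<dots> = A * r + (\<bar>ln r\<bar> * r) * A" using r by simp
    also have "\<dots> \<le> A * R + \<bar>B\<bar> * A"
      using r A(1) B[OF r] by (intro add_mono mult_left_mono mult_right_mono) auto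
    finally show ?thesis by (simp add: C_def)
  qed
  have main: "cmod (F r - F s) \<le> C * \<bar>r - s\<bar>" if "0 < s" "s < r" "r \<le> R" for r s
  proof -
    have der: "(F has_derivative (\<lambda>h. h *\<^sub>R F' x)) (at x within S)" if "x > 0" for x S
      using Fd[OF that] by (simp add: has_vector_derivative_def)
    have cont: "continuous_on {s..r} F"
      unfolding continuous_on_eq_continuous_within
      using has_derivative_continuous[OF der] that by auto
    have "\<exists>x\<in>{s<..<r}. norm (F r - F s) \<le> norm ((r - s) *\<^sub>R F' x)"
      by (rule mvt_general[OF that(2) cont]) (use der that in auto)
    then obtain x where x: "x \<in> {s<..<r}" "norm (F r - F s) \<le> norm ((r - s) *\<^sub>R F' x)" by blast
    have "norm ((r - s) *\<^sub>R F' x) = \<bar>r - s\<bar> * cmod (F' x)" by simp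
    also have "\<dots> \<le> \<bar>r - s\<bar> * C" using F'b[of x] x(1) that by (intro mult_left_mono) auto
    finally show ?thesis using x(2) by (simp add: mult.commute)
  qed
  show thesis
  proof (rule that[OF C0])
    fix r s assume rs: "0 < r" "r \<le> R" "0 < s" "s \<le> R"
    have "cmod (F r - F s) \<le> C * \<bar>r - s\<bar>"
      using main[of s r] main[of r s] rs by (cases r s rule: linorder_cases) (auto simp: norm_minus_commute abs_minus_commute)
    then show "cmod (of_real (ln r) * (bessel_E ((a * of_real r)\<^sup>2) - bessel_E ((b * of_real r)\<^sup>2))
       - of_real (ln s) * (bessel_E ((a * of_real s)\<^sup>2) - bessel_E ((b * of_real s)\<^sup>2))) \<le> C * \<bar>r - s\<bar>"
      by (simp only: F_def Q_def)
  qed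
qed

text \<open>The leading singularity, 1 / (4 pi r) or - ln r / (2 pi), does not depend on \<mu>. The
  value 1 is the reference because its multiplier is known explicitly.\<close>

lemma screen_kernel_difference_lipschitz:
  assumes R: "R > 0"
  obtains C where "C \<ge> 0" "\<And>r s. 0 < r \<Longrightarrow> r \<le> R \<Longrightarrow> 0 < s \<Longrightarrow> s \<le> R \<Longrightarrow>
    cmod ((screen_kernel m \<mu> r - screen_kernel m 1 r) - (screen_kernel m \<mu> s - screen_kernel m 1 s)) \<le> C * \<bar>r - s\<bar>"
proof (cases "m = 2")
  case True
  obtain C where C: "C \<ge> 0" "\<And>r s. 0 < r \<Longrightarrow> r \<le> R \<Longrightarrow> 0 < s \<Longrightarrow> s \<le> R \<Longrightarrow>
    cmod ((exp (- \<mu> * of_real r) - exp (- 1 * of_real r)) / of_real r - (exp (- \<mu> * of_real s) - exp (- 1 * of_real s)) / of_real s)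
      \<le> C * \<bar>r - s\<bar>"
    using exp_difference_quotient_lipschitz[of R "- \<mu>" "- 1"] by blast
  show thesis
  proof (rule that[OF C(1)])
    fix r s assume rs: "0 < r" "r \<le> R" "0 < s" "s \<le> R"
    let ?D = "(exp (- \<mu> * of_real r) - exp (- 1 * of_real r)) / of_real r - (exp (- \<mu> * of_real s) - exp (- 1 * of_real s)) / of_real s"
    have "(screen_kernel m \<mu> r - screen_kernel m 1 r) - (screen_kernel m \<mu> s - screen_kernel m 1 s) = ?D / of_real (4 * pi)"
      using True rs by (simp add: screen_kernel_def field_simps)
    then have "cmod ((screen_kernel m \<mu> r - screen_kernel m 1 r) - (screen_kernel m \<mu> s - screen_kernel m 1 s)) = cmod ?D / (4 * pi)"
      by (simp only: norm_divide norm_of_real) simp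
    also have "\<dots> \<le> cmod ?D / 1" using pi_ge_two by (intro divide_left_mono) auto
    also have "\<dots> \<le> C * \<bar>r - s\<bar>" using C(2)[OF rs] by simp
    finally show "cmod ((screen_kernel m \<mu> r - screen_kernel m 1 r) - (screen_kernel m \<mu> s - screen_kernel m 1 s)) \<le> C * \<bar>r - s\<bar>" .
  qed
next
  case False
  \<comment> \<open>All terms free of ln r are collected in the entire function \<open>f\<close>;
    what multiplies ln r is a difference of even functions and goes into \<open>h\<close>.\<close>
  define f where "f z = bessel_W ((\<mu> / 2 * z)\<^sup>2) - bessel_W ((1 / 2 * z)\<^sup>2)
     - (Ln (\<mu> / 2) + euler_mascheroni) * bessel_E ((\<mu> / 2 * z)\<^sup>2) + (Ln (1 / 2) + euler_mascheroni) * bessel_E ((1 / 2 * z)\<^sup>2)" for z :: complex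
  have "f holomorphic_on UNIV" unfolding f_def by (intro holomorphic_intros)
  then obtain A where A: "A \<ge> 0" "\<And>z w. cmod z \<le> R \<Longrightarrow> cmod w \<le> R \<Longrightarrow> cmod (f z - f w) \<le> A * cmod (z - w)"
    using entire_lipschitz[of f R] by blast
  define h where "h r = complex_of_real (ln r) * (bessel_E ((\<mu> / 2 * of_real r)\<^sup>2) - bessel_E ((1 / 2 * of_real r)\<^sup>2))" for r
  obtain B where B: "B \<ge> 0" "\<And>r s. 0 < r \<Longrightarrow> r \<le> R \<Longrightarrow> 0 < s \<Longrightarrow> s \<le> R \<Longrightarrow> cmod (h r - h s) \<le> B * \<bar>r - s\<bar>"
    unfolding h_def using log_times_even_lipschitz[OF R, of "\<mu> / 2" "1 / 2"] by blast
  have dec: "screen_kernel m \<mu> r - screen_kernel m 1 r = (f (of_real r) - h r) / of_real (2 * pi)" for r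
  proof -
    have z: "\<mu> * of_real r / 2 = \<mu> / 2 * of_real r" "1 * of_real r / 2 = 1 / 2 * complex_of_real r" by simp_all
    have "(W1 - (L1 + l + g) * E1) / p - (W2 - (L2 + l + g) * E2) / p =
      (W1 - W2 - (L1 + g) * E1 + (L2 + g) * E2 - l * (E1 - E2)) / p" for W1 W2 L1 L2 l g E1 E2 p :: complex
      by (simp add: diff_divide_distrib add_divide_distrib algebra_simps)
    then show ?thesis
      using False unfolding screen_kernel_def f_def h_def z by (simp only: if_False)
  qed
  show thesis
  proof (rule that[of "A + B"])
    show "A + B \<ge> 0" using A B by simp
    fix r s assume rs: "0 < r" "r \<le> R" "0 < s" "s \<le> R"
    have "(screen_kernel m \<mu> r - screen_kernel m 1 r) - (screen_kernel m \<mu> s - screen_kernel m 1 s)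
       = ((f (of_real r) - f (of_real s)) - (h r - h s)) / of_real (2 * pi)"
      unfolding dec by (simp add: diff_divide_distrib)
    then have "cmod ((screen_kernel m \<mu> r - screen_kernel m 1 r) - (screen_kernel m \<mu> s - screen_kernel m 1 s))
      = cmod ((f (of_real r) - f (of_real s)) - (h r - h s)) / (2 * pi)"
      by (simp only: norm_divide norm_of_real) simp
    also have "\<dots> \<le> cmod ((f (of_real r) - f (of_real s)) - (h r - h s)) / 1"
      using pi_ge_two by (intro divide_left_mono) auto
    also have "\<dots> \<le> cmod (f (of_real r) - f (of_real s)) + cmod (h r - h s)"
      unfolding div_by_1 by (rule norm_triangle_ineq4)
    also have "\<dots> \<le> A * \<bar>r - s\<bar> + B * \<bar>r - s\<bar>"
      using A(2)[of "of_real r" "of_real s"] B(2)[OF rs] rs by (intro add_mono) (simp_all flip: of_real_diff)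
    finally show "cmod ((screen_kernel m \<mu> r - screen_kernel m 1 r) - (screen_kernel m \<mu> s - screen_kernel m 1 s)) \<le> (A + B) * \<bar>r - s\<bar>"
      by (simp add: distrib_right)
  qed
qed


subsection \<open>The heat kernel as a Fourier multiplier\<close>

text \<open>Subordination: an inverse square root as a time integral of exponentials. The factor (4
  pi t)^(- 1/2) is what the heat kernel of R^(m+1) retains after the transform in m
  variables.\<close>

lemma
  assumes c: "c > 0"
  shows gaussian_trace_integrable: "integrable half_line (\<lambda>t. (4 * pi * t) powr (- 1/2) * exp (- c * t))"
    and gaussian_trace_integral: "(\<integral>t. (4 * pi * t) powr (- 1/2) * exp (- c * t) \<partial>half_line) = 1 / (2 * sqrt c)"
proof -
  have "(\<integral>t. (4 * pi * t) powr (- 1/2) * exp (- c * t) \<partial>half_line) =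
    1 / c * (\<integral>s. (4 * pi * (1 / c * s)) powr (- 1/2) * exp (- c * (1 / c * s)) \<partial>half_line)"
    by (rule half_line_scale) (use c in simp)
  also have "(\<integral>s. (4 * pi * (1 / c * s)) powr (- 1/2) * exp (- c * (1 / c * s)) \<partial>half_line) =
    (\<integral>s. (4 * pi / c) powr (- 1/2) * (s powr (- 1/2) * exp (- s)) \<partial>half_line)"
  proof (rule Bochner_Integration.integral_cong[OF refl])
    fix s assume "s \<in> space half_line"
    then have "(4 * pi * (1 / c * s)) powr (- 1/2) = (4 * pi / c) powr (- 1/2) * s powr (- 1/2)"
      using c powr_mult[of "4 * pi / c" s "- 1/2"] by simp
    then show "(4 * pi * (1 / c * s)) powr (- 1/2) * exp (- c * (1 / c * s)) = (4 * pi / c) powr (- 1/2) * (s powr (- 1/2) * exp (- s))"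
      using c by simp
  qed
  also have "\<dots> = (4 * pi / c) powr (- 1/2) * sqrt pi"
    using Gamma_integral[of "- 1/2"] by (simp only: integral_mult_right_zero) (simp add: Gamma_one_half_real)
  also have "(4 * pi / c) powr (- 1/2) = sqrt c / (2 * sqrt pi)"
    using c by (simp add: powr_minus_divide powr_half_sqrt real_sqrt_divide real_sqrt_mult)
  also have "1 / c * (sqrt c / (2 * sqrt pi) * sqrt pi) = 1 / (2 * sqrt c)"
    using c real_sqrt_mult_self[of c] by (simp add: field_simps)
  finally show eq: "(\<integral>t. (4 * pi * t) powr (- 1/2) * exp (- c * t) \<partial>half_line) = 1 / (2 * sqrt c)" .
  \<comment> \<open>The Bochner integral of a non-integrable function is 0, so the nonzero value
    just computed already proves integrability.\<close>
  show "integrable half_line (\<lambda>t. (4 * pi * t) powr (- 1/2) * exp (- c * t))"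
  proof (rule ccontr)
    assume "\<not> integrable half_line (\<lambda>t. (4 * pi * t) powr (- 1/2) * exp (- c * t))"
    then have "(\<integral>t. (4 * pi * t) powr (- 1/2) * exp (- c * t) \<partial>half_line) = 0" by (rule not_integrable_integral_eq)
    then show False using eq c by simp
  qed
qed

lemma sigma_finite_half_line: "sigma_finite_measure half_line"
  by (rule sigma_finite_measure_restrict_space) (auto intro: lborel.sigma_finite_measure_axioms)

text \<open>Fubini in time and space. The kernel belongs to R^(m+1) but is transformed along the
  hyperplane only: the m Gaussian integrals supply (4 pi t)^(m/2), which leaves one factor (4 pi
  t)^(- 1/2) under the time integral and makes the symbol one of order - 1.\<close>

lemma
  fixes \<kappa> :: real and \<xi> :: "real^'m::finite"
  assumes \<kappa>: "\<kappa> > 0"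
  defines "K \<equiv> \<lambda>z::real^'m. complex_of_real (heat_kernel (real CARD('m) + 1) \<kappa> (norm z))"
  shows heat_kernel_integrable: "integrable lborel K"
    and heat_kernel_multiplier: "multiplier K \<xi> = of_real (1 / (2 * sqrt (\<kappa>\<^sup>2 + (norm \<xi>)\<^sup>2)))"
proof -
  interpret sigma_finite_measure half_line by (rule sigma_finite_half_line)
  interpret P: pair_sigma_finite half_line "lborel :: (real^'m) measure" ..
  define p where "p = real CARD('m) + 1"
  define g where "g t z = (4 * pi * t) powr (- p / 2) * exp (- \<kappa>\<^sup>2 * t - (norm z)\<^sup>2 / (4 * t))" for t and z :: "real^'m"
  define G where "G \<xi> t z = exp (- \<i> * of_real (\<xi> \<bullet> z)) * complex_of_real (g t z)" for \<xi> t and z :: "real^'m"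
  have gm: "case_prod g \<in> borel_measurable (half_line \<Otimes>\<^sub>M lborel)"
  proof -
    have [measurable]: "(\<lambda>t. t) \<in> borel_measurable half_line" by (rule half_line_measurable) simp
    have [measurable]: "(\<lambda>x. fst x) \<in> borel_measurable (half_line \<Otimes>\<^sub>M (lborel :: (real^'m) measure))"
      using measurable_compose[OF measurable_fst \<open>(\<lambda>t. t) \<in> borel_measurable half_line\<close>] by simp
    show ?thesis unfolding g_def case_prod_beta by measurable
  qed
  have Gm: "case_prod (G \<xi>) \<in> borel_measurable (half_line \<Otimes>\<^sub>M lborel)" for \<xi>
  proof -
    have "(\<lambda>x. g (fst x) (snd x)) \<in> borel_measurable (half_line \<Otimes>\<^sub>M lborel)"
      using gm unfolding case_prod_beta' .
    moreover have "complex_of_real \<in> borel_measurable borel" by measurable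
    ultimately have g: "(\<lambda>x. complex_of_real (g (fst x) (snd x))) \<in> borel_measurable (half_line \<Otimes>\<^sub>M lborel)"
      by (rule measurable_compose)
    have "(\<lambda>z. exp (- \<i> * of_real (\<xi> \<bullet> z))) \<in> borel_measurable lborel" by measurable
    with measurable_snd have e: "(\<lambda>x. exp (- \<i> * of_real (\<xi> \<bullet> snd x))) \<in> borel_measurable (half_line \<Otimes>\<^sub>M (lborel :: (real^'m) measure))"
      by (rule measurable_compose)
    show ?thesis unfolding G_def case_prod_beta' by (rule borel_measurable_times[OF e g])
  qed
  have split: "g t z = (4 * pi * t) powr (- p / 2) * exp (- \<kappa>\<^sup>2 * t) * exp (- (1 / (4 * t)) * (norm z)\<^sup>2)" for t z
    unfolding g_def diff_conv_add_uminus exp_add by simp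
  have Gint: "integrable lborel (G \<xi> t)" and Gval: "(\<integral>z. G \<xi> t z \<partial>lborel) =
      of_real ((4 * pi * t) powr (- 1/2) * exp (- (\<kappa>\<^sup>2 + (norm \<xi>)\<^sup>2) * t))" if t: "t > 0" for t \<xi>
  proof -
    have a: "1 / (4 * t) > 0" using t by simp
    have eq: "G \<xi> t z = of_real ((4 * pi * t) powr (- p / 2) * exp (- \<kappa>\<^sup>2 * t)) *
      (exp (- \<i> * of_real (\<xi> \<bullet> z)) * complex_of_real (exp (- (1 / (4 * t)) * (norm z)\<^sup>2)))" for z
      unfolding G_def split by (simp only: of_real_mult mult_ac)
    show "integrable lborel (G \<xi> t)"
      unfolding eq by (intro integrable_mult_right gaussian_fourier_vec(1) a)
    have pw: "(4 * pi * t) powr (- p / 2) * sqrt (pi / (1 / (4 * t))) ^ CARD('m) = (4 * pi * t) powr (- 1/2)"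
    proof -
      have "sqrt (pi / (1 / (4 * t))) ^ CARD('m) = ((4 * pi * t) powr (1/2)) powr real CARD('m)"
        using t by (simp add: powr_realpow powr_half_sqrt mult_ac)
      also have "\<dots> = (4 * pi * t) powr (real CARD('m) / 2)" by (simp add: powr_powr)
      finally have "(4 * pi * t) powr (- p / 2) * sqrt (pi / (1 / (4 * t))) ^ CARD('m) =
          (4 * pi * t) powr (- p / 2 + real CARD('m) / 2)" by (simp only: powr_add)
      also have "- p / 2 + real CARD('m) / 2 = - 1/2" unfolding p_def by (simp add: field_simps)
      finally show ?thesis .
    qed
    have "(\<integral>z. G \<xi> t z \<partial>lborel) = of_real ((4 * pi * t) powr (- p / 2) * exp (- \<kappa>\<^sup>2 * t)) *
      of_real (sqrt (pi / (1 / (4 * t))) ^ CARD('m) * exp (- (norm \<xi>)\<^sup>2 / (4 * (1 / (4 * t)))))"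
      unfolding eq integral_mult_right_zero gaussian_fourier_vec(2)[OF a] ..
    also have "\<dots> = of_real ((4 * pi * t) powr (- p / 2) * sqrt (pi / (1 / (4 * t))) ^ CARD('m) *
        (exp (- \<kappa>\<^sup>2 * t) * exp (- (norm \<xi>)\<^sup>2 / (4 * (1 / (4 * t))))))"
      by (simp only: of_real_mult mult_ac)
    also have "exp (- \<kappa>\<^sup>2 * t) * exp (- (norm \<xi>)\<^sup>2 / (4 * (1 / (4 * t)))) = exp (- (\<kappa>\<^sup>2 + (norm \<xi>)\<^sup>2) * t)"
      unfolding exp_add[symmetric] using t by (simp add: algebra_simps)
    finally show "(\<integral>z. G \<xi> t z \<partial>lborel) = of_real ((4 * pi * t) powr (- 1/2) * exp (- (\<kappa>\<^sup>2 + (norm \<xi>)\<^sup>2) * t))"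
      unfolding pw .
  qed
  have normG: "norm (G \<xi> t z) = g t z" for \<xi> t z by (simp add: G_def norm_mult g_def)
  \<comment> \<open>The modulus of \<open>G\<close> is \<open>g\<close> whatever the frequency, so
    its integral is the value at frequency 0.\<close>
  have norm_int: "(\<integral>z. norm (G \<xi> t z) \<partial>lborel) = (4 * pi * t) powr (- 1/2) * exp (- \<kappa>\<^sup>2 * t)" if "t > 0" for t \<xi>
  proof -
    have "complex_of_real (\<integral>z. g t z \<partial>lborel) = (\<integral>z. G 0 t z \<partial>lborel)" by (simp add: G_def)
    also have "\<dots> = of_real ((4 * pi * t) powr (- 1/2) * exp (- \<kappa>\<^sup>2 * t))" using Gval[OF that, of 0] by simp
    finally show ?thesis unfolding normG of_real_eq_iff .
  qed
  have int: "integrable (half_line \<Otimes>\<^sub>M lborel) (case_prod (G \<xi>))" for \<xi>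
  proof (rule P.Fubini_integrable[OF Gm])
    have "integrable half_line (\<lambda>t. (4 * pi * t) powr (- 1/2) * exp (- \<kappa>\<^sup>2 * t))"
      by (rule gaussian_trace_integrable) (use \<kappa> in simp)
    then show "integrable half_line (\<lambda>t. \<integral>z. norm (case (t, z) of (t, z) \<Rightarrow> G \<xi> t z) \<partial>lborel)"
      by (rule Bochner_Integration.integrable_cong[THEN iffD1, rotated 2]) (simp_all add: norm_int)
    show "AE t in half_line. integrable lborel (\<lambda>z. case (t, z) of (t, z) \<Rightarrow> G \<xi> t z)"
      using Gint by (intro AE_I2) simp
  qed
  have inner: "(\<integral>t. G \<xi> t z \<partial>half_line) = exp (- \<i> * of_real (\<xi> \<bullet> z)) * K z" for \<xi> z
    unfolding G_def K_def heat_kernel_def integral_mult_right_zero g_def p_def integral_complex_of_real ..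
  have "integrable lborel (\<lambda>z. \<integral>t. G 0 t z \<partial>half_line)" by (rule P.integrable_snd[OF int])
  then show "integrable lborel K" unfolding inner by simp
  have "multiplier K \<xi> = (\<integral>z. \<integral>t. G \<xi> t z \<partial>half_line \<partial>lborel)" unfolding multiplier_def inner ..
  also have "\<dots> = (\<integral>t. \<integral>z. G \<xi> t z \<partial>lborel \<partial>half_line)" by (rule P.Fubini_integral[OF int])
  also have "\<dots> = (\<integral>t. complex_of_real ((4 * pi * t) powr (- 1/2) * exp (- (\<kappa>\<^sup>2 + (norm \<xi>)\<^sup>2) * t)) \<partial>half_line)"
    by (rule Bochner_Integration.integral_cong[OF refl]) (simp add: Gval)
  also have "\<dots> = of_real (1 / (2 * sqrt (\<kappa>\<^sup>2 + (norm \<xi>)\<^sup>2)))"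
    unfolding integral_complex_of_real by (subst gaussian_trace_integral) (use \<kappa> in \<open>simp_all add: add_pos_nonneg\<close>)
  finally show "multiplier K \<xi> = of_real (1 / (2 * sqrt (\<kappa>\<^sup>2 + (norm \<xi>)\<^sup>2)))" .
qed


subsection \<open>Analytic continuation in the wave number\<close>

text \<open>A local majorant of the integrand alone is required. Cauchy's inequality on discs of
  half the radius turns it into a majorant of the derivative, with the factor 2 / r.\<close>

lemma holomorphic_on_integral:
  fixes f :: "complex \<Rightarrow> 'a \<Rightarrow> complex"
  assumes hol: "\<And>x. x \<in> space M \<Longrightarrow> (\<lambda>z. f z x) holomorphic_on S"
    and int: "\<And>z. z \<in> S \<Longrightarrow> integrable M (f z)"
    and bd: "\<And>z0. z0 \<in> S \<Longrightarrow> \<exists>r>0. \<exists>h. cball z0 r \<subseteq> S \<and> integrable M h \<and>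
      (\<forall>z\<in>cball z0 r. \<forall>x\<in>space M. cmod (f z x) \<le> h x)"
  shows "(\<lambda>z. \<integral>x. f z x \<partial>M) holomorphic_on S"
proof (rule holomorphic_onI)
  fix z0 assume "z0 \<in> S"
  from bd[OF this] obtain r h where r: "r > 0" "cball z0 r \<subseteq> S" and h: "integrable M h"
    and fh: "\<And>z x. z \<in> cball z0 r \<Longrightarrow> x \<in> space M \<Longrightarrow> cmod (f z x) \<le> h x"
    by blast
  have sub: "cball z (r / 2) \<subseteq> cball z0 r" if "z \<in> ball z0 (r / 2)" for z
  proof
    fix w assume "w \<in> cball z (r / 2)"
    then show "w \<in> cball z0 r" using that dist_triangle[of z0 w z] by simp
  qed
  have "((\<lambda>z. \<integral>x. f z x \<partial>M) has_field_derivative (\<integral>x. deriv (\<lambda>z. f z x) z0 \<partial>M)) (at z0)"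
  proof (rule has_field_derivative_integral[where f = f and f' = "\<lambda>z x. deriv (\<lambda>z. f z x) z" and \<delta> = "r / 2" and h = "\<lambda>x. 2 / r * h x"])
    show "r / 2 > 0" using r by simp
    show "integrable M (f z)" if z: "z \<in> ball z0 (r / 2)" for z
    proof (rule int)
      have "z \<in> cball z (r / 2)" using r by simp
      then show "z \<in> S" using sub[OF z] r(2) by (meson subsetD)
    qed
    show "((\<lambda>z. f z x) has_field_derivative deriv (\<lambda>z. f z x) z) (at z)" if z: "z \<in> ball z0 (r / 2)" and x: "x \<in> space M" for z x
    proof (rule holomorphic_derivI)
      show "(\<lambda>z. f z x) holomorphic_on ball z0 r"
        by (rule holomorphic_on_subset[OF hol[OF x]]) (meson r(2) ball_subset_cball subset_trans)
      show "z \<in> ball z0 r" using z r by simp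
    qed simp
    show "cmod (deriv (\<lambda>z. f z x) z) \<le> 2 / r * h x" if z: "z \<in> ball z0 (r / 2)" and x: "x \<in> space M" for z x
    proof -
      have hz: "(\<lambda>z. f z x) holomorphic_on cball z (r / 2)"
        by (rule holomorphic_on_subset[OF hol[OF x]]) (meson sub[OF z] r(2) subset_trans)
      have "cmod ((deriv ^^ 1) (\<lambda>z. f z x) z) \<le> fact 1 * h x / (r / 2) ^ 1"
      proof (rule Cauchy_inequality)
        show "(\<lambda>z. f z x) holomorphic_on ball z (r / 2)"
          by (rule holomorphic_on_subset[OF hz ball_subset_cball])
        show "continuous_on (cball z (r / 2)) (\<lambda>z. f z x)" by (rule holomorphic_on_imp_continuous_on[OF hz])
        show "cmod (f w x) \<le> h x" if "cmod (z - w) = r / 2" for w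
        proof (rule fh[OF subsetD[OF sub[OF z]] x])
          show "w \<in> cball z (r / 2)" using that by (simp add: dist_norm)
        qed
      qed (use r in simp)
      then show ?thesis by (simp add: mult.commute)
    qed
    show "integrable M (\<lambda>x. 2 / r * h x)" using h by (intro integrable_mult_right)
  qed
  then show "(\<lambda>z. \<integral>x. f z x \<partial>M) field_differentiable at z0 within S"
    using field_differentiable_at_within field_differentiable_def by blast
qed


text \<open>The value at the origin does not affect integrals; with the value 0 the diagonal
  satisfies every bound trivially.\<close>

definition screen_potential :: "complex \<Rightarrow> real^'m::finite \<Rightarrow> complex" where
  "screen_potential \<mu> z = (if z = 0 then 0 else screen_kernel CARD('m) \<mu> (norm z))"

lemma screen_potential_measurable [measurable]:
  "(screen_potential \<mu> :: real^'m::finite \<Rightarrow> complex) \<in> borel_measurable borel"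
proof -
  have [measurable]: "(\<lambda>z::real^'m. screen_kernel CARD('m) \<mu> (norm z)) \<in> borel_measurable borel"
    by (rule measurable_compose[OF _ screen_kernel_measurable]) simp
  have "{z::real^'m. z = 0} = {0}" by auto
  then have "{z \<in> space borel. z = (0::real^'m)} \<in> sets borel" by simp
  then show ?thesis
    unfolding screen_potential_def
    by (intro measurable_If borel_measurable_const \<open>(\<lambda>z::real^'m. screen_kernel CARD('m) \<mu> (norm z)) \<in> borel_measurable borel\<close>)
qed

lemma screen_potential_holomorphic: "(\<lambda>\<mu>. screen_potential \<mu> z) holomorphic_on (- \<real>\<^sub>\<le>\<^sub>0)"
  using screen_kernel_holomorphic by (cases "z = 0") (simp_all add: screen_potential_def)

lemma screen_potential_heat:
  fixes z :: "real^'m::finite"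
  assumes "CARD('m) \<in> {1, 2}" "\<kappa> > 0" "z \<noteq> 0"
  shows "screen_potential (of_real \<kappa>) z = of_real (heat_kernel (real CARD('m) + 1) \<kappa> (norm z))"
  using screen_kernel_heat[OF assms(1,2), of "norm z"] assms(3) by (simp add: screen_potential_def)

text \<open>Kernels are compared off the diagonal only. The second integrand is the first one
  modified at a point and thereby inherits its measurability.\<close>

lemma lborel_integral_cong_off_point:
  fixes f g :: "'a::euclidean_space \<Rightarrow> 'b::{banach,second_countable_topology}"
  assumes f: "f \<in> borel_measurable borel" and eq: "\<And>y. y \<noteq> x \<Longrightarrow> f y = g y"
  shows "(\<integral>y. f y \<partial>lborel) = (\<integral>y. g y \<partial>lborel)"
proof (rule integral_cong_AE)
  have "{y::'a. y = x} = {x}" by auto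
  then have "{y \<in> space borel. y = x} \<in> sets borel" by simp
  then have "(\<lambda>y. if y = x then g x else f y) \<in> borel_measurable borel"
    by (intro measurable_If borel_measurable_const f)
  also have "(\<lambda>y. if y = x then g x else f y) = g" using eq by auto
  finally show "g \<in> borel_measurable lborel" unfolding measurable_lborel2 .
  show "AE y in lborel. f y = g y"
    using AE_lborel_singleton[of x] eq by (auto elim!: eventually_mono)
qed (use f in simp)

section \<open>The quadratic forms of kernel and symbol\<close>

context
  fixes \<phi> \<psi> :: "real^'m::finite \<Rightarrow> complex" and \<rho> :: real
  assumes m: "CARD('m) \<in> {1, 2}"
    and \<phi>: "\<phi> \<in> schwartz" and \<psi>: "\<psi> \<in> schwartz" and \<rho>: "\<rho> > 0"
    and \<phi>0: "\<forall>x. norm x > \<rho> \<longrightarrow> \<phi> x = 0" and \<psi>0: "\<forall>x. norm x > \<rho> \<longrightarrow> \<psi> x = 0"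
begin

text \<open>The form is kept as one integral over the product space, so that holomorphy and
  continuity in \<mu> each take a single domination argument; \<open>layer_form_eq\<close> recovers
  the iterated integral.\<close>

definition layer_density :: "complex \<Rightarrow> (real^'m) \<times> (real^'m) \<Rightarrow> complex" where
  "layer_density \<mu> p = screen_potential \<mu> (fst p - snd p) * \<phi> (snd p) * \<psi> (fst p)"

lemma layer_density_measurable: "layer_density \<mu> \<in> borel_measurable (lborel \<Otimes>\<^sub>M lborel)"
proof -
  note [measurable] = schwartz_measurable[OF \<phi>] schwartz_measurable[OF \<psi>]
  show ?thesis unfolding layer_density_def by measurable
qed

text \<open>Both factors live in the ball of radius \<rho>, so only distances up to 2 \<rho> matter,
  where the kernel is dominated by 1 plus the heat kernel for \<kappa> = 1. The first part is a
  product of integrable functions; the second is the integrand of a convolution of such, with \<psi>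
  replaced by its bound.\<close>

lemma layer_density_bound:
  assumes ab: "0 < a" "a \<le> b"
  obtains h where "integrable (lborel \<Otimes>\<^sub>M lborel) h"
    "\<And>\<mu> p. a \<le> cmod \<mu> \<Longrightarrow> cmod \<mu> \<le> b \<Longrightarrow> Re \<mu> \<ge> 0 \<Longrightarrow> cmod (layer_density \<mu> p) \<le> h p"
proof -
  obtain C where C: "C \<ge> 0" "\<And>\<mu> r. a \<le> cmod \<mu> \<Longrightarrow> cmod \<mu> \<le> b \<Longrightarrow> Re \<mu> \<ge> 0 \<Longrightarrow> 0 < r \<Longrightarrow> r \<le> 2 * \<rho> \<Longrightarrow>
      cmod (screen_kernel CARD('m) \<mu> r) \<le> C * (1 + heat_kernel (real CARD('m) + 1) 1 r)"
    by (rule screen_kernel_bound[OF m ab, of "2 * \<rho>"]) (use \<rho> in auto)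
  obtain B where B: "B \<ge> 0" "\<And>x. cmod (\<psi> x) \<le> B / (1 + norm x) ^ 0" using schwartz_decay_pos[OF \<psi>] by blast
  define K where "K = (\<lambda>z::real^'m. complex_of_real (heat_kernel (real CARD('m) + 1) 1 (norm z)))"
  have K: "integrable lborel K" unfolding K_def by (rule heat_kernel_integrable) simp
  define H1 where "H1 p = \<psi> (fst p) * \<phi> (snd p)" for p
  define H2 where "H2 p = K (fst p - snd p) * \<phi> (snd p)" for p
  have H1: "integrable (lborel \<Otimes>\<^sub>M lborel) H1"
    using integrable_lborel_pair_mult[OF schwartz_integrable[OF \<psi>] schwartz_integrable[OF \<phi>]]
    by (simp only: H1_def[abs_def] case_prod_beta')
  have H2: "integrable (lborel \<Otimes>\<^sub>M lborel) H2"
    using convolution_integrable_pair[OF K schwartz_integrable[OF \<phi>]]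
    by (simp only: H2_def[abs_def] case_prod_beta')
  show thesis
  proof (rule that[of "\<lambda>p. C * (cmod (H1 p) + B * cmod (H2 p))"])
    show "integrable (lborel \<Otimes>\<^sub>M lborel) (\<lambda>p. C * (cmod (H1 p) + B * cmod (H2 p)))"
      by (intro integrable_mult_right Bochner_Integration.integrable_add integrable_norm H1 H2)
    fix \<mu> and p :: "(real^'m) \<times> (real^'m)" assume \<mu>: "a \<le> cmod \<mu>" "cmod \<mu> \<le> b" "Re \<mu> \<ge> 0"
    obtain x y where p: "p = (x, y)" by (cases p)
    show "cmod (layer_density \<mu> p) \<le> C * (cmod (H1 p) + B * cmod (H2 p))"
    proof (cases "x = y \<or> norm x > \<rho> \<or> norm y > \<rho>")
      case True
      then have "layer_density \<mu> p = 0" using \<phi>0 \<psi>0 by (auto simp: layer_density_def screen_potential_def p)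
      then show ?thesis using C B by simp
    next
      case False
      then have xy: "norm (x - y) > 0" "norm (x - y) \<le> 2 * \<rho>"
        using norm_triangle_ineq4[of x y] by auto
      define e where "e = heat_kernel (real CARD('m) + 1) 1 (norm (x - y))"
      have e: "e \<ge> 0" unfolding e_def by (rule heat_kernel_nonneg)
      have "cmod (layer_density \<mu> p) = cmod (screen_kernel CARD('m) \<mu> (norm (x - y))) * (cmod (\<phi> y) * cmod (\<psi> x))"
        using xy by (simp add: layer_density_def screen_potential_def p norm_mult)
      also have "\<dots> \<le> (C * (1 + e)) * (cmod (\<phi> y) * cmod (\<psi> x))"
        unfolding e_def by (intro mult_right_mono C(2) \<mu> xy) simp
      also have "\<dots> = C * (cmod (\<phi> y) * cmod (\<psi> x)) + C * (e * cmod (\<phi> y) * cmod (\<psi> x))" by (simp add: algebra_simps)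
      also have "\<dots> \<le> C * (cmod (\<phi> y) * cmod (\<psi> x)) + C * (e * cmod (\<phi> y) * B)"
        using B C e by (intro add_left_mono mult_left_mono) auto
      also have "\<dots> = C * (cmod (H1 p) + B * cmod (H2 p))"
        using e by (simp add: H1_def H2_def p norm_mult K_def e_def algebra_simps)
      finally show ?thesis .
    qed
  qed
qed

lemma layer_density_integrable:
  assumes "\<mu> \<noteq> 0" "Re \<mu> \<ge> 0"
  shows "integrable (lborel \<Otimes>\<^sub>M lborel) (layer_density \<mu>)"
proof -
  have c: "0 < cmod \<mu>" using assms by simp
  show ?thesis
  proof (rule layer_density_bound[OF c order_refl])
    fix h :: "(real^'m) \<times> (real^'m) \<Rightarrow> real"
    assume h: "integrable (lborel \<Otimes>\<^sub>M lborel) h"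
      "\<And>\<nu> p. cmod \<mu> \<le> cmod \<nu> \<Longrightarrow> cmod \<nu> \<le> cmod \<mu> \<Longrightarrow> Re \<nu> \<ge> 0 \<Longrightarrow> cmod (layer_density \<nu> p) \<le> h p"
    show "integrable (lborel \<Otimes>\<^sub>M lborel) (layer_density \<mu>)"
    proof (rule Bochner_Integration.integrable_bound[OF h(1) layer_density_measurable])
      show "AE p in lborel \<Otimes>\<^sub>M lborel. norm (layer_density \<mu> p) \<le> norm (h p)"
        unfolding real_norm_def by (intro AE_I2 order_trans[OF h(2)[OF order_refl order_refl assms(2)] abs_ge_self])
    qed
  qed
qed

definition layer_form :: "complex \<Rightarrow> complex" where
  "layer_form \<mu> = (\<integral>p. layer_density \<mu> p \<partial>(lborel \<Otimes>\<^sub>M lborel))"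

lemma layer_form_eq:
  assumes "\<mu> \<noteq> 0" "Re \<mu> \<ge> 0"
  shows "layer_form \<mu> = (\<integral>x. (\<integral>y. screen_potential \<mu> (x - y) * \<phi> y \<partial>lborel) * \<psi> x \<partial>lborel)"
  unfolding layer_form_def using lborel_pair.integral_fst'[OF layer_density_integrable[OF assms], symmetric]
  by (simp add: layer_density_def)

definition symbol_form :: "complex \<Rightarrow> complex" where
  "symbol_form \<mu> = (\<integral>\<xi>. fourier \<phi> \<xi> * fourier \<psi> (- \<xi>) * (1 / (2 * csqrt (of_real ((norm \<xi>)\<^sup>2) + \<mu>\<^sup>2))) \<partial>lborel)"

lemma layer_form_real:
  assumes \<kappa>: "\<kappa> > 0"
  shows "layer_form (of_real \<kappa>) = symbol_form (of_real \<kappa>)"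
proof -
  define K where "K = (\<lambda>z::real^'m. complex_of_real (heat_kernel (real CARD('m) + 1) \<kappa> (norm z)))"
  have K: "integrable lborel K" unfolding K_def by (rule heat_kernel_integrable[OF \<kappa>])
  note [measurable] = schwartz_measurable[OF \<phi>] borel_measurable_integrable[OF K, simplified]
  have "(\<integral>y. screen_potential (of_real \<kappa>) (x - y) * \<phi> y \<partial>lborel) = (\<integral>y. K (x - y) * \<phi> y \<partial>lborel)" for x
  proof (rule lborel_integral_cong_off_point[of _ x])
    show "screen_potential (of_real \<kappa>) (x - y) * \<phi> y = K (x - y) * \<phi> y" if "y \<noteq> x" for y
      using screen_potential_heat[OF m \<kappa>, of "x - y"] that by (simp add: K_def)
  qed measurable
  then have "layer_form (of_real \<kappa>) = (\<integral>\<xi>. multiplier K \<xi> * fourier \<phi> \<xi> * fourier \<psi> (- \<xi>) \<partial>lborel)"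
    using layer_form_eq[of "of_real \<kappa>"] \<kappa> convolution_form[OF K schwartz_integrable[OF \<phi>] \<psi>] by simp
  also have "\<dots> = symbol_form (of_real \<kappa>)"
    unfolding symbol_form_def
  proof (rule Bochner_Integration.integral_cong[OF refl])
    fix \<xi> :: "real^'m"
    have c: "csqrt (of_real ((norm \<xi>)\<^sup>2) + (complex_of_real \<kappa>)\<^sup>2) = of_real (sqrt (\<kappa>\<^sup>2 + (norm \<xi>)\<^sup>2))"
      by (simp add: csqrt_of_real_nonneg add.commute flip: of_real_power of_real_add)
    have "multiplier K \<xi> = 1 / (2 * csqrt (of_real ((norm \<xi>)\<^sup>2) + (complex_of_real \<kappa>)\<^sup>2))"
      unfolding c K_def heat_kernel_multiplier[OF \<kappa>] by simp
    then show "multiplier K \<xi> * fourier \<phi> \<xi> * fourier \<psi> (- \<xi>) =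
        fourier \<phi> \<xi> * fourier \<psi> (- \<xi>) * (1 / (2 * csqrt (of_real ((norm \<xi>)\<^sup>2) + (complex_of_real \<kappa>)\<^sup>2)))"
      by (simp only: mult_ac)
  qed
  finally show ?thesis .
qed

lemma layer_form_holomorphic: "layer_form holomorphic_on {\<mu>. Re \<mu> > 0}"
  unfolding layer_form_def
proof (rule holomorphic_on_integral)
  show "(\<lambda>\<mu>. layer_density \<mu> p) holomorphic_on {\<mu>. Re \<mu> > 0}" for p
    unfolding layer_density_def
    by (intro holomorphic_intros holomorphic_on_subset[OF screen_potential_holomorphic]) (auto simp: complex_nonpos_Reals_iff)
  show "integrable (lborel \<Otimes>\<^sub>M lborel) (layer_density \<mu>)" if "\<mu> \<in> {\<mu>. Re \<mu> > 0}" for \<mu>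
    using that by (intro layer_density_integrable) auto
  fix z0 assume z0: "z0 \<in> {\<mu>. Re \<mu> > 0}"
  define r where "r = Re z0 / 2"
  have r: "r > 0" using z0 by (simp add: r_def)
  have near: "Re z \<ge> r \<and> cmod z \<le> cmod z0 + r" if "z \<in> cball z0 r" for z
  proof -
    have d: "cmod (z0 - z) \<le> r" using that by (simp add: dist_norm)
    have "Re (z0 - z) \<le> r" using complex_Re_le_cmod[of "z0 - z"] d by linarith
    moreover have "cmod z \<le> cmod z0 + cmod (z0 - z)" using norm_triangle_ineq4[of z0 "z0 - z"] by simp
    ultimately show ?thesis using d by (simp add: r_def)
  qed
  have "r \<le> cmod z0 + r" by simp
  obtain h where h: "integrable (lborel \<Otimes>\<^sub>M lborel) h"
    "\<And>\<mu> p. r \<le> cmod \<mu> \<Longrightarrow> cmod \<mu> \<le> cmod z0 + r \<Longrightarrow> Re \<mu> \<ge> 0 \<Longrightarrow> cmod (layer_density \<mu> p) \<le> h p"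
    by (rule layer_density_bound[OF r \<open>r \<le> cmod z0 + r\<close>]) (rule that)
  have sub: "cball z0 r \<subseteq> {\<mu>. Re \<mu> > 0}"
  proof
    fix z assume "z \<in> cball z0 r"
    then show "z \<in> {\<mu>. Re \<mu> > 0}" using near[of z] r by simp
  qed
  have "cmod (layer_density z p) \<le> h p" if "z \<in> cball z0 r" for z p
    using near[OF that] r complex_Re_le_cmod[of z] by (intro h(2)) linarith+
  then show "\<exists>r>0. \<exists>h. cball z0 r \<subseteq> {\<mu>. Re \<mu> > 0} \<and> integrable (lborel \<Otimes>\<^sub>M lborel) h \<and>
      (\<forall>z\<in>cball z0 r. \<forall>p\<in>space (lborel \<Otimes>\<^sub>M lborel). cmod (layer_density z p) \<le> h p)"
    by (intro exI[of _ r] exI[of _ h] conjI ballI r sub h(1))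
qed

text \<open>The factorisation t + \<mu>^2 = (\<mu> + i sqrt t)(\<mu> - i sqrt t) has two factors of
  real part Re \<mu>, hence the lower bound. The cut of the root is avoided because a real \<mu>^2
  forces \<mu> to be real, and then the sum is positive.\<close>

lemma symbol_nonpos:
  assumes "Re \<mu> > 0" "t \<ge> 0"
  shows "of_real t + \<mu>\<^sup>2 \<notin> \<real>\<^sub>\<le>\<^sub>0" and "(Re \<mu>)\<^sup>2 \<le> cmod (of_real t + \<mu>\<^sup>2)"
proof -
  have eq: "of_real t + \<mu>\<^sup>2 = (\<mu> + \<i> * of_real (sqrt t)) * (\<mu> - \<i> * of_real (sqrt t))"
    using assms(2) by (simp add: algebra_simps power2_eq_square flip: of_real_mult)
  have "(Re \<mu>)\<^sup>2 = Re \<mu> * Re \<mu>" by (rule power2_eq_square)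
  also have "\<dots> \<le> cmod (\<mu> + \<i> * of_real (sqrt t)) * cmod (\<mu> - \<i> * of_real (sqrt t))"
    using assms complex_Re_le_cmod[of "\<mu> + \<i> * of_real (sqrt t)"] complex_Re_le_cmod[of "\<mu> - \<i> * of_real (sqrt t)"]
    by (intro mult_mono) auto
  finally show "(Re \<mu>)\<^sup>2 \<le> cmod (of_real t + \<mu>\<^sup>2)" unfolding eq norm_mult .
  show "of_real t + \<mu>\<^sup>2 \<notin> \<real>\<^sub>\<le>\<^sub>0"
  proof
    assume "of_real t + \<mu>\<^sup>2 \<in> \<real>\<^sub>\<le>\<^sub>0"
    then have *: "Re (\<mu>\<^sup>2) + t \<le> 0" "Im (\<mu>\<^sup>2) = 0" by (simp_all add: complex_nonpos_Reals_iff)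
    then have "Im \<mu> = 0" using assms by (simp add: power2_eq_square)
    then have "(Re \<mu>)\<^sup>2 + t \<le> 0" using * by (simp add: power2_eq_square)
    moreover have "(Re \<mu>)\<^sup>2 > 0" using assms by simp
    ultimately show False using assms(2) by linarith
  qed
qed

lemma fourier_product_integrable: "integrable lborel (\<lambda>\<xi>. fourier \<phi> \<xi> * fourier \<psi> (- \<xi>))"
  by (intro schwartz_mult_integrable[OF inverse_fourier_schwartz[OF \<psi>]] schwartz_integrable fourier_schwartz \<phi>)

lemma symbol_measurable:
  assumes "Re \<mu> > 0"
  shows "(\<lambda>\<xi>::real^'m. 1 / (2 * csqrt (of_real ((norm \<xi>)\<^sup>2) + \<mu>\<^sup>2))) \<in> borel_measurable borel"
proof -
  have "continuous_on UNIV (\<lambda>\<xi>::real^'m. csqrt (of_real ((norm \<xi>)\<^sup>2) + \<mu>\<^sup>2))"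
    by (rule continuous_on_compose2[OF holomorphic_on_imp_continuous_on[OF holomorphic_on_csqrt]])
      (use symbol_nonpos(1)[OF assms] in \<open>auto intro!: continuous_intros simp del: of_real_power\<close>)
  then have "(\<lambda>\<xi>::real^'m. csqrt (of_real ((norm \<xi>)\<^sup>2) + \<mu>\<^sup>2)) \<in> borel_measurable borel"
    by (rule borel_measurable_continuous_onI)
  then show ?thesis by (intro borel_measurable_divide borel_measurable_const borel_measurable_times)
qed

lemma symbol_bound:
  assumes "Re \<mu> \<ge> r" "r > 0"
  shows "cmod (1 / (2 * csqrt (of_real ((norm \<xi>)\<^sup>2) + \<mu>\<^sup>2))) \<le> 1 / (2 * r)"
proof -
  have "r\<^sup>2 \<le> (Re \<mu>)\<^sup>2" using assms by (intro power_mono) auto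
  also have "\<dots> \<le> cmod (of_real ((norm \<xi>)\<^sup>2) + \<mu>\<^sup>2)" by (rule symbol_nonpos) (use assms in auto)
  finally have "r \<le> sqrt (cmod (of_real ((norm \<xi>)\<^sup>2) + \<mu>\<^sup>2))" by (rule real_le_rsqrt)
  then have "1 / (2 * sqrt (cmod (of_real ((norm \<xi>)\<^sup>2) + \<mu>\<^sup>2))) \<le> 1 / (2 * r)"
    using assms by (intro divide_left_mono mult_pos_pos) linarith+
  then show ?thesis by (simp add: norm_divide norm_mult del: of_real_power)
qed

lemma symbol_form_integrable:
  assumes "Re \<mu> > 0"
  shows "integrable lborel (\<lambda>\<xi>. fourier \<phi> \<xi> * fourier \<psi> (- \<xi>) * (1 / (2 * csqrt (of_real ((norm \<xi>)\<^sup>2) + \<mu>\<^sup>2))))"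
proof (rule Bochner_Integration.integrable_bound)
  show "integrable lborel (\<lambda>\<xi>. fourier \<phi> \<xi> * fourier \<psi> (- \<xi>) * of_real (1 / (2 * Re \<mu>)))"
    by (intro integrable_mult_left fourier_product_integrable)
  show "(\<lambda>\<xi>. fourier \<phi> \<xi> * fourier \<psi> (- \<xi>) * (1 / (2 * csqrt (of_real ((norm \<xi>)\<^sup>2) + \<mu>\<^sup>2)))) \<in> borel_measurable lborel"
    using borel_measurable_times[OF _ symbol_measurable[OF assms]] borel_measurable_integrable[OF fourier_product_integrable]
    unfolding measurable_lborel2 by blast
  show "AE \<xi> in lborel. norm (fourier \<phi> \<xi> * fourier \<psi> (- \<xi>) * (1 / (2 * csqrt (of_real ((norm \<xi>)\<^sup>2) + \<mu>\<^sup>2))))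
      \<le> norm (fourier \<phi> \<xi> * fourier \<psi> (- \<xi>) * of_real (1 / (2 * Re \<mu>)))"
  proof (rule AE_I2)
    fix \<xi> :: "real^'m"
    have "cmod (1 / (2 * csqrt (of_real ((norm \<xi>)\<^sup>2) + \<mu>\<^sup>2))) \<le> cmod (of_real (1 / (2 * Re \<mu>)))"
      using symbol_bound[of "Re \<mu>" \<mu> \<xi>] assms unfolding norm_of_real by linarith
    then show "norm (fourier \<phi> \<xi> * fourier \<psi> (- \<xi>) * (1 / (2 * csqrt (of_real ((norm \<xi>)\<^sup>2) + \<mu>\<^sup>2))))
      \<le> norm (fourier \<phi> \<xi> * fourier \<psi> (- \<xi>) * of_real (1 / (2 * Re \<mu>)))"
      unfolding norm_mult[of "fourier \<phi> \<xi> * fourier \<psi> (- \<xi>)"] by (intro mult_left_mono) auto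
  qed
qed

lemma symbol_form_holomorphic: "symbol_form holomorphic_on {\<mu>. Re \<mu> > 0}"
  unfolding symbol_form_def
proof (rule holomorphic_on_integral)
  show "(\<lambda>\<mu>. fourier \<phi> \<xi> * fourier \<psi> (- \<xi>) * (1 / (2 * csqrt (of_real ((norm \<xi>)\<^sup>2) + \<mu>\<^sup>2)))) holomorphic_on {\<mu>. Re \<mu> > 0}" for \<xi>
  proof (intro holomorphic_intros)
    fix \<mu> :: complex assume "\<mu> \<in> {\<mu>. Re \<mu> > 0}"
    then have n: "of_real ((norm \<xi>)\<^sup>2) + \<mu>\<^sup>2 \<notin> \<real>\<^sub>\<le>\<^sub>0" by (intro symbol_nonpos) auto
    then show "of_real ((norm \<xi>)\<^sup>2) + \<mu>\<^sup>2 \<notin> \<real>\<^sub>\<le>\<^sub>0" .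
    show "2 * csqrt (of_real ((norm \<xi>)\<^sup>2) + \<mu>\<^sup>2) \<noteq> 0"
    proof
      assume "2 * csqrt (of_real ((norm \<xi>)\<^sup>2) + \<mu>\<^sup>2) = 0"
      then have "of_real ((norm \<xi>)\<^sup>2) + \<mu>\<^sup>2 = 0" by (simp only: mult_eq_0_iff csqrt_eq_0) simp
      then show False using n by (simp only: nonpos_Reals_zero_I not_True_eq_False)
    qed
  qed
  show "integrable lborel (\<lambda>\<xi>. fourier \<phi> \<xi> * fourier \<psi> (- \<xi>) * (1 / (2 * csqrt (of_real ((norm \<xi>)\<^sup>2) + \<mu>\<^sup>2))))"
    if "\<mu> \<in> {\<mu>. Re \<mu> > 0}" for \<mu>
    using that by (intro symbol_form_integrable) simp
  fix z0 assume z0: "z0 \<in> {\<mu>. Re \<mu> > 0}"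
  define r where "r = Re z0 / 2"
  have r: "r > 0" using z0 by (simp add: r_def)
  have near: "Re z \<ge> r" if "z \<in> cball z0 r" for z
  proof -
    have "Re (z0 - z) \<le> r" using complex_Re_le_cmod[of "z0 - z"] that by (simp add: dist_norm)
    then show ?thesis by (simp add: r_def)
  qed
  have sub: "cball z0 r \<subseteq> {\<mu>. Re \<mu> > 0}"
  proof
    fix z assume "z \<in> cball z0 r"
    then show "z \<in> {\<mu>. Re \<mu> > 0}" using near[of z] r by simp
  qed
  define h where "h \<xi> = cmod (fourier \<phi> \<xi> * fourier \<psi> (- \<xi>)) * (1 / (2 * r))" for \<xi>
  have h: "integrable lborel h" unfolding h_def by (intro integrable_mult_left integrable_norm fourier_product_integrable)
  have "cmod (fourier \<phi> \<xi> * fourier \<psi> (- \<xi>) * (1 / (2 * csqrt (of_real ((norm \<xi>)\<^sup>2) + z\<^sup>2)))) \<le> h \<xi>" if "z \<in> cball z0 r" for z \<xi>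
    unfolding norm_mult[of "fourier \<phi> \<xi> * fourier \<psi> (- \<xi>)"] h_def
    by (intro mult_left_mono symbol_bound near that r) simp
  then show "\<exists>r>0. \<exists>h. cball z0 r \<subseteq> {\<mu>. Re \<mu> > 0} \<and> integrable lborel h \<and>
      (\<forall>z\<in>cball z0 r. \<forall>\<xi>\<in>space lborel.
        cmod (fourier \<phi> \<xi> * fourier \<psi> (- \<xi>) * (1 / (2 * csqrt (of_real ((norm \<xi>)\<^sup>2) + z\<^sup>2)))) \<le> h \<xi>)"
    by (intro exI[of _ r] exI[of _ h] conjI ballI r sub h)
qed

text \<open>Identity theorem: the equality on the positive real axis, whose points accumulate at 1,
  spreads over the connected half plane.\<close>

lemma layer_form_symbol_form:
  assumes "Re \<mu> > 0"
  shows "layer_form \<mu> = symbol_form \<mu>"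
proof -
  define U where "U = complex_of_real ` {0<..}"
  have "layer_form \<mu> - symbol_form \<mu> = 0"
  proof (rule analytic_continuation[where f = "\<lambda>\<mu>. layer_form \<mu> - symbol_form \<mu>" and S = "{\<mu>. Re \<mu> > 0}" and U = U and \<xi> = 1])
    show "(\<lambda>\<mu>. layer_form \<mu> - symbol_form \<mu>) holomorphic_on {\<mu>. Re \<mu> > 0}"
      by (intro holomorphic_on_diff layer_form_holomorphic symbol_form_holomorphic)
    show "open {\<mu>. Re \<mu> > 0}" by (rule open_halfspace_Re_gt)
    show "connected {\<mu>. Re \<mu> > 0}" by (rule convex_connected[OF convex_halfspace_Re_gt])
    show "U \<subseteq> {\<mu>. Re \<mu> > 0}" by (auto simp: U_def)
    show "1 islimpt U"
      unfolding islimpt_approachable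
    proof (intro allI impI)
      fix e :: real assume "e > 0"
      then have "complex_of_real (1 + e / 2) \<in> U \<and> complex_of_real (1 + e / 2) \<noteq> 1 \<and> dist (complex_of_real (1 + e / 2)) 1 < e"
        unfolding U_def dist_norm by (intro conjI imageI) (simp_all add: norm_divide)
      then show "\<exists>x'\<in>U. x' \<noteq> 1 \<and> dist x' 1 < e" by blast
    qed
    show "layer_form z - symbol_form z = 0" if "z \<in> U" for z
      using that layer_form_real by (auto simp: U_def)
  qed (use assms in auto)
  then show ?thesis by simp
qed

lemma layer_form_tendsto:
  assumes k: "k > 0"
  shows "(\<lambda>n. layer_form (of_real (inverse (real (Suc n))) - \<i> * of_real k)) \<longlonglongrightarrow> layer_form (- \<i> * of_real k)"
proof -
  define \<mu> where "\<mu> n = of_real (inverse (real (Suc n))) - \<i> * of_real k" for n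
  have lim: "\<mu> \<longlonglongrightarrow> - \<i> * of_real k"
  proof -
    have "(\<lambda>n. complex_of_real (inverse (real (Suc n))) - \<i> * of_real k) \<longlonglongrightarrow> of_real 0 - \<i> * of_real k"
      by (intro tendsto_intros LIMSEQ_inverse_real_of_nat)
    then show ?thesis unfolding \<mu>_def by simp
  qed
  have bd: "k \<le> cmod (\<mu> n)" "cmod (\<mu> n) \<le> k + 1" "Re (\<mu> n) \<ge> 0" for n
  proof -
    have c: "\<mu> n = Complex (inverse (real (Suc n))) (- k)"
      unfolding \<mu>_def Complex_eq by simp
    show "k \<le> cmod (\<mu> n)" using abs_Im_le_cmod[of "\<mu> n"] k by (simp add: c del: of_nat_Suc)
    have "cmod (\<mu> n) \<le> \<bar>Re (\<mu> n)\<bar> + \<bar>Im (\<mu> n)\<bar>" by (rule cmod_le)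
    also have "\<dots> = inverse (real (Suc n)) + k" unfolding c using k by (simp del: of_nat_Suc)
    also have "\<dots> \<le> k + 1" by (simp add: inverse_eq_divide)
    finally show "cmod (\<mu> n) \<le> k + 1" .
    show "Re (\<mu> n) \<ge> 0" unfolding c by simp
  qed
  have k1: "k \<le> k + 1" by simp
  obtain h where h: "integrable (lborel \<Otimes>\<^sub>M lborel) h"
    "\<And>\<mu> p. k \<le> cmod \<mu> \<Longrightarrow> cmod \<mu> \<le> k + 1 \<Longrightarrow> Re \<mu> \<ge> 0 \<Longrightarrow> cmod (layer_density \<mu> p) \<le> h p"
    by (rule layer_density_bound[OF k k1]) (rule that)
  have "(\<lambda>n. \<integral>p. layer_density (\<mu> n) p \<partial>(lborel \<Otimes>\<^sub>M lborel)) \<longlonglongrightarrow> (\<integral>p. layer_density (- \<i> * of_real k) p \<partial>(lborel \<Otimes>\<^sub>M lborel))"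
  proof (rule integral_dominated_convergence[OF layer_density_measurable layer_density_measurable h(1)])
    show "AE p in lborel \<Otimes>\<^sub>M lborel. (\<lambda>n. layer_density (\<mu> n) p) \<longlonglongrightarrow> layer_density (- \<i> * of_real k) p"
    proof (rule AE_I2)
      fix p :: "(real^'m) \<times> (real^'m)"
      \<comment> \<open>The point - i k lies on the boundary of the half plane but off the cut of
        the logarithm, so the kernel at a fixed p is holomorphic around it.\<close>
      have "isCont (\<lambda>\<mu>. screen_potential \<mu> (fst p - snd p)) (- \<i> * of_real k)"
      proof (rule continuous_on_interior[OF holomorphic_on_imp_continuous_on[OF screen_potential_holomorphic]])
        have "open (- \<real>\<^sub>\<le>\<^sub>0 :: complex set)" by (rule open_Compl[OF closed_nonpos_Reals_complex])
        then show "- \<i> * of_real k \<in> interior (- \<real>\<^sub>\<le>\<^sub>0)"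
          using k by (simp add: interior_open complex_nonpos_Reals_iff)
      qed
      then show "(\<lambda>n. layer_density (\<mu> n) p) \<longlonglongrightarrow> layer_density (- \<i> * of_real k) p"
        unfolding layer_density_def by (intro tendsto_intros isCont_tendsto_compose[OF _ lim])
    qed
    show "AE p in lborel \<Otimes>\<^sub>M lborel. norm (layer_density (\<mu> n) p) \<le> h p" for n
      by (intro AE_I2 h(2) bd)
  qed
  then show ?thesis unfolding layer_form_def \<mu>_def .
qed

end

text \<open>The imaginary part of \<open>w\<close> is - 2 \<epsilon> k < 0, so its principal root
  lies in the closed fourth quadrant and the reciprocal in the first, where real plus imaginary part
  dominates the modulus. The modulus of \<open>w\<close> is at most t + \<epsilon>^2 + k^2, and the
  loss against k^2 + t is a factor tending to 1 with \<epsilon>.\<close>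

lemma csqrt_inverse_bound:
  fixes k \<epsilon> t :: real
  assumes k: "k > 0" and \<epsilon>: "\<epsilon> > 0" and t: "t \<ge> 0"
  defines "w \<equiv> of_real t + (of_real \<epsilon> - \<i> * of_real k)\<^sup>2"
  shows "1 / sqrt (1 + \<epsilon>\<^sup>2 / k\<^sup>2) * (k\<^sup>2 + t) powr (- 1/2) \<le> Re (1 / csqrt w) + Im (1 / csqrt w)"
proof -
  have w: "Re w = t + \<epsilon>\<^sup>2 - k\<^sup>2" "Im w = - 2 * \<epsilon> * k" by (simp_all add: w_def power2_eq_square)
  have Imw: "Im w < 0" using k \<epsilon> by (simp add: w)
  then have w0: "cmod w > 0" by auto
  have s: "Re (csqrt w) \<ge> 0" "Im (csqrt w) \<le> 0"
  proof -
    have "0 \<le> cmod w + Re w" "0 \<le> cmod w - Re w" using abs_Re_le_cmod[of w] by linarith+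
    then show "Re (csqrt w) \<ge> 0" "Im (csqrt w) \<le> 0" using Imw by (simp_all add: sgn_if)
  qed
  have "0 \<le> Re (1 / csqrt w)" "0 \<le> Im (1 / csqrt w)"
    using s by (simp_all add: Re_divide Im_divide divide_nonpos_nonneg)
  then have "cmod (1 / csqrt w) \<le> Re (1 / csqrt w) + Im (1 / csqrt w)"
    using cmod_le[of "1 / csqrt w"] by linarith
  moreover have "1 / sqrt (1 + \<epsilon>\<^sup>2 / k\<^sup>2) * (k\<^sup>2 + t) powr (- 1/2) \<le> cmod (1 / csqrt w)"
  proof -
    have kt: "k\<^sup>2 + t > 0" using k t by (simp add: add_pos_nonneg)
    have c: "1 + \<epsilon>\<^sup>2 / k\<^sup>2 > 0" by (simp add: add_pos_nonneg)
    have "cmod w \<le> cmod (of_real t) + cmod ((of_real \<epsilon> - \<i> * of_real k)\<^sup>2)" unfolding w_def by (rule norm_triangle_ineq)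
    also have "\<dots> = t + (\<epsilon>\<^sup>2 + k\<^sup>2)" using t by (simp add: norm_power cmod_power2)
    also have "\<dots> \<le> (1 + \<epsilon>\<^sup>2 / k\<^sup>2) * (k\<^sup>2 + t)" using k t by (simp add: field_simps)
    finally have "sqrt (cmod w) \<le> sqrt ((1 + \<epsilon>\<^sup>2 / k\<^sup>2) * (k\<^sup>2 + t))" by (rule real_sqrt_le_mono)
    then have "1 / sqrt ((1 + \<epsilon>\<^sup>2 / k\<^sup>2) * (k\<^sup>2 + t)) \<le> 1 / sqrt (cmod w)"
      using w0 c kt by (intro divide_left_mono mult_pos_pos) auto
    moreover have "(k\<^sup>2 + t) powr (- 1/2) = 1 / sqrt (k\<^sup>2 + t)"
      using kt by (simp add: powr_minus_divide powr_half_sqrt)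
    ultimately show ?thesis by (simp add: norm_divide real_sqrt_mult)
  qed
  ultimately show ?thesis by linarith
qed

lemma Re_plus_Im_le: "Re z + Im z \<le> sqrt 2 * cmod z"
proof -
  have "(Re z + Im z)\<^sup>2 \<le> 2 * ((Re z)\<^sup>2 + (Im z)\<^sup>2)"
    using sum_squares_bound[of "Re z" "Im z"] by (simp add: power2_sum)
  also have "\<dots> = (sqrt 2 * cmod z)\<^sup>2" by (simp add: power_mult_distrib cmod_power2)
  finally show ?thesis by (rule power2_le_imp_le) simp
qed

lemma layer_form_coercive:
  fixes \<phi> :: "real^'m::finite \<Rightarrow> complex"
  assumes m: "CARD('m) \<in> {1, 2}" and k: "k > 0"
    and \<phi>: "\<phi> \<in> schwartz" and \<rho>: "\<rho> > 0" and \<phi>0: "\<forall>x. norm x > \<rho> \<longrightarrow> \<phi> x = 0"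
  shows "1 / (2 * sqrt 2) * (wnorm k (- 1/2) (fourier \<phi>))\<^sup>2 \<le>
    cmod (\<integral>x. (\<integral>y. screen_potential (- \<i> * of_real k) (x - y) * \<phi> y \<partial>lborel) * cnj (\<phi> x) \<partial>lborel)"
proof -
  \<comment> \<open>With this choice the product of the two transforms in \<open>symbol_form\<close>
    becomes the squared modulus of the transform of \<phi>.\<close>
  define \<psi> where "\<psi> = (\<lambda>x. cnj (\<phi> x))"
  have \<psi>: "\<psi> \<in> schwartz" unfolding \<psi>_def by (rule schwartz_cnj[OF \<phi>])
  have \<psi>0: "\<forall>x. norm x > \<rho> \<longrightarrow> \<psi> x = 0" using \<phi>0 by (simp add: \<psi>_def)
  note ctx = m \<phi> \<psi> \<rho> \<phi>0 \<psi>0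
  define \<epsilon> where "\<epsilon> n = inverse (real (Suc n))" for n
  define \<mu> where "\<mu> n = of_real (\<epsilon> n) - \<i> * of_real k" for n
  define W where "W = (wnorm k (- 1/2) (fourier \<phi>))\<^sup>2"
  have W: "W = (\<integral>\<xi>. weight k (- 1/2) \<xi> * (cmod (fourier \<phi> \<xi>))\<^sup>2 \<partial>lborel)" unfolding W_def by (rule wnorm_square)
  have "fourier \<phi> \<in> wspace (- 1/2)" by (rule schwartz_wspace[OF fourier_schwartz[OF \<phi>]]) simp
  then have intW: "integrable lborel (\<lambda>\<xi>. weight k (- 1/2) \<xi> * (cmod (fourier \<phi> \<xi>))\<^sup>2)" by (rule wspace_integrable[OF _ k])
  have lower: "1 / (2 * sqrt 2) * (1 / sqrt (1 + (\<epsilon> n)\<^sup>2 / k\<^sup>2) * W) \<le> cmod (layer_form \<phi> \<psi> (\<mu> n))" for n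
  proof -
    have \<epsilon>: "\<epsilon> n > 0" by (simp add: \<epsilon>_def)
    have Re\<mu>: "Re (\<mu> n) > 0" using \<epsilon> by (simp add: \<mu>_def)
    define g where "g \<xi> = fourier \<phi> \<xi> * fourier \<psi> (- \<xi>) * (1 / (2 * csqrt (of_real ((norm \<xi>)\<^sup>2) + (\<mu> n)\<^sup>2)))" for \<xi>
    have int: "integrable lborel g" unfolding g_def by (rule symbol_form_integrable[OF ctx Re\<mu>])
    have G: "layer_form \<phi> \<psi> (\<mu> n) = (\<integral>\<xi>. g \<xi> \<partial>lborel)"
      unfolding layer_form_symbol_form[OF ctx Re\<mu>] symbol_form_def[OF ctx] g_def ..
    have g_eq: "g \<xi> = of_real ((cmod (fourier \<phi> \<xi>))\<^sup>2 / 2) * (1 / csqrt (of_real ((norm \<xi>)\<^sup>2) + (\<mu> n)\<^sup>2))" for \<xi>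
    proof -
      have "fourier \<phi> \<xi> * fourier \<psi> (- \<xi>) = of_real ((cmod (fourier \<phi> \<xi>))\<^sup>2)"
        unfolding \<psi>_def fourier_cnj complex_norm_square by simp
      then show ?thesis unfolding g_def by simp
    qed
    have pt: "1 / 2 * (1 / sqrt (1 + (\<epsilon> n)\<^sup>2 / k\<^sup>2)) * (weight k (- 1/2) \<xi> * (cmod (fourier \<phi> \<xi>))\<^sup>2) \<le> Re (g \<xi>) + Im (g \<xi>)" for \<xi>
    proof -
      have "1 / 2 * (1 / sqrt (1 + (\<epsilon> n)\<^sup>2 / k\<^sup>2)) * (weight k (- 1/2) \<xi> * (cmod (fourier \<phi> \<xi>))\<^sup>2) =
        (cmod (fourier \<phi> \<xi>))\<^sup>2 / 2 * (1 / sqrt (1 + (\<epsilon> n)\<^sup>2 / k\<^sup>2) * (k\<^sup>2 + (norm \<xi>)\<^sup>2) powr (- 1/2))"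
        unfolding weight_def by (simp add: mult_ac)
      also have "\<dots> \<le> (cmod (fourier \<phi> \<xi>))\<^sup>2 / 2 * (Re (1 / csqrt (of_real ((norm \<xi>)\<^sup>2) + (\<mu> n)\<^sup>2)) + Im (1 / csqrt (of_real ((norm \<xi>)\<^sup>2) + (\<mu> n)\<^sup>2)))"
        unfolding \<mu>_def by (intro mult_left_mono csqrt_inverse_bound k \<epsilon>) auto
      also have "\<dots> = Re (g \<xi>) + Im (g \<xi>)"
        unfolding g_eq by (simp only: distrib_left Re_complex_of_real times_complex.sel Im_complex_of_real mult_zero_left diff_0_right add_0_right)
      finally show ?thesis .
    qed
    have "1 / 2 * (1 / sqrt (1 + (\<epsilon> n)\<^sup>2 / k\<^sup>2)) * W = (\<integral>\<xi>. 1 / 2 * (1 / sqrt (1 + (\<epsilon> n)\<^sup>2 / k\<^sup>2)) * (weight k (- 1/2) \<xi> * (cmod (fourier \<phi> \<xi>))\<^sup>2) \<partial>lborel)"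
      unfolding W by (simp only: integral_mult_right_zero)
    \<comment> \<open>Real plus imaginary part is used in place of the modulus because it is linear
      and commutes with the integral; the loss of sqrt 2 against the modulus is paid once, after
      integrating.\<close>
    also have "\<dots> \<le> (\<integral>\<xi>. Re (g \<xi>) + Im (g \<xi>) \<partial>lborel)"
      using pt by (intro integral_mono integrable_mult_right intW Bochner_Integration.integrable_add integrable_Re integrable_Im int)
    also have "\<dots> = Re (\<integral>\<xi>. g \<xi> \<partial>lborel) + Im (\<integral>\<xi>. g \<xi> \<partial>lborel)"
      using int by (subst Bochner_Integration.integral_add) (simp_all add: integral_Re integral_Im)
    also have "\<dots> \<le> sqrt 2 * cmod (layer_form \<phi> \<psi> (\<mu> n))" unfolding G by (rule Re_plus_Im_le)
    finally have "1 / 2 * (1 / sqrt (1 + (\<epsilon> n)\<^sup>2 / k\<^sup>2)) * W \<le> sqrt 2 * cmod (layer_form \<phi> \<psi> (\<mu> n))" .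
    moreover have "1 / 2 * c * W \<le> sqrt 2 * X \<Longrightarrow> 1 / (2 * sqrt 2) * (c * W) \<le> X" for c X :: real
      by (simp add: field_simps)
    ultimately show ?thesis by blast
  qed
  have lim: "(\<lambda>n. cmod (layer_form \<phi> \<psi> (\<mu> n))) \<longlonglongrightarrow> cmod (layer_form \<phi> \<psi> (- \<i> * of_real k))"
    unfolding \<mu>_def \<epsilon>_def by (intro tendsto_norm layer_form_tendsto[OF ctx k])
  have "\<epsilon> \<longlonglongrightarrow> 0" unfolding \<epsilon>_def by (rule LIMSEQ_inverse_real_of_nat)
  then have "(\<lambda>n. 1 / (2 * sqrt 2) * (1 / sqrt (1 + (\<epsilon> n)\<^sup>2 / k\<^sup>2) * W)) \<longlonglongrightarrow> 1 / (2 * sqrt 2) * (1 / sqrt (1 + 0\<^sup>2 / k\<^sup>2) * W)"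
    by (intro tendsto_intros) (use k in auto)
  then have "1 / (2 * sqrt 2) * (1 / sqrt (1 + 0\<^sup>2 / k\<^sup>2) * W) \<le> cmod (layer_form \<phi> \<psi> (- \<i> * of_real k))"
    by (rule LIMSEQ_le[OF _ lim]) (use lower in auto)
  moreover have "- \<i> * of_real k \<noteq> 0" "Re (- \<i> * of_real k) \<ge> 0" using k by auto
  ultimately show ?thesis
    unfolding W_def using layer_form_eq[OF ctx, of "- \<i> * of_real k"] by (simp add: \<psi>_def)
qed


subsection \<open>The single-layer operator as a Fourier multiplier\<close>

text \<open>The inverse transform of g as a distribution: g need not be integrable, so the inverse
  transform \<open>fourier f (- \<xi>)\<close> is applied to the test function instead.\<close>

definition fourier_inverse_dist :: "(real^'m::finite \<Rightarrow> complex) \<Rightarrow> (real^'m \<Rightarrow> complex) \<Rightarrow> complex" where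
  "fourier_inverse_dist g f = (if f \<in> schwartz then (\<integral>\<xi>. g \<xi> * fourier f (- \<xi>) \<partial>lborel) else 0)"

context
  fixes g :: "real^'m::finite \<Rightarrow> complex" and s :: real
  assumes g: "g \<in> wspace s" and s: "s \<ge> 0"
begin

lemma wspace_schwartz_integrable: "f \<in> schwartz \<Longrightarrow> integrable lborel (\<lambda>\<xi>. g \<xi> * f \<xi>)"
  by (rule wspace_integrable_mult[OF g schwartz_wspace]) (use s in auto)

lemma fourier_inverse_dist_add:
  assumes f: "f \<in> schwartz" "h \<in> schwartz"
  shows "fourier_inverse_dist g (\<lambda>x. f x + h x) = fourier_inverse_dist g f + fourier_inverse_dist g h"
proof -
  have "fourier_inverse_dist g (\<lambda>x. f x + h x) = (\<integral>\<xi>. g \<xi> * fourier f (- \<xi>) + g \<xi> * fourier h (- \<xi>) \<partial>lborel)"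
    using f by (simp add: fourier_inverse_dist_def schwartz_add fourier_add schwartz_integrable distrib_left)
  also have "\<dots> = fourier_inverse_dist g f + fourier_inverse_dist g h"
    using f by (subst Bochner_Integration.integral_add)
      (simp_all add: fourier_inverse_dist_def wspace_schwartz_integrable inverse_fourier_schwartz)
  finally show ?thesis .
qed

text \<open>Duality of the weighted spaces reduces the claim to the norm with exponent - s; there
  the weight is at most 1 and Plancherel gives the L2 norm of f, which a seminorm of order m
  controls because (1 + norm x)^(- 2 m) is integrable.\<close>

lemma fourier_inverse_dist_bound:
  "\<exists>C N. \<forall>f\<in>schwartz. cmod (fourier_inverse_dist g f) \<le> C * schwartz_seminorm N f"
proof -
  let ?N = "CARD('m)"
  let ?w = "\<lambda>x::real^'m. 1 / (1 + norm x) ^ (2 * ?N)"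
  define J where "J = (\<integral>x. ?w x \<partial>lborel)"
  have "cmod (fourier_inverse_dist g f) \<le> (wnorm 1 s g * sqrt J) * schwartz_seminorm ?N f" if f: "f \<in> schwartz" for f
  proof -
    define S where "S = schwartz_seminorm ?N f"
    have S: "S \<ge> 0" unfolding S_def by (rule schwartz_seminorm_nonneg[OF f])
    have F: "(\<lambda>\<xi>. fourier f (- \<xi>)) \<in> schwartz" by (rule inverse_fourier_schwartz[OF f])
    note [measurable] = schwartz_measurable[OF fourier_schwartz[OF f]]
    have "(wnorm 1 (- s) (\<lambda>\<xi>. fourier f (- \<xi>)))\<^sup>2 \<le> (\<integral>\<xi>. (cmod (fourier f (- \<xi>)))\<^sup>2 \<partial>lborel)"
      unfolding wnorm_square
    proof (rule integral_mono)
      have "(\<lambda>\<xi>. fourier f (- \<xi>)) \<in> wspace (- s)" by (rule schwartz_wspace[OF F]) (use s in simp)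
      then show "integrable lborel (\<lambda>\<xi>. weight 1 (- s) \<xi> * (cmod (fourier f (- \<xi>)))\<^sup>2)" by (rule wspace_integrable) simp
      show "integrable lborel (\<lambda>\<xi>. (cmod (fourier f (- \<xi>)))\<^sup>2)" by (rule schwartz_integrable_square[OF F])
      fix \<xi> :: "real^'m"
      have "(1 + (norm \<xi>)\<^sup>2) powr (- s) \<le> (1 + (norm \<xi>)\<^sup>2) powr 0" using s by (intro powr_mono) auto
      then have "weight 1 (- s) \<xi> \<le> 1" by (simp add: weight_def add_nonneg_eq_0_iff)
      then show "weight 1 (- s) \<xi> * (cmod (fourier f (- \<xi>)))\<^sup>2 \<le> (cmod (fourier f (- \<xi>)))\<^sup>2"
        by (simp add: mult_left_le_one_le)
    qed
    also have "\<dots> = (\<integral>x. (cmod (f x))\<^sup>2 \<partial>lborel)"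
    proof -
      have "(\<lambda>\<xi>. (cmod (fourier f \<xi>))\<^sup>2) \<in> borel_measurable borel" by measurable
      then show ?thesis
        using lborel_integral_reflect[of "\<lambda>\<xi>. (cmod (fourier f \<xi>))\<^sup>2"] plancherel[OF f] by simp
    qed
    also have "\<dots> \<le> (\<integral>x. S\<^sup>2 * ?w x \<partial>lborel)"
    proof (rule integral_mono)
      show "integrable lborel (\<lambda>x. (cmod (f x))\<^sup>2)" by (rule schwartz_integrable_square[OF f])
      show "integrable lborel (\<lambda>x. S\<^sup>2 * ?w x)" by (intro integrable_mult_right integrable_inverse_polynomial)
      fix x :: "real^'m"
      have p: "(1 + norm x) ^ ?N > 0" by (intro zero_less_power add_pos_nonneg) auto
      have "(1 + norm x) ^ ?N * cmod (f x) \<le> S" using schwartz_seminorm_upper[OF f, of "[]" ?N x] by (simp add: S_def)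
      then have "cmod (f x) \<le> S / (1 + norm x) ^ ?N" using p by (simp add: pos_le_divide_eq mult.commute)
      then have "(cmod (f x))\<^sup>2 \<le> (S / (1 + norm x) ^ ?N)\<^sup>2" by (rule power_mono) simp
      also have "\<dots> = S\<^sup>2 * ?w x" by (simp add: power_divide power_mult[symmetric] mult.commute)
      finally show "(cmod (f x))\<^sup>2 \<le> S\<^sup>2 * ?w x" .
    qed
    also have "\<dots> = S\<^sup>2 * J" unfolding J_def by (rule integral_mult_right_zero)
    finally have "sqrt ((wnorm 1 (- s) (\<lambda>\<xi>. fourier f (- \<xi>)))\<^sup>2) \<le> sqrt (S\<^sup>2 * J)" by (rule real_sqrt_le_mono)
    then have n: "wnorm 1 (- s) (\<lambda>\<xi>. fourier f (- \<xi>)) \<le> S * sqrt J" using S by (simp add: real_sqrt_mult)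
    have "cmod (fourier_inverse_dist g f) \<le> wnorm 1 s g * wnorm 1 (- s) (\<lambda>\<xi>. fourier f (- \<xi>))"
      using f wspace_pairing_le[OF g schwartz_wspace[OF F]] s by (simp add: fourier_inverse_dist_def)
    also have "\<dots> \<le> wnorm 1 s g * (S * sqrt J)" by (intro mult_left_mono n) simp
    finally show ?thesis by (simp add: S_def mult_ac)
  qed
  then show ?thesis by blast
qed

lemma fourier_inverse_dist_tempered: "fourier_inverse_dist g \<in> tempered"
proof -
  obtain C N where "\<forall>f\<in>schwartz. cmod (fourier_inverse_dist g f) \<le> C * schwartz_seminorm N f"
    using fourier_inverse_dist_bound by blast
  then show ?thesis
    by (intro temperedI[where C = C and N = N] fourier_inverse_dist_add)
      (simp_all add: fourier_inverse_dist_def schwartz_cmult fourier_cmult mult.left_commute[of _ "_::complex"])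
qed

lemma fourier_inverse_dist_represents: "represents g (fourier_dist (fourier_inverse_dist g))"
  unfolding represents_def
proof (intro conjI allI impI ballI)
  fix f :: "real^'m \<Rightarrow> complex" assume f: "f \<in> schwartz"
  show "integrable lborel (\<lambda>\<xi>. g \<xi> * f \<xi>)" by (rule wspace_schwartz_integrable[OF f])
  show "fourier_dist (fourier_inverse_dist g) f = (\<integral>\<xi>. g \<xi> * f \<xi> \<partial>lborel)"
    using f by (simp add: fourier_dist_def fourier_inverse_dist_def fourier_schwartz fourier_inversion)
next
  fix K :: "(real^'m) set" assume K: "compact K"
  have iK: "integrable lborel (indicator K :: real^'m \<Rightarrow> real)"
    using K emeasure_compact_finite[OF K] by (simp add: borel_compact)
  \<comment> \<open>The indicator of a compact set lies in the dual weighted space, so its pairing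
    with g gives local integrability.\<close>
  have "(\<lambda>\<xi>. complex_of_real (indicator K \<xi>)) \<in> wspace (- s)"
    unfolding wspace_def mem_Collect_eq
  proof (intro conjI)
    have "(indicator K :: real^'m \<Rightarrow> real) \<in> borel_measurable borel"
      using K by (intro borel_measurable_indicator borel_compact)
    moreover have "complex_of_real \<in> borel_measurable borel" by measurable
    ultimately show m: "(\<lambda>\<xi>. complex_of_real (indicator K \<xi>)) \<in> borel_measurable borel"
      by (rule measurable_compose)
    show "integrable lborel (\<lambda>\<xi>. weight 1 (- s) \<xi> * (cmod (complex_of_real (indicator K \<xi>)))\<^sup>2)"
    proof (rule Bochner_Integration.integrable_bound[OF iK])
      show "(\<lambda>\<xi>. weight 1 (- s) \<xi> * (cmod (complex_of_real (indicator K \<xi>)))\<^sup>2) \<in> borel_measurable lborel"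
        unfolding measurable_lborel2
        by (intro borel_measurable_times weight_measurable borel_measurable_power measurable_compose[OF m borel_measurable_norm])
      show "AE \<xi> in lborel. norm (weight 1 (- s) \<xi> * (cmod (complex_of_real (indicator K \<xi>)))\<^sup>2) \<le> norm (indicator K \<xi> :: real)"
      proof (rule AE_I2)
        fix \<xi> :: "real^'m"
        have "(1 + (norm \<xi>)\<^sup>2) powr (- s) \<le> (1 + (norm \<xi>)\<^sup>2) powr 0" using s by (intro powr_mono) auto
        then have "weight 1 (- s) \<xi> \<le> 1" by (simp add: weight_def add_nonneg_eq_0_iff)
        then show "norm (weight 1 (- s) \<xi> * (cmod (complex_of_real (indicator K \<xi>)))\<^sup>2) \<le> norm (indicator K \<xi> :: real)"
          by (simp split: split_indicator)
      qed
    qed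
  qed
  from wspace_integrable_mult[OF g this] show "set_integrable lborel K g"
    unfolding set_integrable_def scaleR_conv_of_real by (simp only: mult.commute)
qed

lemma fourier_inverse_dist_sobolev: "fourier_inverse_dist g \<in> sobolev s"
  by (rule sobolevI[OF fourier_inverse_dist_tempered fourier_inverse_dist_represents g])

lemma fourier_inverse_dist_norm: "sobolev_norm k s (fourier_inverse_dist g) = wnorm k s g"
  by (rule sobolev_norm_eq[OF fourier_inverse_dist_represents])

end

lemma fourier_inverse_dist_cong_AE:
  assumes "AE \<xi> in lborel. g \<xi> = h \<xi>" "g \<in> borel_measurable borel" "h \<in> borel_measurable borel"
  shows "fourier_inverse_dist g = fourier_inverse_dist h"
proof
  fix f
  show "fourier_inverse_dist g f = fourier_inverse_dist h f"
  proof (cases "f \<in> schwartz")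
    case True
    have m: "(\<lambda>\<xi>. fourier f (- \<xi>)) \<in> borel_measurable borel"
      by (rule schwartz_measurable[OF inverse_fourier_schwartz[OF True]])
    have "(\<integral>\<xi>. g \<xi> * fourier f (- \<xi>) \<partial>lborel) = (\<integral>\<xi>. h \<xi> * fourier f (- \<xi>) \<partial>lborel)"
    proof (rule integral_cong_AE)
      show "AE \<xi> in lborel. g \<xi> * fourier f (- \<xi>) = h \<xi> * fourier f (- \<xi>)"
        using assms(1) by eventually_elim simp
    qed (use assms m in \<open>simp_all add: borel_measurable_times\<close>)
    then show ?thesis by (simp add: fourier_inverse_dist_def)
  qed (simp add: fourier_inverse_dist_def)
qed

section \<open>Multiplier operators from order - 1/2 to order 1/2\<close>

context
  fixes M :: "real^'m::finite \<Rightarrow> complex" and C :: real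
  assumes M: "M \<in> borel_measurable borel" and C: "C \<ge> 0" and MC: "\<forall>\<xi>. cmod (M \<xi>) \<le> C * weight 1 (- 1/2) \<xi>"
begin

text \<open>The square of the bound on \<open>M\<close> contributes the weight with exponent - 1/2
  twice; one copy cancels the weight with exponent 1/2 and the other is the weight of the source
  space.\<close>

lemma multiplier_wspace:
  assumes g: "g \<in> wspace (- 1/2)"
  shows "(\<lambda>\<xi>. M \<xi> * g \<xi>) \<in> wspace (1/2)" and "wnorm 1 (1/2) (\<lambda>\<xi>. M \<xi> * g \<xi>) \<le> C * wnorm 1 (- 1/2) g"
proof -
  have pt: "weight 1 (1/2) \<xi> * (cmod (M \<xi> * g \<xi>))\<^sup>2 \<le> C\<^sup>2 * (weight 1 (- 1/2) \<xi> * (cmod (g \<xi>))\<^sup>2)" for \<xi>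
  proof -
    have w: "weight 1 (1/2) \<xi> * weight 1 (- 1/2) \<xi> = 1" using weight_minus[of 1 "1/2" \<xi>] by simp
    have "(cmod (M \<xi>))\<^sup>2 \<le> (C * weight 1 (- 1/2) \<xi>)\<^sup>2" using MC by (intro power_mono) auto
    then have "weight 1 (1/2) \<xi> * ((cmod (M \<xi>))\<^sup>2 * (cmod (g \<xi>))\<^sup>2) \<le>
        weight 1 (1/2) \<xi> * ((C * weight 1 (- 1/2) \<xi>)\<^sup>2 * (cmod (g \<xi>))\<^sup>2)"
      by (intro mult_left_mono mult_right_mono) auto
    also have "\<dots> = (weight 1 (1/2) \<xi> * weight 1 (- 1/2) \<xi>) * (C\<^sup>2 * (weight 1 (- 1/2) \<xi> * (cmod (g \<xi>))\<^sup>2))"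
      by (simp only: power2_eq_square mult_ac)
    finally show ?thesis unfolding w by (simp add: norm_mult power_mult_distrib)
  qed
  have gm: "g \<in> borel_measurable borel" by (rule wspace_measurable[OF g])
  have m: "(\<lambda>\<xi>. M \<xi> * g \<xi>) \<in> borel_measurable borel" by (rule borel_measurable_times[OF M gm])
  have i: "integrable lborel (\<lambda>\<xi>. C\<^sup>2 * (weight 1 (- 1/2) \<xi> * (cmod (g \<xi>))\<^sup>2))"
    by (intro integrable_mult_right wspace_integrable[OF g]) simp
  have i2: "integrable lborel (\<lambda>\<xi>. weight 1 (1/2) \<xi> * (cmod (M \<xi> * g \<xi>))\<^sup>2)"
  proof (rule Bochner_Integration.integrable_bound[OF i])
    show "(\<lambda>\<xi>. weight 1 (1/2) \<xi> * (cmod (M \<xi> * g \<xi>))\<^sup>2) \<in> borel_measurable lborel"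
      unfolding measurable_lborel2
      by (intro borel_measurable_times[OF weight_measurable] borel_measurable_power measurable_compose[OF m borel_measurable_norm])
    show "AE \<xi> in lborel. norm (weight 1 (1/2) \<xi> * (cmod (M \<xi> * g \<xi>))\<^sup>2) \<le> norm (C\<^sup>2 * (weight 1 (- 1/2) \<xi> * (cmod (g \<xi>))\<^sup>2))"
    proof (rule AE_I2)
      fix \<xi> :: "real^'m"
      have "0 \<le> weight 1 (1/2) \<xi> * (cmod (M \<xi> * g \<xi>))\<^sup>2" by simp
      then show "norm (weight 1 (1/2) \<xi> * (cmod (M \<xi> * g \<xi>))\<^sup>2) \<le> norm (C\<^sup>2 * (weight 1 (- 1/2) \<xi> * (cmod (g \<xi>))\<^sup>2))"
        using pt[of \<xi>] unfolding real_norm_def by linarith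
    qed
  qed
  show "(\<lambda>\<xi>. M \<xi> * g \<xi>) \<in> wspace (1/2)" using m i2 unfolding wspace_def by blast
  have "(wnorm 1 (1/2) (\<lambda>\<xi>. M \<xi> * g \<xi>))\<^sup>2 \<le> C\<^sup>2 * (wnorm 1 (- 1/2) g)\<^sup>2"
    unfolding wnorm_square integral_mult_right_zero[symmetric] by (rule integral_mono[OF i2 i pt])
  then have "(wnorm 1 (1/2) (\<lambda>\<xi>. M \<xi> * g \<xi>))\<^sup>2 \<le> (C * wnorm 1 (- 1/2) g)\<^sup>2" by (simp add: power_mult_distrib)
  then show "wnorm 1 (1/2) (\<lambda>\<xi>. M \<xi> * g \<xi>) \<le> C * wnorm 1 (- 1/2) g"
    by (rule power2_le_imp_le) (use C in simp)
qed

definition multiplier_dist :: "((real^'m \<Rightarrow> complex) \<Rightarrow> complex) \<Rightarrow> (real^'m \<Rightarrow> complex) \<Rightarrow> complex" where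
  "multiplier_dist u = fourier_inverse_dist (\<lambda>\<xi>. M \<xi> * fhat u \<xi>)"

lemma multiplier_dist_sobolev:
  assumes "u \<in> sobolev (- 1/2)"
  shows "multiplier_dist u \<in> sobolev (1/2)"
    and "sobolev_norm 1 (1/2) (multiplier_dist u) \<le> C * sobolev_norm 1 (- 1/2) u"
proof -
  note w = multiplier_wspace[OF sobolev_wspace[OF assms]]
  have h: "(0::real) \<le> 1/2" by simp
  show "multiplier_dist u \<in> sobolev (1/2)"
    unfolding multiplier_dist_def by (rule fourier_inverse_dist_sobolev[OF w(1) h])
  show "sobolev_norm 1 (1/2) (multiplier_dist u) \<le> C * sobolev_norm 1 (- 1/2) u"
    unfolding multiplier_dist_def fourier_inverse_dist_norm[OF w(1) h] unfolding sobolev_norm_wnorm by (rule w(2))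
qed

text \<open>Lets the chosen representative \<open>fhat u\<close> be exchanged for a known one, such
  as a sum, a multiple or the transform of a test function.\<close>

lemma multiplier_dist_AE:
  assumes u: "u \<in> sobolev t" and g: "AE \<xi> in lborel. fhat u \<xi> = g \<xi>" "g \<in> borel_measurable borel"
  shows "multiplier_dist u = fourier_inverse_dist (\<lambda>\<xi>. M \<xi> * g \<xi>)"
  unfolding multiplier_dist_def
proof (rule fourier_inverse_dist_cong_AE)
  show "AE \<xi> in lborel. M \<xi> * fhat u \<xi> = M \<xi> * g \<xi>" using g(1) by eventually_elim simp
qed (intro borel_measurable_times M g(2) fhat_measurable[OF u])+

lemma multiplier_dist_add:
  assumes u: "u \<in> sobolev (- 1/2)" and v: "v \<in> sobolev (- 1/2)"
  shows "multiplier_dist (\<lambda>f. u f + v f) = (\<lambda>f. multiplier_dist u f + multiplier_dist v f)"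
proof
  fix f
  have m: "(\<lambda>\<xi>. fhat u \<xi> + fhat v \<xi>) \<in> borel_measurable borel"
    by (intro borel_measurable_add fhat_measurable[OF u] fhat_measurable[OF v])
  note eq = multiplier_dist_AE[OF sobolev_add[OF u v] fhat_add_AE[OF u v] m]
  note w = multiplier_wspace(1)[OF sobolev_wspace[OF u]] multiplier_wspace(1)[OF sobolev_wspace[OF v]]
  have h: "(0::real) \<le> 1/2" by simp
  show "multiplier_dist (\<lambda>f. u f + v f) f = multiplier_dist u f + multiplier_dist v f"
  proof (cases "f \<in> schwartz")
    case True
    note i = wspace_schwartz_integrable[OF w(1) h inverse_fourier_schwartz[OF True]]
      wspace_schwartz_integrable[OF w(2) h inverse_fourier_schwartz[OF True]]
    have "M \<xi> * (fhat u \<xi> + fhat v \<xi>) * fourier f (- \<xi>) =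
      M \<xi> * fhat u \<xi> * fourier f (- \<xi>) + M \<xi> * fhat v \<xi> * fourier f (- \<xi>)" for \<xi>
      by (simp only: distrib_left distrib_right)
    then show ?thesis
      unfolding eq unfolding multiplier_dist_def fourier_inverse_dist_def
      using True Bochner_Integration.integral_add[OF i] by (simp only: if_True)
  qed (simp add: multiplier_dist_def fourier_inverse_dist_def)
qed

lemma multiplier_dist_cmult:
  assumes u: "u \<in> sobolev (- 1/2)"
  shows "multiplier_dist (\<lambda>f. c * u f) = (\<lambda>f. c * multiplier_dist u f)"
proof
  fix f
  have m: "(\<lambda>\<xi>. c * fhat u \<xi>) \<in> borel_measurable borel"
    by (intro borel_measurable_times borel_measurable_const fhat_measurable[OF u])
  note eq = multiplier_dist_AE[OF sobolev_cmult[OF u] fhat_cmult_AE[OF u] m]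
  have "M \<xi> * (c * fhat u \<xi>) * fourier f (- \<xi>) = c * (M \<xi> * fhat u \<xi> * fourier f (- \<xi>))" for \<xi>
    by (simp only: mult_ac)
  then show "multiplier_dist (\<lambda>f. c * u f) f = c * multiplier_dist u f"
    unfolding eq unfolding multiplier_dist_def fourier_inverse_dist_def
    by (simp only: integral_mult_right_zero if_distrib[of "\<lambda>z. c * z"] mult_zero_right)
qed

lemma multiplier_dist_test:
  assumes \<phi>: "\<phi> \<in> schwartz" and f: "f \<in> schwartz"
  shows "multiplier_dist (tempered_of \<phi>) f = (\<integral>\<xi>. M \<xi> * fourier \<phi> \<xi> * fourier f (- \<xi>) \<partial>lborel)"
proof -
  have h: "- 1/2 \<le> (0::real)" by simp
  show ?thesis
    using f multiplier_dist_AE[OF tempered_of_sobolev[OF \<phi> h] fhat_AE_eq[OF tempered_of_represents[OF \<phi>]]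
        schwartz_measurable[OF fourier_schwartz[OF \<phi>]]]
    by (simp add: fourier_inverse_dist_def)
qed

end

text \<open>The radial profile is given for r > 0 only. Being Lipschitz it extends to r = 0, and
  multiplication by a piecewise linear cutoff, 1 up to R and 0 from 2 R on, makes it compactly
  supported. The distance between R and 2 R is the room for that cutoff.\<close>

lemma cutoff_lipschitz_kernel:
  fixes d :: "real \<Rightarrow> complex"
  assumes R: "R > 0" and L: "L \<ge> 0"
    and lip: "\<And>r s. 0 < r \<Longrightarrow> r \<le> 2 * R \<Longrightarrow> 0 < s \<Longrightarrow> s \<le> 2 * R \<Longrightarrow> cmod (d r - d s) \<le> L * \<bar>r - s\<bar>"
  obtains D :: "'a::real_normed_vector \<Rightarrow> complex" and L' where
    "\<And>x y. cmod (D x - D y) \<le> L' * norm (x - y)" "\<And>x. norm x > 2 * R \<Longrightarrow> D x = 0"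
    "\<And>x. x \<noteq> 0 \<Longrightarrow> norm x \<le> R \<Longrightarrow> D x = d (norm x)"
proof -
  have "L-lipschitz_on {0<..2 * R} d"
    using lip L by (intro lipschitz_onI) (auto simp: dist_norm)
  from lipschitz_extend_closure[OF this] obtain e where
    e: "L-lipschitz_on (closure {0<..2 * R}) e" "\<forall>r\<in>{0<..2 * R}. e r = d r" by blast
  have "closure {0<..2 * R} = {0..2 * R}" using R by (intro closure_greaterThanAtMost) simp
  then have el: "cmod (e r - e s) \<le> L * \<bar>r - s\<bar>" if "0 \<le> r" "r \<le> 2 * R" "0 \<le> s" "s \<le> 2 * R" for r s
    using lipschitz_onD[OF e(1), of r s] that by (simp add: dist_norm)
  \<comment> \<open>Beyond 2 R the extension is frozen at its last value, which keeps it Lipschitz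
    and bounded by \<open>B\<close> on the whole half line, as the product with the cutoff
    requires.\<close>
  define E where "E r = e (min r (2 * R))" for r
  define cut where "cut r = max 0 (min 1 (2 - r / R))" for r
  have El: "cmod (E r - E s) \<le> L * \<bar>r - s\<bar>" if "0 \<le> r" "0 \<le> s" for r s
  proof -
    have "cmod (E r - E s) \<le> L * \<bar>min r (2 * R) - min s (2 * R)\<bar>" unfolding E_def using that R by (intro el) auto
    also have "\<dots> \<le> L * \<bar>r - s\<bar>" using L by (intro mult_left_mono) auto
    finally show ?thesis .
  qed
  define B where "B = cmod (e 0) + L * (2 * R)"
  have B: "B \<ge> 0" using L R by (simp add: B_def)
  have Eb: "cmod (E r) \<le> B" if "0 \<le> r" for r
  proof -
    have "cmod (E r - e 0) \<le> L * \<bar>min r (2 * R) - 0\<bar>" unfolding E_def using that R by (intro el) auto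
    also have "\<dots> \<le> L * (2 * R)" using L R that by (intro mult_left_mono) auto
    finally show ?thesis using norm_triangle_ineq2[of "E r" "e 0"] by (simp add: B_def)
  qed
  have cut_le_1: "\<bar>cut r\<bar> \<le> 1" for r by (simp add: cut_def)
  have cut_lip: "\<bar>cut r - cut s\<bar> \<le> 1 / R * \<bar>r - s\<bar>" for r s
  proof -
    have "\<bar>cut r - cut s\<bar> \<le> \<bar>r / R - s / R\<bar>" unfolding cut_def by linarith
    also have "\<dots> = 1 / R * \<bar>r - s\<bar>" using R by (simp add: diff_divide_distrib[symmetric])
    finally show ?thesis .
  qed
  define D where "D x = of_real (cut (norm x)) * E (norm x)" for x :: 'a
  show thesis
  proof (rule that[of D "L + B / R"])
    fix x y :: 'a
    have "D x - D y = of_real (cut (norm x)) * (E (norm x) - E (norm y)) + of_real (cut (norm x) - cut (norm y)) * E (norm y)"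
      by (simp add: D_def algebra_simps)
    then have "cmod (D x - D y) \<le> \<bar>cut (norm x)\<bar> * cmod (E (norm x) - E (norm y)) + \<bar>cut (norm x) - cut (norm y)\<bar> * cmod (E (norm y))"
      by (metis norm_triangle_ineq norm_mult norm_of_real)
    also have "\<dots> \<le> 1 * (L * \<bar>norm x - norm y\<bar>) + (1 / R * \<bar>norm x - norm y\<bar>) * B"
      using R L by (intro add_mono mult_mono cut_le_1 cut_lip El Eb) auto
    also have "\<dots> = (L + B / R) * \<bar>norm x - norm y\<bar>" by (simp add: algebra_simps)
    also have "\<dots> \<le> (L + B / R) * norm (x - y)"
      using L B R by (intro mult_left_mono norm_triangle_ineq3) auto
    finally show "cmod (D x - D y) \<le> (L + B / R) * norm (x - y)" .
  next
    fix x :: 'a assume "norm x > 2 * R"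
    then have "2 - norm x / R < 0" using R by (simp add: pos_less_divide_eq)
    then show "D x = 0" by (simp add: D_def cut_def)
  next
    fix x :: 'a assume x: "x \<noteq> 0" "norm x \<le> R"
    then have "norm x / R \<le> 1" using R by simp
    then have "cut (norm x) = 1" unfolding cut_def by linarith
    moreover have "norm x \<le> 2 * R" using x R by linarith
    then have "E (norm x) = d (norm x)" using x e(2) R unfolding E_def by (simp add: min_def)
    ultimately show "D x = d (norm x)" by (simp add: D_def)
  qed
qed

text \<open>The heat kernel for \<kappa> = 1 plus the difference of the two kernels, cut off. The
  first part contributes the 1/2 of its explicit symbol to the constant, the second the decay
  constant of a compactly supported Lipschitz function.\<close>

lemma screen_potential_multiplier:
  fixes k R :: real
  assumes m: "CARD('m::finite) \<in> {1, 2}" and R: "R > 0"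
  obtains K :: "real^'m \<Rightarrow> complex" and C where
    "integrable lborel K" "C \<ge> 0" "\<forall>\<xi>. cmod (multiplier K \<xi>) \<le> C * weight 1 (- 1/2) \<xi>"
    "\<And>z. z \<noteq> 0 \<Longrightarrow> norm z \<le> R \<Longrightarrow> K z = screen_potential \<mu> z"
proof -
  have R2: "2 * R > 0" using R by simp
  obtain L where L: "L \<ge> 0" "\<And>r s. 0 < r \<Longrightarrow> r \<le> 2 * R \<Longrightarrow> 0 < s \<Longrightarrow> s \<le> 2 * R \<Longrightarrow>
    cmod ((screen_kernel CARD('m) \<mu> r - screen_kernel CARD('m) 1 r) - (screen_kernel CARD('m) \<mu> s - screen_kernel CARD('m) 1 s)) \<le> L * \<bar>r - s\<bar>"
    by (rule screen_kernel_difference_lipschitz[OF R2]) (rule that)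
  obtain D :: "real^'m \<Rightarrow> complex" and L' where
    D: "\<And>x y. cmod (D x - D y) \<le> L' * norm (x - y)" "\<And>x. norm x > 2 * R \<Longrightarrow> D x = 0"
    "\<And>x. x \<noteq> 0 \<Longrightarrow> norm x \<le> R \<Longrightarrow> D x = screen_kernel CARD('m) \<mu> (norm x) - screen_kernel CARD('m) 1 (norm x)"
    by (rule cutoff_lipschitz_kernel[where d = "\<lambda>r. screen_kernel CARD('m) \<mu> r - screen_kernel CARD('m) 1 r", OF R L(1)],
      erule (3) L(2), rule that)
  define K1 where "K1 = (\<lambda>z::real^'m. complex_of_real (heat_kernel (real CARD('m) + 1) 1 (norm z)))"
  have K1: "integrable lborel K1" "multiplier K1 \<xi> = of_real (1 / (2 * sqrt (1\<^sup>2 + (norm \<xi>)\<^sup>2)))" for \<xi>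
    unfolding K1_def by (rule heat_kernel_integrable heat_kernel_multiplier; simp)+
  have iD: "integrable lborel D" by (rule lipschitz_multiplier_decay(1)[OF D(1,2)])
  obtain C where C: "C \<ge> 0" "\<forall>\<xi>. cmod (multiplier D \<xi>) \<le> C * weight 1 (- 1/2) \<xi>"
    using lipschitz_multiplier_decay(2)[OF D(1,2)] by blast
  show thesis
  proof (rule that[of "\<lambda>z. K1 z + D z" "1/2 + C"])
    show "integrable lborel (\<lambda>z. K1 z + D z)" by (rule Bochner_Integration.integrable_add[OF K1(1) iD])
    show "1/2 + C \<ge> 0" using C by simp
    show "\<forall>\<xi>. cmod (multiplier (\<lambda>z. K1 z + D z) \<xi>) \<le> (1/2 + C) * weight 1 (- 1/2) \<xi>"
    proof
      fix \<xi> :: "real^'m"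
      have p: "1 + (norm \<xi>)\<^sup>2 > 0" by (simp add: add_pos_nonneg)
      have "cmod (multiplier K1 \<xi>) = 1/2 * weight 1 (- 1/2) \<xi>"
        unfolding K1(2) norm_of_real using p by (simp add: weight_def powr_minus_divide powr_half_sqrt)
      moreover have "cmod (multiplier (\<lambda>z. K1 z + D z) \<xi>) \<le> cmod (multiplier K1 \<xi>) + cmod (multiplier D \<xi>)"
        unfolding multiplier_add[OF K1(1) iD] by (rule norm_triangle_ineq)
      moreover have "cmod (multiplier D \<xi>) \<le> C * weight 1 (- 1/2) \<xi>" using C(2) by blast
      ultimately show "cmod (multiplier (\<lambda>z. K1 z + D z) \<xi>) \<le> (1/2 + C) * weight 1 (- 1/2) \<xi>"
        unfolding distrib_right by linarith
    qed
    fix z :: "real^'m" assume z: "z \<noteq> 0" "norm z \<le> R"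
    have "screen_kernel CARD('m) 1 (norm z) = K1 z"
      using screen_kernel_heat[OF m, of 1 "norm z"] z by (simp add: K1_def)
    then show "K1 z + D z = screen_potential \<mu> z"
      using D(3)[OF z] z by (simp add: screen_potential_def)
  qed
qed

lemma distribution_of_test:
  assumes "f \<in> test_functions \<Omega>"
  shows "distribution_of \<Omega> w f = (\<integral>x. w x * f x \<partial>lborel)"
proof -
  have "indicator \<Omega> x *\<^sub>R (w x * f x) = w x * f x" for x
    using test_functions_eq_0[OF assms, of x] by (cases "x \<in> \<Omega>") simp_all
  then show ?thesis
    using assms unfolding distribution_of_def set_lebesgue_integral_def by simp
qed

text \<open>The kernel K is left open because it is used twice: with the altered integrable kernel
  to construct the operator, and with \<open>screen_potential\<close> itself for the coercivity
  estimate.\<close>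

lemma single_layer_classical_eq:
  fixes \<Gamma> :: "((real^'m::finite) \<times> real) set"
  assumes m: "CARD('m) \<in> {1, 2}" and k: "k > 0" and \<phi>: "\<phi> \<in> test_functions (flat \<Gamma>)"
    and K: "K \<in> borel_measurable borel"
    and eq: "\<And>y. y \<in> flat \<Gamma> \<Longrightarrow> y \<noteq> x \<Longrightarrow> K (x - y) = screen_potential (- \<i> * of_real k) (x - y)"
  shows "single_layer_classical k \<Gamma> \<phi> x = (\<integral>y. K (x - y) * \<phi> y \<partial>lborel)"
  unfolding single_layer_classical_def set_lebesgue_integral_def
proof (rule lborel_integral_cong_off_point[symmetric, where x = x])
  have "(\<lambda>y. x - y) \<in> borel_measurable borel" by measurable
  then have "(\<lambda>y. K (x - y)) \<in> borel_measurable borel" by (rule measurable_compose[OF _ K])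
  then show "(\<lambda>y. K (x - y) * \<phi> y) \<in> borel_measurable borel"
    by (rule borel_measurable_times[OF _ schwartz_measurable[OF test_functions_schwartz[OF \<phi>]]])
  show "K (x - y) * \<phi> y = indicator (flat \<Gamma>) y *\<^sub>R (fundamental_solution k (x, 0 :: real) (y, 0) * \<phi> y)" if "y \<noteq> x" for y
  proof (cases "y \<in> flat \<Gamma>")
    case True
    then show ?thesis
      using eq[OF True that] screen_kernel_fundamental_solution[OF m k, of x y] that by (simp add: screen_potential_def)
  next
    case False
    then show ?thesis using test_functions_eq_0[OF \<phi>] by simp
  qed
qed

lemma extends_single_layer_exists:
  fixes \<Gamma> :: "((real^'m::finite) \<times> real) set"
  assumes m: "CARD('m) \<in> {1, 2}" and k: "k > 0" and bdd: "bounded (flat \<Gamma>)"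
  shows "\<exists>A. extends_single_layer k \<Gamma> A"
proof -
  obtain \<rho> where \<rho>: "\<rho> > 0" "\<And>x. x \<in> flat \<Gamma> \<Longrightarrow> norm x \<le> \<rho>" using bdd bounded_pos by metis
  \<comment> \<open>Two points of the screen are at most 2 \<rho> apart, so K has to agree with the
    true kernel only up to that distance.\<close>
  have R: "2 * \<rho> > 0" using \<rho> by simp
  obtain K :: "real^'m \<Rightarrow> complex" and C where K: "integrable lborel K" and C: "C \<ge> 0" "\<forall>\<xi>. cmod (multiplier K \<xi>) \<le> C * weight 1 (- 1/2) \<xi>"
    and Keq: "\<And>z. z \<noteq> 0 \<Longrightarrow> norm z \<le> 2 * \<rho> \<Longrightarrow> K z = screen_potential (- \<i> * of_real k) z"
    by (rule screen_potential_multiplier[OF m R]) (rule that)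
  have Km: "K \<in> borel_measurable borel" using K by simp
  have M: "multiplier K \<in> borel_measurable borel" by (rule multiplier_measurable[OF Km])
  note ctx = M C
  define A where "A u = restrict_dist (flat \<Gamma>) (multiplier_dist (multiplier K) u)" for u
  note sob = sobolev_tilde_sobolev[of _ "- 1/2" "flat \<Gamma>"]
  have "extends_single_layer k \<Gamma> A"
    unfolding extends_single_layer_def
  proof (intro conjI ballI allI)
    show "A u \<in> sobolev_on (1/2) (flat \<Gamma>)" if "u \<in> sobolev_tilde (- 1/2) (flat \<Gamma>)" for u
      unfolding A_def sobolev_on_def by (rule imageI[OF multiplier_dist_sobolev(1)[OF ctx sob[OF that]]])
    show "A (\<lambda>f. u f + v f) = (\<lambda>f. A u f + A v f)"
      if "u \<in> sobolev_tilde (- 1/2) (flat \<Gamma>)" "v \<in> sobolev_tilde (- 1/2) (flat \<Gamma>)" for u v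
      unfolding A_def restrict_dist_def multiplier_dist_add[OF ctx sob[OF that(1)] sob[OF that(2)]] by (rule ext) simp
    show "A (\<lambda>f. c * u f) = (\<lambda>f. c * A u f)" if "u \<in> sobolev_tilde (- 1/2) (flat \<Gamma>)" for c u
      unfolding A_def restrict_dist_def multiplier_dist_cmult[OF ctx sob[OF that]] by (rule ext) simp
    show "\<exists>C. \<forall>u\<in>sobolev_tilde (- 1/2) (flat \<Gamma>). sobolev_on_norm 1 (1/2) (flat \<Gamma>) (A u) \<le> C * sobolev_norm 1 (- 1/2) u"
    proof (intro exI ballI)
      fix u assume "u \<in> sobolev_tilde (- 1/2) (flat \<Gamma>)"
      note w = multiplier_dist_sobolev[OF ctx sob[OF this]]
      show "sobolev_on_norm 1 (1/2) (flat \<Gamma>) (A u) \<le> C * sobolev_norm 1 (- 1/2) u"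
        unfolding A_def by (rule order_trans[OF sobolev_on_norm_le[OF w(1)] w(2)])
    qed
    fix \<phi> assume \<phi>: "\<phi> \<in> test_functions (flat \<Gamma>)"
    note \<phi>s = test_functions_schwartz[OF \<phi>]
    show "A (tempered_of \<phi>) = distribution_of (flat \<Gamma>) (single_layer_classical k \<Gamma> \<phi>)"
    proof
      fix f
      show "A (tempered_of \<phi>) f = distribution_of (flat \<Gamma>) (single_layer_classical k \<Gamma> \<phi>) f"
      proof (cases "f \<in> test_functions (flat \<Gamma>)")
        case True
        \<comment> \<open>For x off the screen the distances exceed the range in which K is the true
          kernel, and the two integrals may differ; but there f vanishes.\<close>
        have pt: "(\<integral>y. K (x - y) * \<phi> y \<partial>lborel) * f x = single_layer_classical k \<Gamma> \<phi> x * f x" for x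
        proof (cases "x \<in> flat \<Gamma>")
          case x: True
          have "single_layer_classical k \<Gamma> \<phi> x = (\<integral>y. K (x - y) * \<phi> y \<partial>lborel)"
          proof (rule single_layer_classical_eq[OF m k \<phi> Km])
            fix y assume y: "y \<in> flat \<Gamma>" "y \<noteq> x"
            have "norm (x - y) \<le> 2 * \<rho>" using norm_triangle_ineq4[of x y] \<rho>(2)[OF x] \<rho>(2)[OF y(1)] by linarith
            then show "K (x - y) = screen_potential (- \<i> * of_real k) (x - y)" using y(2) by (intro Keq) auto
          qed
          then show ?thesis by simp
        qed (simp add: test_functions_eq_0[OF True])
        have "A (tempered_of \<phi>) f = multiplier_dist (multiplier K) (tempered_of \<phi>) f"
          using True by (simp add: A_def restrict_dist_def)
        also have "\<dots> = (\<integral>\<xi>. multiplier K \<xi> * fourier \<phi> \<xi> * fourier f (- \<xi>) \<partial>lborel)"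
          by (rule multiplier_dist_test[OF ctx \<phi>s test_functions_schwartz[OF True]])
        also have "\<dots> = (\<integral>x. (\<integral>y. K (x - y) * \<phi> y \<partial>lborel) * f x \<partial>lborel)"
          by (rule convolution_form[OF K schwartz_integrable[OF \<phi>s] test_functions_schwartz[OF True], symmetric])
        also have "\<dots> = distribution_of (flat \<Gamma>) (single_layer_classical k \<Gamma> \<phi>) f"
          unfolding pt distribution_of_test[OF True] ..
        finally show ?thesis .
      qed (simp add: A_def restrict_dist_def distribution_of_def)
    qed
  qed
  then show ?thesis by blast
qed


subsection \<open>Coercivity\<close>

lemma form_test_coercive:
  fixes \<Gamma> :: "((real^'m::finite) \<times> real) set"
  assumes m: "CARD('m) \<in> {1, 2}" and k: "k > 0" and bdd: "bounded (flat \<Gamma>)"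
    and A: "extends_single_layer k \<Gamma> A" and \<phi>: "\<phi> \<in> test_functions (flat \<Gamma>)"
  shows "1 / (2 * sqrt 2) * (sobolev_norm k (- 1/2) (tempered_of \<phi>))\<^sup>2 \<le>
    cmod (dual_pairing (- 1/2) (flat \<Gamma>) (A (tempered_of \<phi>)) (tempered_of \<phi>))"
proof -
  note \<phi>s = test_functions_schwartz[OF \<phi>]
  have h: "- 1/2 \<le> (0::real)" by simp
  obtain \<rho> where \<rho>: "\<rho> > 0" "\<And>x. x \<in> flat \<Gamma> \<Longrightarrow> norm x \<le> \<rho>" using bdd bounded_pos by metis
  have \<phi>0: "\<forall>x. norm x > \<rho> \<longrightarrow> \<phi> x = 0"
    using test_functions_eq_0[OF \<phi>] \<rho>(2) by (meson not_le)
  have on: "A (tempered_of \<phi>) \<in> sobolev_on (- (- 1/2)) (flat \<Gamma>)"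
    using A test_function_sobolev_tilde[OF \<phi> h] unfolding extends_single_layer_def by simp
  have eqA: "A (tempered_of \<phi>) = distribution_of (flat \<Gamma>) (single_layer_classical k \<Gamma> \<phi>)"
    using A \<phi> unfolding extends_single_layer_def by blast
  \<comment> \<open>Against a test function the pairing is an evaluation of the classical potential,
    here with its unaltered kernel; this is the double integral that
    \<open>layer_form_coercive\<close> estimates.\<close>
  have "dual_pairing (- 1/2) (flat \<Gamma>) (A (tempered_of \<phi>)) (tempered_of \<phi>) =
      (\<integral>x. (\<integral>y. screen_potential (- \<i> * of_real k) (x - y) * \<phi> y \<partial>lborel) * cnj (\<phi> x) \<partial>lborel)"
    unfolding dual_pairing_test[OF h on \<phi>]
    unfolding eqA distribution_of_test[OF test_functions_cnj[OF \<phi>]]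
      single_layer_classical_eq[OF m k \<phi> screen_potential_measurable refl] ..
  then show ?thesis
    using layer_form_coercive[OF m k \<phi>s \<rho>(1) \<phi>0] unfolding sobolev_norm_eq[OF tempered_of_represents[OF \<phi>s]] by simp
qed

text \<open>The approximation is in the norm for the parameter 1 while the estimate concerns the
  parameter k, so the constant of \<open>wnorm_le\<close> enters. Working with the norm instead of
  its square lets the triangle inequality separate the error, which disappears with
  \<epsilon>.\<close>

lemma form_coercive:
  fixes \<Gamma> :: "((real^'m::finite) \<times> real) set"
  assumes m: "CARD('m) \<in> {1, 2}" and k: "k > 0" and bdd: "bounded (flat \<Gamma>)"
    and A: "extends_single_layer k \<Gamma> A" and u: "u \<in> sobolev_tilde (- 1/2) (flat \<Gamma>)"
  shows "1 / (2 * sqrt 2) * (sobolev_norm k (- 1/2) u)\<^sup>2 \<le> cmod (dual_pairing (- 1/2) (flat \<Gamma>) (A u) u)"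
proof -
  let ?N = "sobolev_norm k (- 1/2)" and ?D = "\<lambda>u. cmod (dual_pairing (- 1/2) (flat \<Gamma>) (A u) u)"
  define c :: real where "c = 2 * sqrt 2"
  have c: "c > 0" by (simp add: c_def)
  have h: "- 1/2 \<le> (0::real)" by simp
  obtain C where C: "C > 0" "\<And>g::real^'m \<Rightarrow> complex. g \<in> wspace (- 1/2) \<Longrightarrow> wnorm k (- 1/2) g \<le> C * wnorm 1 (- 1/2) g"
    by (rule wnorm_le[OF k]) (rule that)
  have approx: "?N u \<le> sqrt (c * (?D u + \<epsilon>)) + C * \<epsilon>" if \<epsilon>: "\<epsilon> > 0" for \<epsilon>
  proof -
    obtain \<phi> where \<phi>: "\<phi> \<in> test_functions (flat \<Gamma>)"
      and n: "sobolev_norm 1 (- 1/2) (\<lambda>f. u f - tempered_of \<phi> f) < \<epsilon>"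
      and d: "cmod (dual_pairing (- 1/2) (flat \<Gamma>) (A u) u
       - dual_pairing (- 1/2) (flat \<Gamma>) (A (tempered_of \<phi>)) (tempered_of \<phi>)) < \<epsilon>"
      by (rule form_approx[OF A u \<epsilon>])
    have t: "tempered_of \<phi> \<in> sobolev (- 1/2)" by (rule tempered_of_sobolev[OF test_functions_schwartz[OF \<phi>] h])
    have diff: "(\<lambda>f. u f - tempered_of \<phi> f) \<in> sobolev (- 1/2)"
      by (rule sobolev_diff[OF sobolev_tilde_sobolev[OF u] t])
    have "?N (\<lambda>f. u f - tempered_of \<phi> f) \<le> C * sobolev_norm 1 (- 1/2) (\<lambda>f. u f - tempered_of \<phi> f)"
      unfolding sobolev_norm_wnorm by (rule C(2)[OF sobolev_wspace[OF diff]])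
    also have "\<dots> \<le> C * \<epsilon>" using n C(1) by (intro mult_left_mono) auto
    finally have n': "?N (\<lambda>f. u f - tempered_of \<phi> f) \<le> C * \<epsilon>" .
    have "1 / c * (?N (tempered_of \<phi>))\<^sup>2 \<le> ?D (tempered_of \<phi>)"
      unfolding c_def by (rule form_test_coercive[OF m k bdd A \<phi>])
    also have "\<dots> \<le> ?D u + \<epsilon>"
      using d norm_triangle_ineq3[of "dual_pairing (- 1/2) (flat \<Gamma>) (A u) u" "dual_pairing (- 1/2) (flat \<Gamma>) (A (tempered_of \<phi>)) (tempered_of \<phi>)"]
      by linarith
    finally have "(?N (tempered_of \<phi>))\<^sup>2 \<le> c * (?D u + \<epsilon>)" using c by (simp add: pos_divide_le_eq mult.commute)
    then have "?N (tempered_of \<phi>) \<le> sqrt (c * (?D u + \<epsilon>))" by (rule real_le_rsqrt)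
    moreover have "?N (\<lambda>f. tempered_of \<phi> f + (u f - tempered_of \<phi> f)) \<le> ?N (tempered_of \<phi>) + ?N (\<lambda>f. u f - tempered_of \<phi> f)"
      by (rule sobolev_norm_add[OF t diff k])
    moreover have "(\<lambda>f. tempered_of \<phi> f + (u f - tempered_of \<phi> f)) = u" by simp
    ultimately show ?thesis using n' by simp
  qed
  have "(\<lambda>n. sqrt (c * (?D u + inverse (real (Suc n)))) + C * inverse (real (Suc n))) \<longlonglongrightarrow> sqrt (c * (?D u + 0)) + C * 0"
    by (intro tendsto_intros LIMSEQ_inverse_real_of_nat)
  then have "?N u \<le> sqrt (c * (?D u + 0)) + C * 0"
    by (rule LIMSEQ_le_const) (intro exI[of _ 0] allI impI approx, simp)
  then have "?N u \<le> sqrt (c * ?D u)" by simp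
  moreover have "?N u \<ge> 0" by (simp add: sobolev_norm_wnorm)
  ultimately have "(?N u)\<^sup>2 \<le> (sqrt (c * ?D u))\<^sup>2" by (intro power_mono)
  also have "\<dots> = c * ?D u" using c by simp
  finally have "1 / c * (?N u)\<^sup>2 \<le> ?D u" using c by (simp add: pos_divide_le_eq mult.commute)
  then show ?thesis by (simp only: c_def)
qed

theorem theorem5p3:
  fixes n :: nat and \<Gamma> :: "((real^'m::finite) \<times> real) set"
  assumes "n \<in> {2, 3}"
    and "DIM((real^'m) \<times> real) = n"
    and "bounded \<Gamma>"
    and "\<Gamma> \<noteq> {}"
    and "openin (top_of_set Gamma_inf) \<Gamma>"
  shows "\<forall>k>0. \<forall>\<phi> \<in> sobolev_tilde (- 1/2) (flat \<Gamma>).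
    cmod (single_layer_form k \<Gamma> \<phi> \<phi>) \<ge> 1 / (2 * sqrt 2) * (sobolev_norm k (- 1/2) \<phi>)\<^sup>2"
proof (intro allI impI ballI)
  fix k :: real and \<phi>
  assume k: "k > 0" and \<phi>: "\<phi> \<in> sobolev_tilde (- 1/2) (flat \<Gamma>)"
  have "CARD('m) + 1 = n" using assms(2) by simp
  then have m: "CARD('m) \<in> {1, 2}" using assms(1) by auto
  obtain B where B: "\<And>p. p \<in> \<Gamma> \<Longrightarrow> norm p \<le> B" using assms(3) unfolding bounded_iff by blast
  have "norm x \<le> B" if "x \<in> flat \<Gamma>" for x
    using B[of "(x, 0)"] that by (simp add: Defs.flat_def norm_Pair)
  then have bdd: "bounded (flat \<Gamma>)" unfolding bounded_iff by blast
  \<comment> \<open>Existence makes the indefinite choice an actual extension; its defining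
    properties are all that the estimate uses.\<close>
  have "extends_single_layer k \<Gamma> (single_layer k \<Gamma>)"
    unfolding single_layer_def by (rule someI_ex[OF extends_single_layer_exists[OF m k bdd]])
  from form_coercive[OF m k bdd this \<phi>]
  show "1 / (2 * sqrt 2) * (sobolev_norm k (- 1/2) \<phi>)\<^sup>2 \<le> cmod (single_layer_form k \<Gamma> \<phi> \<phi>)"
    unfolding single_layer_form_def .
qed

end
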